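(* Let $f=0$ be a unitangent reduced singular plane curve germ at $0\in\mathbf C^2$ and let $\ell_1=0$, $\ell_2=0$ be smooth curve germs at $0$ transverse to $f=0$. Then the initial Newton polynomials of the discriminants of the morphisms $(\ell_1,f)$ and $(\ell_2,f)$ are equal up to rescaling variables.
   Context: A curve is unitangent if it has only one tangent line at $0$ (its tangent cone is a single line, possibly multiple). A smooth curve $\ell=0$ is transverse to $f=0$ if its tangent line at $0$ is not a tangent of $f=0$. Power series $H_1(u,v)$, $H_2(u,v)$ are equal up to rescaling variables if there exist nonzero constants $A,B,C$ such that $H_1(u,v)=C\,H_2(Au,Bv)$. Discriminant: for a morphism $(\ell,f):(\mathbf C^2,0)\to(\mathbf C^2,0)$ given by $u=\ell(x,y)$, $v=f(x,y)$, the polar curve is $\frac{\partial \ell}{\partial x}\frac{\partial f}{\partial y}-\frac{\partial \ell}{\partial y}\frac{\partial f}{\partial x}=0$, and its direct image $\mathcal D(u,v)=0$ (with multiplicities) under $(\ell,f)$ is the discriminant curve; the power series $\mathcal D(u,v)$, defined up to multiplication by an invertible power series, is the discriminant. Analytic changes of coordinates in the source do not change it. In coordinates with $\ell(x,y)=x$, put $p=\mathrm{ord}\, f(0,y)$ and write $\frac{\partial f}{\partial y}(x,y)=\tilde u(x,y)\prod_{j=1}^{p-1}[y-\gamma_j(x)]$ with $\tilde u$ a unit and $\gamma_j$ Puiseux series of positive order; then $\mathcal D(u,v)=\prod_{j=1}^{p-1}(v-f(u,\gamma_j(u)))$ up to a unit. For $g=\sum a_{ij}u^iv^j\neq 0$,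 the Newton diagram is the convex hull of $\{(i,j):a_{ij}\neq0\}+\mathbf R_{\ge0}^2$, and the initial Newton polynomial of $g$ is the sum of the terms $a_{ij}u^iv^j$ with $(i,j)$ on a compact edge of it. (Multiplying $g$ by a unit changes it only by a nonzero constant factor.) *)

theory Defs
  imports
    "HOL-Analysis.Analysis"
    "HOL-Computational_Algebra.Computational_Algebra"
begin

section \<open>The ring of convergent power series in two variables\<close>

text \<open>
  A series \<open>F :: complex fps fps\<close> stands for the double series \<open>\<Sum>i j. coef2 F i j x\<^sup>i y\<^sup>j\<close>:
  the inner variable is \<open>x\<close> (or \<open>u\<close>), the outer one is \<open>y\<close> (or \<open>v\<close>).
\<close>

definition coef2 :: "complex fps fps \<Rightarrow> nat \<Rightarrow> nat \<Rightarrow> complex" where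
  "coef2 F i j = fps_nth (fps_nth F j) i"

definition convergent2 :: "complex fps fps \<Rightarrow> bool" where
  "convergent2 F \<longleftrightarrow>
     (\<exists>r>0. (\<lambda>(i, j). norm (coef2 F i j) * r ^ i * r ^ j) summable_on UNIV)"

lemma convergent2_iff_bound:
  "convergent2 F \<longleftrightarrow> (\<exists>C\<ge>0. \<exists>R\<ge>1. \<forall>i j. norm (coef2 F i j) \<le> C * R ^ (i + j))"
proof
  assume "convergent2 F"
  then obtain r where r: "r > 0"
    and s: "(\<lambda>(i, j). norm (coef2 F i j) * r ^ i * r ^ j) summable_on UNIV"
    unfolding convergent2_def by blast
  define g where "g = (\<lambda>(i, j). norm (coef2 F i j) * r ^ i * r ^ j)"
  define C where "C = infsum g UNIV"
  have gs: "g summable_on UNIV" using s by (simp add: g_def)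
  have g0: "g p \<ge> 0" for p using r by (simp add: g_def split: prod.split)
  have gC: "g p \<le> C" for p
    using finite_sum_le_infsum[OF gs, of "{p}"] g0 by (simp add: C_def)
  define R where "R = max 1 (1 / r)"
  have "norm (coef2 F i j) \<le> C * R ^ (i + j)" for i j
  proof -
    have "norm (coef2 F i j) * r ^ (i + j) \<le> C"
      using gC[of "(i, j)"] r by (simp add: g_def power_add mult.assoc)
    then have "norm (coef2 F i j) \<le> C * (1 / r) ^ (i + j)"
      using r by (simp add: power_divide field_simps)
    also have "\<dots> \<le> C * R ^ (i + j)"
      using order_trans[OF g0 gC] r by (intro mult_left_mono power_mono) (auto simp: R_def)
    finally show ?thesis .
  qed
  moreover have "C \<ge> 0" using order_trans[OF g0 gC] .
  moreover have "R \<ge> 1" by (simp add: R_def)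
  ultimately show "\<exists>C\<ge>0. \<exists>R\<ge>1. \<forall>i j. norm (coef2 F i j) \<le> C * R ^ (i + j)" by blast
next
  assume "\<exists>C\<ge>0. \<exists>R\<ge>1. \<forall>i j. norm (coef2 F i j) \<le> C * R ^ (i + j)"
  then obtain C R where C: "C \<ge> 0" and R: "R \<ge> 1"
    and b: "\<And>i j. norm (coef2 F i j) \<le> C * R ^ (i + j)" by blast
  define r where "r = 1 / (2 * R)"
  have r: "r > 0" using R by (simp add: r_def)
  have Rr: "R * r = 1 / 2" using R by (simp add: r_def)
  have geo: "((\<lambda>j. (1 / 2 :: real) ^ j) has_sum 2) UNIV"
    using geometric_sums[of "1 / 2 :: real"]
    by (subst sums_nonneg_imp_has_sum) (auto)
  have "(\<lambda>(i, j). C * (1 / 2) ^ i * (1 / 2 :: real) ^ j) summable_on (UNIV \<times> UNIV)"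
  proof (rule summable_on_SigmaI)
    show "((\<lambda>j. (\<lambda>(i, j). C * (1 / 2) ^ i * (1 / 2 :: real) ^ j) (i, j)) has_sum
            (C * (1 / 2) ^ i * 2)) UNIV" for i :: nat
      using has_sum_cmult_right[OF geo, of "C * (1 / 2) ^ i"] by simp
    have "(\<lambda>i. (1 / 2 :: real) ^ i) summable_on UNIV"
      using geo by (auto simp: summable_on_def)
    then have "(\<lambda>i. (C * 2) * (1 / 2 :: real) ^ i) summable_on UNIV"
      by (rule summable_on_cmult_right)
    then show "(\<lambda>i. C * (1 / 2 :: real) ^ i * 2) summable_on UNIV"
      by (simp add: mult_ac)
  qed (use C in auto)
  then have S: "(\<lambda>(i, j). C * (1 / 2) ^ i * (1 / 2 :: real) ^ j) summable_on UNIV" by simp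
  have "(\<lambda>(i, j). norm (coef2 F i j) * r ^ i * r ^ j) summable_on UNIV"
  proof (rule summable_on_comparison_test[OF S])
    fix p :: "nat \<times> nat"
    obtain i j where p: "p = (i, j)" by fastforce
    have "norm (coef2 F i j) * r ^ i * r ^ j = norm (coef2 F i j) * r ^ (i + j)"
      by (simp add: power_add)
    also have "\<dots> \<le> (C * R ^ (i + j)) * r ^ (i + j)"
      using b r by (intro mult_right_mono) auto
    also have "\<dots> = C * (R * r) ^ (i + j)" by (simp add: power_mult_distrib)
    finally have "norm (coef2 F i j) * r ^ i * r ^ j \<le> C * (1 / 2) ^ i * (1 / 2) ^ j"
      by (simp only: Rr power_add mult.assoc)
    then show "(case p of (i, j) \<Rightarrow> norm (coef2 F i j) * r ^ i * r ^ j)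
            \<le> (case p of (i, j) \<Rightarrow> C * (1 / 2) ^ i * (1 / 2) ^ j)"
      by (simp add: p)
    show "0 \<le> (case p of (i, j) \<Rightarrow> norm (coef2 F i j) * r ^ i * r ^ j)"
      using r by (simp add: p)
  qed
  then show "convergent2 F" unfolding convergent2_def using r by blast
qed

lemma convergent2I:
  assumes "C \<ge> 0" "R \<ge> 1" "\<And>i j. norm (coef2 F i j) \<le> C * R ^ (i + j)"
  shows "convergent2 F"
  using assms convergent2_iff_bound by blast

lemma convergent2E:
  assumes "convergent2 F"
  obtains C R where "C \<ge> 0" "R \<ge> 1" "\<And>i j. norm (coef2 F i j) \<le> C * R ^ (i + j)"
  using assms convergent2_iff_bound by blast

lemma convergent2E2:
  assumes "convergent2 F" "convergent2 G"
  obtains C R where "C \<ge> 0" "R \<ge> 1" "\<And>i j. norm (coef2 F i j) \<le> C * R ^ (i + j)"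
    "\<And>i j. norm (coef2 G i j) \<le> C * R ^ (i + j)"
proof -
  from assms(1) obtain C R where F: "C \<ge> 0" "R \<ge> 1" "\<And>i j. norm (coef2 F i j) \<le> C * R ^ (i + j)"
    by (rule convergent2E) blast
  from assms(2) obtain C' R' where G: "C' \<ge> 0" "R' \<ge> 1" "\<And>i j. norm (coef2 G i j) \<le> C' * R' ^ (i + j)"
    by (rule convergent2E) blast
  have m: "C * R ^ n \<le> max C C' * max R R' ^ n" "C' * R' ^ n \<le> max C C' * max R R' ^ n" for n
    using F(1,2) G(1,2) by (auto intro!: mult_mono power_mono)
  show ?thesis
  proof (rule that[of "max C C'" "max R R'"])
    show "norm (coef2 F i j) \<le> max C C' * max R R' ^ (i + j)" for i j
      using F(3) m(1) order_trans by blast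
    show "norm (coef2 G i j) \<le> max C C' * max R R' ^ (i + j)" for i j
      using G(3) m(2) order_trans by blast
  qed (use F G in auto)
qed

lemma Suc_le_two_power: "real (Suc n) \<le> 2 ^ n"
  by (induction n) auto

lemma coef2_mult:
  "coef2 (F * G) i j = (\<Sum>q\<le>j. \<Sum>p\<le>i. coef2 F p q * coef2 G (i - p) (j - q))"
  by (simp add: coef2_def fps_mult_nth fps_sum_nth atLeast0AtMost)

lemma convergent2_mult:
  assumes "convergent2 F" "convergent2 G"
  shows "convergent2 (F * G)"
proof -
  obtain C R where CR: "C \<ge> 0" "R \<ge> 1" "\<And>i j. norm (coef2 F i j) \<le> C * R ^ (i + j)"
    "\<And>i j. norm (coef2 G i j) \<le> C * R ^ (i + j)"
    using assms by (rule convergent2E2) blast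
  show ?thesis
  proof (rule convergent2I[of "C\<^sup>2" "2 * R"])
    fix i j
    have "norm (coef2 (F * G) i j)
            \<le> (\<Sum>q\<le>j. \<Sum>p\<le>i. norm (coef2 F p q * coef2 G (i - p) (j - q)))"
      unfolding coef2_mult by (intro sum_norm_le norm_sum)
    also have "\<dots> \<le> (\<Sum>q\<le>j. \<Sum>p\<le>i. C\<^sup>2 * R ^ (i + j))"
    proof (intro sum_mono)
      fix p q assume pq: "q \<in> {..j}" "p \<in> {..i}"
      have "norm (coef2 F p q * coef2 G (i - p) (j - q))
              \<le> (C * R ^ (p + q)) * (C * R ^ ((i - p) + (j - q)))"
        unfolding norm_mult using CR by (intro mult_mono) auto
      also have "\<dots> = C\<^sup>2 * R ^ ((p + q) + ((i - p) + (j - q)))"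
        by (simp only: power_add power2_eq_square mult_ac)
      also have "(p + q) + ((i - p) + (j - q)) = i + j" using pq by auto
      finally show "norm (coef2 F p q * coef2 G (i - p) (j - q)) \<le> C\<^sup>2 * R ^ (i + j)" .
    qed
    also have "\<dots> = (real (Suc j) * real (Suc i)) * (C\<^sup>2 * R ^ (i + j))"
      by (simp add: algebra_simps)
    also have "\<dots> \<le> (2 ^ j * 2 ^ i) * (C\<^sup>2 * R ^ (i + j))"
      using CR by (intro mult_right_mono mult_mono Suc_le_two_power) auto
    also have "\<dots> = C\<^sup>2 * (2 * R) ^ (i + j)"
      by (simp add: power_mult_distrib power_add mult_ac)
    finally show "norm (coef2 (F * G) i j) \<le> C\<^sup>2 * (2 * R) ^ (i + j)" .
  qed (use CR in auto)
qed

lemma convergent2_add: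
  assumes "convergent2 F" "convergent2 G"
  shows "convergent2 (F + G)"
proof -
  obtain C R where CR: "C \<ge> 0" "R \<ge> 1" "\<And>i j. norm (coef2 F i j) \<le> C * R ^ (i + j)"
    "\<And>i j. norm (coef2 G i j) \<le> C * R ^ (i + j)"
    using assms by (rule convergent2E2) blast
  show ?thesis
  proof (rule convergent2I[of "2 * C" R])
    fix i j
    show "norm (coef2 (F + G) i j) \<le> 2 * C * R ^ (i + j)"
      using norm_triangle_ineq[of "coef2 F i j" "coef2 G i j"] CR(3,4)[of i j]
      by (simp add: coef2_def)
  qed (use CR in auto)
qed

lemma convergent2_uminus:
  assumes "convergent2 F"
  shows "convergent2 (- F)"
  using assms unfolding convergent2_iff_bound by (simp add: coef2_def)

lemma convergent2_0: "convergent2 0"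
  by (rule convergent2I[of 0 1]) (auto simp: coef2_def)

lemma convergent2_1: "convergent2 1"
  by (rule convergent2I[of 1 1]) (auto simp: coef2_def fps_one_nth)

typedef germ2 = "{F. convergent2 F}"
  morphisms series_of Germ2
  using convergent2_0 by blast

text \<open>
  \<^typ>\<open>germ2\<close> is the ring \<open>\<complex>{x, y}\<close> of germs at \<open>0\<close> of analytic functions on \<open>\<complex>\<^sup>2\<close>, so that
  \<^const>\<open>irreducible\<close>, \<^const>\<open>squarefree\<close> and divisibility by \<open>1\<close> refer to this ring.
\<close>

setup_lifting type_definition_germ2

instantiation germ2 :: idom
begin

lift_definition zero_germ2 :: germ2 is 0 by (rule convergent2_0)
lift_definition one_germ2 :: germ2 is 1 by (rule convergent2_1)
lift_definition plus_germ2 :: "germ2 \<Rightarrow> germ2 \<Rightarrow> germ2" is "(+)" by (rule convergent2_add)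
lift_definition times_germ2 :: "germ2 \<Rightarrow> germ2 \<Rightarrow> germ2" is "(*)" by (rule convergent2_mult)
lift_definition uminus_germ2 :: "germ2 \<Rightarrow> germ2" is uminus by (rule convergent2_uminus)
lift_definition minus_germ2 :: "germ2 \<Rightarrow> germ2 \<Rightarrow> germ2" is "(-)"
  by (metis convergent2_add convergent2_uminus diff_conv_add_uminus)

instance
  by standard (transfer; simp add: algebra_simps)+

end

definition coef :: "germ2 \<Rightarrow> nat \<Rightarrow> nat \<Rightarrow> complex" where
  "coef f i j = coef2 (series_of f) i j"

lemma convergent2_weight:
  assumes "convergent2 F"
    and "\<And>i j. norm (coef2 G i j) \<le> real (Suc i) * real (Suc j) * norm (coef2 F (i + a) (j + b))"
  shows "convergent2 G"
proof -
  from assms(1) obtain C R where CR: "C \<ge> 0" "R \<ge> 1" "\<And>i j. norm (coef2 F i j) \<le> C * R ^ (i + j)"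
    by (rule convergent2E) blast
  show ?thesis
  proof (rule convergent2I[of "C * R ^ (a + b)" "2 * R"])
    fix i j
    have "norm (coef2 G i j) \<le> (2 ^ i * 2 ^ j) * (C * R ^ ((i + a) + (j + b)))"
      using assms(2)[of i j]
      by (rule order_trans) (use CR in \<open>intro mult_mono Suc_le_two_power, auto\<close>)
    also have "\<dots> = C * R ^ (a + b) * (2 * R) ^ (i + j)"
      by (simp add: power_mult_distrib power_add mult_ac)
    finally show "norm (coef2 G i j) \<le> C * R ^ (a + b) * (2 * R) ^ (i + j)" .
  qed (use CR in auto)
qed

lift_definition deriv_x :: "germ2 \<Rightarrow> germ2" is "\<lambda>F. Abs_fps (\<lambda>j. fps_deriv (fps_nth F j))"
proof -
  fix F :: "complex fps fps" assume F: "convergent2 F"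
  show "convergent2 (Abs_fps (\<lambda>j. fps_deriv (fps_nth F j)))"
  proof (rule convergent2_weight[OF F, where a = 1 and b = 0])
    fix i j
    have "norm (1 + of_nat i :: complex) = real (Suc i)"
      by (metis norm_of_nat of_nat_Suc)
    then show "norm (coef2 (Abs_fps (\<lambda>j. fps_deriv (fps_nth F j))) i j)
            \<le> real (Suc i) * real (Suc j) * norm (coef2 F (i + 1) (j + 0))"
      by (simp add: coef2_def norm_mult mult_right_mono)
  qed
qed

lift_definition deriv_y :: "germ2 \<Rightarrow> germ2" is fps_deriv
proof -
  fix F :: "complex fps fps" assume F: "convergent2 F"
  show "convergent2 (fps_deriv F)"
  proof (rule convergent2_weight[OF F, where a = 0 and b = 1])
    fix i j
    have "norm (1 + of_nat j :: complex) = real (Suc j)"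
      by (metis norm_of_nat of_nat_Suc)
    moreover have "coef2 (fps_deriv F) i j = (1 + of_nat j) * coef2 F i (Suc j)"
      by (simp add: coef2_def fps_of_nat[symmetric] distrib_right)
    ultimately show "norm (coef2 (fps_deriv F) i j)
            \<le> real (Suc i) * real (Suc j) * norm (coef2 F (i + 0) (j + 1))"
      by (simp add: norm_mult mult_right_mono)
  qed
qed


section \<open>Plane curve germs and their tangents\<close>

definition singular_germ :: "germ2 \<Rightarrow> bool" where
  "singular_germ f \<longleftrightarrow> coef f 0 0 = 0 \<and> coef f 1 0 = 0 \<and> coef f 0 1 = 0"

definition smooth_germ :: "germ2 \<Rightarrow> bool" where
  "smooth_germ l \<longleftrightarrow> coef l 0 0 = 0 \<and> (coef l 1 0 \<noteq> 0 \<or> coef l 0 1 \<noteq> 0)"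

definition germ_order :: "germ2 \<Rightarrow> nat" where
  "germ_order f = (LEAST n. \<exists>i j. i + j = n \<and> coef f i j \<noteq> 0)"

definition initial_form :: "germ2 \<Rightarrow> complex \<Rightarrow> complex \<Rightarrow> complex" where
  "initial_form f x y =
     (\<Sum>i\<le>germ_order f. coef f i (germ_order f - i) * x ^ i * y ^ (germ_order f - i))"

definition tangent_cone :: "germ2 \<Rightarrow> (complex \<times> complex) set" where
  "tangent_cone f = {(x, y). initial_form f x y = 0}"

definition line_through_0 :: "(complex \<times> complex) set \<Rightarrow> bool" where
  "line_through_0 L \<longleftrightarrow> (\<exists>a b. (a, b) \<noteq> (0, 0) \<and> L = {(x, y). a * x + b * y = 0})"

definition tangent_line :: "(complex \<times> complex) set \<Rightarrow> germ2 \<Rightarrow> bool" where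
  "tangent_line L f \<longleftrightarrow> line_through_0 L \<and> L \<subseteq> tangent_cone f"

definition unitangent :: "germ2 \<Rightarrow> bool" where
  "unitangent f \<longleftrightarrow> (\<exists>!L. tangent_line L f)"

definition transverse :: "germ2 \<Rightarrow> germ2 \<Rightarrow> bool" where
  "transverse l f \<longleftrightarrow> (\<forall>L. tangent_line L l \<longrightarrow> \<not> tangent_line L f)"


section \<open>Direct images and discriminants\<close>

text \<open>
  \<open>f(a(t), b(t))\<close>, for series \<open>a\<close>, \<open>b\<close> without constant term: then the monomial \<open>a\<^sup>i b\<^sup>j\<close> has
  order at least \<open>i + j\<close>, so only the terms below contribute to the coefficient of \<open>t\<^sup>n\<close>.
\<close>

definition subst_arc :: "germ2 \<Rightarrow> complex fps \<Rightarrow> complex fps \<Rightarrow> complex fps" where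
  "subst_arc f a b = Abs_fps (\<lambda>n. \<Sum>i\<le>n. \<Sum>j\<le>n. coef f i j * fps_nth (a ^ i * b ^ j) n)"

definition analytic_arc :: "complex fps \<Rightarrow> complex fps \<Rightarrow> bool" where
  "analytic_arc a b \<longleftrightarrow> fps_conv_radius a > 0 \<and> fps_conv_radius b > 0 \<and>
     fps_nth a 0 = 0 \<and> fps_nth b 0 = 0 \<and> (a, b) \<noteq> (0, 0)"

text \<open>
  A primitive (that is, generically injective) arc is one that is not obtained from another arc
  by a ramified reparametrization \<open>t \<mapsto> s(t)\<close>.
\<close>

definition primitive_arc :: "complex fps \<Rightarrow> complex fps \<Rightarrow> bool" where
  "primitive_arc a b \<longleftrightarrow> analytic_arc a b \<and>
     \<not> (\<exists>a' b' s. analytic_arc a' b' \<and> fps_conv_radius s > 0 \<and> subdegree s \<ge> 2 \<and>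
                  a = fps_compose a' s \<and> b = fps_compose b' s)"

definition parametrizes :: "complex fps \<Rightarrow> complex fps \<Rightarrow> germ2 \<Rightarrow> bool" where
  "parametrizes a b h \<longleftrightarrow> primitive_arc a b \<and> subst_arc h a b = 0"

text \<open>
  The irreducible germ \<open>h = 0\<close> is mapped by \<open>(l, f)\<close> onto the irreducible germ \<open>H = 0\<close> with
  degree \<open>d\<close>: in terms of the parameters of the two branches the map is \<open>t \<mapsto> s(t)\<close>, whose
  degree is the order of \<open>s\<close>.
\<close>

definition maps_branch :: "germ2 \<Rightarrow> germ2 \<Rightarrow> germ2 \<Rightarrow> nat \<Rightarrow> germ2 \<Rightarrow> bool" where
  "maps_branch l f h d H \<longleftrightarrow> irreducible h \<and> irreducible H \<and>
     (\<exists>a b a' b' s. parametrizes a b h \<and> parametrizes a' b' H \<and>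
        fps_conv_radius s > 0 \<and> s \<noteq> 0 \<and> fps_nth s 0 = 0 \<and>
        subst_arc l a b = fps_compose a' s \<and> subst_arc f a b = fps_compose b' s \<and>
        subdegree s = d)"

text \<open>
  The direct image with multiplicities: the image of a branch \<open>h = 0\<close> is \<open>H\<^sup>d = 0\<close>, with \<open>H\<close> and
  \<open>d\<close> as above, and this is extended multiplicatively to all curve germs. Equations of curves are
  determined up to units of \<^typ>\<open>germ2\<close>, hence a relation and not a function.
\<close>

definition direct_image :: "germ2 \<Rightarrow> germ2 \<Rightarrow> germ2 \<Rightarrow> germ2 \<Rightarrow> bool" where
  "direct_image l f g D \<longleftrightarrow>
     (\<exists>bs :: (germ2 \<times> nat \<times> germ2) list.
        (\<forall>(h, d, H) \<in> set bs. maps_branch l f h d H) \<and>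
        (\<exists>w. w dvd 1 \<and> g = w * prod_list (map (\<lambda>(h, d, H). h) bs)) \<and>
        (\<exists>w. w dvd 1 \<and> D = w * prod_list (map (\<lambda>(h, d, H). H ^ d) bs)))"

definition polar :: "germ2 \<Rightarrow> germ2 \<Rightarrow> germ2" where
  "polar l f = deriv_x l * deriv_y f - deriv_y l * deriv_x f"

definition is_discriminant :: "germ2 \<Rightarrow> germ2 \<Rightarrow> germ2 \<Rightarrow> bool" where
  "is_discriminant l f D \<longleftrightarrow> direct_image l f (polar l f) D"


section \<open>Newton diagrams\<close>

definition newton_diagram :: "germ2 \<Rightarrow> (real \<times> real) set" where
  "newton_diagram g =
     convex hull {(real i + s, real j + t) | i j s t. coef g i j \<noteq> 0 \<and> s \<ge> 0 \<and> t \<ge> 0}"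

definition initial_newton_polynomial :: "germ2 \<Rightarrow> complex fps fps" where
  "initial_newton_polynomial g = Abs_fps (\<lambda>j. Abs_fps (\<lambda>i.
     if \<exists>E. E edge_of newton_diagram g \<and> compact E \<and> (real i, real j) \<in> E
     then coef g i j else 0))"

definition rescale :: "complex \<Rightarrow> complex \<Rightarrow> complex fps fps \<Rightarrow> complex fps fps" where
  "rescale A B H = Abs_fps (\<lambda>j. Abs_fps (\<lambda>i. coef2 H i j * A ^ i * B ^ j))"

definition equal_up_to_rescaling :: "complex fps fps \<Rightarrow> complex fps fps \<Rightarrow> bool" where
  "equal_up_to_rescaling H1 H2 \<longleftrightarrow>
     (\<exists>A B C. A \<noteq> 0 \<and> B \<noteq> 0 \<and> C \<noteq> 0 \<and> H1 = fps_const (fps_const C) * rescale A B H2)"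

end

theory Submission
  imports Defs "HOL-Complex_Analysis.Complex_Analysis"
begin

text \<open>
  Choose linear coordinates \<open>(x, z)\<close> in which \<open>f = c z\<^sup>n + \<dots>\<close>. Transversality says that \<open>\<ell>\<^sub>k = \<kappa>\<^sub>k x + \<dots>\<close> with
  \<open>\<kappa>\<^sub>k \<noteq> 0\<close>, so that \<open>(z, u)\<close>, with \<open>u = \<ell>\<^sub>k\<close>, are coordinates of the source; after rescaling \<open>u\<close> one has
  \<open>x = X\<^sub>k(z, u)\<close> with \<open>u\<close>-coefficient \<open>1\<close>. Put \<open>X\<^sub>s = X\<^sub>1 + s (X\<^sub>2 - X\<^sub>1)\<close>, \<open>\<Delta> = X\<^sub>2 - X\<^sub>1\<close>, and
  \<open>F\<^sub>s(z, u) = f(X\<^sub>s(z, u), z)\<close>; the discriminant of \<open>(u, F\<^sub>s)\<close> is \<open>D\<^sub>s = \<Prod>(v - F\<^sub>s(\<gamma>(u), u))\<close> over the roots \<open>\<gamma>\<close> of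
  \<open>\<partial>F\<^sub>s/\<partial>z\<close>. The form of \<open>f\<close> forces these roots to have order greater than \<open>1\<close>, so \<open>\<Delta>\<close> has order greater than
  \<open>1\<close> on every polar branch. There \<open>\<partial>F\<^sub>s/\<partial>s\<close> is \<open>\<Delta>\<close> times \<open>\<partial>F\<^sub>s/\<partial>u\<close>, up to a unit, while \<open>d/du F\<^sub>s(\<gamma>(u), u)\<close> is
  \<open>\<partial>F\<^sub>s/\<partial>u\<close>; hence \<open>\<partial>F\<^sub>s/\<partial>s\<close> has greater order than \<open>F\<^sub>s\<close>, the derivative \<open>d/ds D\<^sub>s\<close> has greater weight than
  \<open>D\<^sub>s\<close> for every positive weight, and the initial forms of \<open>D\<^sub>s\<close> do not depend on \<open>s\<close>. Differentiating roots is
  avoided by expressing \<open>D\<^sub>s\<close> through the power sums of the \<open>F\<^sub>s(\<gamma>(u), u)\<close>, which are residues.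
\<close>

subsection \<open>Double power series\<close>

text \<open>The discriminant is given as a direct image of irreducible branches, while the
  deformation needs the product over Puiseux roots. The two are matched because the equation of a
  branch generates the ideal of all series vanishing on a primitive parametrization. Irreducibility
  and convergence matter only for this match; everything else is formal in \<open>z\<close> and
  \<open>u\<close>, and complex differentiable in \<open>s\<close> coefficient by coefficient. As
  \<open>s\<close> moves, roots may collide and the common denominator of their exponents may
  change, so the roots do not form a differentiable family, whereas their power sums do. It is
  enough to know the initial forms for positive weights because every compact edge of a Newton
  diagram is cut out by such a weight. The weight of \<open>D_s\<close> is not known in advance to
  be constant, and the derivative is only compared with the weight at the same \<open>s\<close>; a
  connectedness argument in the parameter plane closes this gap. Normalizing the
  \<open>u\<close>-coefficients of \<open>X_1\<close> and \<open>X_2\<close> to 1 removes the linear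
  term in \<open>u\<close> from \<open>\<Delta>\<close>; its price is the rescaling of
  \<open>u\<close> in the theorem.\<close>

definition cc :: "complex \<Rightarrow> complex fps fps" where "cc c = fps_const (fps_const c)"
definition XX :: "complex fps fps" where "XX = fps_const fps_X"
abbreviation YY :: "complex fps fps" where "YY \<equiv> fps_X"

lemma coef2_eqI: "(\<And>i j. coef2 F i j = coef2 G i j) \<Longrightarrow> F = G"
  by (auto simp: coef2_def fps_eq_iff)

lemma coef2_simps [simp]:
  "coef2 0 i j = 0" "coef2 (F + G) i j = coef2 F i j + coef2 G i j"
  "coef2 (F - G) i j = coef2 F i j - coef2 G i j" "coef2 (- F) i j = - coef2 F i j"
  "coef2 (cc c * F) i j = c * coef2 F i j"
  by (simp_all add: coef2_def cc_def)

lemma coef2_sum: "coef2 (sum f A) i j = (\<Sum>x\<in>A. coef2 (f x) i j)"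
  by (induction A rule: infinite_finite_induct) auto

lemma coef2_cc: "coef2 (cc c) i j = (if i = 0 \<and> j = 0 then c else 0)"
  by (simp add: coef2_def cc_def)

lemma coef2_1: "coef2 1 i j = (if i = 0 \<and> j = 0 then 1 else 0)"
  by (simp add: coef2_def)

lemma cc_hom [simp]: "cc 0 = 0" "cc 1 = 1" "cc (a + b) = cc a + cc b" "cc (a * b) = cc a * cc b"
   "cc (a - b) = cc a - cc b" "cc (- a) = - cc a"
  by (simp_all add: cc_def)

lemma cc_power: "cc (a ^ n) = cc a ^ n"
  by (simp add: cc_def)

lemma XX_power: "XX ^ i = fps_const (fps_X ^ i)"
  by (simp add: XX_def)

lemma coef2_mono: "coef2 (XX ^ i * YY ^ j) k l = (if k = i \<and> l = j then 1 else 0)"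
  by (simp add: coef2_def XX_power fps_X_power_mult_right_nth)

lemma coef2_XX: "coef2 XX k l = (if k = 1 \<and> l = 0 then 1 else 0)"
  using coef2_mono[of 1 0 k l] by simp
lemma coef2_YY: "coef2 YY k l = (if k = 0 \<and> l = 1 then 1 else 0)"
  using coef2_mono[of 0 1 k l] by simp

subsection \<open>Total order\<close>

text \<open>Power \<open>n\<close> of the maximal ideal, described by coefficients. It supplies the
  adic topology in which series are approximated by polynomials and equations are solved by
  successive approximation.\<close>

definition in_ideal :: "nat \<Rightarrow> complex fps fps set" where
  "in_ideal n = {F. \<forall>i j. i + j < n \<longrightarrow> coef2 F i j = 0}"

lemma in_idealI: "(\<And>i j. i + j < n \<Longrightarrow> coef2 F i j = 0) \<Longrightarrow> F \<in> in_ideal n"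
  by (auto simp: in_ideal_def)
lemma in_idealD: "F \<in> in_ideal n \<Longrightarrow> i + j < n \<Longrightarrow> coef2 F i j = 0"
  by (auto simp: in_ideal_def)

lemma in_ideal_0 [simp]: "0 \<in> in_ideal n" "F \<in> in_ideal 0"
  by (auto simp: in_ideal_def)
lemma in_ideal_mono: "F \<in> in_ideal n \<Longrightarrow> m \<le> n \<Longrightarrow> F \<in> in_ideal m"
  by (auto simp: in_ideal_def)
lemma in_ideal_Suc: "F \<in> in_ideal (Suc n) \<Longrightarrow> F \<in> in_ideal n"
  by (rule in_ideal_mono) auto
lemma in_ideal_add [intro]: "F \<in> in_ideal n \<Longrightarrow> G \<in> in_ideal n \<Longrightarrow> F + G \<in> in_ideal n"
  by (auto simp: in_ideal_def)
lemma in_ideal_diff [intro]: "F \<in> in_ideal n \<Longrightarrow> G \<in> in_ideal n \<Longrightarrow> F - G \<in> in_ideal n"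
  by (auto simp: in_ideal_def)
lemma in_ideal_uminus [intro]: "F \<in> in_ideal n \<Longrightarrow> - F \<in> in_ideal n"
  by (auto simp: in_ideal_def)
lemma in_ideal_sum: "(\<And>x. x \<in> A \<Longrightarrow> f x \<in> in_ideal n) \<Longrightarrow> sum f A \<in> in_ideal n"
  by (auto simp: in_ideal_def coef2_sum)
lemma in_ideal_mult: assumes "F \<in> in_ideal n" "G \<in> in_ideal m" shows "F * G \<in> in_ideal (n + m)"
proof (rule in_idealI)
  fix i j assume ij: "i + j < n + m"
  have "coef2 F p q * coef2 G (i - p) (j - q) = 0" if "q \<le> j" "p \<le> i" for p q
  proof (cases "p + q < n")
    case True then show ?thesis using in_idealD[OF assms(1)] by simp
  next
    case False
    then have "(i - p) + (j - q) < m" using that ij by auto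
    then show ?thesis using in_idealD[OF assms(2)] by simp
  qed
  then show "coef2 (F * G) i j = 0" unfolding coef2_mult by (intro sum.neutral ballI) auto
qed
lemma in_ideal_mult1: "F \<in> in_ideal n \<Longrightarrow> F * G \<in> in_ideal n"
  using in_ideal_mult[of F n G 0] by simp
lemma in_ideal_mult2: "F \<in> in_ideal n \<Longrightarrow> G * F \<in> in_ideal n"
  using in_ideal_mult[of G 0 F n] by simp
lemma in_ideal_power: "F \<in> in_ideal n \<Longrightarrow> F ^ k \<in> in_ideal (k * n)"
  by (induction k) (auto intro: in_ideal_mult)
definition max_ideal :: "complex fps fps set" where "max_ideal = in_ideal 1"
lemma in_ideal_power1: "F \<in> max_ideal \<Longrightarrow> F ^ k \<in> in_ideal k"
  using in_ideal_power[of F 1 k] by (simp add: max_ideal_def)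
lemma in_ideal_powers: "a \<in> max_ideal \<Longrightarrow> b \<in> max_ideal \<Longrightarrow> a ^ i * b ^ j \<in> in_ideal (i + j)"
  by (intro in_ideal_mult in_ideal_power1)
lemma in_ideal_all: "(\<And>n. F \<in> in_ideal n) \<Longrightarrow> F = 0"
  by (rule coef2_eqI) (metis coef2_simps(1) in_idealD less_add_one)
lemma max_ideal_iff: "F \<in> max_ideal \<longleftrightarrow> coef2 F 0 0 = 0"
  by (auto simp: in_ideal_def max_ideal_def)
lemma max_ideal_add [intro]: "F \<in> max_ideal \<Longrightarrow> G \<in> max_ideal \<Longrightarrow> F + G \<in> max_ideal"
  and max_ideal_diff [intro]: "F \<in> max_ideal \<Longrightarrow> G \<in> max_ideal \<Longrightarrow> F - G \<in> max_ideal"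
  and max_ideal_uminus [intro]: "F \<in> max_ideal \<Longrightarrow> - F \<in> max_ideal"
  and max_ideal_0 [simp]: "0 \<in> max_ideal"
  and max_ideal_mult1 [intro]: "F \<in> max_ideal \<Longrightarrow> F * G \<in> max_ideal"
  and max_ideal_mult2 [intro]: "G \<in> max_ideal \<Longrightarrow> F * G \<in> max_ideal"
  by (auto simp: max_ideal_def intro: in_ideal_mult1 in_ideal_mult2)
lemma max_ideal_power [intro]: "F \<in> max_ideal \<Longrightarrow> n > 0 \<Longrightarrow> F ^ n \<in> max_ideal"
  by (cases n) auto
lemma XX_ideal [simp]: "XX \<in> max_ideal" and YY_ideal [simp]: "YY \<in> max_ideal"
  by (auto simp: max_ideal_iff coef2_XX coef2_YY)

definition trunc2 :: "nat \<Rightarrow> complex fps fps \<Rightarrow> complex fps fps" where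
  "trunc2 K F = (\<Sum>i<K. \<Sum>j<K. cc (coef2 F i j) * (XX ^ i * YY ^ j))"

lemma coef2_trunc2: "coef2 (trunc2 K F) k l = (if k < K \<and> l < K then coef2 F k l else 0)"
proof -
  have "coef2 (trunc2 K F) k l = (\<Sum>i<K. \<Sum>j<K. if i = k \<and> j = l then coef2 F i j else 0)"
    unfolding trunc2_def coef2_sum by (intro sum.cong refl) (auto simp: coef2_mono)
  also have "\<dots> = (\<Sum>i<K. if i = k then (\<Sum>j<K. if j = l then coef2 F i j else 0) else 0)"
    by (intro sum.cong refl) auto
  also have "\<dots> = (if k < K \<and> l < K then coef2 F k l else 0)"
    by (simp add: sum.delta)
  finally show ?thesis .
qed

lemma trunc2_diff: "F - trunc2 K F \<in> in_ideal K"
  by (rule in_idealI) (simp add: coef2_trunc2)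

text \<open>Additive maps that are continuous for the adic topology are determined by their values on
  monomials.\<close>

lemma cont_additive_eqI:
  fixes \<Phi> \<Psi> :: "complex fps fps \<Rightarrow> complex fps fps"
  assumes add: "\<And>F G. \<Phi> (F + G) = \<Phi> F + \<Phi> G" "\<And>F G. \<Psi> (F + G) = \<Psi> F + \<Psi> G"
    and cont: "\<And>n F. F \<in> in_ideal (Suc n) \<Longrightarrow> \<Phi> F \<in> in_ideal n" "\<And>n F. F \<in> in_ideal (Suc n) \<Longrightarrow> \<Psi> F \<in> in_ideal n"
    and mono: "\<And>c i j. \<Phi> (cc c * (XX ^ i * YY ^ j)) = \<Psi> (cc c * (XX ^ i * YY ^ j))"
  shows "\<Phi> F = \<Psi> F"
proof -
  have z: "\<Phi> 0 = 0" "\<Psi> 0 = 0" using add(1)[of 0 0] add(2)[of 0 0] by auto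
  have s: "\<Phi> (sum f A) = (\<Sum>x\<in>A. \<Phi> (f x))" "\<Psi> (sum f A) = (\<Sum>x\<in>A. \<Psi> (f x))" for f :: "nat \<Rightarrow> _" and A
    by (induction A rule: infinite_finite_induct) (auto simp: add z)
  have "\<Phi> F - \<Psi> F \<in> in_ideal n" for n
  proof -
    define T where "T = trunc2 (Suc n) F"
    have "\<Phi> T = \<Psi> T" unfolding T_def trunc2_def s mono ..
    have "\<Phi> F = \<Phi> T + \<Phi> (F - T)" "\<Psi> F = \<Psi> T + \<Psi> (F - T)"
      by (simp_all flip: add)
    with \<open>\<Phi> T = \<Psi> T\<close> have "\<Phi> F - \<Psi> F = \<Phi> (F - T) - \<Psi> (F - T)" by simp
    also have "\<dots> \<in> in_ideal n"
      using trunc2_diff[of F "Suc n"] by (auto intro: cont simp: T_def)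
    finally show ?thesis .
  qed
  then have "\<Phi> F - \<Psi> F = 0" by (rule in_ideal_all)
  then show ?thesis by simp
qed

subsection \<open>Substitution\<close>

text \<open>For \<open>a\<close> and \<open>b\<close> in the maximal ideal
  \<open>a ^ i * b ^ j\<close> has order at least \<open>i + j\<close>, so the coefficient at
  \<open>(n, m)\<close> sees only \<open>i + j \<le> n + m\<close>. The square of indices contains
  these and keeps the sum finite; linearity in \<open>F\<close> then holds for arbitrary
  \<open>a\<close>, \<open>b\<close>, while multiplicativity asks for the maximal ideal.\<close>

definition sub :: "complex fps fps \<Rightarrow> complex fps fps \<Rightarrow> complex fps fps \<Rightarrow> complex fps fps" where
  "sub F a b = Abs_fps (\<lambda>m. Abs_fps (\<lambda>n. \<Sum>i\<le>n+m. \<Sum>j\<le>n+m. coef2 F i j * coef2 (a ^ i * b ^ j) n m))"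

lemma coef2_sub: "coef2 (sub F a b) n m = (\<Sum>i\<le>n+m. \<Sum>j\<le>n+m. coef2 F i j * coef2 (a ^ i * b ^ j) n m)"
  by (simp add: sub_def coef2_def)

lemma sub_add: "sub (F + G) a b = sub F a b + sub G a b"
  by (rule coef2_eqI) (simp add: coef2_sub ring_distribs sum.distrib)

lemma sub_0 [simp]: "sub 0 a b = 0"
  by (rule coef2_eqI) (simp add: coef2_sub)

lemma sub_diff: "sub (F - G) a b = sub F a b - sub G a b"
  by (metis add_diff_cancel diff_add_cancel sub_add)

lemma sub_sum: "sub (sum f A) a b = (\<Sum>x\<in>A. sub (f x) a b)"
  by (induction A rule: infinite_finite_induct) (auto simp: sub_add)

lemma sub_cc_mult: "sub (cc c * F) a b = cc c * sub F a b"
  by (rule coef2_eqI) (simp add: coef2_sub sum_distrib_left mult.assoc)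

lemma sub_ideal:
  assumes "a \<in> max_ideal" "b \<in> max_ideal" "F \<in> in_ideal n"
  shows "sub F a b \<in> in_ideal n"
proof (rule in_idealI)
  fix k l assume kl: "k + l < n"
  have "coef2 F i j * coef2 (a ^ i * b ^ j) k l = 0" for i j
  proof (cases "i + j < n")
    case True then show ?thesis using in_idealD[OF assms(3)] by simp
  next
    case False
    then have "k + l < i + j" using kl by simp
    then show ?thesis using in_idealD[OF in_ideal_powers[OF assms(1,2)]] by simp
  qed
  then show "coef2 (sub F a b) k l = 0" by (simp only: coef2_sub sum.neutral_const)
qed

lemma coef2_sub_00: "coef2 (sub F a b) 0 0 = coef2 F 0 0"
  by (simp add: coef2_sub coef2_1)

lemma sub_max_ideal: "F \<in> max_ideal \<Longrightarrow> sub F a b \<in> max_ideal"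
  by (simp add: max_ideal_iff coef2_sub_00)

lemma sub_mono:
  assumes "a \<in> max_ideal" "b \<in> max_ideal"
  shows "sub (XX ^ i * YY ^ j) a b = a ^ i * b ^ j"
proof (rule coef2_eqI)
  fix n m
  have "coef2 (sub (XX ^ i * YY ^ j) a b) n m
     = (\<Sum>i'\<le>n+m. \<Sum>j'\<le>n+m. if i' = i then (if j' = j then coef2 (a ^ i * b ^ j) n m else 0) else 0)"
    unfolding coef2_sub by (intro sum.cong refl) (auto simp: coef2_mono)
  also have "\<dots> = (\<Sum>i'\<le>n+m. if i' = i then (\<Sum>j'\<le>n+m. (if j' = j then coef2 (a ^ i * b ^ j) n m else 0)) else 0)"
    by (intro sum.cong refl) auto
  also have "\<dots> = (if i \<le> n + m \<and> j \<le> n + m then coef2 (a ^ i * b ^ j) n m else 0)"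
    by (simp add: sum.delta)
  also have "\<dots> = coef2 (a ^ i * b ^ j) n m"
    using in_idealD[OF in_ideal_powers[OF assms], of n m i j] by auto
  finally show "coef2 (sub (XX ^ i * YY ^ j) a b) n m = coef2 (a ^ i * b ^ j) n m" .
qed

lemma sub_XX: "a \<in> max_ideal \<Longrightarrow> b \<in> max_ideal \<Longrightarrow> sub XX a b = a"
  using sub_mono[of a b 1 0] by simp
lemma sub_YY: "a \<in> max_ideal \<Longrightarrow> b \<in> max_ideal \<Longrightarrow> sub YY a b = b"
  using sub_mono[of a b 0 1] by simp
lemma sub_1 [simp]: "sub 1 a b = 1"
proof (rule coef2_eqI)
  fix n m
  have "coef2 (sub 1 a b) n m = (\<Sum>i\<le>n+m. \<Sum>j\<le>n+m. if i = 0 then (if j = 0 then coef2 1 n m else 0) else 0)"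
    unfolding coef2_sub by (intro sum.cong refl) (auto simp: coef2_1)
  also have "\<dots> = (\<Sum>i\<le>n+m. if i = 0 then (\<Sum>j\<le>n+m. if j = 0 then coef2 1 n m else 0) else 0)"
    by (intro sum.cong refl) auto
  also have "\<dots> = coef2 1 n m" by (simp add: sum.delta)
  finally show "coef2 (sub 1 a b) n m = coef2 1 n m" .
qed
lemma sub_cc [simp]: "sub (cc c) a b = cc c"
  using sub_cc_mult[of c 1 a b] by simp

text \<open>Both sides are additive and continuous in each factor separately;
  \<open>cont_additive_eqI\<close>, applied to \<open>F\<close> and then to \<open>G\<close>, leaves
  the case of two monomials.\<close>

lemma sub_mult:
  assumes ab: "a \<in> max_ideal" "b \<in> max_ideal"
  shows "sub (F * G) a b = sub F a b * sub G a b"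
proof (rule cont_additive_eqI[of "\<lambda>F. sub (F * G) a b" "\<lambda>F. sub F a b * sub G a b"])
  fix c i j
  let ?M = "cc c * (XX ^ i * YY ^ j)"
  show "sub (?M * G) a b = sub ?M a b * sub G a b"
  proof (rule cont_additive_eqI[of "\<lambda>G. sub (?M * G) a b" "\<lambda>G. sub ?M a b * sub G a b"])
    fix d k l
    have e: "?M * (cc d * (XX ^ k * YY ^ l)) = cc (c * d) * (XX ^ (i + k) * YY ^ (j + l))"
      by (simp add: power_add mult_ac)
    show "sub (?M * (cc d * (XX ^ k * YY ^ l))) a b = sub ?M a b * sub (cc d * (XX ^ k * YY ^ l)) a b"
      unfolding e sub_cc_mult sub_mono[OF ab] by (simp add: power_add mult_ac)
    show "sub (?M * F) a b \<in> in_ideal n" "sub ?M a b * sub F a b \<in> in_ideal n" if "F \<in> in_ideal (Suc n)" for F n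
      using in_ideal_Suc[OF that] by (auto intro: in_ideal_mult2 sub_ideal[OF ab])
  qed (simp_all add: ring_distribs sub_add)
  show "sub (F * G) a b \<in> in_ideal n" "sub F a b * sub G a b \<in> in_ideal n" if "F \<in> in_ideal (Suc n)" for F n
    using in_ideal_Suc[OF that] by (auto intro: in_ideal_mult1 sub_ideal[OF ab])
qed (simp_all add: ring_distribs sub_add)

lemma sub_power: "a \<in> max_ideal \<Longrightarrow> b \<in> max_ideal \<Longrightarrow> sub (F ^ n) a b = sub F a b ^ n"
  by (induction n) (auto simp: sub_mult)

lemma sub_prod_list: "a \<in> max_ideal \<Longrightarrow> b \<in> max_ideal \<Longrightarrow> sub (prod_list Fs) a b = (\<Prod>F\<leftarrow>Fs. sub F a b)"
  by (induction Fs) (auto simp: sub_mult)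

lemma sub_prod: "a \<in> max_ideal \<Longrightarrow> b \<in> max_ideal \<Longrightarrow> sub (prod f A) a b = (\<Prod>x\<in>A. sub (f x) a b)"
  by (induction A rule: infinite_finite_induct) (auto simp: sub_mult)

lemma sub_sub:
  assumes "a \<in> max_ideal" "b \<in> max_ideal" "c \<in> max_ideal" "d \<in> max_ideal"
  shows "sub (sub F a b) c d = sub F (sub a c d) (sub b c d)"
proof (rule cont_additive_eqI[of "\<lambda>F. sub (sub F a b) c d" "\<lambda>F. sub F (sub a c d) (sub b c d)"])
  have i: "sub a c d \<in> max_ideal" "sub b c d \<in> max_ideal"
    using assms by (auto intro: sub_max_ideal)
  show "sub (sub (cc e * (XX ^ i * YY ^ j)) a b) c d = sub (cc e * (XX ^ i * YY ^ j)) (sub a c d) (sub b c d)" for e i j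
    using assms i by (simp add: sub_cc_mult sub_mono sub_mult sub_power sub_XX sub_YY)
  show "F \<in> in_ideal (Suc n) \<Longrightarrow> sub (sub F a b) c d \<in> in_ideal n" for F n
    using assms by (intro in_ideal_mono[of _ "Suc n" n] sub_ideal) auto
  show "F \<in> in_ideal (Suc n) \<Longrightarrow> sub F (sub a c d) (sub b c d) \<in> in_ideal n" for F n
    using i by (intro in_ideal_mono[of _ "Suc n" n] sub_ideal) auto
qed (simp_all add: sub_add)

lemma sub_id [simp]: "sub F XX YY = F"
  by (rule cont_additive_eqI[of "\<lambda>F. sub F XX YY" "\<lambda>F. F"])
    (auto simp: sub_add sub_cc_mult sub_mono intro!: sub_ideal dest: in_ideal_Suc)

subsection \<open>Derivatives\<close>

definition dx :: "complex fps fps \<Rightarrow> complex fps fps" where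
  "dx F = Abs_fps (\<lambda>j. fps_deriv (fps_nth F j))"
abbreviation dy :: "complex fps fps \<Rightarrow> complex fps fps" where "dy \<equiv> fps_deriv"

lemma coef2_dx: "coef2 (dx F) i j = of_nat (Suc i) * coef2 F (Suc i) j"
  by (simp add: dx_def coef2_def)
lemma coef2_dy: "coef2 (dy F) i j = of_nat (Suc j) * coef2 F i (Suc j)"
  by (simp add: coef2_def fps_of_nat[symmetric] distrib_right)

text \<open>The four properties behind the chain rule, which is thus proved once for
  \<open>dx\<close> and \<open>dy\<close>. The loss of one order in \<open>cont\<close> is the
  reason for the \<open>Suc n\<close> in \<open>cont_additive_eqI\<close>.\<close>

locale deriv2 =
  fixes \<delta> :: "complex fps fps \<Rightarrow> complex fps fps"
  assumes add: "\<delta> (F + G) = \<delta> F + \<delta> G"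
    and mult: "\<delta> (F * G) = \<delta> F * G + F * \<delta> G"
    and cc: "\<delta> (cc c) = 0"
    and cont: "F \<in> in_ideal (Suc n) \<Longrightarrow> \<delta> F \<in> in_ideal n"
begin
lemma power: "\<delta> (F ^ n) = of_nat n * F ^ (n - 1) * \<delta> F"
proof (induction n)
  case 0 then show ?case using cc[of 1] by simp
next
  case (Suc n)
  then show ?case by (cases n) (auto simp: mult algebra_simps)
qed
end

lemma dx_mult: "dx (F * G) = dx F * G + F * dx G"
proof (rule fps_ext)
  fix n
  have "fps_nth (dx (F * G)) n = (\<Sum>i=0..n. fps_deriv (fps_nth F i * fps_nth G (n - i)))"
    by (simp only: dx_def fps_nth_Abs_fps fps_mult_nth fps_deriv_sum)
  also have "\<dots> = (\<Sum>i=0..n. fps_deriv (fps_nth F i) * fps_nth G (n - i) + fps_nth F i * fps_deriv (fps_nth G (n - i)))"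
    by (simp add: add.commute)
  also have "\<dots> = fps_nth (dx F * G + F * dx G) n"
    by (simp only: sum.distrib fps_mult_nth fps_add_nth dx_def fps_nth_Abs_fps)
  finally show "fps_nth (dx (F * G)) n = fps_nth (dx F * G + F * dx G) n" .
qed

global_interpretation dx: deriv2 dx
proof
  show "dx (F + G) = dx F + dx G" for F G by (rule coef2_eqI) (simp add: coef2_dx ring_distribs)
  show "dx (cc c) = 0" for c by (rule coef2_eqI) (simp add: coef2_dx coef2_cc)
  show "dx F \<in> in_ideal n" if "F \<in> in_ideal (Suc n)" for F n
    using that by (auto simp: in_ideal_def coef2_dx)
qed (rule dx_mult)

global_interpretation dy: deriv2 dy
proof
  show "dy (cc c) = 0" for c by (simp add: cc_def)
  show "dy F \<in> in_ideal n" if "F \<in> in_ideal (Suc n)" for F n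
    using that by (auto simp: in_ideal_def coef2_dy)
qed auto

lemma dx_cc_mult: "dx (cc c * F) = cc c * dx F"
  by (simp add: dx_mult dx.cc)
lemma dy_cc_mult: "dy (cc c * F) = cc c * dy F"
  by (simp add: dy.cc)
lemma dx_XX [simp]: "dx XX = 1"
  by (rule coef2_eqI) (auto simp: coef2_dx coef2_XX coef2_1)
lemma dx_YY [simp]: "dx YY = 0"
  by (rule coef2_eqI) (auto simp: coef2_dx coef2_YY)
lemma dy_XX [simp]: "dy XX = 0"
  by (simp add: XX_def)

lemma (in deriv2) chain:
  assumes ab: "a \<in> max_ideal" "b \<in> max_ideal"
  shows "\<delta> (sub F a b) = sub (dx F) a b * \<delta> a + sub (dy F) a b * \<delta> b"
proof (rule cont_additive_eqI[of "\<lambda>F. \<delta> (sub F a b)" "\<lambda>F. sub (dx F) a b * \<delta> a + sub (dy F) a b * \<delta> b"])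
  show "F \<in> in_ideal (Suc n) \<Longrightarrow> \<delta> (sub F a b) \<in> in_ideal n" for F n
    by (intro cont sub_ideal ab)
  show "F \<in> in_ideal (Suc n) \<Longrightarrow> sub (dx F) a b * \<delta> a + sub (dy F) a b * \<delta> b \<in> in_ideal n" for F n
    by (intro in_ideal_add in_ideal_mult1 sub_ideal ab dx.cont dy.cont)
  fix c i j
  have on: "of_nat k = cc (of_nat k)" for k by (simp add: cc_def fps_of_nat)
  show "\<delta> (sub (cc c * (XX ^ i * YY ^ j)) a b) = sub (dx (cc c * (XX ^ i * YY ^ j))) a b * \<delta> a + sub (dy (cc c * (XX ^ i * YY ^ j))) a b * \<delta> b"
    unfolding sub_cc_mult sub_mono[OF ab] dx.mult dy.mult mult cc dx.cc dy.cc dx.power dy.power power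
    by (simp add: sub_cc_mult sub_add sub_mult[OF ab] sub_power[OF ab] sub_XX[OF ab] sub_YY[OF ab] on algebra_simps)
qed (simp_all add: sub_add dx.add dy.add add ring_distribs algebra_simps)

subsection \<open>Units and implicit functions\<close>

lemma unit2_inverse:
  assumes "coef2 F 0 0 \<noteq> 0"
  shows "\<exists>G. F * G = 1"
proof -
  have 0: "fps_nth F 0 * inverse (fps_nth F 0) = 1"
    using assms by (intro inverse_mult_eq_1') (simp add: coef2_def)
  show ?thesis using fps_right_inverse[OF 0] by blast
qed

lemma coef2_mult_00: "coef2 (F * G) 0 0 = coef2 F 0 0 * coef2 G 0 0"
  by (simp add: coef2_mult)

lemma unit2_coef: "F * G = 1 \<Longrightarrow> coef2 F 0 0 \<noteq> 0"
  using coef2_mult_00[of F G] by (auto simp: coef2_1)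

text \<open>First-order Taylor expansion in the first argument, with an error one order better than
  \<open>a - a'\<close>. In \<open>a ^ i - a' ^ i\<close> the factor \<open>a - a'\<close> splits
  off and leaves order \<open>i - 1\<close>, so every term of \<open>G\<close> except the one at
  \<open>(1, 0)\<close> gains an order or cancels.\<close>

lemma coef2_0_sub_diff:
  assumes ab: "a \<in> max_ideal" "a' \<in> max_ideal" "b \<in> max_ideal" and d: "a - a' \<in> in_ideal k"
  shows "sub G a b - sub G a' b - cc (coef2 G 1 0) * (a - a') \<in> in_ideal (Suc k)"
proof -
  have *: "a ^ i - a' ^ i \<in> in_ideal (k + (i - 1))" for i
  proof (cases i)
    case (Suc n)
    have "a ^ Suc n - a' ^ Suc n = (a - a') * (\<Sum>p<Suc n. a ^ p * a' ^ (n - p))"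
      by (rule diff_power_eq_sum)
    moreover have "(\<Sum>p<Suc n. a ^ p * a' ^ (n - p)) \<in> in_ideal n"
    proof (rule in_ideal_sum)
      fix p assume "p \<in> {..<Suc n}"
      then show "a ^ p * a' ^ (n - p) \<in> in_ideal n"
        using in_ideal_powers[OF ab(1,2), of p "n - p"] by simp
    qed
    ultimately show ?thesis using in_ideal_mult[OF d] by (simp only: Suc diff_Suc_1)
  qed auto
  \<comment> \<open>The bound is at least 2, so that the index \<open>(1, 0)\<close> of the linear
    term occurs in the truncation also for \<open>k = 0\<close>.\<close>
  define T where "T = trunc2 (Suc (Suc k)) G"
  have G: "G - T \<in> in_ideal (Suc k)" unfolding T_def by (rule in_ideal_Suc) (rule trunc2_diff)
  have r: "sub (G - T) a b \<in> in_ideal (Suc k)" "sub (G - T) a' b \<in> in_ideal (Suc k)"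
    using G ab by (auto intro: sub_ideal)
  define f where "f = (\<lambda>(i, j). cc (coef2 G i j) * ((a ^ i - a' ^ i) * b ^ j))"
  let ?P = "{..<Suc (Suc k)} \<times> {..<Suc (Suc k)}"
  have cT: "coef2 T i j = coef2 G i j" if "i < Suc (Suc k)" "j < Suc (Suc k)" for i j
    using that by (simp add: T_def coef2_trunc2)
  have "sub T c b = (\<Sum>i<Suc (Suc k). \<Sum>j<Suc (Suc k). cc (coef2 G i j) * (c ^ i * b ^ j))" if "c \<in> max_ideal" for c
    using ab that unfolding T_def trunc2_def by (simp only: sub_sum sub_cc_mult sub_mono)
  then have "sub T a b - sub T a' b = (\<Sum>i<Suc (Suc k). \<Sum>j<Suc (Suc k). f (i, j))"
    using ab by (simp only: sum_subtractf[symmetric] f_def prod.case left_diff_distrib right_diff_distrib)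
  also have "\<dots> = sum f ?P" by (simp only: sum.cartesian_product case_prod_conv split_def prod.collapse)
  finally have "sub T a b - sub T a' b - cc (coef2 G 1 0) * (a - a') = sum f ?P - f (1, 0)"
    by (simp add: f_def)
  also have "\<dots> = sum f (?P - {(1, 0)})" by (subst sum_diff1) auto
  also have "\<dots> \<in> in_ideal (Suc k)"
  proof (intro in_ideal_sum)
    fix p assume p: "p \<in> ?P - {(1, 0)}"
    obtain i j where ij: "p = (i, j)" by fastforce
    show "f p \<in> in_ideal (Suc k)"
    proof (cases "i = 0")
      case False
      have "(a ^ i - a' ^ i) * b ^ j \<in> in_ideal ((k + (i - 1)) + j)"
        by (intro in_ideal_mult * in_ideal_power1 ab)
      moreover have "Suc k \<le> k + (i - 1) + j" using False p ij by auto
      ultimately have "(a ^ i - a' ^ i) * b ^ j \<in> in_ideal (Suc k)" by (rule in_ideal_mono)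
      then show ?thesis by (auto simp: f_def ij intro: in_ideal_mult2)
    qed (simp add: f_def ij)
  qed
  finally have "sub T a b - sub T a' b - cc (coef2 G 1 0) * (a - a') \<in> in_ideal (Suc k)" .
  from in_ideal_add[OF this in_ideal_diff[OF r]]
  show ?thesis by (simp add: sub_diff algebra_simps)
qed

lemma minus_mult_alg:
  fixes i g d :: "'a :: comm_ring_1"
  shows "(- i) * (x - y - g * d) = i * g * d - i * (x - y)"
  by (simp add: algebra_simps)

text \<open>If \<open>a - a'\<close> has order at least \<open>k\<close>, equality of the two values
  and the Taylor expansion force order \<open>k + 1\<close>, as the linear coefficient is
  invertible.\<close>

lemma implicit_unique:
  assumes "a \<in> max_ideal" "a' \<in> max_ideal" "b \<in> max_ideal" "coef2 G 1 0 \<noteq> 0"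
    and "sub G a b = sub G a' b"
  shows "a = a'"
proof -
  have "a - a' \<in> in_ideal k" for k
  proof (induction k)
    case (Suc k)
    define i where "i = cc (inverse (coef2 G 1 0))"
    define g where "g = cc (coef2 G 1 0)"
    have ig: "i * g = 1" unfolding i_def g_def using assms(4) by (subst cc_hom(4)[symmetric]) simp
    have "(- i) * (sub G a b - sub G a' b - g * (a - a')) \<in> in_ideal (Suc k)"
      unfolding g_def by (intro in_ideal_mult2 coef2_0_sub_diff assms Suc)
    then show ?case unfolding minus_mult_alg ig assms(5) by simp
  qed simp
  then have "a - a' = 0" by (rule in_ideal_all)
  then show ?thesis by simp
qed

text \<open>Completeness: the coefficient at \<open>(i, j)\<close> no longer changes from index
  \<open>i + j + 1\<close> on, and is read off there.\<close>

lemma ideal_limit: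
  assumes "\<And>k. A (Suc k) - A k \<in> in_ideal k"
  shows "\<exists>L. \<forall>k. L - A k \<in> in_ideal k"
proof -
  have d: "A (k + m) - A k \<in> in_ideal k" for k m
  proof (induction m)
    case (Suc m)
    have "A (Suc (k + m)) - A (k + m) \<in> in_ideal k"
      using in_ideal_mono[OF assms[of "k + m"], of k] by simp
    from in_ideal_add[OF this Suc] show ?case by simp
  qed simp
  define L where "L = Abs_fps (\<lambda>j. Abs_fps (\<lambda>i. coef2 (A (Suc (i + j))) i j))"
  have L: "coef2 L i j = coef2 (A (Suc (i + j))) i j" for i j by (simp add: L_def coef2_def)
  have "L - A k \<in> in_ideal k" for k
  proof (rule in_idealI)
    fix i j assume ij: "i + j < k"
    then obtain m where "k = Suc (i + j) + m" using less_iff_Suc_add by auto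
    with d[of "Suc (i + j)" m] show "coef2 (L - A k) i j = 0"
      using in_idealD[of "A (Suc (i + j) + m) - A (Suc (i + j))" "Suc (i + j)" i j] by (simp add: L)
  qed
  then show ?thesis by blast
qed

lemma implicit_exists:
  assumes b: "b \<in> max_ideal" "c \<in> max_ideal" and G: "coef2 G 0 0 = 0" "coef2 G 1 0 \<noteq> 0"
  shows "\<exists>a\<in>max_ideal. sub G a b = c"
proof -
  define g where "g = coef2 G 1 0"
  \<comment> \<open>Newton's iteration with the slope frozen at the origin; the Taylor expansion
    makes it a contraction that gains one order at every step.\<close>
  define \<Phi> where "\<Phi> a = a - cc (inverse g) * (sub G a b - c)" for a
  have g: "cc (inverse g) * cc g = 1" using G by (subst cc_hom(4)[symmetric]) (simp add: g_def)
  have \<Phi>: "\<Phi> a \<in> max_ideal" if "a \<in> max_ideal" for a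
    using that b G by (auto simp: \<Phi>_def max_ideal_iff coef2_sub_00)
  have contr: "\<Phi> a - \<Phi> a' \<in> in_ideal (Suc k)" if "a \<in> max_ideal" "a' \<in> max_ideal" "a - a' \<in> in_ideal k" for a a' k
  proof -
    have "cc (- inverse g) * (sub G a b - sub G a' b - cc g * (a - a')) \<in> in_ideal (Suc k)"
      unfolding g_def by (intro in_ideal_mult2 coef2_0_sub_diff that b)
    also have "cc (- inverse g) * (sub G a b - sub G a' b - cc g * (a - a')) = cc (inverse g) * cc g * (a - a') - cc (inverse g) * (sub G a b - sub G a' b)"
      unfolding cc_hom minus_mult_alg ..
    also have "\<dots> = \<Phi> a - \<Phi> a'" unfolding g by (simp add: \<Phi>_def algebra_simps)
    finally show ?thesis .
  qed
  define A where "A k = (\<Phi> ^^ k) 0" for k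
  have AS: "A (Suc k) = \<Phi> (A k)" for k by (simp add: A_def)
  have A: "A k \<in> max_ideal" for k by (induction k) (simp_all add: AS \<Phi>, simp add: A_def)
  have "A (Suc k) - A k \<in> in_ideal k" for k
  proof (induction k)
    case (Suc k)
    then show ?case using contr[OF A A Suc] by (simp add: AS)
  qed simp
  then obtain L where L: "\<And>k. L - A k \<in> in_ideal k" using ideal_limit by blast
  have Lm: "L \<in> max_ideal"
  proof -
    have "L - A 1 \<in> max_ideal" using L[of 1] by (simp add: max_ideal_def)
    from max_ideal_add[OF this A[of 1]] show ?thesis by simp
  qed
  have "\<Phi> L - L \<in> in_ideal k" for k
  proof -
    have "\<Phi> L - \<Phi> (A k) \<in> in_ideal (Suc k)" by (rule contr[OF Lm A L])
    moreover have "A (Suc k) - L \<in> in_ideal (Suc k)"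
      using in_ideal_uminus[OF L[of "Suc k"]] by simp
    ultimately have "(\<Phi> L - \<Phi> (A k)) + (A (Suc k) - L) \<in> in_ideal (Suc k)" by (rule in_ideal_add)
    then have "\<Phi> L - L \<in> in_ideal (Suc k)" by (simp add: AS)
    then show ?thesis by (rule in_ideal_Suc)
  qed
  then have "\<Phi> L - L = 0" by (rule in_ideal_all)
  then have "cc (inverse g) * (sub G L b - c) = 0" by (simp only: \<Phi>_def) simp
  then have "cc (inverse g) * cc g * (sub G L b - c) = 0" by (metis mult.assoc mult.commute mult_zero_right)
  then have "sub G L b = c" unfolding g by simp
  then show ?thesis using Lm by blast
qed

subsection \<open>Arcs\<close>

definition arc_eval :: "complex fps fps \<Rightarrow> complex fps \<Rightarrow> complex fps \<Rightarrow> complex fps" where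
  "arc_eval F a b = Abs_fps (\<lambda>n. \<Sum>i\<le>n. \<Sum>j\<le>n. coef2 F i j * fps_nth (a ^ i * b ^ j) n)"

text \<open>\<open>px\<close> and \<open>py\<close> embed one-variable series in the first and in
  the second variable. Evaluation on an arc is substitution of embedded series, so its rules are
  inherited from \<open>sub\<close> by injectivity of the embeddings.\<close>

definition px :: "complex fps \<Rightarrow> complex fps fps" where "px a = fps_const a"
definition py :: "complex fps \<Rightarrow> complex fps fps" where "py a = Abs_fps (\<lambda>k. fps_const (fps_nth a k))"

lemma subst_arc_eq: "subst_arc f a b = arc_eval (series_of f) a b"
  by (simp add: subst_arc_def arc_eval_def coef_def)

lemma coef2_px: "coef2 (px a) i j = (if j = 0 then fps_nth a i else 0)"
  by (simp add: px_def coef2_def)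
lemma coef2_py: "coef2 (py a) i j = (if i = 0 then fps_nth a j else 0)"
  by (simp add: py_def coef2_def)

lemma px_hom [simp]: "px 0 = 0" "px 1 = 1" "px (a + b) = px a + px b" "px (a - b) = px a - px b" "px (- a) = - px a"
  "px (a * b) = px a * px b"
  by (simp_all add: px_def)
lemma px_power: "px (a ^ n) = px a ^ n" by (simp add: px_def)
lemma px_inj: "px a = px b \<longleftrightarrow> a = b" by (simp add: px_def)

lemma py_hom [simp]: "py 0 = 0" "py 1 = 1" "py (a + b) = py a + py b" "py (a - b) = py a - py b" "py (- a) = - py a"
  by (rule coef2_eqI; simp add: coef2_py coef2_1)+
lemma py_mult [simp]: "py (a * b) = py a * py b"
proof -
  have "fps_const (sum f A) = (\<Sum>x\<in>A. fps_const (f x))" for f :: "nat \<Rightarrow> complex" and A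
    by (induction A rule: infinite_finite_induct) (auto simp flip: fps_const_add)
  then show ?thesis
    by (intro fps_ext) (simp add: py_def fps_mult_nth)
qed
lemma py_power: "py (a ^ n) = py a ^ n" by (induction n) auto
lemma py_inj: "py a = py b \<longleftrightarrow> a = b"
  by (auto simp: py_def fps_eq_iff)
lemma py_X: "py fps_X = YY" by (rule coef2_eqI) (simp add: coef2_py coef2_YY)
lemma px_const: "px (fps_const c) = cc c" by (simp add: px_def cc_def)
lemma py_const: "py (fps_const c) = cc c" by (rule coef2_eqI) (simp add: coef2_py coef2_cc)
lemma px_max: "px a \<in> max_ideal \<longleftrightarrow> fps_nth a 0 = 0" and py_max: "py a \<in> max_ideal \<longleftrightarrow> fps_nth a 0 = 0"
  by (simp_all add: max_ideal_iff coef2_px coef2_py)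

lemma sub_px: "sub F (px a) (px b) = px (arc_eval F a b)"
proof (rule coef2_eqI)
  fix n m
  show "coef2 (sub F (px a) (px b)) n m = coef2 (px (arc_eval F a b)) n m"
    by (cases "m = 0") (simp_all add: coef2_sub coef2_px arc_eval_def flip: px_hom px_power)
qed

lemma sub_py: "sub F (py a) (py b) = py (arc_eval F a b)"
proof (rule coef2_eqI)
  fix n m
  show "coef2 (sub F (py a) (py b)) n m = coef2 (py (arc_eval F a b)) n m"
    by (cases "n = 0") (simp_all add: coef2_sub coef2_py arc_eval_def flip: py_hom py_mult py_power)
qed

lemma arc_add: "arc_eval (F + G) a b = arc_eval F a b + arc_eval G a b"
  by (simp add: sub_add flip: px_inj sub_px)
lemma arc_diff: "arc_eval (F - G) a b = arc_eval F a b - arc_eval G a b"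
  by (simp add: sub_diff flip: px_inj sub_px)
lemma arc_0 [simp]: "arc_eval 0 a b = 0"
  by (simp flip: px_inj sub_px)
lemma arc_1 [simp]: "arc_eval 1 a b = 1"
  by (simp flip: px_inj sub_px)
lemma arc_cc [simp]: "arc_eval (cc c) a b = fps_const c"
  by (simp add: px_const flip: px_inj sub_px)
lemma arc_nth_0 [simp]: "fps_nth (arc_eval F a b) 0 = coef2 F 0 0"
  by (simp add: arc_eval_def)

context
  fixes a b :: "complex fps"
  assumes ab: "fps_nth a 0 = 0" "fps_nth b 0 = 0"
begin
lemma arc_mult: "arc_eval (F * G) a b = arc_eval F a b * arc_eval G a b"
  using ab by (simp add: sub_mult px_max flip: px_inj sub_px)
lemma arc_power: "arc_eval (F ^ n) a b = arc_eval F a b ^ n"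
  by (induction n) (auto simp: arc_mult)
lemma arc_prod_list: "arc_eval (prod_list Fs) a b = (\<Prod>F\<leftarrow>Fs. arc_eval F a b)"
  by (induction Fs) (auto simp: arc_mult)
lemma arc_XX: "arc_eval XX a b = a" and arc_YY: "arc_eval YY a b = b"
  using ab by (simp_all add: sub_XX sub_YY px_max flip: px_inj sub_px)
lemma arc_sub:
  assumes "A \<in> max_ideal" "B \<in> max_ideal"
  shows "arc_eval (sub F A B) a b = arc_eval F (arc_eval A a b) (arc_eval B a b)"
  using ab assms by (simp add: sub_sub px_max flip: px_inj sub_px)
lemma arc_deriv: "fps_deriv (arc_eval F a b) = arc_eval (dx F) a b * fps_deriv a + arc_eval (dy F) a b * fps_deriv b"
proof -
  have d: "dy (py c) = py (fps_deriv c)" for c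
    by (rule coef2_eqI) (simp add: coef2_dy coef2_py)
  have "py (fps_deriv (arc_eval F a b)) = dy (sub F (py a) (py b))"
    by (simp only: d sub_py)
  also have "\<dots> = py (arc_eval (dx F) a b * fps_deriv a + arc_eval (dy F) a b * fps_deriv b)"
    using ab by (subst dy.chain) (auto simp: py_max sub_py d)
  finally show ?thesis by (simp only: py_inj)
qed
lemma arc_compose:
  assumes s: "fps_nth s 0 = 0"
  shows "arc_eval F (fps_compose a s) (fps_compose b s) = fps_compose (arc_eval F a b) s"
proof -
  have c: "px (fps_compose c s) = sub (px c) (px s) YY" for c
  proof (rule coef2_eqI)
    fix n m
    have "coef2 (sub (px c) (px s) YY) n m = (\<Sum>i\<le>n+m. \<Sum>j\<le>n+m. if j = 0 then fps_nth c i * coef2 (px (s ^ i)) n m else 0)"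
      unfolding coef2_sub by (intro sum.cong refl) (auto simp: coef2_px px_power)
    also have "\<dots> = (\<Sum>i\<le>n+m. fps_nth c i * coef2 (px (s ^ i)) n m)"
      by (simp add: sum.delta)
    finally show "coef2 (px (fps_compose c s)) n m = coef2 (sub (px c) (px s) YY) n m"
      by (simp add: coef2_px fps_compose_nth atLeast0AtMost)
  qed
  have "px (arc_eval F (fps_compose a s) (fps_compose b s)) = sub F (sub (px a) (px s) YY) (sub (px b) (px s) YY)"
    by (simp only: flip: c sub_px)
  also have "\<dots> = sub (px (arc_eval F a b)) (px s) YY"
    using ab s by (subst sub_sub[symmetric]) (auto simp: px_max sub_px)
  finally show ?thesis by (simp only: px_inj flip: c)
qed
end

subsection \<open>Puiseux factorization\<close>

lemma sub_x0: "coef2 (sub F 0 YY) i j = (if i = 0 then coef2 F 0 j else 0)"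
proof -
  have "coef2 (sub F 0 YY) i j = (\<Sum>k\<le>i+j. \<Sum>l\<le>i+j. if k = 0 then (if l = j then (if i = 0 then coef2 F k l else 0) else 0) else 0)"
    unfolding coef2_sub
    by (intro sum.cong refl) (use coef2_mono[of 0] in \<open>auto simp: power_0_left\<close>)
  also have "\<dots> = (\<Sum>k\<le>i+j. if k = 0 then \<Sum>l\<le>i+j. (if l = j then (if i = 0 then coef2 F k l else 0) else 0) else 0)"
    by (intro sum.cong refl) auto
  also have "\<dots> = (if i = 0 then coef2 F 0 j else 0)" by (simp add: sum.delta)
  finally show ?thesis .
qed

lemma sub_y0: "coef2 (sub F XX 0) i j = (if j = 0 then coef2 F i 0 else 0)"
proof -
  have "coef2 (sub F XX 0) i j = (\<Sum>k\<le>i+j. \<Sum>l\<le>i+j. if k = i then (if l = 0 then (if j = 0 then coef2 F k l else 0) else 0) else 0)"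
    unfolding coef2_sub
    by (intro sum.cong refl) (use coef2_mono[of _ 0] in \<open>auto simp: power_0_left\<close>)
  also have "\<dots> = (\<Sum>k\<le>i+j. if k = i then \<Sum>l\<le>i+j. (if l = 0 then (if j = 0 then coef2 F k l else 0) else 0) else 0)"
    by (intro sum.cong refl) auto
  also have "\<dots> = (if j = 0 then coef2 F i 0 else 0)" by (simp add: sum.delta)
  finally show ?thesis .
qed

lemma arc_py: "arc_eval (py c) a b = fps_compose c b"
proof (rule fps_ext)
  fix n
  have "fps_nth (arc_eval (py c) a b) n = (\<Sum>k\<le>n. if k = 0 then \<Sum>l\<le>n. fps_nth c l * fps_nth (b ^ l) n else 0)"
    unfolding arc_eval_def fps_nth_Abs_fps by (intro sum.cong refl) (simp add: coef2_py)
  then show "fps_nth (arc_eval (py c) a b) n = fps_nth (fps_compose c b) n"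
    by (simp add: sum.delta fps_compose_nth atLeast0AtMost)
qed

lemma arc_px: "arc_eval (px c) a b = fps_compose c a"
proof (rule fps_ext)
  fix n
  have "fps_nth (arc_eval (px c) a b) n = (\<Sum>k\<le>n. \<Sum>l\<le>n. if l = 0 then fps_nth c k * fps_nth (a ^ k) n else 0)"
    unfolding arc_eval_def fps_nth_Abs_fps by (intro sum.cong refl) (simp add: coef2_px)
  then show "fps_nth (arc_eval (px c) a b) n = fps_nth (fps_compose c a) n"
    by (simp add: sum.delta fps_compose_nth atLeast0AtMost)
qed

lemma sub_py_YY_power:
  assumes N: "N > 0"
  shows "sub (py c) A (YY ^ N) = py (fps_compose c (fps_X ^ N))"
proof (rule coef2_eqI)
  fix i j
  have "coef2 (sub (py c) A (YY ^ N)) i j = (\<Sum>k\<le>i+j. if k = 0 then \<Sum>l\<le>i+j. fps_nth c l * coef2 (YY ^ (N * l)) i j else 0)"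
    unfolding coef2_sub by (intro sum.cong refl) (simp add: coef2_py power_mult)
  also have "\<dots> = (\<Sum>l\<le>i+j. fps_nth c l * coef2 (YY ^ (N * l)) i j)" by (simp add: sum.delta)
  also have "\<dots> = (\<Sum>l\<le>i+j. if i = 0 \<and> j = N * l then fps_nth c l else 0)"
    using coef2_mono[of 0] by (intro sum.cong refl) auto
  also have "\<dots> = coef2 (py (fps_compose c (fps_X ^ N))) i j"
    by (auto simp: coef2_py fps_compose_nth atLeast0AtMost fps_X_power_nth simp flip: power_mult intro!: sum.cong)
  finally show "coef2 (sub (py c) A (YY ^ N)) i j = coef2 (py (fps_compose c (fps_X ^ N))) i j" .
qed

lemma sub_py_YY: "sub (py c) A YY = py c"
  using sub_py_YY_power[of 1 c A] by simp

lemma sub_py_0: "sub (py c) A 0 = cc (fps_nth c 0)"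
proof (rule coef2_eqI)
  fix i j
  have "coef2 (sub (py c) A 0) i j = (\<Sum>k\<le>i+j. \<Sum>l\<le>i+j. if k = 0 then if l = 0 then fps_nth c l * coef2 1 i j else 0 else 0)"
    unfolding coef2_sub by (intro sum.cong refl) (auto simp: coef2_py power_0_left)
  also have "\<dots> = (\<Sum>k\<le>i+j. if k = 0 then \<Sum>l\<le>i+j. if l = 0 then fps_nth c l * coef2 1 i j else 0 else 0)"
    by (intro sum.cong refl) auto
  finally show "coef2 (sub (py c) A 0) i j = coef2 (cc (fps_nth c 0)) i j" by (simp add: sum.delta coef2_cc coef2_1)
qed

text \<open>Regularity of order \<open>p\<close> in the first variable, as in Weierstrass
  preparation: \<open>A(z, 0)\<close> has order exactly \<open>p\<close>.\<close>

definition z_order :: "complex fps fps \<Rightarrow> nat \<Rightarrow> bool" where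
  "z_order A p \<longleftrightarrow> (\<forall>i<p. coef2 A i 0 = 0) \<and> coef2 A p 0 \<noteq> 0"

section \<open>The Newton-Puiseux algorithm\<close>

lemma coef2_dx_iter: "coef2 ((dx ^^ k) F) i j = fact (i + k) / fact i * coef2 F (i + k) j"
proof (induction k arbitrary: i)
  case (Suc k)
  have "coef2 ((dx ^^ Suc k) F) i j = of_nat (Suc i) * (fact (Suc i + k) / fact (Suc i) * coef2 F (Suc i + k) j)"
    by (simp only: funpow.simps o_apply coef2_dx Suc)
  also have "fact (Suc i) = (of_nat (Suc i) * fact i :: complex)" by simp
  finally show ?case by (simp del: of_nat_Suc)
qed simp

lemma dx_py [simp]: "dx (py c) = 0"
  by (rule coef2_eqI) (simp add: coef2_dx coef2_py)

lemma dx_iter_translate: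
  assumes "fps_nth c 0 = 0"
  shows "(dx ^^ k) (sub A (XX + py c) YY) = sub ((dx ^^ k) A) (XX + py c) YY"
proof (induction k arbitrary: A)
  case (Suc k)
  have "dx (sub A (XX + py c) YY) = sub (dx A) (XX + py c) YY"
    using assms by (subst dx.chain) (auto simp: py_max dx.add)
  then show ?case by (simp only: funpow_Suc_right o_apply Suc)
qed simp

lemma translate_at_0:
  assumes "fps_nth c 0 = 0"
  shows "coef2 (sub A (XX + py c) YY) 0 j = fps_nth (arc_eval A c fps_X) j"
proof -
  have "sub (sub A (XX + py c) YY) 0 YY = sub A (py c) (py fps_X)"
    using assms by (subst sub_sub) (auto simp: py_max sub_add sub_XX sub_YY py_X sub_py_YY)
  also have "\<dots> = py (arc_eval A c fps_X)" by (rule sub_py)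
  finally have "coef2 (sub (sub A (XX + py c) YY) 0 YY) 0 j = coef2 (py (arc_eval A c fps_X)) 0 j" by simp
  then show ?thesis by (simp add: sub_x0 coef2_py)
qed

lemma translate_back:
  assumes "fps_nth c 0 = 0"
  shows "sub (sub A (XX + py c) YY) (XX - py c) YY = A"
proof -
  have m: "XX + py c \<in> max_ideal" "XX - py c \<in> max_ideal" using assms by (auto simp: py_max)
  then show ?thesis
    by (simp add: sub_sub sub_add sub_XX sub_YY sub_py_YY)
qed

lemma arc_translate:
  assumes "fps_nth c 0 = 0" "fps_nth a 0 = 0" "fps_nth b 0 = 0"
  shows "arc_eval (sub A (XX + py c) YY) a b = arc_eval A (a + fps_compose c b) b"
  using assms by (subst arc_sub) (auto simp: py_max arc_add arc_XX arc_YY arc_py)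

text \<open>Once the root is translated to \<open>z = 0\<close>, divisibility by \<open>z\<close> is
  visible in the coefficients; translating back turns \<open>z\<close> into
  \<open>z - c\<close>.\<close>

lemma root_division:
  assumes "fps_nth c 0 = 0" "arc_eval A c fps_X = 0"
  shows "\<exists>Q. A = (XX - py c) * Q"
proof -
  define B where "B = sub A (XX + py c) YY"
  define Q where "Q = Abs_fps (\<lambda>j. fps_shift 1 (fps_nth B j))"
  have "coef2 B 0 j = 0" for j
    unfolding B_def using assms by (simp add: translate_at_0)
  then have B: "B = XX * Q"
    by (intro coef2_eqI) (auto simp: coef2_def XX_def Q_def)
  have "A = sub B (XX - py c) YY" unfolding B_def by (rule translate_back[symmetric]) fact
  also have "\<dots> = (XX - py c) * sub Q (XX - py c) YY"
    unfolding B using max_ideal_diff[OF XX_ideal, of "py c"] assms by (simp add: sub_mult py_max sub_XX)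
  finally show ?thesis by blast
qed

text \<open>The implicit function theorem provides a curve \<open>z = c(y)\<close> on which the
  \<open>z\<close>-derivative of order \<open>p - 1\<close> vanishes, since the one of order
  \<open>p\<close> is nonzero at the origin. Killing the terms with \<open>z ^ (p - 1)\<close> is
  what later keeps the multiplicities of the roots of the edge polynomial below
  \<open>p\<close>.\<close>

lemma tschirnhaus:
  assumes z: "z_order A p" and p: "p \<ge> 1"
  shows "\<exists>c. fps_nth c 0 = 0 \<and> z_order (sub A (XX + py c) YY) p \<and> (\<forall>j. coef2 (sub A (XX + py c) YY) (p - 1) j = 0)"
proof -
  define G where "G = (dx ^^ (p - 1)) A"
  have "coef2 G 0 0 = 0" "coef2 G 1 0 \<noteq> 0"
    using z p by (auto simp: G_def coef2_dx_iter z_order_def)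
  then obtain a where a: "a \<in> max_ideal" "sub G a YY = 0"
    using implicit_exists[of YY 0 G] by auto
  \<comment> \<open>The solution \<open>a\<close> depends on both variables; its restriction to
    \<open>x = 0\<close> is a solution in \<open>y\<close> alone.\<close>
  define c where "c = Abs_fps (\<lambda>j. coef2 a 0 j)"
  have c: "sub a 0 YY = py c" by (rule coef2_eqI) (simp add: sub_x0 coef2_py c_def)
  have c0: "fps_nth c 0 = 0" using a by (simp add: c_def max_ideal_iff)
  have "sub G (py c) (py fps_X) = sub (sub G a YY) 0 YY"
    using a by (subst sub_sub) (auto simp: c sub_YY py_X)
  then have "arc_eval G c fps_X = 0" using a by (simp add: sub_py flip: py_inj)
  then have "coef2 (sub G (XX + py c) YY) 0 j = 0" for j
    using translate_at_0[OF c0] by simp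
  then have "coef2 (sub A (XX + py c) YY) (p - 1) j = 0" for j
    unfolding G_def dx_iter_translate[OF c0, symmetric] by (simp add: coef2_dx_iter)
  moreover have "coef2 (sub A (XX + py c) YY) i 0 = coef2 A i 0" for i
  proof -
    have "sub (sub A (XX + py c) YY) XX 0 = sub A XX 0"
      using c0 by (subst sub_sub) (auto simp: py_max sub_add sub_YY sub_XX sub_py_0)
    then have "coef2 (sub (sub A (XX + py c) YY) XX 0) i 0 = coef2 (sub A XX 0) i 0" by simp
    then show ?thesis by (simp add: sub_y0)
  qed
  ultimately show ?thesis using c0 z by (auto simp: z_order_def)
qed

text \<open>The pair \<open>(i0, a)\<close> minimizes \<open>j / (p - i)\<close> over the support,
  so it lies on the edge of the Newton polygon that starts at \<open>(p, 0)\<close>; quotients are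
  cross-multiplied to stay within the natural numbers.\<close>

lemma newton_slope:
  fixes P :: "nat \<Rightarrow> nat \<Rightarrow> bool"
  assumes "\<exists>i<p. \<exists>j. P i j"
  shows "\<exists>i0<p. \<exists>a. P i0 a \<and> (\<forall>i<p. \<forall>j. P i j \<longrightarrow> a * (p - i) \<le> j * (p - i0))"
proof -
  define I where "I = {i. i < p \<and> (\<exists>j. P i j)}"
  define m where "m i = (LEAST j. P i j)" for i
  define r where "r i = real (m i) / real (p - i)" for i
  have I: "finite I" "I \<noteq> {}" using assms by (auto simp: I_def)
  have m: "P i (m i)" if "i \<in> I" for i using that unfolding m_def I_def by (auto intro: LeastI_ex)
  have ml: "m i \<le> j" if "P i j" for i j unfolding m_def by (rule Least_le) fact
  define i0 where "i0 = arg_min_on r I"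
  have i0: "i0 \<in> I" unfolding i0_def using I by (rule arg_min_if_finite(1))
  have le: "r i0 \<le> r i" if "i \<in> I" for i
    unfolding i0_def using I that by (metis arg_min_least)
  have "m i0 * (p - i) \<le> j * (p - i0)" if ij: "i < p" "P i j" for i j
  proof -
    have "i \<in> I" using ij by (auto simp: I_def)
    then have "r i0 \<le> r i" by (rule le)
    also have "r i \<le> real j / real (p - i)" unfolding r_def using ml[OF ij(2)] by (intro divide_right_mono) auto
    finally have "real (m i0) * real (p - i) \<le> real j * real (p - i0)"
      using ij i0 unfolding r_def I_def by (auto simp: field_simps)
    then show ?thesis by (simp only: of_nat_mult[symmetric] of_nat_le_iff)
  qed
  moreover have "i0 < p" "P i0 (m i0)" using i0 m[OF i0] by (auto simp: I_def)
  ultimately show ?thesis by blast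
qed

lemma pcompose_power: "pcompose (p ^ n) q = pcompose p q ^ n"
  by (induction n) (simp_all add: pcompose_mult one_pCons)

lemma pcompose_monom: "pcompose (monom c n) q = smult c (q ^ n)"
proof -
  have "monom c n = smult c ([:0, 1:] ^ n)" by (simp add: monom_altdef)
  then show ?thesis by (simp add: pcompose_smult pcompose_power pcompose_pCons)
qed

text \<open>A root of full multiplicity \<open>p\<close> means
  \<open>c = d * (z - \<zeta>) ^ p\<close>; the missing term of degree \<open>p - 1\<close> then
  forces \<open>\<zeta> = 0\<close>, against the nonzero coefficient at \<open>i0\<close>. So any
  root serves.\<close>

lemma poly_root_multiplicity:
  fixes c :: "complex poly"
  assumes deg: "degree c = p" "p \<ge> 1" and c1: "coeff c (p - 1) = 0" and c2: "i0 < p" "coeff c i0 \<noteq> 0"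
  shows "\<exists>\<zeta> q. 1 \<le> q \<and> q < p \<and> (\<forall>i<q. coeff (pcompose c [:\<zeta>, 1:]) i = 0) \<and> coeff (pcompose c [:\<zeta>, 1:]) q \<noteq> 0"
proof -
  have "\<not> constant (poly c)" using deg by (simp add: constant_degree)
  then obtain \<zeta> where \<zeta>: "poly c \<zeta> = 0" using Fundamental_Theorem_Algebra.fundamental_theorem_of_algebra[of c] by blast
  have c0: "c \<noteq> 0" using c2 by auto
  define q where "q = order \<zeta> c"
  obtain c' where c': "c = [:- \<zeta>, 1:] ^ q * c'" "\<not> [:- \<zeta>, 1:] dvd c'"
    using order_decomp[OF c0, of \<zeta>] by (auto simp: q_def)
  have q1: "q \<ge> 1" using \<zeta> c0 by (simp add: q_def order_root Suc_le_eq)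
  have pz: "poly c' \<zeta> \<noteq> 0" using c'(2) by (simp add: poly_eq_0_iff_dvd)
  have "c' \<noteq> 0" using pz by auto
  have degc: "p = q + degree c'"
  proof -
    have "degree c = degree ([:- \<zeta>, 1:] ^ q) + degree c'"
      unfolding c'(1) using \<open>c' \<noteq> 0\<close> by (intro degree_mult_eq) auto
    then show ?thesis using deg by (simp add: degree_power_eq)
  qed
  have "q \<noteq> p"
  proof
    assume qp: "q = p"
    then have "degree c' = 0" using degc by simp
    then obtain d where d: "c' = [:d:]" by (meson degree_eq_zeroE)
    have co: "coeff c i = d * (of_nat (p choose i) * (- \<zeta>) ^ (p - i))" if "i \<le> p" for i
      unfolding c'(1) d qp using that by (simp add: coeff_linear_poly_power)
    have "d \<noteq> 0" using \<open>c' \<noteq> 0\<close> d by auto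
    have "p - (p - 1) = 1" using deg by simp
    with c1 co[of "p - 1"] \<open>d \<noteq> 0\<close> deg have "\<zeta> = 0" by (auto simp: binomial_eq_0_iff)
    with co[of i0] c2 show False by (simp add: power_0_left)
  qed
  then have "q < p" using degc by simp
  have pc: "pcompose ([:- \<zeta>, 1:] ^ n) [:\<zeta>, 1:] = [:0, 1:] ^ n" for n
    by (simp add: pcompose_power pcompose_pCons)
  have "pcompose c [:\<zeta>, 1:] = [:0, 1:] ^ q * pcompose c' [:\<zeta>, 1:]"
    unfolding c'(1) by (simp add: pcompose_mult pc)
  then have e: "pcompose c [:\<zeta>, 1:] = monom 1 q * pcompose c' [:\<zeta>, 1:]"
    by (simp add: monom_altdef)
  have "coeff (pcompose c' [:\<zeta>, 1:]) 0 = poly c' \<zeta>"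
    unfolding poly_0_coeff_0[symmetric] by (simp only: poly_pcompose) simp
  then show ?thesis
    using q1 \<open>q < p\<close> pz by (intro exI[of _ \<zeta>] exI[of _ q]) (auto simp: coeff_monom_mult e)
qed

text \<open>Under \<open>z = t ^ a * (\<zeta> + z')\<close>, \<open>y = t ^ b\<close> the lowest
  power \<open>t ^ (a * p)\<close> carries the edge polynomial; at a root \<open>\<zeta>\<close> of
  multiplicity \<open>q < p\<close> the quotient by this power is regular of order \<open>q\<close>.
  The Tschirnhaus translation makes the order drop every time, so finitely many steps
  suffice.\<close>

lemma puiseux_root:
  assumes "z_order A p" "p \<ge> 1"
  shows "\<exists>N\<ge>1. \<exists>\<gamma>. fps_nth \<gamma> 0 = 0 \<and> arc_eval A \<gamma> (fps_X ^ N) = 0"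
  using assms
proof (induction p arbitrary: A rule: less_induct)
  case (less p A)
  obtain c where c0: "fps_nth c 0 = 0" and zB: "z_order (sub A (XX + py c) YY) p"
    and B1: "\<And>j. coef2 (sub A (XX + py c) YY) (p - 1) j = 0"
    using tschirnhaus[OF less.prems] by blast
  define B where "B = sub A (XX + py c) YY"
  \<comment> \<open>A root of the translated series \<open>B\<close> becomes one of \<open>A\<close>
    by adding the translation, evaluated at \<open>t ^ N\<close>.\<close>
  have goal: ?case if "N \<ge> 1" "fps_nth \<gamma> 0 = 0" "arc_eval B \<gamma> (fps_X ^ N) = 0" for N \<gamma>
  proof (intro exI conjI)
    show "N \<ge> 1" by fact
    show "fps_nth (\<gamma> + fps_compose c (fps_X ^ N)) 0 = 0" using that c0 by simp
    show "arc_eval A (\<gamma> + fps_compose c (fps_X ^ N)) (fps_X ^ N) = 0"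
      using that c0 unfolding B_def by (subst arc_translate[symmetric]) auto
  qed
  show ?case
  proof (cases "\<exists>i<p. \<exists>j. coef2 B i j \<noteq> 0")
    case False
    then have "sub B 0 YY = 0" using less.prems by (intro coef2_eqI) (auto simp: sub_x0)
    then have "arc_eval B 0 (fps_X ^ 1) = 0" using sub_py[of B 0 fps_X] by (simp add: py_X flip: py_inj)
    then show ?thesis using goal[of 1 0] by simp
  next
    case True
    from newton_slope[OF this] obtain i0 a where i0: "i0 < p" and a: "coef2 B i0 a \<noteq> 0"
      and sl: "\<And>i j. i < p \<Longrightarrow> coef2 B i j \<noteq> 0 \<Longrightarrow> a * (p - i) \<le> j * (p - i0)" by blast
    \<comment> \<open>The edge has slope \<open>a / b\<close>, not necessarily in lowest terms;
      \<open>N\<close> only has to be some common denominator of the exponents.\<close>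
    define b where "b = p - i0"
    have b: "b \<ge> 1" using i0 by (simp add: b_def)
    have a1: "a \<ge> 1" using a i0 zB by (cases a) (auto simp: z_order_def B_def)
    define cf where "cf i = (\<Sum>j\<le>a*p. if a * i + b * j = a * p then coef2 B i j else 0)" for i
    define P where "P = (\<Sum>i\<le>p. monom (cf i) i)"
    have coP: "coeff P i = (if i \<le> p then cf i else 0)" for i
      by (simp add: P_def coeff_sum sum.delta)
    have "cf p = coef2 B p 0"
    proof -
      have "cf p = (\<Sum>j\<le>a*p. if j = 0 then coef2 B p j else 0)"
        unfolding cf_def using b by (intro sum.cong refl) auto
      then show ?thesis by (simp add: sum.delta)
    qed
    then have cfp: "cf p \<noteq> 0" using zB by (simp add: B_def z_order_def)
    have cf1: "cf (p - 1) = 0" using B1 unfolding cf_def B_def by (intro sum.neutral) auto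
    have cfi0: "cf i0 = coef2 B i0 a"
    proof -
      have ap: "a * p = a * i0 + a * b" using i0 by (simp add: b_def algebra_simps diff_mult_distrib2)
      have "cf i0 = (\<Sum>j\<le>a*p. if j = a then coef2 B i0 j else 0)"
        unfolding cf_def ap using b by (intro sum.cong refl) auto
      then show ?thesis using less.prems by (simp add: sum.delta)
    qed
    have degP: "degree P = p"
    proof (rule antisym)
      show "degree P \<le> p" by (intro degree_le) (auto simp: coP)
      show "p \<le> degree P" using cfp by (intro le_degree) (simp add: coP)
    qed
    obtain \<zeta> q where q: "1 \<le> q" "q < p" "\<And>i. i < q \<Longrightarrow> coeff (pcompose P [:\<zeta>, 1:]) i = 0"
      "coeff (pcompose P [:\<zeta>, 1:]) q \<noteq> 0"
      using poly_root_multiplicity[of P p i0] degP less.prems(2) cf1 i0 cfi0 a by (auto simp: coP)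
    define Z where "Z = fps_const \<zeta> + fps_X"
    define C where "C = sub B (YY ^ a * px Z) (YY ^ b)"
    have mm: "YY ^ a * px Z \<in> max_ideal" "YY ^ b \<in> max_ideal"
      using a1 b max_ideal_mult1[OF max_ideal_power[OF YY_ideal, of a], of "px Z"] by auto
    have "(YY ^ a * px Z) ^ i * (YY ^ b) ^ j = px (Z ^ i) * YY ^ (a * i + b * j)" for i j
      by (simp add: power_mult_distrib power_add power_mult px_power mult_ac)
    moreover have "coef2 (px (Z ^ i) * YY ^ k) n m = (if m = k then fps_nth (Z ^ i) n else 0)" for i k n m
      by (auto simp: coef2_def fps_X_power_mult_right_nth px_def)
    ultimately have cC: "coef2 C n k = (\<Sum>i\<le>n+k. \<Sum>j\<le>n+k. if a * i + b * j = k then coef2 B i j * fps_nth (Z ^ i) n else 0)" for n k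
      unfolding C_def coef2_sub by (intro sum.cong refl) auto
    \<comment> \<open>The support has no point below the line of the edge, so
      \<open>t ^ (a * p)\<close> divides \<open>C\<close>.\<close>
    have low: "coef2 B i j = 0" if "a * i + b * j < a * p" for i j
    proof (rule ccontr)
      assume nz: "coef2 B i j \<noteq> 0"
      have "i < p" using that a1 by (metis add_lessD1 mult_less_cancel1)
      from sl[OF this nz] have "a * (p - i) \<le> b * j" by (simp add: b_def mult.commute)
      with \<open>i < p\<close> have "a * p \<le> a * i + b * j" by (simp add: diff_mult_distrib2)
      then show False using that by simp
    qed
    have C0: "coef2 C n k = 0" if "k < a * p" for n k
      unfolding cC using low that by (intro sum.neutral ballI) auto
    define C' where "C' = fps_shift (a * p) C"
    have CC': "C = YY ^ (a * p) * C'"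
    proof (rule fps_ext)
      fix k show "fps_nth C k = fps_nth (YY ^ (a * p) * C') k"
        using C0[of k] by (auto simp: C'_def fps_X_power_mult_nth coef2_def fps_eq_iff)
    qed
    have C'0: "coef2 C' n 0 = coeff (pcompose P [:\<zeta>, 1:]) n" for n
    proof -
      have "fps_of_poly ([:\<zeta>, 1:] ^ i) = Z ^ i" for i
        by (simp add: fps_of_poly_power Z_def fps_of_poly_pCons)
      then have zi: "coeff ([:\<zeta>, 1:] ^ i) n = fps_nth (Z ^ i) n" for i
        by (metis fps_of_poly_nth)
      have "coeff (pcompose P [:\<zeta>, 1:]) n = (\<Sum>i\<le>p. cf i * fps_nth (Z ^ i) n)"
        by (simp add: P_def pcompose_sum pcompose_monom coeff_sum zi)
      also have "\<dots> = (\<Sum>i\<le>p. \<Sum>j\<le>a*p. if a * i + b * j = a * p then coef2 B i j * fps_nth (Z ^ i) n else 0)"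
        by (auto simp: cf_def sum_distrib_right intro!: sum.cong)
      also have "\<dots> = (\<Sum>i\<le>n+a*p. \<Sum>j\<le>n+a*p. if a * i + b * j = a * p then coef2 B i j * fps_nth (Z ^ i) n else 0)"
      proof (rule sum.mono_neutral_cong_left)
        show "{..p} \<subseteq> {..n + a * p}" using a1 by (auto simp: trans_le_add2 intro: order_trans)
        have ip: "i \<le> p \<and> j \<le> a * p" if "a * i + b * j = a * p" for i j
        proof
          have "a * i \<le> a * p" using that by linarith
          then show "i \<le> p" using a1 by simp
          have "j \<le> b * j" using b by simp
          then show "j \<le> a * p" using that by linarith
        qed
        show "\<forall>i\<in>{..n + a * p} - {..p}. (\<Sum>j\<le>n + a * p. if a * i + b * j = a * p then coef2 B i j * fps_nth (Z ^ i) n else 0) = 0"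
          using ip by (intro ballI sum.neutral) auto
        show "(\<Sum>j\<le>a*p. if a * i + b * j = a * p then coef2 B i j * fps_nth (Z ^ i) n else 0) = (\<Sum>j\<le>n+a*p. if a * i + b * j = a * p then coef2 B i j * fps_nth (Z ^ i) n else 0)" for i
          using ip[of i] by (intro sum.mono_neutral_left) auto
      qed simp
      also have "\<dots> = coef2 C n (a * p)" by (simp add: cC)
      also have "\<dots> = coef2 C' n 0" by (simp add: C'_def coef2_def)
      finally show ?thesis ..
    qed
    have "z_order C' q" using q by (simp add: z_order_def C'0)
    from less.IH[OF q(2) this q(1)] obtain N \<delta> where N: "N \<ge> 1" "fps_nth \<delta> 0 = 0" "arc_eval C' \<delta> (fps_X ^ N) = 0" by blast
    have XN: "fps_nth (fps_X ^ N :: complex fps) 0 = 0" using N by simp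
    have "arc_eval C \<delta> (fps_X ^ N) = 0"
      unfolding CC' using N XN by (simp add: arc_mult)
    moreover have "arc_eval (px Z) \<delta> (fps_X ^ N) = fps_const \<zeta> + \<delta>"
      using N by (simp add: arc_px Z_def fps_compose_add_distrib del: px_hom)
    then have "arc_eval C \<delta> (fps_X ^ N) = arc_eval B (fps_X ^ (N * a) * (fps_const \<zeta> + \<delta>)) (fps_X ^ (N * b))"
      unfolding C_def using N XN mm
      by (subst arc_sub) (auto simp: arc_mult arc_power arc_YY power_mult)
    ultimately show ?thesis
      using goal[of "N * b" "fps_X ^ (N * a) * (fps_const \<zeta> + \<delta>)"] N b a1 by simp
  qed
qed

text \<open>Roots are split off one at a time. Each step replaces the parameter by a power of
  itself, so the exponents \<open>N\<close> multiply; setting \<open>y = 0\<close> shows that the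
  order in \<open>z\<close> of the quotient drops by one.\<close>

lemma puiseux_factorization:
  assumes "z_order A p"
  shows "\<exists>N\<ge>1. \<exists>\<gamma>s E. length \<gamma>s = p \<and> (\<forall>\<gamma>\<in>set \<gamma>s. fps_nth \<gamma> 0 = 0) \<and> coef2 E 0 0 \<noteq> 0 \<and>
     sub A XX (YY ^ N) = E * (\<Prod>\<gamma>\<leftarrow>\<gamma>s. XX - py \<gamma>)"
  using assms
proof (induction p arbitrary: A)
  case 0
  then show ?case by (intro exI[of _ 1] conjI exI[of _ "[]"] exI[of _ A]) (auto simp: z_order_def)
next
  case (Suc p)
  then obtain N \<gamma> where N: "N \<ge> 1" "fps_nth \<gamma> 0 = 0" "arc_eval A \<gamma> (fps_X ^ N) = 0"
    using puiseux_root[OF Suc.prems] by auto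
  have YN: "YY ^ N \<in> max_ideal" using N by auto
  have "arc_eval (sub A XX (YY ^ N)) \<gamma> fps_X = 0"
    using N YN by (subst arc_sub) (auto simp: arc_XX arc_YY arc_power)
  from root_division[OF N(2) this] obtain Q where Q: "sub A XX (YY ^ N) = (XX - py \<gamma>) * Q" by blast
  have py0: "sub (py \<gamma>) XX 0 = 0" using N by (simp add: sub_py_0)
  have "sub A XX 0 = sub (sub A XX (YY ^ N)) XX 0"
    using YN N by (subst sub_sub) (auto simp: sub_XX sub_YY sub_power power_0_left)
  also have "\<dots> = XX * sub Q XX 0" unfolding Q by (simp add: sub_mult sub_diff sub_XX py0)
  finally have e: "coef2 (sub A XX 0) i 0 = coef2 (XX * sub Q XX 0) i 0" for i by simp
  have "coef2 (XX * G) (Suc i) 0 = coef2 G i 0" for i G by (simp add: coef2_def XX_def)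
  then have "coef2 A (Suc i) 0 = coef2 Q i 0" for i using e[of "Suc i"] by (simp add: sub_y0)
  then have "z_order Q p" using Suc.prems by (auto simp: z_order_def)
  from Suc.IH[OF this] obtain M \<gamma>s E where M: "M \<ge> 1" "length \<gamma>s = p" "\<forall>\<gamma>\<in>set \<gamma>s. fps_nth \<gamma> 0 = 0" "coef2 E 0 0 \<noteq> 0"
     "sub Q XX (YY ^ M) = E * (\<Prod>\<gamma>\<leftarrow>\<gamma>s. XX - py \<gamma>)" by blast
  have YM: "YY ^ M \<in> max_ideal" using M by auto
  have "sub A XX (YY ^ (M * N)) = sub (sub A XX (YY ^ N)) XX (YY ^ M)"
    using YN YM by (subst sub_sub) (auto simp: sub_XX sub_YY sub_power power_mult)
  also have "\<dots> = (XX - py (fps_compose \<gamma> (fps_X ^ M))) * (E * (\<Prod>\<gamma>\<leftarrow>\<gamma>s. XX - py \<gamma>))"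
    unfolding Q M(5)[symmetric] using YM M(1) by (simp add: sub_mult sub_diff sub_XX sub_py_YY_power)
  finally show ?case
    using M N by (intro exI[of _ "M * N"] conjI exI[of _ "fps_compose \<gamma> (fps_X ^ M) # \<gamma>s"] exI[of _ E]) (auto simp: mult_ac)
qed

subsection \<open>Traces as residues\<close>

text \<open>Power series in \<open>y\<close> over the field of Laurent series in \<open>z\<close>:
  there \<open>J\<close> is invertible as soon as \<open>J(z, 0)\<close> is nonzero, and
  \<open>1 / (z - \<gamma>)\<close> is expanded in powers of \<open>\<gamma>(y) / z\<close>, which
  places every root inside the contour of the residue.\<close>

definition laur :: "complex fps fps \<Rightarrow> complex fls fps" where
  "laur F = Abs_fps (\<lambda>k. fps_to_fls (fps_nth F k))"
definition Dz :: "complex fls fps \<Rightarrow> complex fls fps" where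
  "Dz A = Abs_fps (\<lambda>k. fls_deriv (fps_nth A k))"
definition Rz :: "complex fls fps \<Rightarrow> complex fps" where
  "Rz A = Abs_fps (\<lambda>k. fls_nth (fps_nth A k) (-1))"

text \<open>The sum of the values of \<open>G\<close> at the roots \<open>z\<close> of \<open>J\<close>, written as the residue at \<open>z = 0\<close> of
  \<open>G dJ/J\<close>. Unlike the roots, it depends differentiably on \<open>G\<close> and \<open>J\<close>.\<close>

definition trace_at :: "complex fps fps \<Rightarrow> complex fps fps \<Rightarrow> complex fps" where
  "trace_at J G = Rz (laur G * (Dz (laur J) * inverse (laur J)))"

lemma fps_to_fls_sum: "fps_to_fls (sum f A) = (\<Sum>x\<in>A. fps_to_fls (f x))"
  by (induction A rule: infinite_finite_induct) (auto simp: fps_to_fls_plus)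

lemma fls_nth_sum: "fls_nth (sum f A) i = (\<Sum>x\<in>A. fls_nth (f x) i)"
  by (induction A rule: infinite_finite_induct) auto

lemma fls_deriv_sum': "fls_deriv (sum f A) = (\<Sum>x\<in>A. fls_deriv (f x))"
  by (induction A rule: infinite_finite_induct) (auto simp: fls_deriv_add)

lemma laur_add: "laur (F + G) = laur F + laur G" and laur_diff: "laur (F - G) = laur F - laur G"
  and laur_1 [simp]: "laur 1 = 1" and laur_0 [simp]: "laur 0 = 0"
  by (rule fps_ext; simp add: laur_def fps_to_fls_plus fps_to_fls_minus)+
lemma laur_mult: "laur (F * G) = laur F * laur G"
  by (rule fps_ext) (simp add: laur_def fps_mult_nth fps_to_fls_sum fls_times_fps_to_fls)
lemma laur_power: "laur (F ^ n) = laur F ^ n" by (induction n) (auto simp: laur_mult)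
lemma laur_of_nat: "laur (of_nat n) = of_nat n" by (induction n) (auto simp: laur_add)

lemma Dz_mult: "Dz (A * B) = Dz A * B + A * Dz B"
proof (rule fps_ext)
  fix n
  have "fps_nth (Dz (A * B)) n = (\<Sum>i=0..n. fls_deriv (fps_nth A i) * fps_nth B (n - i) + fps_nth A i * fls_deriv (fps_nth B (n - i)))"
    by (simp add: Dz_def fps_mult_nth fls_deriv_sum' fls_deriv_mult add.commute)
  also have "\<dots> = fps_nth (Dz A * B + A * Dz B) n"
    by (simp only: sum.distrib fps_mult_nth fps_add_nth Dz_def fps_nth_Abs_fps)
  finally show "fps_nth (Dz (A * B)) n = fps_nth (Dz A * B + A * Dz B) n" .
qed
lemma Dz_1 [simp]: "Dz 1 = 0" by (rule fps_ext) (simp add: Dz_def)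
lemma Dz_power: "Dz (A ^ n) = of_nat n * A ^ (n - 1) * Dz A"
proof (induction n)
  case (Suc n)
  then show ?case by (cases n) (auto simp: Dz_mult algebra_simps)
qed simp
lemma Dz_laur: "Dz (laur F) = laur (dx F)"
  by (rule fps_ext) (simp add: Dz_def laur_def dx_def fls_deriv_fps_to_fls)

lemma Rz_add: "Rz (A + B) = Rz A + Rz B" by (rule fps_ext) (simp add: Rz_def)
lemma Rz_diff: "Rz (A - B) = Rz A - Rz B" by (rule fps_ext) (simp add: Rz_def)
lemma Rz_Dz [simp]: "Rz (Dz A) = 0" by (rule fps_ext) (simp add: Rz_def Dz_def)
lemma Rz_laur [simp]: "Rz (laur F) = 0" by (rule fps_ext) (simp add: Rz_def laur_def)

lemma laur_z_order:
  assumes "z_order J p"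
  shows "fps_nth (laur J) 0 \<noteq> 0"
proof
  assume "fps_nth (laur J) 0 = 0"
  then have "fps_nth J 0 = 0" by (simp add: laur_def)
  then show False using assms by (simp add: z_order_def coef2_def)
qed

lemma laur_inverse:
  assumes "z_order J p" shows "laur J * inverse (laur J) = 1"
  using laur_z_order[OF assms] by (rule inverse_mult_eq_1')

definition logd :: "complex fls fps \<Rightarrow> complex fls fps" where "logd A = Dz A * inverse A"

lemma logd_mult:
  assumes "fps_nth A 0 \<noteq> 0" "fps_nth B 0 \<noteq> 0"
  shows "logd (A * B) = logd A + logd B"
proof -
  define A' B' where d: "A' = inverse A" "B' = inverse B"
  have i: "A * A' = 1" "B * B' = 1"
    using assms by (auto simp: d intro: inverse_mult_eq_1')
  have "logd (A * B) = (Dz A * B + A * Dz B) * (A' * B')"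
    by (simp add: logd_def Dz_mult fps_inverse_mult d)
  also have "\<dots> = Dz A * A' * (B * B') + Dz B * B' * (A * A')" by (simp add: algebra_simps)
  finally show ?thesis unfolding i by (simp add: logd_def d)
qed

text \<open>The inverse \<open>W\<close> satisfies \<open>z * W = 1 + \<gamma> * W\<close>. As
  \<open>\<gamma>\<close> has no constant term this is a recursion over the powers of
  \<open>y\<close>; it shows that only negative powers of \<open>z\<close> occur, and
  \<open>1 / z\<close> only in the coefficient of \<open>y ^ 0\<close>.\<close>

lemma residue_linear_factor:
  assumes g: "fps_nth \<gamma> 0 = 0"
  shows "Rz (inverse (laur (XX - py \<gamma>))) = 1" and "fps_nth (laur (XX - py \<gamma>)) 0 \<noteq> 0"
proof -
  define W where "W = inverse (laur (XX - py \<gamma>))"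
  have lx: "laur XX = fps_const fls_X"
    by (rule fps_ext) (simp add: laur_def XX_def)
  have lp: "fps_nth (laur (py \<gamma>)) k = fls_const (fps_nth \<gamma> k)" for k
    by (simp add: laur_def py_def)
  have "fps_nth (laur (XX - py \<gamma>)) 0 = fls_X" using g by (simp add: laur_diff lx lp)
  then show nz: "fps_nth (laur (XX - py \<gamma>)) 0 \<noteq> 0" by simp
  have "W * laur (XX - py \<gamma>) = 1" unfolding W_def using nz by (rule inverse_mult_eq_1)
  then have "W * fps_const fls_X = 1 + W * laur (py \<gamma>)"
    by (simp add: laur_diff lx algebra_simps)
  then have eq: "fps_nth W k * fls_X = (if k = 0 then 1 else 0) + (\<Sum>i=0..k. fps_nth W i * fls_const (fps_nth \<gamma> (k - i)))" for k
  proof -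
    have "fps_nth (W * fps_const fls_X) k = fps_nth (1 + W * laur (py \<gamma>)) k" by (simp only: \<open>W * fps_const fls_X = _\<close>)
    then show ?thesis by (simp only: fps_mult_right_const_nth fps_add_nth fps_one_nth fps_mult_nth[of W "laur (py \<gamma>)"] lp)
  qed
  have step: "fls_nth (fps_nth W k) i = fls_nth (if k = 0 then 1 else 0) (i + 1) + (\<Sum>j<k. fls_nth (fps_nth W j) (i + 1) * fps_nth \<gamma> (k - j))" for k i
  proof -
    have "fls_nth (fps_nth W k) i = fls_nth (fps_nth W k * fls_X) (i + 1)"
      by (simp add: fls_X_times_conv_shift)
    also have "\<dots> = fls_nth (if k = 0 then 1 else 0) (i + 1) + (\<Sum>j=0..k. fls_nth (fps_nth W j) (i + 1) * fps_nth \<gamma> (k - j))"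
      by (simp add: eq fls_nth_sum)
    also have "{0..k} = insert k {..<k}" by auto
    finally show ?thesis using g by simp
  qed
  have "(\<forall>i\<ge>0. fls_nth (fps_nth W k) i = 0) \<and> fls_nth (fps_nth W k) (-1) = (if k = 0 then 1 else 0)" for k
  proof (induction k rule: less_induct)
    case (less k)
    have "(\<Sum>j<k. fls_nth (fps_nth W j) (i + 1) * fps_nth \<gamma> (k - j)) = 0" if "i \<ge> -1" for i
      using less that by (intro sum.neutral) auto
    then have "fls_nth (fps_nth W k) i = fls_nth (if k = 0 then 1 else 0) (i + 1)" if "i \<ge> -1" for i
      using step[of k i] that by simp
    then show ?case by auto
  qed
  then show "Rz (inverse (laur (XX - py \<gamma>))) = 1"
    by (intro fps_ext) (simp add: Rz_def W_def)
qed

lemma Rz_py_mult: "Rz (laur (py g) * A) = g * Rz A"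
  by (rule fps_ext) (simp add: Rz_def fps_mult_nth laur_def py_def fls_nth_sum)

text \<open>Division with remainder, \<open>G = G(\<gamma>) + (z - \<gamma>) * Q\<close>: the
  remainder contributes \<open>G(\<gamma>)\<close> times the residue of
  \<open>1 / (z - \<gamma>)\<close>, the quotient only a power series in \<open>z\<close>.\<close>

lemma residue_root:
  assumes g: "fps_nth \<gamma> 0 = 0"
  shows "Rz (laur G * logd (laur (XX - py \<gamma>))) = arc_eval G \<gamma> fps_X"
proof -
  define L where "L = laur (XX - py \<gamma>)"
  have "arc_eval (G - py (arc_eval G \<gamma> fps_X)) \<gamma> fps_X = 0"
    using g by (simp add: arc_diff arc_py)
  from root_division[OF g this] obtain Q where "G - py (arc_eval G \<gamma> fps_X) = (XX - py \<gamma>) * Q" by blast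
  then have Q: "G = py (arc_eval G \<gamma> fps_X) + (XX - py \<gamma>) * Q" by (simp add: algebra_simps)
  have lG: "laur G = laur (py (arc_eval G \<gamma> fps_X)) + L * laur Q"
    using arg_cong[OF Q, of laur] unfolding laur_add laur_mult L_def .
  have "Dz L = 1" unfolding L_def Dz_laur using dx.add[of "XX - py \<gamma>" "py \<gamma>"] by simp
  then have "laur G * logd L = laur (py (arc_eval G \<gamma> fps_X)) * inverse L + laur Q * (L * inverse L)"
    by (simp only: lG logd_def) (simp add: algebra_simps)
  also have "L * inverse L = 1" unfolding L_def using residue_linear_factor(2)[OF g] by (rule inverse_mult_eq_1')
  finally show ?thesis using residue_linear_factor(1)[OF g] by (simp add: Rz_add Rz_py_mult flip: L_def)
qed

text \<open>The logarithmic derivative turns the product into a sum; that of the unit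
  \<open>E\<close> is a power series in \<open>z\<close>, without residue.\<close>

lemma residue_prod:
  assumes E: "coef2 E 0 0 \<noteq> 0" and "\<forall>\<gamma>\<in>set \<gamma>s. fps_nth \<gamma> 0 = 0"
  shows "fps_nth (laur (E * (\<Prod>\<gamma>\<leftarrow>\<gamma>s. XX - py \<gamma>))) 0 \<noteq> 0 \<and>
    Rz (laur G * logd (laur (E * (\<Prod>\<gamma>\<leftarrow>\<gamma>s. XX - py \<gamma>)))) = (\<Sum>\<gamma>\<leftarrow>\<gamma>s. arc_eval G \<gamma> fps_X)"
  using assms(2)
proof (induction \<gamma>s)
  case Nil
  obtain E' where E': "E * E' = 1" using unit2_inverse[OF E] by blast
  have nz: "fps_nth (laur E) 0 \<noteq> 0" using E by (auto simp: laur_def coef2_def)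
  have "laur E * laur E' = 1" using E' by (simp flip: laur_mult)
  then have "inverse (laur E) = laur E'" using nz
    by (metis fps_inverse_unique)
  then have "laur G * logd (laur E) = laur (G * (dx E * E'))"
    by (simp add: logd_def Dz_laur laur_mult)
  then show ?case using nz by simp
next
  case (Cons \<gamma> \<gamma>s)
  let ?P = "E * (\<Prod>\<gamma>\<leftarrow>\<gamma>s. XX - py \<gamma>)"
  have IH: "fps_nth (laur ?P) 0 \<noteq> 0" "Rz (laur G * logd (laur ?P)) = (\<Sum>\<gamma>\<leftarrow>\<gamma>s. arc_eval G \<gamma> fps_X)"
    using Cons by auto
  have e: "E * (\<Prod>\<gamma>\<leftarrow>\<gamma> # \<gamma>s. XX - py \<gamma>) = (XX - py \<gamma>) * ?P" by (simp add: mult_ac)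
  have g: "fps_nth \<gamma> 0 = 0" using Cons.prems by simp
  show ?case unfolding e laur_mult[of "XX - py \<gamma>"]
    using IH residue_linear_factor(2)[OF g] residue_root[OF g, of G]
    by (subst logd_mult) (auto simp: distrib_left Rz_add)
qed

section \<open>Traces after ramification\<close>

lemma fps_nth_compose_X_pow:
  fixes F :: "'a :: comm_ring_1 fps"
  assumes "N > 0"
  shows "fps_nth (fps_compose F (fps_X ^ N)) n = (if N dvd n then fps_nth F (n div N) else 0)"
proof -
  have "fps_nth (fps_compose F (fps_X ^ N)) n = (\<Sum>i=0..n. if N * i = n then fps_nth F i else 0)"
    unfolding fps_compose_nth by (intro sum.cong refl) (auto simp: fps_X_power_nth simp flip: power_mult)
  also have "\<dots> = (\<Sum>i=0..n. if N dvd n \<and> i = n div N then fps_nth F i else 0)"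
    using assms by (intro sum.cong refl if_cong) auto
  also have "\<dots> = (if N dvd n then fps_nth F (n div N) else 0)"
    using assms by (cases "N dvd n") (auto simp: sum.delta)
  finally show ?thesis .
qed

lemma sub_YY_power_nth:
  assumes "N > 0"
  shows "sub F XX (YY ^ N) = fps_compose F (fps_X ^ N)"
proof (rule coef2_eqI)
  fix i k
  have "coef2 (sub F XX (YY ^ N)) i k = (\<Sum>a\<le>i+k. \<Sum>j\<le>i+k. if a = i then (if N * j = k then coef2 F a j else 0) else 0)"
    unfolding coef2_sub power_mult[symmetric] coef2_mono by (intro sum.cong refl) auto
  also have "\<dots> = (\<Sum>a\<le>i+k. if a = i then (\<Sum>j\<le>i+k. if N * j = k then coef2 F a j else 0) else 0)"
    by (intro sum.cong refl) auto
  also have "\<dots> = (\<Sum>j\<le>i+k. if N * j = k then coef2 F i j else 0)" by (simp add: sum.delta)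
  also have "\<dots> = (\<Sum>j\<le>i+k. if N dvd k \<and> j = k div N then coef2 F i j else 0)"
    using assms by (intro sum.cong refl if_cong) auto
  also have "\<dots> = (if N dvd k then coef2 F i (k div N) else 0)"
    using assms by (cases "N dvd k") (auto simp: sum.delta trans_le_add2)
  finally show "coef2 (sub F XX (YY ^ N)) i k = coef2 (fps_compose F (fps_X ^ N)) i k"
    by (simp add: coef2_def fps_nth_compose_X_pow assms)
qed

text \<open>The roots exist only after \<open>y = t ^ N\<close>. This substitution acts on the
  powers of \<open>y\<close> and leaves the coefficients in \<open>z\<close> alone, so it commutes
  with products, inverses, \<open>Dz\<close> and \<open>Rz\<close>, and the trace can be computed
  from the factorization.\<close>

lemma trace_at_roots:
  assumes N: "N > 0" and J: "z_order J p" and E: "coef2 E 0 0 \<noteq> 0" and g: "\<forall>\<gamma>\<in>set \<gamma>s. fps_nth \<gamma> 0 = 0"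
    and eq: "sub J XX (YY ^ N) = E * (\<Prod>\<gamma>\<leftarrow>\<gamma>s. XX - py \<gamma>)"
  shows "fps_compose (trace_at J G) (fps_X ^ N) = (\<Sum>\<gamma>\<leftarrow>\<gamma>s. arc_eval G \<gamma> (fps_X ^ N))"
proof -
  let ?\<theta> = "\<lambda>A :: complex fls fps. fps_compose A (fps_X ^ N)"
  have l: "laur (sub F XX (YY ^ N)) = ?\<theta> (laur F)" for F
    using N by (intro fps_ext) (simp add: sub_YY_power_nth laur_def fps_nth_compose_X_pow)
  have X0: "fps_nth (fps_X ^ N :: complex fls fps) 0 = 0" using N by simp
  have D: "Dz (?\<theta> A) = ?\<theta> (Dz A)" for A
    using N by (intro fps_ext) (simp add: Dz_def fps_nth_compose_X_pow)
  have R: "Rz (?\<theta> A) = fps_compose (Rz A) (fps_X ^ N)" for A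
    using N by (intro fps_ext) (simp add: Rz_def fps_nth_compose_X_pow)
  have "fps_compose (trace_at J G) (fps_X ^ N) = Rz (?\<theta> (laur G) * logd (?\<theta> (laur J)))"
    unfolding trace_at_def logd_def R[symmetric] D fps_compose_mult_distrib[OF X0]
      fps_inverse_compose[OF X0 laur_z_order[OF J]] ..
  also have "\<dots> = Rz (laur (sub G XX (YY ^ N)) * logd (laur (E * (\<Prod>\<gamma>\<leftarrow>\<gamma>s. XX - py \<gamma>))))"
    by (simp only: l flip: eq)
  also have "\<dots> = (\<Sum>\<gamma>\<leftarrow>\<gamma>s. arc_eval (sub G XX (YY ^ N)) \<gamma> fps_X)"
    using residue_prod[OF E g] by blast
  also have "\<dots> = (\<Sum>\<gamma>\<leftarrow>\<gamma>s. arc_eval G \<gamma> (fps_X ^ N))"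
  proof (intro arg_cong[of _ _ sum_list] map_cong refl)
    fix \<gamma> assume "\<gamma> \<in> set \<gamma>s"
    then show "arc_eval (sub G XX (YY ^ N)) \<gamma> fps_X = arc_eval G \<gamma> (fps_X ^ N)"
      using g N by (subst arc_sub) (auto simp: arc_XX arc_YY arc_power)
  qed
  finally show ?thesis .
qed

subsection \<open>Families depending differentiably on a parameter\<close>

definition fam2 :: "(complex \<Rightarrow> complex fps fps) \<Rightarrow> (complex \<Rightarrow> complex fps fps) \<Rightarrow> bool" where
  "fam2 A A' \<longleftrightarrow> (\<forall>s i j. ((\<lambda>s. coef2 (A s) i j) has_field_derivative coef2 (A' s) i j) (at s))"

text \<open>The bound \<open>L\<close> on the poles is uniform in \<open>s\<close>: a coefficient of
  a product is then a finite sum over a range independent of \<open>s\<close> and can be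
  differentiated term by term.\<close>

definition fam_fls :: "(complex \<Rightarrow> complex fls) \<Rightarrow> (complex \<Rightarrow> complex fls) \<Rightarrow> bool" where
  "fam_fls a a' \<longleftrightarrow> (\<exists>L. \<forall>s. \<forall>m<L. fls_nth (a s) m = 0 \<and> fls_nth (a' s) m = 0) \<and>
     (\<forall>s m. ((\<lambda>s. fls_nth (a s) m) has_field_derivative fls_nth (a' s) m) (at s))"

definition fam_laur :: "(complex \<Rightarrow> complex fls fps) \<Rightarrow> (complex \<Rightarrow> complex fls fps) \<Rightarrow> bool" where
  "fam_laur A A' \<longleftrightarrow> (\<forall>k. fam_fls (\<lambda>s. fps_nth (A s) k) (\<lambda>s. fps_nth (A' s) k))"

lemma fam2_mult:
  assumes "fam2 A A'" "fam2 B B'"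
  shows "fam2 (\<lambda>s. A s * B s) (\<lambda>s. A' s * B s + A s * B' s)"
proof -
  have "((\<lambda>s. coef2 (A s * B s) i j) has_field_derivative
     (\<Sum>q\<le>j. \<Sum>p\<le>i. coef2 (A' s) p q * coef2 (B s) (i - p) (j - q) + coef2 (B' s) (i - p) (j - q) * coef2 (A s) p q)) (at s)" for s i j
    unfolding coef2_mult using assms unfolding fam2_def
    by (intro DERIV_sum DERIV_mult) auto
  then show ?thesis
    by (simp add: fam2_def coef2_mult sum.distrib mult.commute)
qed

lemma fam2_const: "fam2 (\<lambda>s. A) (\<lambda>s. 0)" by (simp add: fam2_def)
lemma fam2_power:
  assumes "fam2 A A'"
  shows "fam2 (\<lambda>s. A s ^ n) (\<lambda>s. of_nat n * A s ^ (n - 1) * A' s)"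
proof (induction n)
  case 0 then show ?case using fam2_const[of 1] by simp
next
  case (Suc n)
  have "A' s * A s ^ n + A s * (of_nat n * A s ^ (n - 1) * A' s) = of_nat (Suc n) * A s ^ (Suc n - 1) * A' s" for s
    by (cases n) (auto simp: algebra_simps)
  then show ?case using fam2_mult[OF assms Suc] by simp
qed

lemma fam2_dx: "fam2 A A' \<Longrightarrow> fam2 (\<lambda>s. dx (A s)) (\<lambda>s. dx (A' s))"
  by (auto simp: fam2_def coef2_dx intro!: DERIV_cmult)

text \<open>Differentiating the finite sums in \<open>sub\<close> gives a series
  \<open>D s F\<close>; it agrees with the chain rule expression because both are additive and
  continuous in \<open>F\<close> and coincide on monomials.\<close>

lemma fam2_sub:
  assumes A: "fam2 A A'" and m: "\<And>s. A s \<in> max_ideal" "\<And>s. A' s \<in> max_ideal" "b \<in> max_ideal"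
  shows "fam2 (\<lambda>s. sub F (A s) b) (\<lambda>s. sub (dx F) (A s) b * A' s)"
proof -
  define D where "D s F = Abs_fps (\<lambda>m. Abs_fps (\<lambda>n. \<Sum>i\<le>n+m. \<Sum>j\<le>n+m. coef2 F i j * coef2 (of_nat i * A s ^ (i - 1) * A' s * b ^ j) n m))" for s F
  have cD: "coef2 (D s F) n m = (\<Sum>i\<le>n+m. \<Sum>j\<le>n+m. coef2 F i j * coef2 (of_nat i * A s ^ (i - 1) * A' s * b ^ j) n m)" for s F n m
    by (simp add: D_def coef2_def)
  have ideal: "of_nat i * A s ^ (i - 1) * A' s * b ^ j \<in> in_ideal (i + j)" for i j s
  proof (cases i)
    case (Suc k)
    have "A s ^ k * A' s * b ^ j \<in> in_ideal (k + 1 + j)"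
      using m(2)[of s] unfolding max_ideal_def[symmetric] by (intro in_ideal_mult in_ideal_power1 m) (simp add: max_ideal_def)
    then have "A s ^ k * A' s * b ^ j \<in> in_ideal (i + j)" using Suc by simp
    then have "of_nat i * (A s ^ k * A' s * b ^ j) \<in> in_ideal (i + j)"
      by (rule in_ideal_mult2)
    then show ?thesis using Suc by (simp add: mult.assoc)
  qed simp
  have "sub (dx F) (A s) b * A' s = D s F" for s
  proof (rule cont_additive_eqI[of "\<lambda>F. sub (dx F) (A s) b * A' s" "D s"])
    show "D s (F + G) = D s F + D s G" for F G
      by (rule coef2_eqI) (simp add: cD ring_distribs sum.distrib)
    show "sub (dx F) (A s) b * A' s \<in> in_ideal n" if "F \<in> in_ideal (Suc n)" for F n
      by (intro in_ideal_mult1 sub_ideal m dx.cont that)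
    show "D s F \<in> in_ideal n" if F: "F \<in> in_ideal (Suc n)" for F n
    proof (rule in_idealI)
      fix k l assume kl: "k + l < n"
      have "coef2 F i j * coef2 (of_nat i * A s ^ (i - 1) * A' s * b ^ j) k l = 0" for i j
        using in_idealD[OF F, of i j] in_idealD[OF ideal, of k l i j s] kl by (cases "i + j < Suc n") auto
      then show "coef2 (D s F) k l = 0" by (simp only: cD sum.neutral_const)
    qed
    fix c i j
    have on: "of_nat k = cc (of_nat k)" for k by (simp add: cc_def fps_of_nat)
    have "coef2 (D s (cc c * (XX ^ i * YY ^ j))) n m = coef2 (cc c * (of_nat i * A s ^ (i - 1) * A' s * b ^ j)) n m" for n m
    proof -
      have "coef2 (D s (cc c * (XX ^ i * YY ^ j))) n m = (\<Sum>i'\<le>n+m. \<Sum>j'\<le>n+m. if i' = i then if j' = j then c * coef2 (of_nat i * A s ^ (i - 1) * A' s * b ^ j) n m else 0 else 0)"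
        unfolding cD by (intro sum.cong refl) (simp add: coef2_mono)
      also have "\<dots> = (\<Sum>i'\<le>n+m. if i' = i then \<Sum>j'\<le>n+m. if j' = j then c * coef2 (of_nat i * A s ^ (i - 1) * A' s * b ^ j) n m else 0 else 0)"
        by (intro sum.cong refl) auto
      also have "\<dots> = (if i \<le> n + m \<and> j \<le> n + m then c * coef2 (of_nat i * A s ^ (i - 1) * A' s * b ^ j) n m else 0)"
        by (simp add: sum.delta)
      also have "\<dots> = c * coef2 (of_nat i * A s ^ (i - 1) * A' s * b ^ j) n m"
        using in_idealD[OF ideal, of n m i j s] by auto
      finally show ?thesis by simp
    qed
    then have "D s (cc c * (XX ^ i * YY ^ j)) = cc c * (of_nat i * A s ^ (i - 1) * A' s * b ^ j)" by (rule coef2_eqI)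
    moreover have "sub (dx (cc c * (XX ^ i * YY ^ j))) (A s) b = cc c * (of_nat i * A s ^ (i - 1) * b ^ j)"
      using m by (simp add: dx_cc_mult dx.cc dx.mult dx.power sub_cc_mult sub_mult sub_power sub_XX sub_YY sub_add on)
    ultimately show "sub (dx (cc c * (XX ^ i * YY ^ j))) (A s) b * A' s = D s (cc c * (XX ^ i * YY ^ j))"
      by (simp only: mult_ac)
  qed (auto simp: dx.add sub_add ring_distribs)
  moreover have "((\<lambda>s. coef2 (sub F (A s) b) n m) has_field_derivative coef2 (D s F) n m) (at s)" for s n m
    unfolding coef2_sub cD
  proof (intro DERIV_sum DERIV_cmult)
    fix i j
    have "fam2 (\<lambda>s. A s ^ i * b ^ j) (\<lambda>s. of_nat i * A s ^ (i - 1) * A' s * b ^ j + A s ^ i * 0)"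
      by (intro fam2_mult fam2_power A fam2_const)
    then show "((\<lambda>s. coef2 (A s ^ i * b ^ j) n m) has_field_derivative coef2 (of_nat i * A s ^ (i - 1) * A' s * b ^ j) n m) (at s)"
      by (simp add: fam2_def)
  qed
  ultimately show ?thesis by (simp add: fam2_def)
qed

lemma fls_mult_bounded:
  fixes f g :: "'a :: semiring_0 fls"
  assumes "\<And>m. m < L \<Longrightarrow> fls_nth f m = 0" "\<And>m. m < M \<Longrightarrow> fls_nth g m = 0"
  shows "fls_nth (f * g) n = (\<Sum>i=L..n-M. fls_nth f i * fls_nth g (n - i))"
proof (cases "f = 0 \<or> g = 0")
  case False
  then have s: "L \<le> fls_subdegree f" "M \<le> fls_subdegree g" using assms
    by (auto intro: fls_subdegree_geI)
  show ?thesis unfolding fls_times_nth(2)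
  proof (rule sum.mono_neutral_left)
    show "{fls_subdegree f..n - fls_subdegree g} \<subseteq> {L..n - M}" using s by auto
    show "\<forall>i\<in>{L..n - M} - {fls_subdegree f..n - fls_subdegree g}. fls_nth f i * fls_nth g (n - i) = 0"
    proof
      fix i assume i: "i \<in> {L..n - M} - {fls_subdegree f..n - fls_subdegree g}"
      show "fls_nth f i * fls_nth g (n - i) = 0"
      proof (cases "i < fls_subdegree f")
        case False
        then have "n - i < fls_subdegree g" using i by auto
        then show ?thesis by simp
      qed simp
    qed
  qed simp
qed auto

lemma fam_fls_add: "fam_fls a a' \<Longrightarrow> fam_fls b b' \<Longrightarrow> fam_fls (\<lambda>s. a s + b s) (\<lambda>s. a' s + b' s)"
proof -
  assume A: "fam_fls a a'" and B: "fam_fls b b'"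
  obtain L where L: "\<And>s m. m < L \<Longrightarrow> fls_nth (a s) m = 0 \<and> fls_nth (a' s) m = 0" using A by (auto simp: fam_fls_def)
  obtain M where M: "\<And>s m. m < M \<Longrightarrow> fls_nth (b s) m = 0 \<and> fls_nth (b' s) m = 0" using B by (auto simp: fam_fls_def)
  have "\<exists>L. \<forall>s. \<forall>m<L. fls_nth (a s + b s) m = 0 \<and> fls_nth (a' s + b' s) m = 0"
    using L M by (intro exI[of _ "min L M"]) simp
  then show ?thesis using A B unfolding fam_fls_def by (auto intro!: DERIV_add)
qed

lemma fam_fls_mult:
  assumes A: "fam_fls a a'" and B: "fam_fls b b'"
  shows "fam_fls (\<lambda>s. a s * b s) (\<lambda>s. a' s * b s + a s * b' s)"
proof -
  obtain L where L: "\<And>s m. m < L \<Longrightarrow> fls_nth (a s) m = 0 \<and> fls_nth (a' s) m = 0" using A by (auto simp: fam_fls_def)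
  obtain M where M: "\<And>s m. m < M \<Longrightarrow> fls_nth (b s) m = 0 \<and> fls_nth (b' s) m = 0" using B by (auto simp: fam_fls_def)
  have e: "fls_nth (a s * b s) n = (\<Sum>i=L..n-M. fls_nth (a s) i * fls_nth (b s) (n - i))"
    "fls_nth (a' s * b s) n = (\<Sum>i=L..n-M. fls_nth (a' s) i * fls_nth (b s) (n - i))"
    "fls_nth (a s * b' s) n = (\<Sum>i=L..n-M. fls_nth (a s) i * fls_nth (b' s) (n - i))" for s n
    using L M by (auto intro: fls_mult_bounded)
  have "((\<lambda>s. \<Sum>i=L..n-M. fls_nth (a s) i * fls_nth (b s) (n - i)) has_field_derivative
     (\<Sum>i=L..n-M. fls_nth (a' s) i * fls_nth (b s) (n - i) + fls_nth (b' s) (n - i) * fls_nth (a s) i)) (at s)" for s n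
    using A B unfolding fam_fls_def by (intro DERIV_sum DERIV_mult) auto
  then have d: "((\<lambda>s. fls_nth (a s * b s) n) has_field_derivative fls_nth (a' s * b s + a s * b' s) n) (at s)" for s n
    by (simp add: e sum.distrib mult.commute)
  have "\<forall>s. \<forall>m<L+M. fls_nth (a s * b s) m = 0 \<and> fls_nth (a' s * b s + a s * b' s) m = 0"
    by (simp add: e)
  then show ?thesis using d unfolding fam_fls_def by blast
qed

lemma fam_fls_const: "fam_fls (\<lambda>s. a) (\<lambda>s. 0)"
proof -
  obtain L where "\<forall>n<L. fls_nth a n = 0" by (elim fls_nth_vanishes_belowE)
  then show ?thesis by (auto simp: fam_fls_def)
qed

lemma fam_fls_sum: "(\<And>x. x \<in> A \<Longrightarrow> fam_fls (a x) (a' x)) \<Longrightarrow> fam_fls (\<lambda>s. \<Sum>x\<in>A. a x s) (\<lambda>s. \<Sum>x\<in>A. a' x s)"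
  using fam_fls_const[of 0] by (induction A rule: infinite_finite_induct) (auto intro: fam_fls_add)

lemma fam_fls_unique: "fam_fls a a' \<Longrightarrow> fam_fls a a'' \<Longrightarrow> a' s = a'' s"
  unfolding fam_fls_def fls_eq_iff by (metis DERIV_unique)

lemma fam_laur_mult:
  assumes "fam_laur A A'" "fam_laur B B'"
  shows "fam_laur (\<lambda>s. A s * B s) (\<lambda>s. A' s * B s + A s * B' s)"
  unfolding fam_laur_def
proof
  fix k
  have "fam_fls (\<lambda>s. \<Sum>i=0..k. fps_nth (A s) i * fps_nth (B s) (k - i))
     (\<lambda>s. \<Sum>i=0..k. fps_nth (A' s) i * fps_nth (B s) (k - i) + fps_nth (A s) i * fps_nth (B' s) (k - i))"
    using assms unfolding fam_laur_def by (intro fam_fls_sum fam_fls_mult) auto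
  then show "fam_fls (\<lambda>s. fps_nth (A s * B s) k) (\<lambda>s. fps_nth (A' s * B s + A s * B' s) k)"
    by (simp add: fps_mult_nth sum.distrib)
qed

lemma fam_laur_unique:
  assumes "fam_laur A A'" "fam_laur A A''" shows "A' s = A'' s"
proof (rule fps_ext)
  fix k
  show "fps_nth (A' s) k = fps_nth (A'' s) k"
    using assms fam_fls_unique[of "\<lambda>s. fps_nth (A s) k" "\<lambda>s. fps_nth (A' s) k" "\<lambda>s. fps_nth (A'' s) k"]
    unfolding fam_laur_def by blast
qed

text \<open>The order \<open>p\<close> is the same for all \<open>s\<close>, so \<open>z ^ p\<close>
  splits off and the inverse of the remaining unit has coefficients given recursively by
  differentiable expressions. Only differentiability is asserted; the formula for the derivative
  comes from the product rule in \<open>fam_laur_inverse\<close>.\<close>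

lemma fam_fls_inverse:
  assumes E: "\<And>i s. ((\<lambda>s. fps_nth (e s) i) has_field_derivative fps_nth (e' s) i) (at s)"
    and p: "\<And>s i. i < p \<Longrightarrow> fps_nth (e s) i = 0" "\<And>s. fps_nth (e s) p \<noteq> 0"
  shows "\<exists>x'. fam_fls (\<lambda>s. inverse (fps_to_fls (e s))) x'"
proof -
  define f where "f s = fps_shift p (e s)" for s
  have fnz: "fps_nth (f s) 0 \<noteq> 0" for s using p(2) by (simp add: f_def)
  have e: "e s = f s * fps_X ^ p" for s
    using p(1) by (intro fps_ext) (auto simp: f_def fps_X_power_mult_right_nth)
  define g where "g s = fls_shift (int p) (fps_to_fls (inverse (f s)))" for s
  have "fps_to_fls (e s) * g s = fps_to_fls (f s * inverse (f s))" for s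
    by (simp add: e g_def fls_times_fps_to_fls fls_shifted_times_simps fps_to_fls_power fls_X_power_times_conv_shift)
  also have "\<dots> s = 1" for s using fnz by (simp add: inverse_mult_eq_1')
  finally have inv: "inverse (fps_to_fls (e s)) = g s" for s by (metis inverse_unique)
  have "\<exists>d. \<forall>s. ((\<lambda>s. fps_nth (inverse (f s)) n) has_field_derivative d s) (at s)" for n
  proof (induction n rule: less_induct)
    case (less n)
    show ?case
    proof (cases "n = 0")
      case True
      have "((\<lambda>s. inverse (fps_nth (f s) 0)) has_field_derivative - (inverse (fps_nth (f s) 0) * fps_nth (e' s) p * inverse (fps_nth (f s) 0))) (at s)" for s
        using E[of p s] fnz by (intro DERIV_inverse') (auto simp: f_def)
      then show ?thesis using True by (intro exI[of _ "\<lambda>s. - (inverse (fps_nth (f s) 0) * fps_nth (e' s) p * inverse (fps_nth (f s) 0))"]) simp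
    next
      case False
      from less obtain d where d: "\<And>m s. m < n \<Longrightarrow> ((\<lambda>s. fps_nth (inverse (f s)) m) has_field_derivative d m s) (at s)"
        by metis
      have d0: "((\<lambda>s. inverse (fps_nth (f s) 0)) has_field_derivative d 0 s) (at s)" for s
        using d[of 0 s] False by simp
      have df: "((\<lambda>s. fps_nth (f s) m) has_field_derivative fps_nth (e' s) (m + p)) (at s)" for m s
        using E by (simp add: f_def)
      have n: "fps_nth (inverse (f s)) n = - inverse (fps_nth (f s) 0) * (\<Sum>i=1..n. fps_nth (f s) i * fps_nth (inverse (f s)) (n - i))" for s
        using False by (cases n) (simp_all add: fps_inverse_def)
      have "\<exists>D. ((\<lambda>s. - inverse (fps_nth (f s) 0) * (\<Sum>i=1..n. fps_nth (f s) i * fps_nth (inverse (f s)) (n - i))) has_field_derivative D) (at s)" for s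
      proof -
        have 3: "((\<lambda>s. fps_nth (inverse (f s)) (n - i)) has_field_derivative d (n - i) s) (at s)" if "i \<in> {1..n}" for i
          using that by (intro d) auto
        have "((\<lambda>s. - inverse (fps_nth (f s) 0)) has_field_derivative - d 0 s) (at s)"
          by (rule DERIV_minus[OF d0])
        moreover have "((\<lambda>s. \<Sum>i=1..n. fps_nth (f s) i * fps_nth (inverse (f s)) (n - i)) has_field_derivative
           (\<Sum>i=1..n. fps_nth (e' s) (i + p) * fps_nth (inverse (f s)) (n - i) + d (n - i) s * fps_nth (f s) i)) (at s)"
          by (intro DERIV_sum DERIV_mult df 3)
        ultimately show ?thesis by (intro exI) (rule DERIV_mult)
      qed
      then show ?thesis unfolding n by (intro choice allI)
    qed
  qed
  then obtain d where d: "\<And>n s. ((\<lambda>s. fps_nth (inverse (f s)) n) has_field_derivative d n s) (at s)" by metis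
  define x' where "x' s = fls_shift (int p) (fps_to_fls (Abs_fps (\<lambda>n. d n s)))" for s
  have "fam_fls g x'"
    unfolding fam_fls_def
  proof (intro conjI allI exI[of _ "- int p"] impI)
    fix s m
    show "m < - int p \<Longrightarrow> fls_nth (g s) m = 0" "m < - int p \<Longrightarrow> fls_nth (x' s) m = 0"
      by (simp_all add: g_def x'_def)
    show "((\<lambda>s. fls_nth (g s) m) has_field_derivative fls_nth (x' s) m) (at s)"
      using d by (simp add: g_def x'_def)
  qed
  then show ?thesis unfolding inv by blast
qed

lemma fam_laur_laur: "fam2 A A' \<Longrightarrow> fam_laur (\<lambda>s. laur (A s)) (\<lambda>s. laur (A' s))"
  unfolding fam_laur_def fam_fls_def
proof (intro allI conjI exI[of _ 0] impI)
  fix k s m assume "fam2 A A'"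
  then have "((\<lambda>s. fps_nth (fps_nth (A s) k) (nat m)) has_field_derivative fps_nth (fps_nth (A' s) k) (nat m)) (at s)"
    by (simp add: fam2_def coef2_def)
  then show "((\<lambda>s. fls_nth (fps_nth (laur (A s)) k) m) has_field_derivative fls_nth (fps_nth (laur (A' s)) k) m) (at s)"
    by (cases "m < 0") (simp_all add: laur_def)
qed (simp_all add: laur_def)

text \<open>The recursion for inverses shows that the coefficients are differentiable;
  differentiating \<open>laur (J s) * X s = 1\<close> then determines the derivative.\<close>

lemma fam_laur_inverse:
  assumes J: "fam2 J J'" and p: "\<And>s. z_order (J s) p"
  shows "fam_laur (\<lambda>s. inverse (laur (J s))) (\<lambda>s. - (inverse (laur (J s)) * laur (J' s) * inverse (laur (J s))))"
proof -
  define X where "X s = inverse (laur (J s))" for s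
  have lJ: "fam_laur (\<lambda>s. laur (J s)) (\<lambda>s. laur (J' s))" by (rule fam_laur_laur) fact
  have "\<exists>x'. fam_fls (\<lambda>s. fps_nth (X s) k) x'" for k
  proof (induction k rule: less_induct)
    case (less k)
    have "\<exists>x'. fam_fls (\<lambda>s. inverse (fps_to_fls (fps_nth (J s) 0))) x'"
    proof (rule fam_fls_inverse)
      show "((\<lambda>s. fps_nth (fps_nth (J s) 0) i) has_field_derivative fps_nth (fps_nth (J' s) 0) i) (at s)" for i s
        using J by (simp add: fam2_def coef2_def)
    next
      show "i < p \<Longrightarrow> fps_nth (fps_nth (J s) 0) i = 0" "fps_nth (fps_nth (J s) 0) p \<noteq> 0" for s i
        using p[of s] unfolding z_order_def coef2_def by blast+
    qed
    then obtain x0 where x0: "fam_fls (\<lambda>s. fps_nth (X s) 0) x0" by (auto simp: X_def laur_def)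
    show ?case
    proof (cases "k = 0")
      case True then show ?thesis using x0 by blast
    next
      case False
      from less obtain x' where x': "\<And>m. m < k \<Longrightarrow> fam_fls (\<lambda>s. fps_nth (X s) m) (x' m)" by metis
      have n: "fps_nth (X s) k = (fls_const (-1) * fps_nth (X s) 0) * (\<Sum>i=1..k. fps_nth (laur (J s)) i * fps_nth (X s) (k - i))" for s
        using False by (cases k) (simp_all add: X_def fps_inverse_def)
      have "fam_fls (\<lambda>s. (fls_const (-1) * fps_nth (X s) 0) * (\<Sum>i=1..k. fps_nth (laur (J s)) i * fps_nth (X s) (k - i)))
         (\<lambda>s. (0 * fps_nth (X s) 0 + fls_const (-1) * x0 s) * (\<Sum>i=1..k. fps_nth (laur (J s)) i * fps_nth (X s) (k - i)) +
            (fls_const (-1) * fps_nth (X s) 0) * (\<Sum>i=1..k. fps_nth (laur (J' s)) i * fps_nth (X s) (k - i) + fps_nth (laur (J s)) i * x' (k - i) s))"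
        using lJ unfolding fam_laur_def
        by (intro fam_fls_mult fam_fls_sum fam_fls_const x0 x') auto
      then show ?thesis unfolding n by blast
    qed
  qed
  then obtain x' where x': "\<And>k. fam_fls (\<lambda>s. fps_nth (X s) k) (x' k)" by metis
  define X' where "X' s = Abs_fps (\<lambda>k. x' k s)" for s
  have X': "fam_laur X X'" using x' by (simp add: fam_laur_def X'_def)
  have JX: "laur (J s) * X s = 1" for s unfolding X_def by (rule laur_inverse[OF p])
  have "fam_laur (\<lambda>s. laur (J s) * X s) (\<lambda>s. laur (J' s) * X s + laur (J s) * X' s)"
    by (rule fam_laur_mult[OF lJ X'])
  moreover have "fam_laur (\<lambda>s. 1) (\<lambda>s. 0)" using fam_fls_const by (simp add: fam_laur_def)
  ultimately have z: "laur (J' s) * X s + laur (J s) * X' s = 0" for s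
    unfolding JX by (rule fam_laur_unique)
  have "X' s = - (X s * laur (J' s) * X s)" for s
  proof -
    have "X s * (laur (J' s) * X s + laur (J s) * X' s) = 0" unfolding z by simp
    then have "X s * laur (J' s) * X s + (laur (J s) * X s) * X' s = 0" by (simp add: algebra_simps)
    then show ?thesis unfolding JX by (simp add: eq_neg_iff_add_eq_0 add.commute)
  qed
  then have "X' = (\<lambda>s. - (X s * laur (J' s) * X s))" by blast
  with X' show ?thesis unfolding X_def by simp
qed

text \<open>\<open>F\<close> is stationary at the roots of \<open>dx F\<close>; accordingly the terms coming from the motion of the roots
  add up to a total \<open>z\<close>-derivative, whose residue vanishes.\<close>

lemma trace_power_deriv:
  assumes F: "fam2 F F'" and p: "\<And>s. z_order (dx (F s)) p"
  shows "((\<lambda>s. fps_nth (trace_at (dx (F s)) (F s ^ i)) k) has_field_derivative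
    fps_nth (trace_at (dx (F s)) (of_nat i * F s ^ (i - 1) * F' s)) k) (at s)"
proof -
  define J where "J s = laur (dx (F s))" for s
  define J' where "J' s = laur (dx (F' s))" for s
  define X where "X s = inverse (J s)" for s
  have JX: "J s * X s = 1" for s unfolding X_def J_def by (rule laur_inverse[OF p])
  have Fi: "fam_laur (\<lambda>s. laur (F s ^ i)) (\<lambda>s. laur (of_nat i * F s ^ (i - 1) * F' s))"
    by (intro fam_laur_laur fam2_power F)
  have JJ: "fam_laur (\<lambda>s. Dz (J s)) (\<lambda>s. Dz (J' s))"
    unfolding J_def J'_def Dz_laur by (intro fam_laur_laur fam2_dx F)
  have XX: "fam_laur X (\<lambda>s. - (X s * J' s * X s))"
    unfolding X_def J_def J'_def by (rule fam_laur_inverse[OF fam2_dx[OF F] p])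
  have "fam_laur (\<lambda>s. laur (F s ^ i) * (Dz (J s) * X s))
    (\<lambda>s. laur (of_nat i * F s ^ (i - 1) * F' s) * (Dz (J s) * X s) + laur (F s ^ i) * (Dz (J' s) * X s + Dz (J s) * (- (X s * J' s * X s))))"
    by (intro fam_laur_mult Fi JJ XX)
  then have der: "((\<lambda>s. fps_nth (trace_at (dx (F s)) (F s ^ i)) k) has_field_derivative
     fps_nth (Rz (laur (of_nat i * F s ^ (i - 1) * F' s) * (Dz (J s) * X s) + laur (F s ^ i) * (Dz (J' s) * X s + Dz (J s) * (- (X s * J' s * X s))))) k) (at s)"
    by (simp add: fam_laur_def fam_fls_def trace_at_def Rz_def J_def X_def)
  have "Dz (J s * X s) = 0" by (simp add: JX)
  then have "X s * (Dz (J s) * X s + J s * Dz (X s)) = 0" by (simp add: Dz_mult)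
  then have "X s * Dz (J s) * X s + (J s * X s) * Dz (X s) = 0" by (simp add: algebra_simps)
  then have DX: "Dz (X s) = - (X s * Dz (J s) * X s)"
    unfolding JX by (simp add: eq_neg_iff_add_eq_0 add.commute)
  \<comment> \<open>As \<open>J s\<close> is the \<open>z\<close>-derivative of \<open>F s\<close>,
    the product rule produces a factor \<open>J s * X s = 1\<close> in the first term, which thereby
    becomes a power series in \<open>z\<close> and has no residue.\<close>
  have "Dz (laur (F s ^ i) * J' s * X s) = of_nat i * laur (F s) ^ (i - 1) * J' s * (J s * X s) + laur (F s ^ i) * (Dz (J' s) * X s + Dz (J s) * (- (X s * J' s * X s)))"
    by (simp add: Dz_mult laur_power Dz_power Dz_laur DX J_def[symmetric] algebra_simps)
  then have "laur (F s ^ i) * (Dz (J' s) * X s + Dz (J s) * (- (X s * J' s * X s))) =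
     Dz (laur (F s ^ i) * J' s * X s) - laur (of_nat i * F s ^ (i - 1) * dx (F' s))"
    by (simp add: JX laur_mult laur_of_nat laur_power J'_def)
  with der show ?thesis
    by (simp add: Rz_add Rz_diff trace_at_def J_def X_def)
qed

subsection \<open>Newton's identities\<close>

text \<open>If \<open>T i\<close> is the \<open>i\<close>-th power sum of \<open>v\<^sub>1, v\<^sub>2, \<dots>\<close>, then \<open>newton T k\<close> is the \<open>k\<close>-th coefficient of
  \<open>\<Prod>(1 - v\<^sub>i X)\<close>.\<close>

lemmas [fundef_cong] = sum.cong

fun newton :: "(nat \<Rightarrow> complex fps) \<Rightarrow> nat \<Rightarrow> complex fps" where
  "newton T k = (if k = 0 then 1 else fps_const (- 1 / of_nat k) * (\<Sum>i<k. newton T i * T (k - i)))"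

fun newton_deriv :: "(nat \<Rightarrow> complex fps) \<Rightarrow> (nat \<Rightarrow> complex fps) \<Rightarrow> nat \<Rightarrow> complex fps" where
  "newton_deriv T T' k = (if k = 0 then 0 else
     fps_const (- 1 / of_nat k) * (\<Sum>i<k. newton_deriv T T' i * T (k - i) + newton T i * T' (k - i)))"

declare newton.simps [simp del] newton_deriv.simps [simp del]

definition fam1 :: "(complex \<Rightarrow> complex fps) \<Rightarrow> (complex \<Rightarrow> complex fps) \<Rightarrow> bool" where
  "fam1 A A' \<longleftrightarrow> (\<forall>s i. ((\<lambda>s. fps_nth (A s) i) has_field_derivative fps_nth (A' s) i) (at s))"

lemma fam1_mult:
  assumes "fam1 A A'" "fam1 B B'"
  shows "fam1 (\<lambda>s. A s * B s) (\<lambda>s. A' s * B s + A s * B' s)"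
proof -
  have "((\<lambda>s. fps_nth (A s * B s) k) has_field_derivative
     (\<Sum>i=0..k. fps_nth (A' s) i * fps_nth (B s) (k - i) + fps_nth (B' s) (k - i) * fps_nth (A s) i)) (at s)" for s k
    unfolding fps_mult_nth using assms unfolding fam1_def by (intro DERIV_sum DERIV_mult) auto
  then show ?thesis by (simp add: fam1_def fps_mult_nth sum.distrib mult.commute)
qed

lemma fam1_const: "fam1 (\<lambda>s. A) (\<lambda>s. 0)" by (simp add: fam1_def)

lemma fam1_sum: "(\<And>x. x \<in> I \<Longrightarrow> fam1 (A x) (A' x)) \<Longrightarrow> fam1 (\<lambda>s. \<Sum>x\<in>I. A x s) (\<lambda>s. \<Sum>x\<in>I. A' x s)"
  unfolding fam1_def fps_sum_nth by (intro allI DERIV_sum) auto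

lemma fam1_newton:
  assumes T: "\<And>i. i > 0 \<Longrightarrow> fam1 (\<lambda>s. T s i) (\<lambda>s. T' s i)"
  shows "fam1 (\<lambda>s. newton (T s) k) (\<lambda>s. newton_deriv (T s) (T' s) k)"
proof (induction k rule: less_induct)
  case (less k)
  show ?case
  proof (cases "k = 0")
    case True
    then show ?thesis using fam1_const by (simp add: newton.simps newton_deriv.simps)
  next
    case False
    have "fam1 (\<lambda>s. fps_const (- 1 / of_nat k) * (\<Sum>i<k. newton (T s) i * T s (k - i)))
       (\<lambda>s. 0 * (\<Sum>i<k. newton (T s) i * T s (k - i)) +
          fps_const (- 1 / of_nat k) * (\<Sum>i<k. newton_deriv (T s) (T' s) i * T s (k - i) + newton (T s) i * T' s (k - i)))"
      by (intro fam1_mult fam1_const fam1_sum less T) auto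
    then show ?thesis using False by (simp add: newton.simps[of _ k] newton_deriv.simps[of _ _ k])
  qed
qed

lemma newton_compose:
  assumes "fps_nth b 0 = 0"
  shows "fps_compose (newton T k) b = newton (\<lambda>i. fps_compose (T i) b) k"
proof (induction k rule: less_induct)
  case (less k)
  show ?case using less assms
    by (subst (1 2) newton.simps) (simp add: fps_compose_mult_distrib fps_compose_sum_distrib)
qed

lemma newton_deriv_compose:
  assumes "fps_nth b 0 = 0"
  shows "fps_compose (newton_deriv T T' k) b = newton_deriv (\<lambda>i. fps_compose (T i) b) (\<lambda>i. fps_compose (T' i) b) k"
proof (induction k rule: less_induct)
  case (less k)
  show ?case using less assms
    by (subst (1 2) newton_deriv.simps)
      (simp add: fps_compose_mult_distrib fps_compose_sum_distrib fps_compose_add_distrib newton_compose)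
qed

text \<open>A pair \<open>(v, w)\<close> stands for a quantity \<open>v\<close> with derivative \<open>w\<close>; \<open>rdprod\<close> and \<open>mdprod\<close> are the derivatives of
  the products \<open>rprod\<close> and \<open>mprod\<close>.\<close>

definition rprod :: "(complex fps \<times> complex fps) list \<Rightarrow> complex fps fps" where
  "rprod l = (\<Prod>(v, w)\<leftarrow>l. 1 - fps_const v * fps_X)"

fun rdprod :: "(complex fps \<times> complex fps) list \<Rightarrow> complex fps fps" where
  "rdprod [] = 0"
| "rdprod ((v, w) # l) = - (fps_const w * fps_X * rprod l) + (1 - fps_const v * fps_X) * rdprod l"

definition mprod :: "(complex fps \<times> complex fps) list \<Rightarrow> complex fps fps" where
  "mprod l = (\<Prod>(v, w)\<leftarrow>l. fps_X - fps_const v)"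

fun mdprod :: "(complex fps \<times> complex fps) list \<Rightarrow> complex fps fps" where
  "mdprod [] = 0"
| "mdprod ((v, w) # l) = - (fps_const w * mprod l) + (fps_X - fps_const v) * mdprod l"

text \<open>The generating series \<open>v X / (1 - v X)\<close> of the powers of \<open>v\<close>,
  that is, \<open>- X d/dX\<close> of the logarithm of \<open>1 - v X\<close>;
  \<open>dpsum v w\<close> is its derivative when \<open>v\<close> moves with derivative
  \<open>w\<close>.\<close>

definition psum :: "complex fps \<Rightarrow> complex fps fps" where
  "psum v = Abs_fps (\<lambda>i. if i = 0 then 0 else v ^ i)"
definition dpsum :: "complex fps \<Rightarrow> complex fps \<Rightarrow> complex fps fps" where
  "dpsum v w = Abs_fps (\<lambda>i. of_nat i * v ^ (i - 1) * w)"

lemma psum_eq: "(1 - fps_const v * fps_X) * psum v = fps_const v * fps_X"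
proof (rule fps_ext)
  fix n show "fps_nth ((1 - fps_const v * fps_X) * psum v) n = fps_nth (fps_const v * fps_X) n"
    by (cases n) (auto simp: psum_def algebra_simps mult.assoc[of "fps_const v"] gr0_conv_Suc)
qed

lemma dpsum_eq: "(1 - fps_const v * fps_X) * dpsum v w = fps_const w * fps_X * (1 + psum v)"
proof (rule fps_ext)
  fix n show "fps_nth ((1 - fps_const v * fps_X) * dpsum v w) n = fps_nth (fps_const w * fps_X * (1 + psum v)) n"
  proof (cases n)
    case (Suc m)
    have l: "fps_nth ((1 - fps_const v * fps_X) * dpsum v w) n = fps_nth (dpsum v w) n - v * fps_nth (dpsum v w) m"
      by (simp add: left_diff_distrib mult.assoc Suc)
    have r: "fps_nth (fps_const w * fps_X * (1 + psum v)) n = w * fps_nth (1 + psum v) m"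
      by (simp add: mult.assoc Suc)
    show ?thesis unfolding l r
      by (cases m) (auto simp: dpsum_def psum_def Suc algebra_simps)
  qed (simp add: mult.assoc dpsum_def left_diff_distrib)
qed

text \<open>Newton's identities as a differential equation: the logarithmic derivatives of the
  factors add up.\<close>

lemma rprod_deriv: "fps_X * fps_deriv (rprod l) = rprod l * (- (\<Sum>(v, w)\<leftarrow>l. psum v))"
proof (induction l)
  case Nil then show ?case by (simp add: rprod_def)
next
  case (Cons p l)
  obtain v w where p: "p = (v, w)" by fastforce
  define c where "c = fps_const v * fps_X"
  define S where "S = (\<Sum>(v, w)\<leftarrow>l. psum v)"
  have r: "rprod (p # l) = (1 - c) * rprod l" by (simp add: rprod_def p c_def)
  have dc: "fps_X * fps_deriv c = c" by (simp add: c_def)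
  have ps: "(1 - c) * psum v = c" using psum_eq by (simp add: c_def)
  have "fps_X * fps_deriv (rprod (p # l)) = (1 - c) * (fps_X * fps_deriv (rprod l)) - (fps_X * fps_deriv c) * rprod l"
    unfolding r by (simp add: algebra_simps)
  also have "\<dots> = (1 - c) * (rprod l * (- S)) - ((1 - c) * psum v) * rprod l"
    unfolding dc ps Cons.IH S_def ..
  also have "\<dots> = rprod (p # l) * (- (psum v + S))" unfolding r by (simp add: algebra_simps)
  finally show ?case by (simp add: p S_def)
qed

text \<open>The equation of \<open>rprod_deriv\<close>, differentiated while every \<open>v\<close>
  moves with derivative \<open>w\<close>.\<close>

lemma rdprod_deriv: "fps_X * fps_deriv (rdprod l) = rdprod l * (- (\<Sum>(v, w)\<leftarrow>l. psum v)) + rprod l * (- (\<Sum>(v, w)\<leftarrow>l. dpsum v w))"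
proof (induction l)
  case Nil then show ?case by simp
next
  case (Cons p l)
  obtain v w where p: "p = (v, w)" by fastforce
  define c where "c = fps_const v * fps_X"
  define d where "d = fps_const w * fps_X"
  define S where "S = (\<Sum>(v, w)\<leftarrow>l. psum v)"
  define S' where "S' = (\<Sum>(v, w)\<leftarrow>l. dpsum v w)"
  define P where "P = rprod l"
  define Q where "Q = rdprod l"
  have r: "rprod (p # l) = (1 - c) * P" by (simp add: rprod_def p c_def P_def)
  have r': "rdprod (p # l) = - (d * P) + (1 - c) * Q" by (simp add: p c_def d_def P_def Q_def)
  have dc: "fps_X * fps_deriv c = c" "fps_X * fps_deriv d = d" by (simp_all add: c_def d_def)
  have ps: "(1 - c) * psum v = c" using psum_eq by (simp add: c_def)
  have dps: "(1 - c) * dpsum v w = d * (1 + psum v)" using dpsum_eq by (simp add: c_def d_def)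
  have IH: "fps_X * fps_deriv Q = Q * (- S) + P * (- S')" using Cons.IH by (simp add: Q_def S_def S'_def P_def)
  have IP: "fps_X * fps_deriv P = P * (- S)" using rprod_deriv[of l] by (simp add: P_def S_def)
  have "fps_X * fps_deriv (rdprod (p # l)) = - ((fps_X * fps_deriv d) * P + d * (fps_X * fps_deriv P)) - (fps_X * fps_deriv c) * Q + (1 - c) * (fps_X * fps_deriv Q)"
    unfolding r' by (simp add: algebra_simps)
  also have "\<dots> = - (d * P) + d * P * S - c * Q - (1 - c) * Q * S - (1 - c) * P * S'"
    unfolding dc IH IP by (simp add: algebra_simps)
  also have "\<dots> = (- (d * P) + (1 - c) * Q) * (- (psum v + S)) + (1 - c) * P * (- (dpsum v w + S'))"
  proof -
    have "(- (d * P) + (1 - c) * Q) * (- (psum v + S)) + (1 - c) * P * (- (dpsum v w + S')) =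
       d * P * psum v + d * P * S - ((1 - c) * psum v) * Q - (1 - c) * Q * S - ((1 - c) * dpsum v w) * P - (1 - c) * P * S'"
      by (simp add: algebra_simps)
    then show ?thesis unfolding ps dps by (simp add: algebra_simps)
  qed
  finally show ?case unfolding r r' by (simp add: p S_def S'_def)
qed

lemma fps_nth_sum_list: "fps_nth (sum_list xs) k = (\<Sum>x\<leftarrow>xs. fps_nth x k)"
  by (induction xs) auto

lemma recursion_step:
  fixes P S :: "complex fps fps"
  assumes eq: "fps_X * fps_deriv P = R" and k: "k > 0" and R: "fps_nth R k = - r"
  shows "fps_nth P k = fps_const (- 1 / of_nat k) * r"
proof -
  obtain m where m: "k = Suc m" using k by (cases k) auto
  have "fps_nth (fps_X * fps_deriv P) k = of_nat k * fps_nth P k" by (simp add: m)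
  then have "of_nat k * fps_nth P k = - r" using eq R by simp
  then have "fps_const (1 / of_nat k) * (of_nat k * fps_nth P k) = - (fps_const (1 / of_nat k) * r)" by simp
  also have "fps_const (1 / of_nat k) * (of_nat k * fps_nth P k) = (fps_const (1 / of_nat k) * of_nat k) * fps_nth P k"
    by (simp only: mult.assoc)
  also have "fps_const (1 / of_nat k :: complex) * of_nat k = 1"
    using k by (simp flip: fps_of_nat)
  finally show ?thesis by (simp flip: fps_const_neg)
qed

lemma newton_rprod:
  assumes T: "\<And>i. i > 0 \<Longrightarrow> T i = (\<Sum>(v, w)\<leftarrow>l. v ^ i)"
  shows "fps_nth (rprod l) k = newton T k"
proof (induction k rule: less_induct)
  case (less k)
  show ?case
  proof (cases "k = 0")
    case True
    have "fps_nth (rprod l) 0 = 1" by (induction l) (auto simp: rprod_def)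
    then show ?thesis using True by (simp add: newton.simps)
  next
    case False
    define S where "S = (\<Sum>(v, w)\<leftarrow>l. psum v)"
    have S: "fps_nth S i = (if i = 0 then 0 else T i)" for i
      using T by (auto simp: S_def fps_nth_sum_list case_prod_unfold psum_def comp_def sum_list_0)
    have "fps_nth (rprod l * (- S)) k = - (\<Sum>i<k. newton T i * T (k - i))"
    proof -
      have "{0..k} = insert k {..<k}" by auto
      then show ?thesis using less by (simp add: fps_mult_nth S sum_negf)
    qed
    from recursion_step[OF rprod_deriv[of l, folded S_def] _ this] False
    show ?thesis by (simp add: newton.simps[of T k])
  qed
qed

lemma newton_rdprod:
  assumes T: "\<And>i. i > 0 \<Longrightarrow> T i = (\<Sum>(v, w)\<leftarrow>l. v ^ i)" "\<And>i. i > 0 \<Longrightarrow> T' i = (\<Sum>(v, w)\<leftarrow>l. of_nat i * v ^ (i - 1) * w)"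
  shows "fps_nth (rdprod l) k = newton_deriv T T' k"
proof (induction k rule: less_induct)
  case (less k)
  show ?case
  proof (cases "k = 0")
    case True
    have "fps_nth (rdprod l) 0 = 0" by (induction l rule: rdprod.induct) (auto simp: mult.assoc)
    then show ?thesis using True by (simp add: newton_deriv.simps)
  next
    case False
    define S where "S = (\<Sum>(v, w)\<leftarrow>l. psum v)"
    define S' where "S' = (\<Sum>(v, w)\<leftarrow>l. dpsum v w)"
    have S: "fps_nth S i = (if i = 0 then 0 else T i)" for i
      using T by (auto simp: S_def fps_nth_sum_list case_prod_unfold psum_def comp_def sum_list_0)
    have S': "fps_nth S' i = (if i = 0 then 0 else T' i)" for i
      using T by (auto simp: S'_def fps_nth_sum_list case_prod_unfold dpsum_def comp_def sum_list_0)
    have "fps_nth (rdprod l * (- S) + rprod l * (- S')) k = - (\<Sum>i<k. newton_deriv T T' i * T (k - i) + newton T i * T' (k - i))"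
    proof -
      have "{0..k} = insert k {..<k}" by auto
      then show ?thesis using less newton_rprod[OF T(1)] by (simp add: fps_mult_nth S S' sum_negf sum.distrib)
    qed
    from recursion_step[OF rdprod_deriv[of l, folded S_def S'_def] _ this] False
    show ?thesis by (simp add: newton_deriv.simps[of T T' k])
  qed
qed

text \<open>The relation \<open>A = X ^ p * B(1 / X)\<close> for \<open>B\<close> of degree at most
  \<open>p\<close>; it connects products of factors \<open>X - v\<close> with products of factors
  \<open>1 - v X\<close>.\<close>

definition reversal :: "nat \<Rightarrow> complex fps fps \<Rightarrow> complex fps fps \<Rightarrow> bool" where
  "reversal p A B \<longleftrightarrow> (\<forall>j. fps_nth A j = (if j \<le> p then fps_nth B (p - j) else 0)) \<and> (\<forall>k>p. fps_nth B k = 0)"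

lemma reversal_step:
  assumes "reversal p A B"
  shows "reversal (Suc p) ((fps_X - fps_const v) * A) ((1 - fps_const v * fps_X) * B)"
    and "reversal (Suc p) (fps_const v * A) (fps_const v * fps_X * B)"
proof -
  have l: "fps_nth ((fps_X - fps_const v) * A) j = (if j = 0 then 0 else fps_nth A (j - 1)) - v * fps_nth A j" for j
    by (cases j) (simp_all add: left_diff_distrib)
  have r: "fps_nth ((1 - fps_const v * fps_X) * B) k = fps_nth B k - (if k = 0 then 0 else v * fps_nth B (k - 1))" for k
    by (cases k) (simp_all add: left_diff_distrib mult.assoc)
  have r2: "fps_nth (fps_const v * fps_X * B) k = (if k = 0 then 0 else v * fps_nth B (k - 1))" for k
    by (cases k) (simp_all add: mult.assoc)
  have A: "\<And>j. fps_nth A j = (if j \<le> p then fps_nth B (p - j) else 0)" and B: "\<And>k. k > p \<Longrightarrow> fps_nth B k = 0"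
    using assms by (auto simp: reversal_def)
  have "fps_nth ((fps_X - fps_const v) * A) j = (if j \<le> Suc p then fps_nth ((1 - fps_const v * fps_X) * B) (Suc p - j) else 0)" for j
    unfolding l r A by (cases j) (auto simp: B Suc_diff_le le_Suc_eq)
  then show "reversal (Suc p) ((fps_X - fps_const v) * A) ((1 - fps_const v * fps_X) * B)"
    by (auto simp: reversal_def r B)
  have "fps_nth (fps_const v * A) j = (if j \<le> Suc p then fps_nth (fps_const v * fps_X * B) (Suc p - j) else 0)" for j
    unfolding r2 by (auto simp: A Suc_diff_le le_Suc_eq)
  then show "reversal (Suc p) (fps_const v * A) (fps_const v * fps_X * B)"
    by (auto simp: reversal_def r2 B)
qed

lemma reversal_add: "reversal p A B \<Longrightarrow> reversal p A' B' \<Longrightarrow> reversal p (A + A') (B + B')"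
  by (auto simp: reversal_def)
lemma reversal_uminus: "reversal p A B \<Longrightarrow> reversal p (- A) (- B)"
  by (auto simp: reversal_def)

lemma reversal_prod: "reversal (length l) (mprod l) (rprod l)"
proof (induction l)
  case Nil then show ?case by (simp add: reversal_def mprod_def rprod_def)
next
  case (Cons p l) then show ?case using reversal_step(1) by (cases p) (simp add: mprod_def rprod_def)
qed

lemma reversal_dprod: "reversal (length l) (mdprod l) (rdprod l)"
proof (induction l rule: rdprod.induct)
  case 1 then show ?case by (simp add: reversal_def)
next
  case (2 v w l)
  show ?case unfolding rdprod.simps mdprod.simps
    using reversal_step[OF reversal_prod[of l]] reversal_step[OF 2]
    by (intro reversal_add reversal_uminus) auto
qed

text \<open>For \<open>e = newton T\<close> this is the monic polynomial of degree \<open>p\<close>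
  in the outer variable whose roots have the power sums \<open>T\<close>.\<close>

definition monic2 :: "nat \<Rightarrow> (nat \<Rightarrow> complex fps) \<Rightarrow> complex fps fps" where
  "monic2 p e = Abs_fps (\<lambda>j. if j \<le> p then e (p - j) else 0)"

lemma sub_XX_power_nth:
  assumes "N > 0"
  shows "fps_nth (sub F (XX ^ N) YY) j = fps_compose (fps_nth F j) (fps_X ^ N)"
proof (rule fps_ext)
  fix i
  have "coef2 (sub F (XX ^ N) YY) i j = (\<Sum>a\<le>i+j. \<Sum>b\<le>i+j. if b = j then (if N * a = i then coef2 F a b else 0) else 0)"
    unfolding coef2_sub power_mult[symmetric] coef2_mono by (intro sum.cong refl) auto
  also have "\<dots> = (\<Sum>a\<le>i+j. if N * a = i then coef2 F a j else 0)" by (simp add: sum.delta)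
  also have "\<dots> = (\<Sum>a\<le>i+j. if N dvd i \<and> a = i div N then coef2 F a j else 0)"
    using assms by (intro sum.cong refl if_cong) auto
  also have "\<dots> = (if N dvd i then coef2 F (i div N) j else 0)"
    using assms by (cases "N dvd i") (auto simp: sum.delta trans_le_add1)
  finally show "fps_nth (fps_nth (sub F (XX ^ N) YY) j) i = fps_nth (fps_compose (fps_nth F j) (fps_X ^ N)) i"
    by (simp add: coef2_def fps_nth_compose_X_pow assms)
qed

lemma monic2_newton:
  assumes N: "N > 0" and l: "length l = p"
    and T: "\<And>i. i > 0 \<Longrightarrow> fps_compose (T i) (fps_X ^ N) = (\<Sum>(v, w)\<leftarrow>l. v ^ i)"
  shows "sub (monic2 p (newton T)) (XX ^ N) YY = mprod l"
proof (rule fps_ext)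
  fix j
  show "fps_nth (sub (monic2 p (newton T)) (XX ^ N) YY) j = fps_nth (mprod l) j"
    using reversal_prod[of l] newton_rprod[of "\<lambda>i. fps_compose (T i) (fps_X ^ N)" l, OF T] N l
    by (simp add: reversal_def sub_XX_power_nth monic2_def newton_compose)
qed

lemma monic2_newton_deriv:
  assumes N: "N > 0" and l: "length l = p"
    and T: "\<And>i. i > 0 \<Longrightarrow> fps_compose (T i) (fps_X ^ N) = (\<Sum>(v, w)\<leftarrow>l. v ^ i)"
      "\<And>i. i > 0 \<Longrightarrow> fps_compose (T' i) (fps_X ^ N) = (\<Sum>(v, w)\<leftarrow>l. of_nat i * v ^ (i - 1) * w)"
  shows "sub (monic2 p (newton_deriv T T')) (XX ^ N) YY = mdprod l"
proof (rule fps_ext)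
  fix j
  show "fps_nth (sub (monic2 p (newton_deriv T T')) (XX ^ N) YY) j = fps_nth (mdprod l) j"
    using reversal_dprod[of l] newton_rdprod[of "\<lambda>i. fps_compose (T i) (fps_X ^ N)" l "\<lambda>i. fps_compose (T' i) (fps_X ^ N)", OF T] N l
    by (simp add: reversal_def sub_XX_power_nth monic2_def newton_deriv_compose)
qed

subsection \<open>Weighted orders\<close>

definition wt :: "real \<Rightarrow> real \<Rightarrow> nat \<Rightarrow> nat \<Rightarrow> real" where
  "wt w1 w2 i j = w1 * real i + w2 * real j"
text \<open>The zero series has no weight at all, whereas it satisfies \<open>gt_wt\<close> for
  every \<open>r\<close>.\<close>

definition has_wt :: "real \<Rightarrow> real \<Rightarrow> complex fps fps \<Rightarrow> real \<Rightarrow> bool" where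
  "has_wt w1 w2 G r \<longleftrightarrow> (\<forall>i j. coef2 G i j \<noteq> 0 \<longrightarrow> r \<le> wt w1 w2 i j) \<and> (\<exists>i j. coef2 G i j \<noteq> 0 \<and> wt w1 w2 i j = r)"
definition gt_wt :: "real \<Rightarrow> real \<Rightarrow> complex fps fps \<Rightarrow> real \<Rightarrow> bool" where
  "gt_wt w1 w2 G r \<longleftrightarrow> (\<forall>i j. coef2 G i j \<noteq> 0 \<longrightarrow> r < wt w1 w2 i j)"

lemma wt_add: "wt w1 w2 (i + k) (j + l) = wt w1 w2 i j + wt w1 w2 k l"
  by (simp add: wt_def algebra_simps)

lemma finite_wt_le:
  assumes "w1 > 0" "w2 > 0"
  shows "finite {(i, j). wt w1 w2 i j \<le> c}"
proof (rule finite_subset)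
  show "{(i, j). wt w1 w2 i j \<le> c} \<subseteq> {..nat \<lfloor>c / w1\<rfloor>} \<times> {..nat \<lfloor>c / w2\<rfloor>}"
  proof clarify
    fix i j assume "wt w1 w2 i j \<le> c"
    then have "w1 * real i \<le> c" "w2 * real j \<le> c"
      using assms mult_nonneg_nonneg[of w1 "real i"] mult_nonneg_nonneg[of w2 "real j"]
      unfolding wt_def by linarith+
    then have "real i \<le> c / w1" "real j \<le> c / w2" using assms by (simp_all add: field_simps)
    then show "i \<in> {..nat \<lfloor>c / w1\<rfloor>} \<and> j \<in> {..nat \<lfloor>c / w2\<rfloor>}"
      by (auto simp: le_nat_floor)
  qed
qed simp

lemma has_wt_exists:
  assumes w: "w1 > 0" "w2 > 0" and P: "P i0 j0"
  shows "\<exists>r. (\<forall>i j. P i j \<longrightarrow> r \<le> wt w1 w2 i j) \<and> (\<exists>i j. P i j \<and> wt w1 w2 i j = r)"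
proof -
  define S where "S = {p. case p of (i, j) \<Rightarrow> wt w1 w2 i j \<le> wt w1 w2 i0 j0 \<and> P i j}"
  have S: "finite S" "(i0, j0) \<in> S"
    using finite_wt_le[OF w, of "wt w1 w2 i0 j0"] P by (auto simp: S_def elim: rev_finite_subset)
  define r where "r = Min ((\<lambda>(i, j). wt w1 w2 i j) ` S)"
  have "r \<in> (\<lambda>(i, j). wt w1 w2 i j) ` S" unfolding r_def using S by (intro Min_in) auto
  moreover have "r \<le> wt w1 w2 i j" if "(i, j) \<in> S" for i j
    unfolding r_def using S that by (intro Min_le) (auto intro!: image_eqI[of _ _ "(i, j)"])
  moreover have "r \<le> wt w1 w2 i0 j0" using calculation(2) S by blast
  ultimately have "r \<le> wt w1 w2 i j" if "P i j" for i j
    using that by (cases "wt w1 w2 i j \<le> wt w1 w2 i0 j0") (auto simp: S_def)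
  moreover obtain i j where "(i, j) \<in> S" "r = wt w1 w2 i j"
    using \<open>r \<in> (\<lambda>(i, j). wt w1 w2 i j) ` S\<close> by auto
  ultimately show ?thesis unfolding S_def by blast
qed

text \<open>In each factor the monomial of least weight with the largest exponent \<open>j\<close>
  is taken. Weight and \<open>j\<close> determine \<open>i\<close> since \<open>w1 > 0\<close>, so
  the product of these two monomials arises only once and cannot cancel.\<close>

lemma has_wt_mult:
  assumes w: "w1 > 0" "w2 > 0" and F: "has_wt w1 w2 F r" and G: "has_wt w1 w2 G s"
  shows "has_wt w1 w2 (F * G) (r + s)"
proof -
  have ex: "\<exists>i j. coef2 H i j \<noteq> 0 \<and> wt w1 w2 i j = t \<and> (\<forall>i' j'. coef2 H i' j' \<noteq> 0 \<and> wt w1 w2 i' j' = t \<longrightarrow> j' \<le> j)"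
    if "has_wt w1 w2 H t" for H t
  proof -
    define J where "J = {j. \<exists>i. coef2 H i j \<noteq> 0 \<and> wt w1 w2 i j = t}"
    have "J \<subseteq> snd ` {(i, j). wt w1 w2 i j \<le> t}" by (force simp: J_def)
    then have fJ: "finite J" using finite_wt_le[OF w] finite_surj by blast
    have "J \<noteq> {}" using that by (auto simp: has_wt_def J_def)
    then have "Max J \<in> J" using fJ by simp
    then show ?thesis using Max_ge[OF fJ] unfolding J_def by blast
  qed
  obtain i1 j1 where 1: "coef2 F i1 j1 \<noteq> 0" "wt w1 w2 i1 j1 = r" "\<And>i j. coef2 F i j \<noteq> 0 \<Longrightarrow> wt w1 w2 i j = r \<Longrightarrow> j \<le> j1"
    using ex[OF F] by blast
  obtain i2 j2 where 2: "coef2 G i2 j2 \<noteq> 0" "wt w1 w2 i2 j2 = s" "\<And>i j. coef2 G i j \<noteq> 0 \<Longrightarrow> wt w1 w2 i j = s \<Longrightarrow> j \<le> j2"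
    using ex[OF G] by blast
  have Fge: "\<And>i j. coef2 F i j \<noteq> 0 \<Longrightarrow> r \<le> wt w1 w2 i j" and Gge: "\<And>i j. coef2 G i j \<noteq> 0 \<Longrightarrow> s \<le> wt w1 w2 i j"
    using F G by (auto simp: has_wt_def)
  have split: "wt w1 w2 p q + wt w1 w2 (i - p) (j - q) = wt w1 w2 i j" if "p \<le> i" "q \<le> j" for i j p q
    using that by (simp add: wt_add[symmetric])
  have "coef2 (F * G) (i1 + i2) (j1 + j2) = (\<Sum>q\<le>j1+j2. \<Sum>p\<le>i1+i2. if q = j1 then (if p = i1 then coef2 F i1 j1 * coef2 G i2 j2 else 0) else 0)"
    unfolding coef2_mult
  proof (intro sum.cong refl)
    fix q p assume "q \<in> {..j1 + j2}" "p \<in> {..i1 + i2}"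
    then have pq: "p \<le> i1 + i2" "q \<le> j1 + j2" by auto
    show "coef2 F p q * coef2 G (i1 + i2 - p) (j1 + j2 - q) = (if q = j1 then (if p = i1 then coef2 F i1 j1 * coef2 G i2 j2 else 0) else 0)"
    proof (cases "coef2 F p q = 0 \<or> coef2 G (i1 + i2 - p) (j1 + j2 - q) = 0")
      case True
      then show ?thesis using 1 2 by auto
    next
      case False
      then have a: "r \<le> wt w1 w2 p q" "s \<le> wt w1 w2 (i1 + i2 - p) (j1 + j2 - q)" using Fge Gge by auto
      have "wt w1 w2 p q + wt w1 w2 (i1 + i2 - p) (j1 + j2 - q) = r + s"
        using split[OF pq] 1 2 by (simp add: wt_add)
      with a have e: "wt w1 w2 p q = r" "wt w1 w2 (i1 + i2 - p) (j1 + j2 - q) = s" by linarith+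
      then have "q \<le> j1" "j1 + j2 - q \<le> j2" using False 1(3) 2(3) by auto
      then have q: "q = j1" by linarith
      have "wt w1 w2 p q = wt w1 w2 i1 j1" using e(1) 1(2) by simp
      then have "p = i1" using w by (simp add: wt_def q)
      then show ?thesis using q by simp
    qed
  qed
  also have "\<dots> = (\<Sum>q\<le>j1+j2. if q = j1 then \<Sum>p\<le>i1+i2. if p = i1 then coef2 F i1 j1 * coef2 G i2 j2 else 0 else 0)"
    by (intro sum.cong refl) auto
  also have "\<dots> = coef2 F i1 j1 * coef2 G i2 j2" by (simp add: sum.delta)
  finally have nz: "coef2 (F * G) (i1 + i2) (j1 + j2) \<noteq> 0" using 1 2 by simp
  have "r + s \<le> wt w1 w2 i j" if "coef2 (F * G) i j \<noteq> 0" for i j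
  proof (rule ccontr)
    assume lt: "\<not> r + s \<le> wt w1 w2 i j"
    have "coef2 F p q * coef2 G (i - p) (j - q) = 0" if "p \<le> i" "q \<le> j" for p q
      using split[OF that] lt Fge[of p q] Gge[of "i - p" "j - q"] by fastforce
    then have "coef2 (F * G) i j = 0" unfolding coef2_mult by (intro sum.neutral ballI) auto
    then show False using that by simp
  qed
  then show ?thesis using nz 1 2 unfolding has_wt_def by (blast intro: wt_add[THEN trans])
qed

lemma gt_wt_mult:
  assumes F: "gt_wt w1 w2 F r" and G: "has_wt w1 w2 G s"
  shows "gt_wt w1 w2 (F * G) (r + s)"
  unfolding gt_wt_def
proof (intro allI impI)
  fix i j assume nz: "coef2 (F * G) i j \<noteq> 0"
  show "r + s < wt w1 w2 i j"
  proof (rule ccontr)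
    assume lt: "\<not> r + s < wt w1 w2 i j"
    have "coef2 F p q * coef2 G (i - p) (j - q) = 0" if "p \<le> i" "q \<le> j" for p q
    proof -
      have "wt w1 w2 p q + wt w1 w2 (i - p) (j - q) = wt w1 w2 i j"
        using that by (simp add: wt_add[symmetric])
      then show ?thesis using lt F G unfolding gt_wt_def has_wt_def by fastforce
    qed
    then have "coef2 (F * G) i j = 0" unfolding coef2_mult by (intro sum.neutral ballI) auto
    then show False using nz by simp
  qed
qed

lemma gt_wt_add: "gt_wt w1 w2 F r \<Longrightarrow> gt_wt w1 w2 G r \<Longrightarrow> gt_wt w1 w2 (F + G) r"
  unfolding gt_wt_def by (metis add_0 coef2_simps(2))
lemma gt_wt_uminus: "gt_wt w1 w2 F r \<Longrightarrow> gt_wt w1 w2 (- F) r"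
  by (simp add: gt_wt_def)

lemma has_wt_unique: "has_wt w1 w2 F r \<Longrightarrow> has_wt w1 w2 F s \<Longrightarrow> r = s"
  unfolding has_wt_def by (metis order_antisym)

lemma has_wt_1: "has_wt w1 w2 1 0"
  unfolding has_wt_def by (auto simp: coef2_1 wt_def)

text \<open>The premise says that the order of \<open>\<omega>\<close> exceeds that of
  \<open>v\<close>, and that \<open>\<omega> = 0\<close> if \<open>v = 0\<close>. The weight of
  \<open>YY - px v\<close> is at most \<open>w1\<close> times the order of \<open>v\<close>, hence
  below every term of \<open>px \<omega>\<close>.\<close>

lemma has_wt_linear:
  assumes w: "w1 > 0" "w2 > 0"
  shows "\<exists>r. has_wt w1 w2 (YY - px v) r \<and>
    (\<forall>\<omega>. (\<forall>k. (\<forall>i<k. fps_nth v i = 0) \<longrightarrow> (\<forall>i\<le>k. fps_nth \<omega> i = 0)) \<longrightarrow> gt_wt w1 w2 (px \<omega>) r)"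
proof -
  have c: "coef2 (YY - px v) i j = (if i = 0 \<and> j = 1 then 1 else 0) - (if j = 0 then fps_nth v i else 0)" for i j
    by (simp add: coef2_YY coef2_px)
  have "coef2 (YY - px v) 0 1 \<noteq> 0" by (simp only: c) simp
  from has_wt_exists[OF w, of "\<lambda>i j. coef2 (YY - px v) i j \<noteq> 0", OF this]
  obtain r where r: "has_wt w1 w2 (YY - px v) r" unfolding has_wt_def by blast
  show ?thesis
  proof (intro exI[of _ r] conjI r allI impI)
    fix w' :: "complex fps" assume h: "\<forall>k. (\<forall>i<k. fps_nth v i = 0) \<longrightarrow> (\<forall>i\<le>k. fps_nth w' i = 0)"
    show "gt_wt w1 w2 (px w') r"
      unfolding gt_wt_def
    proof (intro allI impI)
      fix i j assume nz: "coef2 (px w') i j \<noteq> 0"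
      then have j: "j = 0" and wi: "fps_nth w' i \<noteq> 0" by (auto simp: coef2_px split: if_splits)
      then obtain k where k: "k < i" "fps_nth v k \<noteq> 0" using h by auto
      then have "coef2 (YY - px v) k 0 \<noteq> 0" by (simp only: c) simp
      then have "r \<le> wt w1 w2 k 0" using r by (auto simp: has_wt_def)
      also have "\<dots> < wt w1 w2 i j" using k w j by (simp add: wt_def)
      finally show "r < wt w1 w2 i j" .
    qed
  qed
qed

text \<open>Dividing the first weight by \<open>N\<close> compensates for the multiplication of the
  exponents of \<open>u\<close> by \<open>N\<close>.\<close>

lemma has_wt_compose_XX:
  assumes N: "N > 0"
  shows "coef2 (sub F (XX ^ N) YY) i j = (if N dvd i then coef2 F (i div N) j else 0)"
    and "has_wt (w1 / real N) w2 (sub F (XX ^ N) YY) r \<longleftrightarrow> has_wt w1 w2 F r"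
proof -
  show c: "coef2 (sub F (XX ^ N) YY) i j = (if N dvd i then coef2 F (i div N) j else 0)" for i j
    using N by (simp add: coef2_def sub_XX_power_nth fps_nth_compose_X_pow)
  have wN: "wt (w1 / real N) w2 (N * i) j = wt w1 w2 i j" for i j using N by (simp add: wt_def)
  show "has_wt (w1 / real N) w2 (sub F (XX ^ N) YY) r \<longleftrightarrow> has_wt w1 w2 F r" (is "?L \<longleftrightarrow> ?R")
  proof
    assume L: ?L
    have "r \<le> wt w1 w2 i j" if "coef2 F i j \<noteq> 0" for i j
    proof -
      have "coef2 (sub F (XX ^ N) YY) (N * i) j \<noteq> 0" using that N by (simp add: c)
      then show ?thesis using L wN unfolding has_wt_def by metis
    qed
    moreover have "\<exists>i j. coef2 F i j \<noteq> 0 \<and> wt w1 w2 i j = r"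
    proof -
      obtain i j where "coef2 (sub F (XX ^ N) YY) i j \<noteq> 0" "wt (w1 / real N) w2 i j = r" using L by (auto simp: has_wt_def)
      moreover from this obtain k where "i = N * k" by (auto simp: c split: if_splits)
      ultimately show ?thesis using wN N by (metis c dvd_triv_left nonzero_mult_div_cancel_left not_gr_zero)
    qed
    ultimately show ?R by (simp add: has_wt_def)
  next
    assume R: ?R
    have "r \<le> wt (w1 / real N) w2 i j" if "coef2 (sub F (XX ^ N) YY) i j \<noteq> 0" for i j
    proof -
      from that obtain k where k: "i = N * k" by (auto simp: c split: if_splits)
      then have "coef2 F k j \<noteq> 0" using that N by (simp add: c)
      then show ?thesis using R wN k by (auto simp: has_wt_def)
    qed
    moreover obtain i j where "coef2 F i j \<noteq> 0" "wt w1 w2 i j = r" using R by (auto simp: has_wt_def)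
    then have "coef2 (sub F (XX ^ N) YY) (N * i) j \<noteq> 0 \<and> wt (w1 / real N) w2 (N * i) j = r"
      using N wN by (simp add: c)
    ultimately show ?L unfolding has_wt_def by blast
  qed
qed

text \<open>The set where the values at \<open>K\<close> are those at a given parameter is closed, and open since the
  derivatives vanish wherever the values are not all zero.\<close>

lemma constant_path:
  fixes d :: "complex \<Rightarrow> 'k \<Rightarrow> complex"
  assumes K: "finite K" and der: "\<And>s k. k \<in> K \<Longrightarrow> ((\<lambda>s. d s k) has_field_derivative d' s k) (at s)"
    and z: "\<And>s k k'. k \<in> K \<Longrightarrow> d s k \<noteq> 0 \<Longrightarrow> k' \<in> K \<Longrightarrow> d' s k' = 0"
    and k: "k \<in> K"
  shows "d s k = d t k"
proof (cases "\<exists>s. \<exists>k\<in>K. d s k \<noteq> 0")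
  case False then show ?thesis using k by auto
next
  case True
  then obtain s0 k0 where k0: "k0 \<in> K" "d s0 k0 \<noteq> 0" by blast
  have cont: "continuous_on UNIV (\<lambda>s. d s k)" if "k \<in> K" for k
    using der[OF that] by (meson DERIV_continuous_on has_field_derivative_at_within)
  define C where "C = {s. \<forall>k\<in>K. d s k = d s0 k}"
  have "C = (\<Inter>k\<in>K. {s. d s k = d s0 k})" by (auto simp: C_def)
  moreover have "closed {s. d s k = d s0 k}" if "k \<in> K" for k
    using continuous_closed_preimage_constant[OF cont[OF that] closed_UNIV, of "d s0 k"] by simp
  ultimately have "closed C" by auto
  moreover have "open C"
    unfolding open_contains_ball
  proof
    fix s1 assume s1: "s1 \<in> C"
    have "open {s. d s k0 \<noteq> 0}"
      using open_Collect_neq[OF cont[OF k0(1)] continuous_on_const[of UNIV 0]] .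
    moreover have "s1 \<in> {s. d s k0 \<noteq> 0}" using s1 k0 by (simp add: C_def)
    ultimately obtain e where e: "e > 0" "ball s1 e \<subseteq> {s. d s k0 \<noteq> 0}"
      by (meson openE)
    have "d s k = d s1 k" if "s \<in> ball s1 e" "k \<in> K" for s k
    proof (rule has_field_derivative_zero_constant[of "ball s1 e" "\<lambda>s. d s k", THEN exE])
      show "((\<lambda>s. d s k) has_field_derivative 0) (at x within ball s1 e)" if "x \<in> ball s1 e" for x
      proof -
        have "d' x k = 0" using z[OF k0(1) _ \<open>k \<in> K\<close>, of x] e that by blast
        then show ?thesis using der[OF \<open>k \<in> K\<close>, of x] by (simp add: has_field_derivative_at_within)
      qed
      fix c assume "\<forall>x\<in>ball s1 e. d x k = c"
      then show "d s k = d s1 k" using that e by simp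
    qed auto
    then have "ball s1 e \<subseteq> C" using s1 by (auto simp: C_def)
    then show "\<exists>e>0. ball s1 e \<subseteq> C" using e by blast
  qed
  ultimately have "C = {} \<or> C = UNIV" by (meson clopen)
  moreover have "s0 \<in> C" by (simp add: C_def)
  ultimately have "C = UNIV" by blast
  then show ?thesis using k by (metis (mono_tags, lifting) C_def UNIV_I mem_Collect_eq)
qed

text \<open>The hypothesis \<open>z\<close> compares the derivative with the weight at the same
  \<open>s\<close>. The minimum \<open>r\<close> is therefore taken over all parameters at once: a
  parameter with a nonzero coefficient of weight at most \<open>r\<close> has weight exactly
  \<open>r\<close>, and there the derivatives of the finitely many coefficients up to weight
  \<open>r\<close> vanish, as \<open>constant_path\<close> requires.\<close>

lemma initial_form_constant:
  assumes w: "w1 > 0" "w2 > 0" and D: "fam2 D D'" and nz: "coef2 (D s0) i0 j0 \<noteq> 0"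
    and z: "\<And>s r i j. has_wt w1 w2 (D s) r \<Longrightarrow> wt w1 w2 i j \<le> r \<Longrightarrow> coef2 (D' s) i j = 0"
  shows "\<exists>r. (\<forall>i j. wt w1 w2 i j \<le> r \<longrightarrow> coef2 (D s) i j = coef2 (D t) i j) \<and> has_wt w1 w2 (D s) r"
proof -
  from has_wt_exists[OF w, of "\<lambda>i j. \<exists>s. coef2 (D s) i j \<noteq> 0"] nz
  obtain r i1 j1 s1 where r: "\<And>i j s. coef2 (D s) i j \<noteq> 0 \<Longrightarrow> r \<le> wt w1 w2 i j"
    and 1: "coef2 (D s1) i1 j1 \<noteq> 0" "wt w1 w2 i1 j1 = r" by metis
  define K where "K = {p. case p of (i, j) \<Rightarrow> wt w1 w2 i j \<le> r}"
  have K: "finite K" using finite_wt_le[OF w, of r] by (simp add: K_def)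
  have const: "coef2 (D s) (fst k) (snd k) = coef2 (D t) (fst k) (snd k)" if "k \<in> K" for k s t
  proof (rule constant_path[OF K _ _ that, where d = "\<lambda>s k. coef2 (D s) (fst k) (snd k)" and d' = "\<lambda>s k. coef2 (D' s) (fst k) (snd k)"])
    show "((\<lambda>s. coef2 (D s) (fst k) (snd k)) has_field_derivative coef2 (D' s) (fst k) (snd k)) (at s)" if "k \<in> K" for s k
      using D by (simp add: fam2_def)
    fix s k k' assume k: "k \<in> K" "coef2 (D s) (fst k) (snd k) \<noteq> 0" "k' \<in> K"
    then have "has_wt w1 w2 (D s) r" using r unfolding has_wt_def K_def by (fastforce intro: antisym)
    then show "coef2 (D' s) (fst k') (snd k') = 0" using z k by (auto simp: K_def)
  qed
  have c: "coef2 (D s) i j = coef2 (D t) i j" if "wt w1 w2 i j \<le> r" for i j s t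
    using const[of "(i, j)"] that by (simp add: K_def)
  have "coef2 (D s) i1 j1 \<noteq> 0" using c[of i1 j1 s s1] 1 by simp
  then have "has_wt w1 w2 (D s) r" using r 1 unfolding has_wt_def by blast
  then show ?thesis using c by blast
qed

subsection \<open>The discriminant as a trace, and its initial forms\<close>

definition discr :: "nat \<Rightarrow> complex fps fps \<Rightarrow> complex fps fps" where
  "discr p F = monic2 p (newton (\<lambda>i. trace_at (dx F) (F ^ i)))"

lemma arc_order:
  assumes R: "R \<in> in_ideal m" and a: "\<And>i. i < g \<Longrightarrow> fps_nth a i = 0" and b: "\<And>i. i < g \<Longrightarrow> fps_nth b i = 0" and k: "k < g * m"
  shows "fps_nth (arc_eval R a b) k = 0"
proof -
  have "a = fps_X ^ g * fps_shift g a" "b = fps_X ^ g * fps_shift g b"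
    using a b by (auto intro!: fps_ext simp: fps_X_power_mult_nth)
  then obtain a' b' where ab: "a = fps_X ^ g * a'" "b = fps_X ^ g * b'" by blast
  have "coef2 R i j * fps_nth (a ^ i * b ^ j) k = 0" for i j
  proof (cases "i + j < m")
    case True then show ?thesis using in_idealD[OF R] by simp
  next
    case False
    have "a ^ i * b ^ j = fps_X ^ (g * (i + j)) * (a' ^ i * b' ^ j)"
      by (simp add: ab power_mult_distrib power_add power_mult mult_ac)
    moreover have "k < g * (i + j)" using False k by (meson le_trans not_le mult_le_mono2)
    ultimately show ?thesis by (simp add: fps_X_power_mult_nth)
  qed
  then show ?thesis by (simp only: arc_eval_def fps_nth_Abs_fps sum.neutral_const)
qed

text \<open>If the order \<open>h\<close> of \<open>\<gamma>\<close> were at most \<open>N\<close>,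
  then \<open>d * \<gamma> ^ p\<close> would have order exactly \<open>h * p\<close>, while the rest
  of \<open>J\<close> has order at least \<open>h * (p + 1)\<close> on the arc; the two could not
  cancel.\<close>

lemma tangent_root_order:
  assumes J: "J - cc d * XX ^ p \<in> in_ideal (Suc p)" "d \<noteq> 0" and p: "p > 0"
    and g: "fps_nth \<gamma> 0 = 0" "arc_eval J \<gamma> (fps_X ^ N) = 0" and N: "N > 0" and i: "i \<le> N"
  shows "fps_nth \<gamma> i = 0"
proof (rule ccontr)
  assume nz: "fps_nth \<gamma> i \<noteq> 0"
  define h where "h = subdegree \<gamma>"
  have g0: "\<gamma> \<noteq> 0" using nz by auto
  have h: "h \<le> N" using nz i unfolding h_def by (meson subdegree_leI le_trans)
  have h1: "h > 0" using g g0 unfolding h_def by (metis gr0I nth_subdegree_nonzero)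
  have X0: "fps_nth (fps_X ^ N :: complex fps) 0 = 0" using N by simp
  have "fps_nth (arc_eval (J - cc d * XX ^ p) \<gamma> (fps_X ^ N)) (h * p) = 0"
  proof (rule arc_order[OF J(1)])
    show "fps_nth \<gamma> i = 0" if "i < h" for i using that unfolding h_def by (rule nth_less_subdegree_zero)
    show "fps_nth (fps_X ^ N :: complex fps) i = 0" if "i < h" for i using that h by (simp add: fps_X_power_nth)
    show "h * p < h * Suc p" using h1 by simp
  qed
  moreover have "arc_eval (J - cc d * XX ^ p) \<gamma> (fps_X ^ N) = - (fps_const d * \<gamma> ^ p)"
    using g X0 by (simp add: arc_diff arc_mult arc_power arc_XX)
  moreover have "fps_nth (\<gamma> ^ p) (h * p) = fps_nth \<gamma> h ^ p"
  proof -
    have "\<gamma> = fps_shift h \<gamma> * fps_X ^ h" unfolding h_def by (rule subdegree_decompose)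
    then have "\<gamma> ^ p = (fps_shift h \<gamma>) ^ p * fps_X ^ (h * p)" by (metis power_mult power_mult_distrib)
    then show ?thesis by (simp add: fps_X_power_mult_right_nth fps_nth_power_0)
  qed
  ultimately show False using J(2) nth_subdegree_nonzero[OF g0] by (simp add: h_def)
qed

text \<open>By the Leibniz rule each term of \<open>mdprod l\<close> arises, up to sign, from
  \<open>mprod l\<close> by replacing one factor \<open>YY - px v\<close> by \<open>px w\<close>, of
  larger weight; weights of products add up.\<close>

lemma mprod_mdprod_wt:
  assumes w: "w1 > 0" "w2 > 0"
    and l: "\<And>v w k. (v, w) \<in> set l \<Longrightarrow> (\<forall>i<k. fps_nth v i = 0) \<Longrightarrow> (\<forall>i\<le>k. fps_nth w i = 0)"
  shows "\<exists>r. has_wt w1 w2 (mprod l) r \<and> gt_wt w1 w2 (mdprod l) r"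
  using l
proof (induction l)
  case Nil
  then show ?case using has_wt_1 by (intro exI[of _ 0]) (auto simp: mprod_def gt_wt_def)
next
  case (Cons p l)
  obtain v w where p: "p = (v, w)" by fastforce
  have "\<exists>r. has_wt w1 w2 (mprod l) r \<and> gt_wt w1 w2 (mdprod l) r"
  proof (rule Cons.IH)
    fix v w k assume "(v, w) \<in> set l" "\<forall>i<k. fps_nth v i = 0"
    then show "\<forall>i\<le>k. fps_nth w i = 0" using Cons.prems[of v w k] by simp
  qed
  then obtain r where r: "has_wt w1 w2 (mprod l) r" "gt_wt w1 w2 (mdprod l) r" by blast
  obtain q where q: "has_wt w1 w2 (YY - px v) q" and q': "gt_wt w1 w2 (px w) q"
    using has_wt_linear[OF w, of v] Cons.prems[of v w] p by (metis list.set_intros(1))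
  have "has_wt w1 w2 ((YY - px v) * mprod l) (q + r)" by (rule has_wt_mult[OF w q r(1)])
  moreover have "gt_wt w1 w2 (- (px w * mprod l) + (YY - px v) * mdprod l) (q + r)"
  proof (intro gt_wt_add gt_wt_uminus)
    show "gt_wt w1 w2 (px w * mprod l) (q + r)" by (rule gt_wt_mult[OF q' r(1)])
    show "gt_wt w1 w2 ((YY - px v) * mdprod l) (q + r)"
      using gt_wt_mult[OF r(2) q] by (simp add: mult.commute add.commute)
  qed
  ultimately show ?case by (auto simp: p mprod_def px_def)
qed

lemma z_order_unique: "z_order J p \<Longrightarrow> z_order J q \<Longrightarrow> p = q"
  unfolding z_order_def by (metis linorder_neqE_nat)

lemma z_order_length:
  assumes J: "z_order J p" and E: "coef2 E 0 0 \<noteq> 0" and g: "\<forall>\<gamma>\<in>set \<gamma>s. fps_nth \<gamma> 0 = 0" and N: "N > 0"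
    and eq: "sub J XX (YY ^ N) = E * (\<Prod>\<gamma>\<leftarrow>\<gamma>s. XX - py \<gamma>)"
  shows "length \<gamma>s = p"
proof -
  have YN: "YY ^ N \<in> max_ideal" using N by auto
  have "sub (XX - py \<gamma>) XX 0 = XX" if "\<gamma> \<in> set \<gamma>s" for \<gamma>
    using g that by (simp add: sub_diff sub_XX sub_py_0)
  then have "(\<Prod>\<gamma>\<leftarrow>\<gamma>s. sub (XX - py \<gamma>) XX 0) = XX ^ length \<gamma>s" by (induction \<gamma>s) auto
  then have "sub (sub J XX (YY ^ N)) XX 0 = sub E XX 0 * XX ^ length \<gamma>s"
    unfolding eq by (simp add: sub_mult sub_prod_list comp_def)
  moreover have "sub (sub J XX (YY ^ N)) XX 0 = sub J XX 0"
    using YN N by (subst sub_sub) (auto simp: sub_XX sub_YY sub_power power_0_left)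
  ultimately have "coef2 (sub J XX 0) i 0 = coef2 (sub E XX 0 * XX ^ length \<gamma>s) i 0" for i by simp
  then have c: "coef2 J i 0 = (if i < length \<gamma>s then 0 else coef2 E (i - length \<gamma>s) 0)" for i
    by (simp add: sub_y0 coef2_def XX_power fps_X_power_mult_right_nth flip: sub_y0) (simp add: sub_y0 flip: coef2_def)
  have "z_order J (length \<gamma>s)" using E by (simp add: z_order_def c)
  then show ?thesis using J by (rule z_order_unique)
qed

text \<open>The power sums of the values of \<open>F\<close> at the roots are traces, and Newton's
  identities recover the product from them.\<close>

lemma discr_roots:
  assumes "z_order (dx F) p" "coef2 E 0 0 \<noteq> 0" "\<forall>\<gamma>\<in>set \<gamma>s. fps_nth \<gamma> 0 = 0" "N > 0"
    and "sub (dx F) XX (YY ^ N) = E * (\<Prod>\<gamma>\<leftarrow>\<gamma>s. XX - py \<gamma>)"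
  shows "sub (discr p F) (XX ^ N) YY = (\<Prod>\<gamma>\<leftarrow>\<gamma>s. YY - px (arc_eval F \<gamma> (fps_X ^ N)))"
proof -
  define l where "l = map (\<lambda>\<gamma>. (arc_eval F \<gamma> (fps_X ^ N), 0 :: complex fps)) \<gamma>s"
  have "sub (discr p F) (XX ^ N) YY = mprod l"
    unfolding discr_def
  proof (rule monic2_newton)
    show "length l = p" using z_order_length[OF assms(1-4,5)] by (simp add: l_def)
    fix i :: nat
    have "arc_eval (F ^ i) \<gamma> (fps_X ^ N) = arc_eval F \<gamma> (fps_X ^ N) ^ i" if "\<gamma> \<in> set \<gamma>s" for \<gamma>
      using that assms(3,4) by (subst arc_power) auto
    then show "fps_compose (trace_at (dx F) (F ^ i)) (fps_X ^ N) = (\<Sum>(v, w)\<leftarrow>l. v ^ i)"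
      using trace_at_roots[OF assms(4,1,2,3,5), of "F ^ i"] by (simp add: l_def comp_def cong: map_cong)
  qed (use assms in auto)
  then show ?thesis by (simp add: mprod_def l_def px_def comp_def)
qed

text \<open>Here \<open>XX\<close> is the coordinate \<open>z\<close> along which one differentiates and \<open>YY\<close> is the target variable \<open>u\<close>, while the
  arguments of \<open>f\<close> are \<open>(x, z)\<close>; the curves \<open>x = X1\<close>, \<open>x = X2\<close> are the level curves of the two morphisms.\<close>

locale tangent_family =
  fixes f X1 X2 :: "complex fps fps" and n :: nat and c :: complex
  assumes f: "f - cc c * YY ^ n \<in> in_ideal (Suc n)" and c: "c \<noteq> 0" and n: "n > 0"
    and X: "X1 \<in> max_ideal" "X2 \<in> max_ideal" "coef2 X1 0 1 = 1" "coef2 X2 0 1 = 1"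
begin

text \<open>Both series have \<open>u\<close>-coefficient 1. Hence \<open>Xs s\<close> has it too
  for every complex \<open>s\<close>, and \<open>\<Delta>\<close> has no linear term in
  \<open>u\<close>.\<close>

definition "\<Delta> = X2 - X1"
definition "Xs s = X1 + cc s * \<Delta>"
definition "Fs s = sub f (Xs s) XX"
definition "Fd s = sub (dx f) (Xs s) XX * \<Delta>"

lemma Delta_max: "\<Delta> \<in> max_ideal" using X by (auto simp: \<Delta>_def)
lemma Xs_max: "Xs s \<in> max_ideal" using X Delta_max by (auto simp: Xs_def)

lemma fam_Fs: "fam2 Fs Fd"
proof -
  have "fam2 Xs (\<lambda>s. \<Delta>)"
    unfolding fam2_def Xs_def by (auto intro!: derivative_eq_intros)
  from fam2_sub[OF this Xs_max Delta_max XX_ideal, of f] show ?thesis by (simp add: Fs_def[abs_def] Fd_def[abs_def])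
qed

lemma dxFs: "dx (Fs s) - cc (of_nat n * c) * XX ^ (n - 1) \<in> in_ideal n"
proof -
  have "Fs s - cc c * XX ^ n = sub (f - cc c * YY ^ n) (Xs s) XX"
    using Xs_max by (simp add: sub_diff sub_cc_mult sub_power sub_YY Fs_def)
  also have "\<dots> \<in> in_ideal (Suc n)" by (intro sub_ideal f Xs_max) simp
  finally have "dx (Fs s - cc c * XX ^ n) \<in> in_ideal n" by (rule dx.cont)
  also have "dx (Fs s - cc c * XX ^ n) = dx (Fs s) - cc (of_nat n * c) * XX ^ (n - 1)"
  proof -
    have "dx (Fs s) = dx (Fs s - cc c * XX ^ n) + dx (cc c * XX ^ n)"
      by (simp flip: dx.add)
    moreover have "cc (of_nat n) = (of_nat n :: complex fps fps)" by (simp add: cc_def fps_of_nat)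
    ultimately show ?thesis by (simp add: dx_cc_mult dx.power mult_ac)
  qed
  finally show ?thesis .
qed

text \<open>The number of polar roots is the same for every \<open>s\<close>, so the deformation may
  run over the whole complex plane.\<close>

lemma z_order_Fs: "z_order (dx (Fs s)) (n - 1)"
proof -
  have co: "coef2 (dx (Fs s)) i 0 = (if i = n - 1 then of_nat n * c else 0)" if "i < n" for i
  proof -
    have "coef2 (cc (of_nat n * c) * XX ^ (n - 1)) i 0 = (if i = n - 1 then of_nat n * c else 0)"
      unfolding coef2_simps using coef2_mono[of "n - 1" 0 i 0] by simp
    then show ?thesis using in_idealD[OF dxFs[of s], of i 0] that by (simp del: cc_hom)
  qed
  show ?thesis using c n by (auto simp: z_order_def co)
qed

definition "Ds s = discr (n - 1) (Fs s)"
definition "Dd s = monic2 (n - 1) (newton_deriv (\<lambda>i. trace_at (dx (Fs s)) (Fs s ^ i))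
   (\<lambda>i. trace_at (dx (Fs s)) (of_nat i * Fs s ^ (i - 1) * Fd s)))"

lemma fam_Ds: "fam2 Ds Dd"
proof -
  have "fam1 (\<lambda>s. newton (\<lambda>i. trace_at (dx (Fs s)) (Fs s ^ i)) k)
     (\<lambda>s. newton_deriv (\<lambda>i. trace_at (dx (Fs s)) (Fs s ^ i)) (\<lambda>i. trace_at (dx (Fs s)) (of_nat i * Fs s ^ (i - 1) * Fd s)) k)" for k
    by (rule fam1_newton) (use trace_power_deriv[OF fam_Fs z_order_Fs] in \<open>simp add: fam1_def\<close>)
  then show ?thesis
    by (simp add: fam2_def fam1_def Ds_def Dd_def discr_def monic2_def coef2_def)
qed

text \<open>Along the polar branch \<open>z = \<gamma>(t)\<close>, \<open>u = t\<^sup>N\<close>, the total derivative of \<open>F\<close> is \<open>F\<^sub>u N t\<^bsup>N-1\<^esup>\<close>, and the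
  parameter derivative of \<open>F\<close> is \<open>F\<^sub>u \<Delta>\<close> up to a unit. As \<open>\<Delta>\<close> has order more than \<open>N\<close> on the branch, this
  parameter derivative has larger order than \<open>F\<close> itself.\<close>

lemma root_estimate:
  assumes g: "fps_nth \<gamma> 0 = 0" "arc_eval (dx (Fs s)) \<gamma> (fps_X ^ N) = 0" and N: "N > 0" and n1: "n > 1"
    and v: "\<forall>i<k. fps_nth (arc_eval (Fs s) \<gamma> (fps_X ^ N)) i = 0" and i: "i \<le> k"
  shows "fps_nth (arc_eval (Fd s) \<gamma> (fps_X ^ N)) i = 0"
proof -
  define b :: "complex fps" where "b = fps_X ^ N"
  have b0: "fps_nth b 0 = 0" using N by (simp add: b_def)
  have g_ord: "fps_nth \<gamma> j = 0" if "j \<le> N" for j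
  proof (rule tangent_root_order[OF _ _ _ g N that])
    show "dx (Fs s) - cc (of_nat n * c) * XX ^ (n - 1) \<in> in_ideal (Suc (n - 1))"
      using dxFs[of s] n by simp
  qed (use n1 c in auto)
  define \<xi> where "\<xi> = arc_eval (dy (Xs s)) \<gamma> b"
  define \<delta> where "\<delta> = arc_eval \<Delta> \<gamma> b"
  define \<eta> where "\<eta> = arc_eval (dy (Fs s)) \<gamma> b"
  define \<omega> where "\<omega> = arc_eval (Fd s) \<gamma> b"
  have "dy (Fs s) = sub (dx f) (Xs s) XX * dy (Xs s)"
    unfolding Fs_def by (subst dy.chain) (auto simp: Xs_max)
  then have "Fd s * dy (Xs s) = \<Delta> * dy (Fs s)" by (simp add: Fd_def mult_ac)
  \<comment> \<open>As \<open>\<xi>\<close> is a unit on the branch, this makes the order of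
    \<open>\<omega>\<close> the sum of the orders of \<open>\<delta>\<close> and
    \<open>\<eta>\<close>.\<close>
  then have rel: "\<omega> * \<xi> = \<delta> * \<eta>"
    unfolding \<omega>_def \<xi>_def \<delta>_def \<eta>_def using g b0 by (simp flip: arc_mult)
  have \<xi>0: "fps_nth \<xi> 0 \<noteq> 0"
  proof -
    have "fps_nth \<xi> 0 = coef2 (dy (Xs s)) 0 0" by (simp add: \<xi>_def)
    also have "\<dots> = coef2 (Xs s) 0 1" unfolding coef2_dy by simp
    also have "\<dots> = 1" using X by (simp add: Xs_def \<Delta>_def)
    finally show ?thesis by simp
  qed
  \<comment> \<open>A monomial of \<open>\<Delta>\<close> contains \<open>z\<close>, of order above
    \<open>N\<close> on the branch, or at least \<open>u ^ 2\<close>, of order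
    \<open>2 * N\<close>.\<close>
  have \<delta>0: "fps_nth \<delta> j = 0" if "j \<le> N" for j
  proof -
    have "coef2 \<Delta> p q * fps_nth (\<gamma> ^ p * b ^ q) j = 0" for p q
    proof (cases "p = 0")
      case True
      show ?thesis
      proof (cases "q \<le> 1")
        case q: True
        then have "coef2 \<Delta> p q = 0" using X True by (auto simp: \<Delta>_def max_ideal_iff le_Suc_eq)
        then show ?thesis by simp
      next
        case False
        then have "N * 2 \<le> N * q" by (intro mult_le_mono2) simp
        then have "j \<noteq> N * q" using that N by linarith
        then show ?thesis using True by (simp add: b_def fps_X_power_nth flip: power_mult)
      qed
    next
      case False
      have gg: "\<gamma> = fps_X ^ Suc N * fps_shift (Suc N) \<gamma>"
        using g_ord by (intro fps_ext) (auto simp del: power_Suc simp: fps_X_power_mult_nth)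
      have "\<gamma> ^ p * b ^ q = \<gamma> * (\<gamma> ^ (p - 1) * b ^ q)"
        using False by (cases p) (simp_all add: mult_ac)
      also have "\<dots> = fps_X ^ Suc N * (fps_shift (Suc N) \<gamma> * (\<gamma> ^ (p - 1) * b ^ q))"
        by (subst gg) (simp only: mult.assoc)
      also have "fps_nth \<dots> j = 0" unfolding fps_X_power_mult_nth using that by simp
      finally show ?thesis by simp
    qed
    then show ?thesis by (simp only: \<delta>_def arc_eval_def fps_nth_Abs_fps sum.neutral_const)
  qed
  \<comment> \<open>The \<open>z\<close>-derivative of \<open>Fs s\<close> vanishes on the polar
    branch, so only the \<open>u\<close>-derivative is left.\<close>
  have "fps_deriv (arc_eval (Fs s) \<gamma> b) = \<eta> * fps_deriv b"
    using g b0 by (simp add: arc_deriv \<eta>_def b_def)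
  moreover have "fps_deriv b = of_nat N * fps_X ^ (N - 1)"
    by (simp add: b_def fps_deriv_power fps_of_nat)
  ultimately have dv: "fps_deriv (arc_eval (Fs s) \<gamma> b) = of_nat N * (fps_X ^ (N - 1) * \<eta>)"
    by (simp add: mult_ac)
  have \<eta>0: "fps_nth \<eta> m = 0" if "m + N < k" for m
  proof -
    have "fps_nth (fps_deriv (arc_eval (Fs s) \<gamma> b)) (m + (N - 1)) = of_nat (m + N) * fps_nth (arc_eval (Fs s) \<gamma> b) (m + N)"
      using N by (cases N) (simp_all)
    also have "\<dots> = 0" using v that by (simp add: b_def)
    finally have "of_nat N * fps_nth \<eta> m = 0"
      unfolding dv by (simp add: fps_X_power_mult_nth fps_of_nat[symmetric])
    then show ?thesis using N by simp
  qed
  \<comment> \<open>The order of \<open>\<delta>\<close> is at least \<open>N + 1\<close>, that of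
    \<open>\<eta>\<close> at least \<open>k - N\<close>; they add up to \<open>k + 1\<close>, which
    gains the coefficient \<open>k\<close> itself.\<close>
  have prod0: "fps_nth (\<omega> * \<xi>) j = 0" if "j \<le> k" for j
    unfolding rel fps_mult_nth
  proof (intro sum.neutral ballI)
    fix a assume "a \<in> {0..j}"
    then show "fps_nth \<delta> a * fps_nth \<eta> (j - a) = 0"
      using \<delta>0[of a] \<eta>0[of "j - a"] that by (cases "a \<le> N") auto
  qed
  have "\<omega> = \<omega> * \<xi> * inverse \<xi>" using inverse_mult_eq_1'[OF \<xi>0] by (simp add: mult.assoc)
  then have "fps_nth \<omega> i = (\<Sum>j=0..i. fps_nth (\<omega> * \<xi>) j * fps_nth (inverse \<xi>) (i - j))"
    by (metis fps_mult_nth)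
  also have "\<dots> = 0" using prod0 i by (intro sum.neutral) auto
  finally show ?thesis by (simp add: \<omega>_def b_def)
qed

text \<open>For a single \<open>s\<close> the roots may be used: after \<open>u = t ^ N\<close> the
  series \<open>Ds s\<close> and \<open>Dd s\<close> become \<open>mprod l\<close> and
  \<open>mdprod l\<close> for the pairs of values of \<open>Fs s\<close> and \<open>Fd s\<close> at
  the polar roots, which \<open>root_estimate\<close> compares.\<close>

lemma Dd_high_weight:
  assumes w: "w1 > 0" "w2 > 0" and D: "has_wt w1 w2 (Ds s) r" and ij: "wt w1 w2 i j \<le> r"
  shows "coef2 (Dd s) i j = 0"
proof -
  obtain N \<gamma>s E where N: "N \<ge> 1" "length \<gamma>s = n - 1" and g: "\<forall>\<gamma>\<in>set \<gamma>s. fps_nth \<gamma> 0 = 0" and E: "coef2 E 0 0 \<noteq> 0"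
    and eq: "sub (dx (Fs s)) XX (YY ^ N) = E * (\<Prod>\<gamma>\<leftarrow>\<gamma>s. XX - py \<gamma>)"
    using puiseux_factorization[OF z_order_Fs] by blast
  have N0: "N > 0" using N by simp
  define l where "l = map (\<lambda>\<gamma>. (arc_eval (Fs s) \<gamma> (fps_X ^ N), arc_eval (Fd s) \<gamma> (fps_X ^ N))) \<gamma>s"
  have am: "arc_eval (A * B) \<gamma> (fps_X ^ N) = arc_eval A \<gamma> (fps_X ^ N) * arc_eval B \<gamma> (fps_X ^ N)"
    and ap: "arc_eval (A ^ i) \<gamma> (fps_X ^ N) = arc_eval A \<gamma> (fps_X ^ N) ^ i" if "\<gamma> \<in> set \<gamma>s" for A B \<gamma> i
    using that g N by (auto simp: arc_mult arc_power)
  have an: "arc_eval (of_nat i) \<gamma> (fps_X ^ N) = of_nat i" for i \<gamma>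
    by (induction i) (auto simp: arc_add)
  note tr = trace_at_roots[OF N0 z_order_Fs E g eq]
  have T1: "fps_compose (trace_at (dx (Fs s)) (Fs s ^ i)) (fps_X ^ N) = (\<Sum>(v, w)\<leftarrow>l. v ^ i)" for i
    by (simp add: tr l_def comp_def ap cong: map_cong)
  have T2: "fps_compose (trace_at (dx (Fs s)) (of_nat i * Fs s ^ (i - 1) * Fd s)) (fps_X ^ N) = (\<Sum>(v, w)\<leftarrow>l. of_nat i * v ^ (i - 1) * w)" for i
    by (simp add: tr l_def comp_def am ap an cong: map_cong)
  have lp: "length l = n - 1" using N by (simp add: l_def)
  have D1: "sub (Ds s) (XX ^ N) YY = mprod l"
    unfolding Ds_def discr_def by (rule monic2_newton[OF N0 lp T1])
  have D2: "sub (Dd s) (XX ^ N) YY = mdprod l"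
    unfolding Dd_def by (rule monic2_newton_deriv[OF N0 lp T1 T2])
  have root: "arc_eval (dx (Fs s)) \<gamma> (fps_X ^ N) = 0" if "\<gamma> \<in> set \<gamma>s" for \<gamma>
  proof -
    have YN: "YY ^ N \<in> max_ideal" using N by auto
    have "arc_eval (sub (dx (Fs s)) XX (YY ^ N)) \<gamma> fps_X = 0"
      unfolding eq using that g
      by (subst arc_mult, simp, simp, subst arc_prod_list, simp, simp)
        (force simp: comp_def arc_diff arc_XX arc_py prod_list_zero_iff)
    then show ?thesis using that g YN by (subst (asm) arc_sub) (auto simp: arc_XX arc_YY arc_power)
  qed
  have "\<exists>r. has_wt (w1 / real N) w2 (mprod l) r \<and> gt_wt (w1 / real N) w2 (mdprod l) r"
  proof (rule mprod_mdprod_wt)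
    fix v w k assume vw: "(v, w) \<in> set l" and v: "\<forall>i<k. fps_nth v i = 0"
    then obtain \<gamma> where \<gamma>: "\<gamma> \<in> set \<gamma>s" "v = arc_eval (Fs s) \<gamma> (fps_X ^ N)" "w = arc_eval (Fd s) \<gamma> (fps_X ^ N)"
      by (auto simp: l_def)
    have "n - 1 > 0" using \<gamma>(1) N(2) by (metis length_pos_if_in_set)
    then show "\<forall>i\<le>k. fps_nth w i = 0"
      using root_estimate[of \<gamma> s N k] root[OF \<gamma>(1)] \<gamma> g N v by auto
  qed (use w N in auto)
  then obtain q where q: "has_wt (w1 / real N) w2 (mprod l) q" "gt_wt (w1 / real N) w2 (mdprod l) q" by blast
  have "has_wt (w1 / real N) w2 (mprod l) r"
    using has_wt_compose_XX(2)[OF N0] D unfolding D1[symmetric] by blast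
  then have "q = r" using q has_wt_unique by blast
  have "wt (w1 / real N) w2 (N * i) j = wt w1 w2 i j" using N by (simp add: wt_def)
  then have "coef2 (mdprod l) (N * i) j = 0"
    using q(2) ij \<open>q = r\<close> by (force simp: gt_wt_def)
  then show ?thesis unfolding D2[symmetric] has_wt_compose_XX(1)[OF N0] using N by simp
qed

theorem initial_forms_agree:
  assumes w: "w1 > 0" "w2 > 0"
  shows "\<exists>r. (\<forall>i j. wt w1 w2 i j \<le> r \<longrightarrow> coef2 (Ds 0) i j = coef2 (Ds 1) i j) \<and> has_wt w1 w2 (Ds 0) r"
proof (rule initial_form_constant[OF w fam_Ds])
  show "coef2 (Ds 0) 0 (n - 1) \<noteq> 0"
    by (simp add: Ds_def discr_def monic2_def coef2_def newton.simps)
qed (rule Dd_high_weight[OF w])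

lemma Fs_0: "Fs 0 = sub f X1 XX" and Fs_1: "Fs 1 = sub f X2 XX"
  by (simp_all add: Fs_def Xs_def \<Delta>_def)

end

subsection \<open>Reparametrization of arcs\<close>

abbreviation conv :: "complex fps \<Rightarrow> bool" where "conv f \<equiv> fps_conv_radius f > 0"

lemma compose_pow: "fps_nth s 0 = 0 \<Longrightarrow> fps_compose (a ^ n) s = fps_compose a s ^ n" for a s :: "complex fps"
  by (simp add: fps_compose_power)
lemma compose_X_pow: "fps_nth s 0 = 0 \<Longrightarrow> fps_compose (fps_X ^ n) s = s ^ n" for s :: "complex fps"
  by (simp add: compose_pow)

lemma conv_iff: "conv f \<longleftrightarrow> eval_fps f has_fps_expansion f"
  by (auto simp: has_fps_expansion_def)

lemma conv_imp: "f has_fps_expansion F \<Longrightarrow> conv F"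
  by (auto simp: has_fps_expansion_def)

lemma conv_compose: "conv f \<Longrightarrow> conv g \<Longrightarrow> fps_nth g 0 = 0 \<Longrightarrow> conv (fps_compose f g)"
  unfolding conv_iff by (blast intro: conv_imp[unfolded conv_iff] has_fps_expansion_compose)

lemma conv_mult: "conv f \<Longrightarrow> conv g \<Longrightarrow> conv (f * g)"
  by (metis fps_conv_radius_mult min_less_iff_conj order_less_le_trans)
lemma conv_power: "conv f \<Longrightarrow> conv (f ^ n)"
  by (induction n) (auto intro: conv_mult)

text \<open>Puts convergence in one variable into the same geometric form as the bounds for
  \<open>convergent2\<close>.\<close>

lemma conv_bound: "conv f \<longleftrightarrow> (\<exists>C\<ge>0. \<exists>R\<ge>1. \<forall>n. norm (fps_nth f n) \<le> C * R ^ n)"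
proof
  assume "conv f"
  then obtain r where r: "0 < ereal r" "ereal r < fps_conv_radius f" using ereal_dense2 by blast
  then have "summable (\<lambda>n. norm (fps_nth f n * complex_of_real r ^ n))"
    by (intro abs_summable_in_conv_radius) (auto simp: fps_conv_radius_def)
  then have "Bseq (\<lambda>n. norm (fps_nth f n * complex_of_real r ^ n))"
    by (intro convergent_imp_Bseq summable_LIMSEQ_zero[THEN convergentI])
  then obtain C where C: "C > 0" "\<And>n. norm (fps_nth f n) * r ^ n \<le> C"
    using r by (auto simp: Bseq_def norm_mult norm_power)
  have r0: "r > 0" using r by simp
  define R where "R = max 1 (1 / r)"
  have "norm (fps_nth f n) \<le> C * R ^ n" for n
  proof -
    have "norm (fps_nth f n) \<le> C * (1 / r) ^ n" using C(2)[of n] r0 by (simp add: power_divide field_simps)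
    also have "\<dots> \<le> C * R ^ n" using C r0 by (intro mult_left_mono power_mono) (auto simp: R_def)
    finally show ?thesis .
  qed
  then show "\<exists>C\<ge>0. \<exists>R\<ge>1. \<forall>n. norm (fps_nth f n) \<le> C * R ^ n"
    using C by (intro exI[of _ C] conjI exI[of _ R]) (auto simp: R_def)
next
  assume "\<exists>C\<ge>0. \<exists>R\<ge>1. \<forall>n. norm (fps_nth f n) \<le> C * R ^ n"
  then obtain C R where C: "C \<ge> 0" "R \<ge> 1" "\<And>n. norm (fps_nth f n) \<le> C * R ^ n" by blast
  define z where "z = complex_of_real (1 / (2 * R))"
  have nz: "norm z = 1 / (2 * R)" using C by (simp add: z_def norm_divide)
  have "summable (\<lambda>n. fps_nth f n * z ^ n)"
  proof (rule summable_comparison_test)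
    show "\<exists>N. \<forall>n\<ge>N. norm (fps_nth f n * z ^ n) \<le> C * (1 / 2) ^ n"
    proof (intro exI allI impI)
      fix n
      have "norm (fps_nth f n * z ^ n) \<le> (C * R ^ n) * (1 / (2 * R)) ^ n"
        unfolding norm_mult norm_power nz using C by (intro mult_right_mono) auto
      also have "\<dots> = C * (1 / 2) ^ n" using C by (simp add: power_mult_distrib power_divide)
      finally show "norm (fps_nth f n * z ^ n) \<le> C * (1 / 2) ^ n" .
    qed
    show "summable (\<lambda>n. C * (1 / 2) ^ n)" by (intro summable_mult summable_geometric) simp
  qed
  then have "conv_radius (fps_nth f) \<ge> norm z" by (rule conv_radius_geI)
  moreover have "norm z > 0" using C nz by simp
  ultimately show "conv f" unfolding fps_conv_radius_def by (metis ereal_less(2) order_less_le_trans)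
qed

lemma complex_root_exists:
  assumes "n > 0" shows "\<exists>d :: complex. d ^ n = c"
proof (cases "c = 0")
  case False
  have "exp (ln c / of_nat n) ^ n = exp (of_nat n * (ln c / of_nat n))" by (simp only: exp_of_nat_mult)
  also have "\<dots> = c" using False assms by simp
  finally show ?thesis by blast
qed (use assms in \<open>auto intro!: exI[of _ 0] simp: power_0_left\<close>)

text \<open>A convergent \<open>u\<close> has the analytic root
  \<open>exp (ln (u / c) / n) * d\<close>, where dividing by \<open>c = u(0)\<close> moves the value
  at the origin to 1, away from the cut of the logarithm. Without convergence the formal radical is
  taken.\<close>

lemma fps_root_exists:
  assumes u: "fps_nth u 0 \<noteq> 0" and n: "n > 0"
  shows "\<exists>r. r ^ n = u \<and> (conv u \<longrightarrow> conv r)"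
proof (cases "conv u")
  case True
  define c where "c = fps_nth u 0"
  obtain d where d: "d ^ n = c" using complex_root_exists[OF n] by blast
  define g where "g z = exp (ln (eval_fps u z / c) / of_nat n) * d" for z
  have uexp: "eval_fps u has_fps_expansion u" using True by (simp add: conv_iff)
  then have ua: "eval_fps u analytic_on {0}" by (rule has_fps_expansion_imp_analytic_0)
  have u0: "eval_fps u 0 = c" by (simp add: c_def eval_fps_at_0)
  have "g analytic_on {0}" unfolding g_def
    using u ua u0 n True by (intro analytic_intros) (auto simp: c_def simp flip: zero_ereal_def)
  then have gexp: "g has_fps_expansion fps_expansion g 0" by (rule analytic_at_imp_has_fps_expansion_0)
  have "continuous (at 0) (eval_fps u)" using uexp by (rule has_fps_expansion_imp_continuous)
  then have "(eval_fps u \<longlongrightarrow> c) (nhds 0)" using u0 by (metis continuous_within tendsto_nhds_iff)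
  then have ev: "eventually (\<lambda>z. eval_fps u z \<noteq> 0) (nhds 0)"
    using u by (intro tendsto_imp_eventually_ne) (auto simp: c_def)
  have "eventually (\<lambda>z. g z ^ n = eval_fps u z) (nhds 0)"
    using ev
  proof eventually_elim
    case (elim z)
    have "g z ^ n = exp (ln (eval_fps u z / c) / of_nat n) ^ n * d ^ n"
      by (simp only: g_def power_mult_distrib)
    also have "exp (ln (eval_fps u z / c) / of_nat n) ^ n = exp (of_nat n * (ln (eval_fps u z / c) / of_nat n))"
      by (rule exp_of_nat_mult[symmetric])
    also have "exp (of_nat n * (ln (eval_fps u z / c) / of_nat n)) * d ^ n = eval_fps u z" using elim u n d by (simp add: c_def)
    finally show ?case .
  qed
  moreover have "(\<lambda>z. g z ^ n) has_fps_expansion fps_expansion g 0 ^ n"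
    by (intro fps_expansion_intros gexp)
  ultimately have "eval_fps u has_fps_expansion fps_expansion g 0 ^ n"
    by (rule has_fps_expansion_cong[THEN iffD1, OF _ refl])
  then have "fps_expansion g 0 ^ n = u" by (rule fps_expansion_unique_complex) (rule uexp)
  then show ?thesis using conv_imp[OF gexp] by blast
next
  case False
  obtain d where d: "d ^ n = fps_nth u 0" using complex_root_exists[OF n] by blast
  obtain k where k: "n = Suc k" using n by (cases n) auto
  have "(\<lambda>_ _. d) (Suc k) (fps_nth u 0) ^ Suc k = fps_nth u 0" using d k by simp
  then have "fps_radical (\<lambda>_ _. d) (Suc k) u ^ Suc k = u" using power_radical[OF u, of "\<lambda>_ _. d" k] by blast
  then show ?thesis using k False by blast
qed

text \<open>The holomorphic local inverse has a convergent expansion, and composition with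
  \<open>r\<close> identifies it with the formal inverse.\<close>

lemma conv_inv:
  assumes r: "conv r" "fps_nth r 0 = 0" "fps_nth r 1 \<noteq> 0"
  shows "conv (fps_inv r)"
proof -
  have inv0: "fps_nth (fps_inv r) 0 = 0" by (simp add: fps_inv_def)
  define f where "f = eval_fps r"
  have fexp: "f has_fps_expansion r" using r by (simp add: f_def conv_iff)
  obtain S where S: "open S" "0 \<in> S" "f holomorphic_on S" by (rule has_fps_expansion_imp_holomorphic[OF fexp])
  have df: "deriv f 0 = fps_nth r 1"
    using fps_nth_fps_expansion[OF fexp, of 1] by simp
  obtain e where e: "e > 0" "ball 0 e \<subseteq> S" "inj_on f (ball 0 e)"
  proof (rule has_complex_derivative_locally_injective[OF S(3,2,1)])
    show "deriv f 0 \<noteq> 0" using df r by simp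
  qed
  have hol: "f holomorphic_on ball 0 e" using S e holomorphic_on_subset by blast
  obtain g where g: "g holomorphic_on (f ` ball 0 e)" "\<And>z. z \<in> ball 0 e \<Longrightarrow> g (f z) = z"
  proof (rule holomorphic_has_inverse[OF hol open_ball e(3)])
    fix g assume "g holomorphic_on (f ` ball 0 e)" "\<And>z. z \<in> ball 0 e \<Longrightarrow> g (f z) = z"
    then show thesis by (rule that)
  qed
  have f0: "f 0 = 0" by (simp add: f_def eval_fps_at_0 r)
  have "open (f ` ball 0 e)" by (rule open_mapping_thm3[OF hol open_ball e(3)])
  moreover have "0 \<in> f ` ball 0 e" using f0 e by (intro image_eqI[of _ _ 0]) auto
  ultimately have "g analytic_on {0}" unfolding analytic_at using g(1) by (intro exI[of _ "f ` ball 0 e"]) auto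
  then have gexp: "g has_fps_expansion fps_expansion g 0" by (rule analytic_at_imp_has_fps_expansion_0)
  have "(g \<circ> f) has_fps_expansion fps_compose (fps_expansion g 0) r"
    by (rule has_fps_expansion_compose[OF gexp fexp r(2)])
  moreover have "eventually (\<lambda>z. (g \<circ> f) z = z) (nhds 0)"
    unfolding eventually_nhds using g(2) e by (intro exI[of _ "ball 0 e"]) auto
  ultimately have "(\<lambda>z. z) has_fps_expansion fps_compose (fps_expansion g 0) r"
    by (simp cong: has_fps_expansion_cong)
  then have "fps_compose (fps_expansion g 0) r = fps_X"
    by (rule fps_expansion_unique_complex) (rule has_fps_expansion_fps_X)
  then have "fps_compose (fps_compose (fps_expansion g 0) r) (fps_inv r) = fps_inv r" by (simp add: fps_inv_def)
  moreover have "fps_compose (fps_compose (fps_expansion g 0) r) (fps_inv r) = fps_expansion g 0"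
    using r inv0 by (subst fps_compose_assoc[symmetric]) (auto simp: fps_inv_right)
  ultimately show ?thesis using conv_imp[OF gexp] by simp
qed

text \<open>A root \<open>\<rho>\<close> of \<open>a\<close> of degree \<open>subdegree a\<close> is
  a local parameter, and its inverse \<open>\<sigma>\<close> turns \<open>a\<close> into a power of
  \<open>t\<close>. Convergence is stated as an implication because merely formal arcs are
  normalized as well.\<close>

lemma normalize_arc:
  assumes a: "a \<noteq> 0" "fps_nth a 0 = 0"
  obtains \<rho> \<sigma> where "fps_nth \<rho> 0 = 0" "fps_nth \<sigma> 0 = 0" "subdegree \<rho> = 1" "subdegree \<sigma> = 1"
    "fps_compose \<rho> \<sigma> = fps_X" "fps_compose \<sigma> \<rho> = fps_X" "a = \<rho> ^ subdegree a"
    "fps_compose a \<sigma> = fps_X ^ subdegree a" "conv a \<Longrightarrow> conv \<rho>" "conv a \<Longrightarrow> conv \<sigma>"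
proof -
  define e where "e = subdegree a"
  have e: "e > 0" using a by (auto simp: e_def subdegree_eq_0_iff intro!: gr0I)
  define u where "u = fps_shift e a"
  have u: "fps_nth u 0 \<noteq> 0" using a by (simp add: u_def e_def)
  have au: "a = fps_X ^ e * u" unfolding u_def e_def using subdegree_decompose[of a] by (simp add: mult.commute)
  obtain r where r: "r ^ e = u" "conv u \<longrightarrow> conv r" using fps_root_exists[OF u e] by blast
  define \<rho> where "\<rho> = fps_X * r"
  define \<sigma> where "\<sigma> = fps_inv \<rho>"
  have r0: "fps_nth r 0 \<noteq> 0" using r(1) u e by (auto simp: fps_power_zeroth)
  have \<rho>: "fps_nth \<rho> 0 = 0" "fps_nth \<rho> 1 \<noteq> 0" using r0 by (simp_all add: \<rho>_def)
  have \<sigma>0: "fps_nth \<sigma> 0 = 0" by (simp add: \<sigma>_def fps_inv_def)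
  have i: "fps_compose \<rho> \<sigma> = fps_X" "fps_compose \<sigma> \<rho> = fps_X"
    unfolding \<sigma>_def using \<rho> by (simp_all add: fps_inv_right fps_inv)
  have "subdegree (fps_compose \<rho> \<sigma>) = 1" unfolding i by simp
  then have sd: "subdegree \<rho> = 1 \<and> subdegree \<sigma> = 1" using \<sigma>0 by (simp add: nat_mult_eq_1_iff)
  have ar: "a = \<rho> ^ e" using au r(1) by (simp add: \<rho>_def power_mult_distrib)
  have "fps_compose a \<sigma> = fps_X ^ e" unfolding ar using \<sigma>0 i by (simp add: compose_pow)
  moreover have "conv \<rho> \<and> conv \<sigma>" if "conv a"
  proof -
    from that have "conv r" using r by (simp add: u_def)
    then have "conv \<rho>" unfolding \<rho>_def by (intro conv_mult) simp_all
    then show "conv \<rho> \<and> conv \<sigma>" unfolding \<sigma>_def using conv_inv \<rho> by blast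
  qed
  ultimately show ?thesis using \<rho>(1) \<sigma>0 i sd ar unfolding e_def by (intro that[of \<rho> \<sigma>]) auto
qed

text \<open>After splitting off the order, the remaining unit has \<open>n\<close>-th power 1, hence
  zero derivative, and is a constant.\<close>

lemma root_of_monomial:
  fixes A :: "complex fps"
  assumes A: "A ^ n = fps_X ^ m" and n: "n > 0"
  shows "\<exists>\<xi> k. m = n * k \<and> \<xi> ^ n = 1 \<and> A = fps_const \<xi> * fps_X ^ k"
proof -
  have "A \<noteq> 0" using A n by (auto simp: power_0_left)
  define k where "k = subdegree A"
  have "subdegree (A ^ n) = m" unfolding A by simp
  then have m: "m = n * k" by (simp add: k_def)
  define u where "u = fps_shift k A"
  have Au: "A = u * fps_X ^ k" unfolding u_def k_def by (rule subdegree_decompose)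
  have "u ^ n * fps_X ^ m = 1 * fps_X ^ m" using A unfolding Au m by (simp add: power_mult_distrib power_mult mult.commute)
  then have un: "u ^ n = 1" by simp
  have "u \<noteq> 0" using un n by (auto simp: power_0_left)
  have "of_nat n * u ^ (n - 1) * fps_deriv u = fps_deriv (u ^ n)" by (simp add: fps_deriv_power fps_of_nat mult.assoc mult.commute)
  also have "\<dots> = 0" by (simp add: un)
  finally have "fps_const (of_nat n) * (u ^ (n - 1) * fps_deriv u) = 0" by (simp add: fps_of_nat mult.assoc)
  then have "fps_deriv u = 0" using \<open>u \<noteq> 0\<close> n by simp
  then obtain \<xi> where \<xi>: "u = fps_const \<xi>" unfolding fps_deriv_eq_0_iff by blast
  have "\<xi> ^ n = fps_nth (u ^ n) 0" by (simp add: \<xi> fps_power_zeroth)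
  then have "\<xi> ^ n = 1" by (simp add: un)
  then show ?thesis using m Au \<xi> by blast
qed

section \<open>Conjugates of an arc and primitivity\<close>

definition rot :: "complex \<Rightarrow> complex fps \<Rightarrow> complex fps" where
  "rot \<zeta> b = fps_compose b (fps_const \<zeta> * fps_X)"

lemma rot_nth [simp]: "fps_nth (rot \<zeta> b) n = \<zeta> ^ n * fps_nth b n"
  unfolding rot_def by (subst fps_compose_linear) simp

text \<open>With \<open>g\<close> the exact order of \<open>\<zeta>\<close>, invariance kills all
  coefficients of \<open>b\<close> whose index is not divisible by \<open>g\<close>.\<close>

lemma rotation_invariant:
  assumes z: "\<zeta> ^ e = 1" "\<zeta> \<noteq> 1" and e: "e > 0" and b: "rot \<zeta> b = b"
  shows "\<exists>g c. g \<ge> 2 \<and> g dvd e \<and> b = fps_compose c (fps_X ^ g)"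
proof -
  define g where "g = (LEAST g. g > 0 \<and> \<zeta> ^ g = 1)"
  have g: "g > 0" "\<zeta> ^ g = 1" using LeastI[of "\<lambda>g. g > 0 \<and> \<zeta> ^ g = 1" e] z e by (auto simp: g_def)
  have min: "g \<le> k" if "k > 0" "\<zeta> ^ k = 1" for k unfolding g_def using that by (intro Least_le) auto
  have dvd: "g dvd k" if "\<zeta> ^ k = 1" for k
  proof -
    have "\<zeta> ^ (g * (k div g) + k mod g) = 1" using that by simp
    then have "\<zeta> ^ (k mod g) = 1" by (simp only: power_add power_mult g(2) power_one mult_1)
    moreover have "k mod g < g" using g(1) by simp
    ultimately have "k mod g = 0" using min[of "k mod g"] by (cases "k mod g = 0") auto
    then show ?thesis by auto
  qed
  have "g \<noteq> 1" using g z by auto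
  then have "g \<ge> 2" using g by linarith
  moreover have "b = fps_compose (Abs_fps (\<lambda>n. fps_nth b (g * n))) (fps_X ^ g)"
  proof (rule fps_ext)
    fix n
    have "\<zeta> ^ n * fps_nth b n = fps_nth b n" using arg_cong[OF b, of "\<lambda>f. fps_nth f n"] by simp
    then have "fps_nth b n = 0 \<or> \<zeta> ^ n = 1" by simp
    then show "fps_nth b n = fps_nth (fps_compose (Abs_fps (\<lambda>n. fps_nth b (g * n))) (fps_X ^ g)) n"
      using g dvd[of n] by (auto simp: fps_nth_compose_X_pow)
  qed
  ultimately show ?thesis using dvd[OF z(1)] by blast
qed

text \<open>Convergence of the reparametrization is dropped: the conjugates of an arc are compared formally.\<close>

definition formally_primitive :: "complex fps \<Rightarrow> complex fps \<Rightarrow> bool" where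
  "formally_primitive a b \<longleftrightarrow> \<not> (\<exists>a' b' s. fps_nth a' 0 = 0 \<and> fps_nth b' 0 = 0 \<and> subdegree s \<ge> 2 \<and>
     a = fps_compose a' s \<and> b = fps_compose b' s)"

lemma primitive_swap: "primitive_arc a b \<Longrightarrow> primitive_arc b a"
  unfolding primitive_arc_def analytic_arc_def by blast

lemma formally_primitive_swap: "formally_primitive a b \<Longrightarrow> formally_primitive b a"
  unfolding formally_primitive_def by blast

text \<open>A formal reparametrization is replaced by a convergent one: normalizing \<open>a\<close>
  and \<open>a'\<close> reduces \<open>s\<close> to \<open>\<xi> * t ^ g\<close>, so the convergent
  series \<open>fps_compose b \<sigma>\<close> is a series \<open>c\<close> in \<open>t ^ g\<close>,
  and thinning out keeps \<open>c\<close> convergent. Then \<open>(t ^ k, c)\<close> and the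
  parameter \<open>\<rho> ^ g\<close> contradict primitivity.\<close>

lemma primitive_imp_formally_primitive_aux:
  assumes prim: "primitive_arc a b" and a0: "a \<noteq> 0"
  shows "formally_primitive a b"
  unfolding formally_primitive_def
proof
  assume "\<exists>a' b' s. fps_nth a' 0 = 0 \<and> fps_nth b' 0 = 0 \<and> subdegree s \<ge> 2 \<and> a = fps_compose a' s \<and> b = fps_compose b' s"
  then obtain a' b' s where f: "fps_nth a' 0 = 0" "fps_nth b' 0 = 0" "subdegree s \<ge> 2" "a = fps_compose a' s" "b = fps_compose b' s" by blast
  have s0: "fps_nth s 0 = 0" using f(3) by (intro nth_less_subdegree_zero) simp
  have ab: "fps_nth a 0 = 0" "fps_nth b 0 = 0" "conv a" "conv b" using prim by (auto simp: primitive_arc_def analytic_arc_def)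
  define e where "e = subdegree a"
  obtain \<rho> \<sigma> where \<rho>: "fps_nth \<rho> 0 = 0" "fps_nth \<sigma> 0 = 0" "subdegree \<rho> = 1" "subdegree \<sigma> = 1"
     "fps_compose \<rho> \<sigma> = fps_X" "fps_compose \<sigma> \<rho> = fps_X" "a = \<rho> ^ e" "fps_compose a \<sigma> = fps_X ^ e" "conv \<rho>" "conv \<sigma>"
    by (rule normalize_arc[OF a0 ab(1), folded e_def]) (use ab in auto)
  have a'0: "a' \<noteq> 0" using a0 f(4) by auto
  define k where "k = subdegree a'"
  have k: "k > 0" using a'0 f(1) by (auto simp: k_def subdegree_eq_0_iff intro!: gr0I)
  obtain \<rho>' \<sigma>' where \<rho>': "fps_nth \<rho>' 0 = 0" "fps_nth \<sigma>' 0 = 0" "subdegree \<rho>' = 1"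
    "fps_compose \<sigma>' \<rho>' = fps_X" "a' = \<rho>' ^ k"
    by (rule normalize_arc[OF a'0 f(1), folded k_def])
  define s1 where "s1 = fps_compose s \<sigma>"
  have s10: "fps_nth s1 0 = 0" using s0 by (simp add: s1_def)
  have "fps_compose \<rho>' s1 ^ k = fps_compose a' s1" using s10 by (simp add: \<rho>'(5) compose_pow)
  also have "\<dots> = fps_compose a \<sigma>" unfolding f(4) s1_def by (rule fps_compose_assoc[OF \<rho>(2) s0])
  also have "\<dots> = fps_X ^ e" by fact
  finally have "fps_compose \<rho>' s1 ^ k = fps_X ^ e" .
  from root_of_monomial[OF this k] obtain \<xi> g where g: "e = k * g" "fps_compose \<rho>' s1 = fps_const \<xi> * fps_X ^ g" "\<xi> ^ k = 1"
    by blast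
  have "\<xi> \<noteq> 0" using g k by (auto simp: power_0_left)
  then have "g = subdegree (fps_compose \<rho>' s1)" using g(2) by simp
  also have "\<dots> = subdegree s" using s10 \<rho>' \<rho> by (simp add: s1_def)
  finally have g2: "g \<ge> 2" using f(3) by simp
  define c where "c = fps_compose (fps_compose b' \<sigma>') (fps_const \<xi> * fps_X)"
  have "fps_compose b \<sigma> = fps_compose b' s1" unfolding f(5) s1_def by (rule fps_compose_assoc[OF \<rho>(2) s0, symmetric])
  also have "s1 = fps_compose (fps_compose \<sigma>' \<rho>') s1" using \<rho>' s10 by simp
  also have "\<dots> = fps_compose \<sigma>' (fps_const \<xi> * fps_X ^ g)" using \<rho>' s10 by (subst fps_compose_assoc[symmetric]) (auto simp: g)
  also have "fps_const \<xi> * fps_X ^ g = fps_compose (fps_const \<xi> * fps_X) (fps_X ^ g)"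
    using g2 by (simp add: fps_compose_mult_distrib)
  also have "fps_compose b' (fps_compose \<sigma>' \<dots>) = fps_compose c (fps_X ^ g)"
    using g2 \<rho>' by (simp add: c_def fps_compose_assoc)
  finally have bs: "fps_compose b \<sigma> = fps_compose c (fps_X ^ g)" .
  have "conv (fps_compose b \<sigma>)" using ab \<rho> by (intro conv_compose)
  then obtain C R where CR: "C \<ge> 0" "R \<ge> 1" "\<And>n. norm (fps_nth (fps_compose b \<sigma>) n) \<le> C * R ^ n"
    unfolding conv_bound by blast
  have "conv c" unfolding conv_bound
  proof (intro exI conjI allI)
    show "C \<ge> 0" "R ^ g \<ge> 1" using CR by simp_all
    show "norm (fps_nth c n) \<le> C * (R ^ g) ^ n" for n
      using CR(3)[of "g * n"] g2 unfolding bs by (simp add: fps_nth_compose_X_pow power_mult)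
  qed
  moreover have c0: "fps_nth c 0 = 0" using f(2) by (simp add: c_def)
  ultimately have "analytic_arc (fps_X ^ k) c" using k by (simp add: analytic_arc_def)
  moreover have "conv (\<rho> ^ g)" using \<rho> by (intro conv_power)
  moreover have "subdegree (\<rho> ^ g) \<ge> 2" using \<rho> g2 by simp
  moreover have rg: "fps_compose (fps_X ^ g) \<rho> = \<rho> ^ g" "fps_nth (\<rho> ^ g) 0 = 0" using \<rho> g2 by (simp_all add: compose_pow fps_power_zeroth)
  have "a = fps_compose (fps_X ^ k) (\<rho> ^ g)" using \<rho> rg by (simp add: compose_pow g power_mult[symmetric] mult.commute)
  moreover have "b = fps_compose c (\<rho> ^ g)"
  proof -
    have "b = fps_compose (fps_compose b \<sigma>) \<rho>"
      unfolding fps_compose_assoc[OF \<rho>(1) \<rho>(2), symmetric] \<rho>(6) by simp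
    also have "\<dots> = fps_compose c (fps_compose (fps_X ^ g) \<rho>)"
      unfolding bs using g2 by (intro fps_compose_assoc[symmetric] \<rho>) simp
    finally show ?thesis unfolding rg .
  qed
  ultimately show False using prim unfolding primitive_arc_def by blast
qed

lemma primitive_imp_formally_primitive: "primitive_arc a b \<Longrightarrow> formally_primitive a b"
  using primitive_imp_formally_primitive_aux primitive_swap formally_primitive_swap
  by (metis analytic_arc_def primitive_arc_def)

text \<open>If two conjugates coincide, a nontrivial root of unity fixes
  \<open>fps_compose b \<sigma>\<close>, which is then a series in \<open>t ^ g\<close> with
  \<open>g \<ge> 2\<close> dividing \<open>e\<close>; so is \<open>t ^ e\<close>, and the arc
  factors through \<open>\<rho> ^ g\<close>.\<close>

lemma conjugates_distinct:
  assumes p: "formally_primitive a b" and ab: "fps_nth a 0 = 0" "fps_nth b 0 = 0"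
    and \<sigma>: "fps_nth \<rho> 0 = 0" "fps_nth \<sigma> 0 = 0" "subdegree \<rho> = 1" "fps_compose \<sigma> \<rho> = fps_X" "fps_compose a \<sigma> = fps_X ^ e" "e > 0"
  shows "inj_on (\<lambda>\<zeta>. rot \<zeta> (fps_compose b \<sigma>)) {\<zeta>. \<zeta> ^ e = 1}"
proof (rule inj_onI, rule ccontr)
  fix x y assume xy: "x \<in> {\<zeta>. \<zeta> ^ e = 1}" "y \<in> {\<zeta>. \<zeta> ^ e = 1}" "x \<noteq> y"
    and eq: "rot x (fps_compose b \<sigma>) = rot y (fps_compose b \<sigma>)"
  define \<zeta> where "\<zeta> = x / y"
  have y0: "y \<noteq> 0" using xy \<sigma> by (auto simp: power_0_left)
  have z: "\<zeta> ^ e = 1" "\<zeta> \<noteq> 1" using xy y0 by (auto simp: \<zeta>_def power_divide)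
  have "rot \<zeta> (fps_compose b \<sigma>) = fps_compose b \<sigma>"
  proof (rule fps_ext)
    fix n
    have "x ^ n * fps_nth (fps_compose b \<sigma>) n = y ^ n * fps_nth (fps_compose b \<sigma>) n"
      using arg_cong[OF eq, of "\<lambda>f. fps_nth f n"] by simp
    then show "fps_nth (rot \<zeta> (fps_compose b \<sigma>)) n = fps_nth (fps_compose b \<sigma>) n"
      using y0 by (auto simp: \<zeta>_def power_divide field_simps)
  qed
  from rotation_invariant[OF z \<sigma>(6) this] obtain g c where g: "g \<ge> 2" "g dvd e" "fps_compose b \<sigma> = fps_compose c (fps_X ^ g)" by blast
  obtain k where k: "e = g * k" using g by blast
  have rg: "fps_compose (fps_X ^ g) \<rho> = \<rho> ^ g" "fps_nth (\<rho> ^ g) 0 = 0" using \<sigma> g by (simp_all add: compose_pow fps_power_zeroth)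
  have "a = fps_compose (fps_compose a \<sigma>) \<rho>" using \<sigma> by (subst fps_compose_assoc[symmetric]) auto
  also have "\<dots> = fps_compose (fps_X ^ k) (\<rho> ^ g)" using \<sigma> rg by (simp add: compose_pow k power_mult)
  finally have 1: "a = fps_compose (fps_X ^ k) (\<rho> ^ g)" .
  have "b = fps_compose (fps_compose b \<sigma>) \<rho>" using \<sigma> by (subst fps_compose_assoc[symmetric]) auto
  also have "\<dots> = fps_compose c (\<rho> ^ g)" unfolding g(3) using \<sigma> g by (subst fps_compose_assoc[symmetric]) (auto simp: rg)
  finally have 2: "b = fps_compose c (\<rho> ^ g)" .
  have "fps_nth c 0 = 0" using 2 ab by (metis fps_compose_nth_0)
  moreover have "k > 0" using \<sigma>(6) k by (cases k) auto
  then have "fps_nth (fps_X ^ k :: complex fps) 0 = 0" by simp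
  moreover have "subdegree (\<rho> ^ g) \<ge> 2" using \<sigma> g by simp
  ultimately show False using p 1 2 unfolding formally_primitive_def by blast
qed

subsection \<open>Equations of branches\<close>

text \<open>Roots are sought in the first variable in \<open>z_order\<close>, but in the second one
  for arcs \<open>(t ^ e, b)\<close>; exchanging the variables mediates between the two
  conventions.\<close>

definition swap2 :: "complex fps fps \<Rightarrow> complex fps fps" where "swap2 F = sub F YY XX"

lemma coef2_swap2: "coef2 (swap2 F) i j = coef2 F j i"
proof -
  have e: "YY ^ k * XX ^ l = XX ^ l * YY ^ k" for k l by (rule mult.commute)
  have "coef2 (swap2 F) i j = (\<Sum>k\<le>i+j. \<Sum>l\<le>i+j. if k = j then (if l = i then coef2 F k l else 0) else 0)"
    unfolding swap2_def coef2_sub e coef2_mono by (intro sum.cong refl) auto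
  also have "\<dots> = (\<Sum>k\<le>i+j. if k = j then \<Sum>l\<le>i+j. (if l = i then coef2 F k l else 0) else 0)"
    by (intro sum.cong refl) auto
  also have "\<dots> = coef2 F j i" by (simp add: sum.delta)
  finally show ?thesis .
qed

lemma swap2_swap2 [simp]: "swap2 (swap2 F) = F" by (rule coef2_eqI) (simp add: coef2_swap2)
lemma swap2_px [simp]: "swap2 (px a) = py a" and swap2_py [simp]: "swap2 (py a) = px a"
  by (auto intro!: coef2_eqI simp: coef2_swap2 coef2_px coef2_py)
lemma swap2_XX [simp]: "swap2 XX = YY" and swap2_YY [simp]: "swap2 YY = XX"
  by (simp_all add: swap2_def sub_XX sub_YY)
lemma swap2_mult: "swap2 (F * G) = swap2 F * swap2 G" by (simp add: swap2_def sub_mult)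
lemma swap2_diff: "swap2 (F - G) = swap2 F - swap2 G" by (simp add: swap2_def sub_diff)
lemma arc_swap2: "fps_nth a 0 = 0 \<Longrightarrow> fps_nth b 0 = 0 \<Longrightarrow> arc_eval (swap2 F) a b = arc_eval F b a"
  by (simp add: swap2_def arc_sub arc_XX arc_YY)
lemma swap2_sub: "a \<in> max_ideal \<Longrightarrow> b \<in> max_ideal \<Longrightarrow> swap2 (sub F a b) = sub F (swap2 a) (swap2 b)"
  by (simp add: swap2_def sub_sub)
lemma sub_swap2: "a \<in> max_ideal \<Longrightarrow> b \<in> max_ideal \<Longrightarrow> sub (swap2 F) a b = sub F b a"
  by (simp add: swap2_def sub_sub sub_XX sub_YY)

lemma root_division_y:
  assumes "fps_nth b 0 = 0" "arc_eval G fps_X b = 0"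
  shows "\<exists>Q. G = (YY - px b) * Q"
proof -
  have "arc_eval (swap2 G) b fps_X = 0" using assms by (simp add: arc_swap2)
  from root_division[OF assms(1) this] obtain Q where "swap2 G = (XX - py b) * Q" by blast
  then have "swap2 (swap2 G) = (YY - px b) * swap2 Q" by (simp add: swap2_mult swap2_diff del: swap2_swap2)
  then show ?thesis by auto
qed

lemma YY_px_nonzero: "YY - px b \<noteq> 0"
proof
  assume "YY - px b = 0"
  then have "coef2 (YY - px b) 0 1 = 0" by (simp only: coef2_simps)
  then show False by (simp only: coef2_simps coef2_YY coef2_px) simp
qed

text \<open>Comparing coefficients expresses \<open>coef2 Q i j\<close> through coefficients of
  \<open>Q\<close> with smaller \<open>i\<close>. The induction closes because
  \<open>K = 1 + B * R\<close> satisfies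
  \<open>1 + (K - 1) * (\<Sum>l<i. K ^ l) = K ^ i\<close>.\<close>

lemma conv_division:
  assumes G: "convergent2 G" and b: "conv b" "fps_nth b 0 = 0" and eq: "G = (YY - px b) * Q"
  shows "convergent2 Q"
proof -
  obtain C1 R1 where 1: "C1 \<ge> 0" "R1 \<ge> 1" "\<And>i j. norm (coef2 G i j) \<le> C1 * R1 ^ (i + j)"
    using G by (rule convergent2E) blast
  obtain B R2 where 2: "B \<ge> 0" "R2 \<ge> 1" "\<And>i. norm (fps_nth b i) \<le> B * R2 ^ i"
    using b(1) unfolding conv_bound by blast
  define R where "R = max R1 R2"
  have R: "R \<ge> 1" using 1 by (simp add: R_def)
  have G: "norm (coef2 G i j) \<le> C1 * R ^ (i + j)" for i j
  proof -
    have "C1 * R1 ^ (i + j) \<le> C1 * R ^ (i + j)" using 1 by (intro mult_left_mono power_mono) (auto simp: R_def)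
    then show ?thesis using 1(3)[of i j] by linarith
  qed
  have bb: "norm (fps_nth b i) \<le> B * R ^ i" for i
  proof -
    have "B * R2 ^ i \<le> B * R ^ i" using 2 by (intro mult_left_mono power_mono) (auto simp: R_def)
    then show ?thesis using 2(3)[of i] by linarith
  qed
  define K where "K = 1 + B * R"
  have K: "K \<ge> 1" using 2 R by (simp add: K_def)
  have cf: "coef2 Q i j = coef2 G i (Suc j) + (\<Sum>l=1..i. fps_nth b l * coef2 Q (i - l) (Suc j))" for i j
  proof -
    have "fps_nth G (Suc j) = fps_nth Q j - b * fps_nth Q (Suc j)"
      by (simp add: eq px_def left_diff_distrib)
    then have "coef2 G i (Suc j) = coef2 Q i j - (\<Sum>l=0..i. fps_nth b l * coef2 Q (i - l) (Suc j))"
      by (simp add: coef2_def fps_mult_nth)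
    moreover have "{0..i} = insert 0 {1..i}" by auto
    ultimately show ?thesis using b(2) by simp
  qed
  have bound: "norm (coef2 Q i j) \<le> C1 * R ^ (i + j + 1) * K ^ i" for i j
  proof (induction i arbitrary: j rule: less_induct)
    case (less i)
    have "norm (coef2 Q i j) \<le> norm (coef2 G i (Suc j)) + (\<Sum>l=1..i. norm (fps_nth b l * coef2 Q (i - l) (Suc j)))"
      by (subst cf) (intro norm_triangle_le add_left_mono norm_sum)
    also have "\<dots> \<le> C1 * R ^ (i + j + 1) + (\<Sum>l=1..i. C1 * R ^ (i + j + 1) * (B * R) * K ^ (i - l))"
    proof (intro add_mono sum_mono)
      show "norm (coef2 G i (Suc j)) \<le> C1 * R ^ (i + j + 1)" using G[of i "Suc j"] by simp
      fix l assume l: "l \<in> {1..i}"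
      then have il: "i - l < i" by auto
      have "norm (fps_nth b l * coef2 Q (i - l) (Suc j)) \<le> (B * R ^ l) * (C1 * R ^ (i - l + Suc j + 1) * K ^ (i - l))"
        unfolding norm_mult by (intro mult_mono bb less.IH[OF il]) (use 2 R in auto)
      also have "\<dots> = C1 * (R ^ l * R ^ (i - l + Suc j + 1)) * B * K ^ (i - l)" by (simp only: mult_ac)
      also have "R ^ l * R ^ (i - l + Suc j + 1) = R ^ (i + j + 1) * R"
      proof -
        have "l + (i - l + Suc j + 1) = Suc (i + j + 1)" using l by auto
        then show ?thesis by (metis power_add power_Suc2)
      qed
      finally show "norm (fps_nth b l * coef2 Q (i - l) (Suc j)) \<le> C1 * R ^ (i + j + 1) * (B * R) * K ^ (i - l)"
        by (simp only: mult_ac)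
    qed
    also have "\<dots> = C1 * R ^ (i + j + 1) * (1 + B * R * (\<Sum>l=1..i. K ^ (i - l)))"
      by (simp add: sum_distrib_left algebra_simps)
    also have "(\<Sum>l=1..i. K ^ (i - l)) = (\<Sum>l<i. K ^ l)"
      by (rule sum.reindex_bij_witness[of _ "\<lambda>l. i - l" "\<lambda>l. i - l"]) auto
    also have "1 + B * R * (\<Sum>l<i. K ^ l) = K ^ i"
      using power_diff_1_eq[of K i] by (simp add: K_def)
    finally show ?case .
  qed
  show ?thesis
  proof (rule convergent2I[of "C1 * R" "R * K"])
    show "C1 * R \<ge> 0" using 1 R by simp
    show "R * K \<ge> 1" using mult_mono[of 1 R 1 K] R K by simp
    fix i j
    have "norm (coef2 Q i j) \<le> C1 * R ^ (i + j + 1) * K ^ i" by (rule bound)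
    also have "\<dots> \<le> C1 * R ^ (i + j + 1) * K ^ (i + j)"
      using 1 R K by (intro mult_left_mono power_increasing) auto
    also have "\<dots> = C1 * R * (R * K) ^ (i + j)" by (simp add: power_mult_distrib)
    finally show "norm (coef2 Q i j) \<le> C1 * R * (R * K) ^ (i + j)" .
  qed
qed

text \<open>Distinct roots are divided out one by one: in an integral domain the remaining ones are
  roots of the quotient.\<close>

lemma distinct_roots_division:
  assumes "finite Z" and "\<And>z. z \<in> Z \<Longrightarrow> fps_nth (b z) 0 = 0" "\<And>z. z \<in> Z \<Longrightarrow> arc_eval G fps_X (b z) = 0" "inj_on b Z"
  shows "\<exists>Q. G = (\<Prod>z\<in>Z. YY - px (b z)) * Q \<and> (convergent2 G \<and> (\<forall>z\<in>Z. conv (b z)) \<longrightarrow> convergent2 Q)"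
  using assms
proof (induction Z arbitrary: G rule: finite_induct)
  case empty then show ?case by auto
next
  case (insert z Z)
  obtain Q where Q: "G = (YY - px (b z)) * Q"
    using root_division_y[of "b z" G] insert.prems by auto
  have bz: "fps_nth (b z) 0 = 0" using insert.prems by simp
  have "arc_eval Q fps_X (b z') = 0" if z': "z' \<in> Z" for z'
  proof -
    have b0: "fps_nth (b z') 0 = 0" using insert.prems z' by simp
    have "0 = arc_eval G fps_X (b z')" using insert.prems z' by simp
    also have "\<dots> = (b z' - b z) * arc_eval Q fps_X (b z')"
      unfolding Q using b0 by (simp add: arc_mult arc_diff arc_YY arc_px)
    finally have "b z' = b z \<or> arc_eval Q fps_X (b z') = 0" by simp
    then show ?thesis using insert.prems(3) insert.hyps z' by (metis DiffI empty_iff imageI inj_on_insert insert_iff)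
  qed
  then obtain Q' where Q': "Q = (\<Prod>z\<in>Z. YY - px (b z)) * Q'" "convergent2 Q \<and> (\<forall>z\<in>Z. conv (b z)) \<longrightarrow> convergent2 Q'"
    using insert.IH[of Q] insert.prems by (auto simp: inj_on_def)
  have "G = (\<Prod>z\<in>insert z Z. YY - px (b z)) * Q'" using insert.hyps by (simp add: Q Q' mult.assoc)
  moreover have "convergent2 Q'" if "convergent2 G" "\<forall>z\<in>insert z Z. conv (b z)"
    using conv_division[OF that(1) _ bz Q] that Q' by auto
  ultimately show ?case by blast
qed

section \<open>Norms of conjugate linear factors\<close>

definition rotx :: "complex \<Rightarrow> complex fps fps \<Rightarrow> complex fps fps" where
  "rotx \<zeta> F = sub F (cc \<zeta> * XX) YY"

lemma ccXX [simp]: "cc \<zeta> * XX \<in> max_ideal" by auto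

lemma coef2_rotx: "coef2 (rotx \<zeta> F) i j = \<zeta> ^ i * coef2 F i j"
proof -
  have e: "coef2 ((cc \<zeta> * XX) ^ k * YY ^ l) i j = (if k = i then (if l = j then \<zeta> ^ i else 0) else 0)" for k l
    unfolding power_mult_distrib cc_power[symmetric] mult.assoc coef2_simps coef2_mono by auto
  have "coef2 (rotx \<zeta> F) i j = (\<Sum>k\<le>i+j. \<Sum>l\<le>i+j. if k = i then (if l = j then \<zeta> ^ i * coef2 F k l else 0) else 0)"
    unfolding rotx_def coef2_sub e by (intro sum.cong refl) auto
  also have "\<dots> = (\<Sum>k\<le>i+j. if k = i then \<Sum>l\<le>i+j. (if l = j then \<zeta> ^ i * coef2 F k l else 0) else 0)"
    by (intro sum.cong refl) auto
  also have "\<dots> = \<zeta> ^ i * coef2 F i j" by (simp add: sum.delta)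
  finally show ?thesis .
qed

lemma rotx_px: "rotx \<zeta> (px b) = px (rot \<zeta> b)"
  by (rule coef2_eqI) (simp add: coef2_rotx coef2_px)
lemma rotx_YY: "rotx \<zeta> YY = YY" by (simp add: rotx_def sub_YY)
lemma rotx_mult: "rotx \<zeta> (F * G) = rotx \<zeta> F * rotx \<zeta> G" by (simp add: rotx_def sub_mult)
lemma rotx_diff: "rotx \<zeta> (F - G) = rotx \<zeta> F - rotx \<zeta> G" by (simp add: rotx_def sub_diff)
lemma rotx_prod: "rotx \<zeta> (prod f A) = (\<Prod>x\<in>A. rotx \<zeta> (f x))" by (simp add: rotx_def sub_prod)
lemma rot_rot: "rot x (rot y b) = rot (x * y) b" by (rule fps_ext) (simp add: power_mult_distrib mult.assoc)

lemma rotx_sub_XX_power: "\<zeta> ^ e = 1 \<Longrightarrow> e > 0 \<Longrightarrow> rotx \<zeta> (sub F (XX ^ e) YY) = sub F (XX ^ e) YY"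
  by (rule coef2_eqI) (auto simp: coef2_rotx has_wt_compose_XX(1) power_mult)

lemma primitive_root_exists: "e > 0 \<Longrightarrow> \<exists>\<zeta>::complex. \<zeta> ^ e = 1 \<and> (\<forall>i. \<zeta> ^ i = 1 \<longrightarrow> e dvd i)"
proof -
  assume e: "e > 0"
  define \<zeta> where "\<zeta> = exp (2 * of_real pi * \<i> * of_nat 1 / of_nat e)"
  have "\<zeta> ^ i = exp (2 * of_real pi * \<i> * of_nat i / of_nat e)" for i
  proof -
    have "\<zeta> ^ i = exp (of_nat i * (2 * of_real pi * \<i> * of_nat 1 / of_nat e))"
      unfolding \<zeta>_def by (rule exp_of_nat_mult[symmetric])
    also have "of_nat i * (2 * of_real pi * \<i> * of_nat 1 / of_nat e) = 2 * of_real pi * \<i> * of_nat i / of_nat e"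
      by simp
    finally show ?thesis .
  qed
  then have "\<zeta> ^ i = 1 \<longleftrightarrow> e dvd i" for i using complex_root_unity_eq_1[of e i] e by auto
  then have "\<zeta> ^ e = 1 \<and> (\<forall>i. \<zeta> ^ i = 1 \<longrightarrow> e dvd i)" by simp
  then show "\<exists>\<zeta>::complex. \<zeta> ^ e = 1 \<and> (\<forall>i. \<zeta> ^ i = 1 \<longrightarrow> e dvd i)" by (rule exI)
qed

text \<open>Invariance under a primitive root of unity leaves only exponents of \<open>x\<close>
  divisible by \<open>e\<close>; the coefficient bound survives with \<open>R ^ e\<close> in place
  of \<open>R\<close>.\<close>

lemma rotx_invariant:
  assumes e: "e > 0" and inv: "\<And>\<zeta>. \<zeta> ^ e = 1 \<Longrightarrow> rotx \<zeta> F = F"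
  shows "\<exists>G. F = sub G (XX ^ e) YY \<and> (convergent2 F \<longrightarrow> convergent2 G)"
proof -
  obtain \<zeta> :: complex where \<zeta>: "\<zeta> ^ e = 1" "\<And>i. \<zeta> ^ i = 1 \<Longrightarrow> e dvd i" using primitive_root_exists[OF e] by blast
  define G where "G = Abs_fps (\<lambda>j. Abs_fps (\<lambda>i. coef2 F (e * i) j))"
  have cG: "coef2 G i j = coef2 F (e * i) j" for i j by (simp add: G_def coef2_def)
  have "F = sub G (XX ^ e) YY"
  proof (rule coef2_eqI)
    fix i j
    have "\<zeta> ^ i * coef2 F i j = coef2 F i j" using inv[OF \<zeta>(1)] by (metis coef2_rotx)
    then have "coef2 F i j = 0 \<or> e dvd i" using \<zeta>(2) by auto
    then show "coef2 F i j = coef2 (sub G (XX ^ e) YY) i j" using e by (auto simp: has_wt_compose_XX(1) cG)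
  qed
  moreover have "convergent2 G" if cF: "convergent2 F"
  proof -
    obtain C R where C: "C \<ge> 0" "R \<ge> 1" "\<And>i j. norm (coef2 F i j) \<le> C * R ^ (i + j)" using cF by (rule convergent2E) blast
    show ?thesis
    proof (rule convergent2I[of C "R ^ e"])
      fix i j
      have "norm (coef2 G i j) \<le> C * R ^ (e * i + j)" using C by (simp add: cG)
      also have "\<dots> \<le> C * R ^ (e * (i + j))" using C e by (intro mult_left_mono power_increasing) (auto simp: distrib_left)
      finally show "norm (coef2 G i j) \<le> C * (R ^ e) ^ (i + j)" by (simp add: power_mult)
    qed (use C in auto)
  qed
  ultimately show ?thesis by blast
qed

lemma sub_XX_power_inj: "e > 0 \<Longrightarrow> sub F (XX ^ e) YY = sub G (XX ^ e) YY \<Longrightarrow> F = G"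
proof (rule coef2_eqI)
  fix i j assume e: "e > 0" and "sub F (XX ^ e) YY = sub G (XX ^ e) YY"
  then have "coef2 (sub F (XX ^ e) YY) (e * i) j = coef2 (sub G (XX ^ e) YY) (e * i) j" by simp
  then show "coef2 F i j = coef2 G i j" using e by (simp add: has_wt_compose_XX(1))
qed

text \<open>The norm of \<open>y - b(t)\<close> over the series in \<open>t ^ e\<close>; for
  distinct conjugates it is the polynomial equation of the branch \<open>(t ^ e, b(t))\<close>,
  written in \<open>t\<close> instead of \<open>x = t ^ e\<close>.\<close>

definition conj_prod :: "nat \<Rightarrow> complex fps \<Rightarrow> complex fps fps" where
  "conj_prod e b = (\<Prod>\<zeta>\<in>{\<zeta>. \<zeta> ^ e = 1}. YY - px (rot \<zeta> b))"

lemma finite_roots: "e > 0 \<Longrightarrow> finite {\<zeta>::complex. \<zeta> ^ e = 1}"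
  by (rule finite_roots_unity) simp

lemma conj_prod_nonzero: "e > 0 \<Longrightarrow> conj_prod e b \<noteq> 0"
  unfolding conj_prod_def using YY_px_nonzero finite_roots by (simp add: prod_zero_iff)

lemma rotx_conj_prod:
  assumes "\<zeta> ^ e = 1" "e > 0" shows "rotx \<zeta> (conj_prod e b) = conj_prod e b"
proof -
  have "\<zeta> \<noteq> 0" using assms by (auto simp: power_0_left)
  have "rotx \<zeta> (conj_prod e b) = (\<Prod>\<eta>\<in>{\<eta>. \<eta> ^ e = 1}. YY - px (rot (\<zeta> * \<eta>) b))"
    by (simp add: conj_prod_def rotx_prod rotx_diff rotx_YY rotx_px rot_rot)
  also have "\<dots> = conj_prod e b"
    unfolding conj_prod_def
    by (rule prod.reindex_bij_witness[of _ "\<lambda>\<eta>. \<eta> / \<zeta>" "\<lambda>\<eta>. \<zeta> * \<eta>"])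
      (use assms \<open>\<zeta> \<noteq> 0\<close> in \<open>auto simp: power_mult_distrib power_divide\<close>)
  finally show ?thesis .
qed

lemma arc_conjugate:
  assumes "fps_nth b 0 = 0" "\<zeta> ^ e = 1" "e > 0"
  shows "arc_eval F (fps_X ^ e) (rot \<zeta> b) = rot \<zeta> (arc_eval F (fps_X ^ e) b)"
proof -
  have "fps_compose (fps_X ^ e) (fps_const \<zeta> * fps_X) = fps_X ^ e"
    using assms by (subst compose_X_pow) (auto simp: power_mult_distrib)
  then show ?thesis unfolding rot_def using assms
    by (subst arc_compose[symmetric]) auto
qed

text \<open>The conjugates \<open>b(\<zeta>t)\<close> of a root of \<open>G(t\<^sup>e, y)\<close> are again roots, since \<open>t \<mapsto> \<zeta>t\<close> fixes \<open>t\<^sup>e\<close>.\<close>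

lemma conj_prod_dvd:
  assumes e: "e > 0" and b: "fps_nth b 0 = 0" "arc_eval G (fps_X ^ e) b = 0" and inj: "inj_on (\<lambda>\<zeta>. rot \<zeta> b) {\<zeta>. \<zeta> ^ e = 1}"
  shows "\<exists>P Q. conj_prod e b = sub P (XX ^ e) YY \<and> G = P * Q \<and> (conv b \<longrightarrow> convergent2 P) \<and> (conv b \<and> convergent2 G \<longrightarrow> convergent2 Q)"
proof -
  define H where "H = sub G (XX ^ e) YY"
  have xe: "XX ^ e \<in> max_ideal" using e by auto
  have roots: "arc_eval H fps_X (rot \<zeta> b) = 0" if "\<zeta> ^ e = 1" for \<zeta>
  proof -
    have "arc_eval H fps_X (rot \<zeta> b) = arc_eval G (fps_X ^ e) (rot \<zeta> b)"
      unfolding H_def using b xe by (subst arc_sub) (auto simp: arc_power arc_XX arc_YY)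
    also have "\<dots> = rot \<zeta> 0" using arc_conjugate[OF b(1) that e, of G] b(2) by simp
    finally show ?thesis by (simp add: rot_def)
  qed
  obtain Q where Q: "H = conj_prod e b * Q"
     "convergent2 H \<and> (\<forall>z\<in>{\<zeta>. \<zeta> ^ e = 1}. conv (rot z b)) \<longrightarrow> convergent2 Q"
  proof -
    have "fps_nth (rot z b) 0 = 0" for z using b by simp
    from distinct_roots_division[OF finite_roots[OF e] this _ inj, of H] roots
    show thesis using that unfolding conj_prod_def by blast
  qed
  have crot: "conv (rot z b)" if "conv b" for z
    unfolding rot_def using that by (intro conv_compose conv_mult) auto
  \<comment> \<open>Dividend and divisor are invariant under the rotation, hence so is the quotient,
    and the factorization descends from \<open>t\<close> to \<open>x = t ^ e\<close>.\<close>
  have "rotx \<zeta> Q = Q" if z: "\<zeta> ^ e = 1" for \<zeta>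
  proof -
    have "conj_prod e b * rotx \<zeta> Q = rotx \<zeta> H" by (simp add: Q(1) rotx_mult rotx_conj_prod z e)
    also have "\<dots> = conj_prod e b * Q" using rotx_sub_XX_power[OF z e] by (simp add: H_def flip: Q(1))
    finally show ?thesis using conj_prod_nonzero[OF e] by simp
  qed
  from rotx_invariant[OF e this] obtain Q' where Q': "Q = sub Q' (XX ^ e) YY" "convergent2 Q \<longrightarrow> convergent2 Q'" by blast
  from rotx_invariant[OF e rotx_conj_prod[OF _ e]] obtain P where P: "conj_prod e b = sub P (XX ^ e) YY" "convergent2 (conj_prod e b) \<longrightarrow> convergent2 P" by blast
  have "sub G (XX ^ e) YY = sub (P * Q') (XX ^ e) YY" using Q(1) xe by (simp add: H_def P Q' sub_mult)
  then have G: "G = P * Q'" by (rule sub_XX_power_inj[OF e])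
  have cpx: "convergent2 (px c)" if cc: "conv c" for c
  proof -
    obtain C R where C: "C \<ge> 0" "R \<ge> 1" "\<And>i. norm (fps_nth c i) \<le> C * R ^ i" using cc[unfolded conv_bound] by blast
    then show ?thesis by (intro convergent2I[of C R]) (auto simp: coef2_px)
  qed
  have cYY: "convergent2 YY" by (intro convergent2I[of 1 1]) (auto simp: coef2_YY)
  have "convergent2 (conj_prod e b)" if "conv b"
  proof -
    have "convergent2 (prod f A)" if "\<And>x. x \<in> A \<Longrightarrow> convergent2 (f x)" for f and A :: "complex set"
      using that by (induction A rule: infinite_finite_induct) (auto intro: convergent2_1 convergent2_mult)
    moreover have "convergent2 (YY - px (rot z b))" for z
      unfolding diff_conv_add_uminus by (intro convergent2_add convergent2_uminus cYY cpx crot[OF \<open>conv b\<close>])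
    ultimately show ?thesis unfolding conj_prod_def by simp
  qed
  moreover have "convergent2 H" if cG: "convergent2 G"
  proof -
    obtain C R where C: "C \<ge> 0" "R \<ge> 1" "\<And>i j. norm (coef2 G i j) \<le> C * R ^ (i + j)" using cG by (rule convergent2E) blast
    show ?thesis
    proof (rule convergent2I[of C R])
      fix i j
      have "C * R ^ (i div e + j) \<le> C * R ^ (i + j)" using C by (intro mult_left_mono power_increasing) auto
      then show "norm (coef2 H i j) \<le> C * R ^ (i + j)"
        using C(1,2) C(3)[of "i div e" j] by (auto simp: H_def has_wt_compose_XX(1) e)
    qed (use C in auto)
  qed
  ultimately have "conv b \<longrightarrow> convergent2 P" "conv b \<and> convergent2 G \<longrightarrow> convergent2 Q'"
    using P(2) Q(2) Q'(2) crot by auto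
  then show ?thesis using P(1) G by (intro exI[of _ P] exI[of _ Q'] conjI)
qed

section \<open>Irreducible germs and the ideal of a branch\<close>

lemma series_of_mult: "series_of (a * b) = series_of a * series_of b" by (rule times_germ2.rep_eq)
lemma series_of_1 [simp]: "series_of 1 = 1" by (rule one_germ2.rep_eq)
lemma series_of_power: "series_of (a ^ n) = series_of a ^ n" by (induction n) (auto simp: series_of_mult)
lemma convergent2_series_of: "convergent2 (series_of a)" using series_of[of a] by simp

lemma germ_unit_coef:
  assumes "w dvd 1" shows "coef2 (series_of w) 0 0 \<noteq> 0"
proof -
  obtain v where "1 = w * v" using assms by (elim dvdE)
  then have "series_of w * series_of v = 1" by (metis series_of_mult series_of_1)
  then show ?thesis by (rule unit2_coef)
qed

text \<open>Irreducibility refers to convergent series, which is why both factors have to converge.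
  A factor vanishing at the origin is no unit, so the other one is.\<close>

lemma irreducible_cofactor:
  assumes h: "irreducible h" and eq: "series_of h = P * Q" and c: "convergent2 P" "convergent2 Q" and P: "coef2 P 0 0 = 0"
  shows "coef2 Q 0 0 \<noteq> 0"
proof -
  have s: "series_of (Germ2 P) = P" "series_of (Germ2 Q) = Q" using c by (simp_all add: Germ2_inverse)
  have "series_of h = series_of (Germ2 P * Germ2 Q)" by (simp add: series_of_mult s eq)
  then have "h = Germ2 P * Germ2 Q" by (simp add: series_of_inject)
  then have "Germ2 P dvd 1 \<or> Germ2 Q dvd 1" by (rule irreducibleD[OF h])
  then show ?thesis using germ_unit_coef P s by metis
qed

lemma swap2_prod_list: "swap2 (prod_list Fs) = (\<Prod>F\<leftarrow>Fs. swap2 F)"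
  by (simp add: swap2_def sub_prod_list)

lemma arc_y0: "arc_eval G z 0 = fps_compose (fps_nth G 0) z"
proof (rule fps_ext)
  fix n
  have "fps_nth (arc_eval G z 0) n = (\<Sum>i\<le>n. \<Sum>j\<le>n. if j = 0 then coef2 G i 0 * fps_nth (z ^ i) n else 0)"
    unfolding arc_eval_def fps_nth_Abs_fps by (intro sum.cong refl) (auto simp: power_0_left)
  then show "fps_nth (arc_eval G z 0) n = fps_nth (fps_compose (fps_nth G 0) z) n"
    by (simp add: sum.delta fps_compose_nth atLeast0AtMost coef2_def)
qed

text \<open>Covers the branch \<open>x = 0\<close>, the only one whose first component cannot be
  normalized to a power of \<open>t\<close>.\<close>

lemma arc_x0_division:
  assumes b: "b \<noteq> 0" "fps_nth b 0 = 0" and g: "arc_eval g 0 b = 0"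
  shows "\<exists>Q. g = XX * Q \<and> (convergent2 g \<longrightarrow> convergent2 Q)"
proof -
  have "arc_eval (swap2 g) b 0 = 0" using b g by (simp add: arc_swap2)
  then have "fps_nth (swap2 g) 0 = 0" using b by (simp add: arc_y0 fps_compose_eq_0_iff)
  then have z: "coef2 g 0 j = 0" for j using coef2_swap2[of g j 0] by (simp add: coef2_def)
  define Q where "Q = Abs_fps (\<lambda>j. fps_shift 1 (fps_nth g j))"
  have "g = XX * Q" using z by (intro coef2_eqI) (auto simp: coef2_def XX_def Q_def)
  moreover have "convergent2 Q" if "convergent2 g"
  proof (rule convergent2_weight[OF that, where a = 1 and b = 0])
    fix i j
    have "1 * norm (coef2 g (i + 1) j) \<le> real (Suc i) * real (Suc j) * norm (coef2 g (i + 1) j)"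
      by (intro mult_right_mono) (simp_all add: algebra_simps)
    then show "norm (coef2 Q i j) \<le> real (Suc i) * real (Suc j) * norm (coef2 g (i + 1) (j + 0))"
      by (simp add: Q_def coef2_def)
  qed
  ultimately show ?thesis by blast
qed

lemma conj_prod_coef_00: "fps_nth b 0 = 0 \<Longrightarrow> e > 0 \<Longrightarrow> coef2 (conj_prod e b) 0 0 = 0"
proof -
  assume b: "fps_nth b 0 = 0" and e: "e > 0"
  have "conj_prod e b = (YY - px (rot 1 b)) * (\<Prod>\<zeta>\<in>{\<zeta>. \<zeta> ^ e = 1} - {1}. YY - px (rot \<zeta> b))"
    unfolding conj_prod_def using finite_roots[OF e] by (intro prod.remove) auto
  then show ?thesis using b by (simp add: coef2_mult_00 coef2_YY coef2_px)
qed

lemma conj_prod_root: "fps_nth b 0 = 0 \<Longrightarrow> e > 0 \<Longrightarrow> arc_eval (conj_prod e b) fps_X b = 0"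
proof -
  assume b: "fps_nth b 0 = 0" and e: "e > 0"
  have r1: "rot 1 b = b" by (rule fps_ext) simp
  have "conj_prod e b = (YY - px (rot 1 b)) * (\<Prod>\<zeta>\<in>{\<zeta>. \<zeta> ^ e = 1} - {1}. YY - px (rot \<zeta> b))"
    unfolding conj_prod_def using finite_roots[OF e] by (intro prod.remove) auto
  then show ?thesis using b by (simp add: r1 arc_mult arc_diff arc_YY arc_px)
qed

text \<open>A branch generates the ideal of all formal power series vanishing on its parametrization;
  this is how irreducibility enters.\<close>

lemma branch_ideal:
  assumes h: "irreducible h" and prim: "primitive_arc a b" and v: "arc_eval (series_of h) a b = 0" and g: "arc_eval g a b = 0"
  shows "\<exists>Q. g = series_of h * Q"
proof -
  have ab: "fps_nth a 0 = 0" "fps_nth b 0 = 0" "conv a" "conv b" "a \<noteq> 0 \<or> b \<noteq> 0"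
    using prim by (auto simp: primitive_arc_def analytic_arc_def)
  note ch = convergent2_series_of[of h]
  show ?thesis
  proof (cases "a = 0")
    case True
    then have b: "b \<noteq> 0" using ab by simp
    obtain Q where Q: "series_of h = XX * Q" "convergent2 Q"
      using arc_x0_division[OF b ab(2), of "series_of h"] v ch True by auto
    have "convergent2 XX" by (intro convergent2I[of 1 1]) (auto simp: coef2_XX)
    then have "coef2 Q 0 0 \<noteq> 0" using irreducible_cofactor[OF h Q(1)] Q(2) by (simp add: coef2_XX)
    then obtain Q' where Q': "Q * Q' = 1" using unit2_inverse by blast
    obtain R where R: "g = XX * R" using arc_x0_division[OF b ab(2), of g] g True by auto
    have "g = series_of h * (Q' * R)" using Q' unfolding R Q(1) by (metis mult.assoc mult_1_right)
    then show ?thesis by blast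
  next
    case False
    define e where "e = subdegree a"
    have e: "e > 0" using False ab(1) by (auto simp: e_def subdegree_eq_0_iff intro!: gr0I)
    obtain \<rho> \<sigma> where \<rho>: "fps_nth \<rho> 0 = 0" "fps_nth \<sigma> 0 = 0" "subdegree \<rho> = 1" "subdegree \<sigma> = 1"
      "fps_compose \<rho> \<sigma> = fps_X" "fps_compose \<sigma> \<rho> = fps_X" "fps_compose a \<sigma> = fps_X ^ e" "conv \<sigma>"
      by (rule normalize_arc[OF False ab(1), folded e_def]) (use ab in auto)
    define b0 where "b0 = fps_compose b \<sigma>"
    have b0: "fps_nth b0 0 = 0" "conv b0" using ab \<rho> by (auto simp: b0_def intro!: conv_compose)
    have inj: "inj_on (\<lambda>\<zeta>. rot \<zeta> b0) {\<zeta>. \<zeta> ^ e = 1}"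
      unfolding b0_def by (rule conjugates_distinct[OF primitive_imp_formally_primitive[OF prim] ab(1,2) \<rho>(1-3,6,7) e])
    have van: "arc_eval k (fps_X ^ e) b0 = 0" if "arc_eval k a b = 0" for k
    proof -
      have "arc_eval k (fps_X ^ e) b0 = fps_compose (arc_eval k a b) \<sigma>"
        unfolding \<rho>(7)[symmetric] b0_def using ab \<rho> by (intro arc_compose)
      then show ?thesis using that by simp
    qed
    \<comment> \<open>The norm of \<open>y - b0\<close> descends to \<open>P\<close> and divides
      every series vanishing on the arc: the equation of the branch, with a unit as cofactor by
      irreducibility, and likewise \<open>g\<close>.\<close>
    obtain P Q where P: "conj_prod e b0 = sub P (XX ^ e) YY" "series_of h = P * Q" "convergent2 P" "convergent2 Q"
      using conj_prod_dvd[OF e b0(1) van[OF v] inj] b0(2) ch by blast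
    have "coef2 P 0 0 = 0" using conj_prod_coef_00[OF b0(1) e] by (simp add: P(1) coef2_sub_00)
    then have "coef2 Q 0 0 \<noteq> 0" by (rule irreducible_cofactor[OF h P(2-4)])
    then obtain Q' where Q': "Q * Q' = 1" using unit2_inverse by blast
    obtain P2 R where R: "conj_prod e b0 = sub P2 (XX ^ e) YY" "g = P2 * R"
      using conj_prod_dvd[OF e b0(1) van[OF g] inj] by blast
    have "P2 = P" using P(1) R(1) sub_XX_power_inj[OF e] by metis
    then have "g = series_of h * (Q' * R)" using Q' unfolding R(2) P(2) by (metis mult.assoc mult_1_right)
    then show ?thesis by blast
  qed
qed

text \<open>The branch enters through its vanishing ideal, since being a generator of it survives
  formal coordinate changes and the exchange of the variables. The norm \<open>P\<close> divides
  \<open>h\<close> and vanishes on the arc, so \<open>h\<close> divides \<open>P\<close> in turn and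
  they differ by a unit.\<close>

lemma branch_equation:
  assumes ker: "\<And>g. arc_eval g a b = 0 \<Longrightarrow> \<exists>Q. g = h * Q" and v: "arc_eval h a b = 0"
    and p: "formally_primitive a b" and ab: "fps_nth a 0 = 0" "fps_nth b 0 = 0"
    and \<sigma>: "fps_nth \<rho> 0 = 0" "fps_nth \<sigma> 0 = 0" "subdegree \<rho> = 1" "fps_compose \<sigma> \<rho> = fps_X" "fps_compose a \<sigma> = fps_X ^ e" "e > 0"
  shows "\<exists>E. coef2 E 0 0 \<noteq> 0 \<and> sub h (XX ^ e) YY = E * conj_prod e (fps_compose b \<sigma>)"
proof -
  define b0 where "b0 = fps_compose b \<sigma>"
  have b0: "fps_nth b0 0 = 0" using ab by (simp add: b0_def)
  have s0: "\<sigma> \<noteq> 0" using \<sigma>(4) by auto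
  have xe: "XX ^ e \<in> max_ideal" using \<sigma> by auto
  have inj: "inj_on (\<lambda>\<zeta>. rot \<zeta> b0) {\<zeta>. \<zeta> ^ e = 1}"
    unfolding b0_def by (rule conjugates_distinct[OF p ab \<sigma>])
  have comp: "arc_eval k (fps_X ^ e) b0 = fps_compose (arc_eval k a b) \<sigma>" for k
    unfolding \<sigma>(5)[symmetric] b0_def using ab \<sigma> by (intro arc_compose)
  have "arc_eval h (fps_X ^ e) b0 = 0" by (simp add: comp v)
  from conj_prod_dvd[OF \<sigma>(6) b0 this inj] obtain P Q where P: "conj_prod e b0 = sub P (XX ^ e) YY" "h = P * Q" by blast
  have "fps_compose (arc_eval P a b) \<sigma> = arc_eval (sub P (XX ^ e) YY) fps_X b0"
    unfolding comp[symmetric] using b0 xe by (subst arc_sub) (auto simp: arc_power arc_XX arc_YY)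
  also have "\<dots> = 0" using conj_prod_root[OF b0 \<sigma>(6)] by (simp add: P)
  finally have "arc_eval P a b = 0" using \<sigma>(2) s0 by (simp add: fps_compose_eq_0_iff)
  then obtain Q2 where "P = h * Q2" using ker by blast
  then have "P * (Q * Q2) = P * 1" by (simp add: P(2) mult.assoc)
  moreover have "P \<noteq> 0" using P(1) conj_prod_nonzero[OF \<sigma>(6), of b0] by auto
  ultimately have "Q * Q2 = 1" by (simp only: mult_cancel_left) simp
  then have "coef2 Q 0 0 \<noteq> 0" by (rule unit2_coef)
  moreover have "sub h (XX ^ e) YY = sub Q (XX ^ e) YY * conj_prod e b0"
    unfolding P using xe by (simp add: sub_mult)
  ultimately show ?thesis unfolding b0_def by (intro exI[of _ "sub Q (XX ^ e) YY"]) (simp add: coef2_sub_00)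
qed

text \<open>The map \<open>\<zeta> \<mapsto> \<xi> * \<zeta> ^ d\<close> sends the
  \<open>(m * d)\<close>-th roots of unity onto the \<open>m\<close>-th ones, with \<open>d\<close>
  elements in every fibre.\<close>

lemma prod_power_map:
  fixes G :: "complex \<Rightarrow> complex fps fps"
  assumes d: "d > 0" and m: "m > 0" and \<xi>: "\<xi> ^ m = 1"
  shows "(\<Prod>\<zeta>\<in>{\<zeta>. \<zeta> ^ (m * d) = 1}. G (\<xi> * \<zeta> ^ d)) = (\<Prod>\<eta>\<in>{\<eta>. \<eta> ^ m = 1}. G \<eta>) ^ d"
proof -
  let ?S = "{\<zeta>::complex. \<zeta> ^ (m * d) = 1}" and ?T = "{\<eta>::complex. \<eta> ^ m = 1}"
  have \<xi>0: "\<xi> \<noteq> 0" using \<xi> m by (auto simp: power_0_left)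
  have fib: "{\<zeta> \<in> ?S. \<xi> * \<zeta> ^ d = \<eta>} = {\<zeta>. \<zeta> ^ d = \<eta> / \<xi>}" if "\<eta> \<in> ?T" for \<eta>
  proof -
    have "\<zeta> ^ (m * d) = 1" if "\<zeta> ^ d = \<eta> / \<xi>" for \<zeta>
    proof -
      have "\<zeta> ^ (m * d) = (\<eta> / \<xi>) ^ m" by (simp add: that[symmetric] power_mult[symmetric] mult.commute)
      then show ?thesis using \<open>\<eta> \<in> ?T\<close> \<xi> by (simp add: power_divide)
    qed
    then show ?thesis using \<xi>0 by (auto simp: field_simps)
  qed
  have "(\<Prod>\<zeta>\<in>?S. G (\<xi> * \<zeta> ^ d)) = (\<Prod>\<eta>\<in>?T. \<Prod>\<zeta>\<in>{\<zeta> \<in> ?S. \<xi> * \<zeta> ^ d = \<eta>}. G (\<xi> * \<zeta> ^ d))"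
    using d m \<xi> by (intro prod.group[symmetric] finite_roots) (auto simp: power_mult_distrib power_mult[symmetric] mult.commute)
  also have "\<dots> = (\<Prod>\<eta>\<in>?T. G \<eta> ^ d)"
  proof (intro prod.cong refl)
    fix \<eta> assume \<eta>: "\<eta> \<in> ?T"
    then have "\<eta> \<noteq> 0" using m by (auto simp: power_0_left)
    then have "card {\<zeta>. \<zeta> ^ d = \<eta> / \<xi>} = d" using \<xi>0 d by (intro card_nth_roots) auto
    moreover have "(\<Prod>\<zeta>\<in>{\<zeta> \<in> ?S. \<xi> * \<zeta> ^ d = \<eta>}. G (\<xi> * \<zeta> ^ d)) = (\<Prod>\<zeta>\<in>{\<zeta> \<in> ?S. \<xi> * \<zeta> ^ d = \<eta>}. G \<eta>)"
      by (intro prod.cong) auto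
    ultimately show "(\<Prod>\<zeta>\<in>{\<zeta> \<in> ?S. \<xi> * \<zeta> ^ d = \<eta>}. G (\<xi> * \<zeta> ^ d)) = G \<eta> ^ d"
      by (simp only: fib[OF \<eta>] prod_constant)
  qed
  finally show ?thesis by (simp add: prod_power_distrib)
qed

text \<open>\<open>D(u, v)\<close> is up to a unit the product of the factors \<open>v - F(\<gamma>(u), u)\<close>, where \<open>\<gamma>\<close> runs over the roots of \<open>J\<close>;
  \<open>N\<close> is a common denominator of the exponents of these Puiseux series.\<close>

definition root_data :: "complex fps fps \<Rightarrow> complex fps fps \<Rightarrow> complex fps fps \<Rightarrow> bool" where
  "root_data F J D \<longleftrightarrow> (\<exists>N \<gamma>s E W. N > 0 \<and> (\<forall>\<gamma>\<in>set \<gamma>s. fps_nth \<gamma> 0 = 0) \<and> coef2 E 0 0 \<noteq> 0 \<and> coef2 W 0 0 \<noteq> 0 \<and>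
     sub J XX (YY ^ N) = E * (\<Prod>\<gamma>\<leftarrow>\<gamma>s. XX - py \<gamma>) \<and>
     sub D (XX ^ N) YY = W * (\<Prod>\<gamma>\<leftarrow>\<gamma>s. YY - px (arc_eval F \<gamma> (fps_X ^ N))))"

text \<open>\<open>(Z, U)\<close> are source coordinates whose second member is the first component of the morphism, and
  \<open>(Px, Py)\<close> is the inverse coordinate change.\<close>

locale coord_change =
  fixes Px Py Z U :: "complex fps fps"
  assumes max: "Px \<in> max_ideal" "Py \<in> max_ideal" "Z \<in> max_ideal" "U \<in> max_ideal"
    and inv: "sub Px Z U = XX" "sub Py Z U = YY" "sub Z Px Py = XX" "sub U Px Py = YY"
begin

definition "new F = sub F Px Py"

lemma new_mult: "new (F * G) = new F * new G" using max by (simp add: new_def sub_mult)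
lemma new_1: "new 1 = 1" by (simp add: new_def)

text \<open>In parameters where \<open>u = t ^ e\<close> on the source branch and the first
  component of the image branch is \<open>t ^ m\<close>, the map of branches is
  \<open>\<xi> * t ^ d\<close> with \<open>e = m * d\<close>. The \<open>e\<close> conjugate roots
  of \<open>h\<close> then hit each of the \<open>m\<close> conjugate roots of \<open>H\<close>
  exactly \<open>d\<close> times, which is the power \<open>H ^ d\<close> of the direct
  image.\<close>

lemma maps_branch_roots:
  assumes mb: "maps_branch l f h d H" and l: "U = series_of l" and q: "z_order (new (series_of h)) q"
  shows "root_data (new (series_of f)) (new (series_of h)) (series_of H ^ d)"
proof -
  obtain a b a' b' s where ir: "irreducible h" "irreducible H"
    and prim: "primitive_arc a b" "primitive_arc a' b'"
    and van: "arc_eval (series_of h) a b = 0" "arc_eval (series_of H) a' b' = 0"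
    and s: "s \<noteq> 0" "fps_nth s 0 = 0" "subdegree s = d"
    and as: "arc_eval (series_of l) a b = fps_compose a' s" and bs: "arc_eval (series_of f) a b = fps_compose b' s"
    using mb unfolding maps_branch_def parametrizes_def subst_arc_eq by blast
  have ab: "fps_nth a 0 = 0" "fps_nth b 0 = 0" "a \<noteq> 0 \<or> b \<noteq> 0" "fps_nth a' 0 = 0" "fps_nth b' 0 = 0"
    using prim by (auto simp: primitive_arc_def analytic_arc_def)
  define z where "z = arc_eval Z a b"
  define u where "u = arc_eval U a b"
  have zu: "fps_nth z 0 = 0" "fps_nth u 0 = 0" using max by (auto simp: z_def u_def max_ideal_iff)
  have a_eq: "a = arc_eval Px z u" and b_eq: "b = arc_eval Py z u"
    using arc_sub[OF ab(1,2) max(3,4), of Px] arc_sub[OF ab(1,2) max(3,4), of Py] arc_XX[OF ab(1,2)] arc_YY[OF ab(1,2)]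
    by (simp_all add: z_def u_def inv)
  have new_arc: "arc_eval (new k) z u = arc_eval k a b" for k
    unfolding new_def using zu max by (simp add: arc_sub flip: a_eq b_eq)
  have u_eq: "u = fps_compose a' s" unfolding u_def l by (rule as)
  \<comment> \<open>The branch is not the curve \<open>u = 0\<close>: as \<open>h\<close> is regular
    in \<open>z\<close>, \<open>u = 0\<close> would force \<open>z = 0\<close>, and the arc would be
    constant.\<close>
  have u0: "u \<noteq> 0"
  proof
    assume u0: "u = 0"
    have "arc_eval (new (series_of h)) z 0 = 0" using new_arc[of "series_of h"] van u0 by simp
    moreover have "fps_nth (new (series_of h)) 0 \<noteq> 0" using q by (auto simp: z_order_def coef2_def)
    ultimately have "z = 0" using zu by (auto simp: arc_y0 fps_compose_eq_0_iff)
    then have "a = 0" "b = 0" using a_eq b_eq u0 max by (simp_all add: arc_y0 max_ideal_iff coef2_def)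
    then show False using ab by simp
  qed
  have a'0: "a' \<noteq> 0" using u_eq u0 by auto
  define e where "e = subdegree u"
  define m where "m = subdegree a'"
  have e: "e > 0" using u0 zu by (auto simp: e_def subdegree_eq_0_iff intro!: gr0I)
  have m: "m > 0" using a'0 ab by (auto simp: m_def subdegree_eq_0_iff intro!: gr0I)
  obtain \<rho> \<sigma> where \<rho>: "fps_nth \<rho> 0 = 0" "fps_nth \<sigma> 0 = 0" "subdegree \<rho> = 1" "subdegree \<sigma> = 1"
    "fps_compose \<rho> \<sigma> = fps_X" "fps_compose \<sigma> \<rho> = fps_X" "fps_compose u \<sigma> = fps_X ^ e"
    by (rule normalize_arc[OF u0 zu(2), folded e_def])
  obtain \<rho>' \<sigma>' where \<rho>': "fps_nth \<rho>' 0 = 0" "fps_nth \<sigma>' 0 = 0" "subdegree \<rho>' = 1" "subdegree \<sigma>' = 1"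
    "fps_compose \<rho>' \<sigma>' = fps_X" "fps_compose \<sigma>' \<rho>' = fps_X" "a' = \<rho>' ^ m" "fps_compose a' \<sigma>' = fps_X ^ m"
    by (rule normalize_arc[OF a'0 ab(4), folded m_def])
  define hs where "hs = swap2 (new (series_of h))"
  define z0 where "z0 = fps_compose z \<sigma>"
  have z00: "fps_nth z0 0 = 0" using zu by (simp add: z0_def)
  have "\<exists>E. coef2 E 0 0 \<noteq> 0 \<and> sub hs (XX ^ e) YY = E * conj_prod e (fps_compose z \<sigma>)"
  proof (rule branch_equation[OF _ _ _ zu(2,1) \<rho>(1-3,6,7) e])
    show "\<exists>Q. g = hs * Q" if "arc_eval g u z = 0" for g
    proof -
      have "arc_eval (sub (swap2 g) Z U) a b = 0"
        using that max ab zu by (simp add: arc_sub arc_swap2 flip: z_def u_def)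
      then obtain Q where "sub (swap2 g) Z U = series_of h * Q" using branch_ideal[OF ir(1) prim(1) van(1)] by blast
      then have "sub (sub (swap2 g) Z U) Px Py = new (series_of h) * new Q" by (simp add: new_mult flip: new_def)
      moreover have "sub (sub (swap2 g) Z U) Px Py = swap2 g" using max by (simp add: sub_sub inv)
      ultimately have "swap2 (swap2 g) = hs * swap2 (new Q)" by (simp add: hs_def swap2_mult del: swap2_swap2)
      then show ?thesis by auto
    qed
    show "arc_eval hs u z = 0" using zu by (simp add: hs_def arc_swap2 new_arc van)
    show "formally_primitive u z"
      unfolding formally_primitive_def
    proof
      assume "\<exists>u' z' s. fps_nth u' 0 = 0 \<and> fps_nth z' 0 = 0 \<and> 2 \<le> subdegree s \<and> u = fps_compose u' s \<and> z = fps_compose z' s"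
      then obtain u' z' t where t: "fps_nth u' 0 = 0" "fps_nth z' 0 = 0" "2 \<le> subdegree t" "u = fps_compose u' t" "z = fps_compose z' t" by blast
      have t0: "fps_nth t 0 = 0" using t(3) by (intro nth_less_subdegree_zero) simp
      have "a = fps_compose (arc_eval Px z' u') t" "b = fps_compose (arc_eval Py z' u') t"
        unfolding a_eq b_eq t(4,5) by (intro arc_compose t t0)+
      moreover have "fps_nth (arc_eval Px z' u') 0 = 0" "fps_nth (arc_eval Py z' u') 0 = 0" using max by (simp_all add: max_ideal_iff)
      ultimately show False using primitive_imp_formally_primitive[OF prim(1)] t(3) unfolding formally_primitive_def by blast
    qed
  qed
  then obtain E where E: "coef2 E 0 0 \<noteq> 0" "sub hs (XX ^ e) YY = E * conj_prod e z0" by (auto simp: z0_def)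
  define b2 where "b2 = fps_compose b' \<sigma>'"
  have b20: "fps_nth b2 0 = 0" using ab by (simp add: b2_def)
  have "\<exists>W. coef2 W 0 0 \<noteq> 0 \<and> sub (series_of H) (XX ^ m) YY = W * conj_prod m (fps_compose b' \<sigma>')"
    by (rule branch_equation[OF branch_ideal[OF ir(2) prim(2) van(2)] van(2) primitive_imp_formally_primitive[OF prim(2)] ab(4,5) \<rho>'(1-3,6,8) m])
  then obtain W where W: "coef2 W 0 0 \<noteq> 0" "sub (series_of H) (XX ^ m) YY = W * conj_prod m b2" by (auto simp: b2_def)
  \<comment> \<open>The map \<open>s\<close> in the normalized parameters. Its \<open>m\<close>-th
    power is \<open>t ^ e\<close>, so it is a monomial, and its exponent is the degree
    \<open>d\<close>.\<close>
  define s2 where "s2 = fps_compose (fps_compose \<rho>' s) \<sigma>"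
  have s20: "fps_nth s2 0 = 0" using s \<rho> \<rho>' by (simp add: s2_def)
  have "s2 ^ m = fps_compose (fps_compose a' s) \<sigma>"
    unfolding \<rho>'(7) s2_def using s(2) \<rho>(2) by (simp add: compose_pow)
  also have "\<dots> = fps_X ^ e" using \<rho>(7) by (simp add: u_eq)
  finally obtain \<xi> k where k: "e = m * k" "\<xi> ^ m = 1" "s2 = fps_const \<xi> * fps_X ^ k"
    using root_of_monomial[OF _ m] by blast
  have "\<xi> \<noteq> 0" using k m by (auto simp: power_0_left)
  then have "k = subdegree s2" by (simp add: k)
  also have "\<dots> = d" using s \<rho> \<rho>' by (simp add: s2_def)
  finally have kd: "k = d" .
  have d: "d > 0" using e k kd by (cases d) auto
  have bs2: "fps_compose (fps_compose b' s) \<sigma> = fps_compose b2 s2"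
  proof -
    have "fps_compose b2 s2 = fps_compose b' (fps_compose \<sigma>' s2)"
      unfolding b2_def by (rule fps_compose_assoc[OF s20 \<rho>'(2), symmetric])
    also have "fps_compose \<sigma>' s2 = fps_compose (fps_compose \<sigma>' (fps_compose \<rho>' s)) \<sigma>"
      unfolding s2_def using \<rho>(2) \<rho>'(1) s(2) by (intro fps_compose_assoc) auto
    also have "fps_compose \<sigma>' (fps_compose \<rho>' s) = s"
      using \<rho>'(1,6) s(2) by (simp add: fps_compose_assoc)
    also have "fps_compose b' (fps_compose s \<sigma>) = fps_compose (fps_compose b' s) \<sigma>"
      by (rule fps_compose_assoc[OF \<rho>(2) s(2)])
    finally show ?thesis ..
  qed
  \<comment> \<open>The conjugate by \<open>\<eta>\<close> of the root of \<open>H\<close>, pulled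
    back to the parameter of the source, where \<open>u = t ^ e = (t ^ d) ^ m\<close>.\<close>
  define w where "w \<eta> = fps_compose (rot \<eta> b2) (fps_X ^ d)" for \<eta>
  have w_eq: "w \<eta> = Abs_fps (\<lambda>n. if d dvd n then \<eta> ^ (n div d) * fps_nth b2 (n div d) else 0)" for \<eta>
    using d by (intro fps_ext) (simp add: w_def fps_nth_compose_X_pow)
  have roots: "arc_eval (new (series_of f)) (rot \<zeta> z0) (fps_X ^ e) = w (\<xi> * \<zeta> ^ d)" if \<zeta>: "\<zeta> ^ e = 1" for \<zeta>
  proof -
    have "arc_eval (new (series_of f)) (rot \<zeta> z0) (fps_X ^ e) = arc_eval (swap2 (new (series_of f))) (fps_X ^ e) (rot \<zeta> z0)"
      using e z00 by (simp add: arc_swap2)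
    also have "\<dots> = rot \<zeta> (arc_eval (swap2 (new (series_of f))) (fps_X ^ e) z0)" by (rule arc_conjugate[OF z00 \<zeta> e])
    also have "arc_eval (swap2 (new (series_of f))) (fps_X ^ e) z0 = arc_eval (new (series_of f)) z0 (fps_X ^ e)"
      using e z00 by (simp add: arc_swap2)
    also have "\<dots> = fps_compose (arc_eval (series_of f) a b) \<sigma>"
      unfolding \<rho>(7)[symmetric] z0_def new_arc[symmetric] by (rule arc_compose[OF zu \<rho>(2)])
    also have "\<dots> = fps_compose b2 (fps_const \<xi> * fps_X ^ d)" by (simp add: bs bs2 k kd)
    also have "\<dots> = w \<xi>"
    proof -
      have "fps_const \<xi> * fps_X ^ d = fps_compose (fps_const \<xi> * fps_X) (fps_X ^ d)"
        using d by (simp add: fps_compose_mult_distrib)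
      then show ?thesis unfolding w_def rot_def using d by (simp add: fps_compose_assoc)
    qed
    also have "rot \<zeta> (w \<xi>) = w (\<xi> * \<zeta> ^ d)"
    proof (rule fps_ext)
      fix n show "fps_nth (rot \<zeta> (w \<xi>)) n = fps_nth (w (\<xi> * \<zeta> ^ d)) n"
        by (auto simp: w_eq power_mult_distrib power_mult[symmetric] elim!: dvdE)
    qed
    finally show ?thesis .
  qed
  have fin: "finite {\<zeta>::complex. \<zeta> ^ e = 1}" by (rule finite_roots[OF e])
  obtain zs where zs: "set zs = {\<zeta>::complex. \<zeta> ^ e = 1}" "distinct zs" using finite_distinct_list[OF fin] by blast
  define \<gamma>s where "\<gamma>s = map (\<lambda>\<zeta>. rot \<zeta> z0) zs"
  have pl: "(\<Prod>\<zeta>\<in>{\<zeta>. \<zeta> ^ e = 1}. G \<zeta>) = (\<Prod>\<zeta>\<leftarrow>zs. G \<zeta>)" for G :: "complex \<Rightarrow> complex fps fps"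
    using zs by (metis prod.distinct_set_conv_list)
  have "sub (new (series_of h)) XX (YY ^ e) = swap2 (sub hs (XX ^ e) YY)"
  proof -
    have m: "XX ^ e \<in> max_ideal" "YY ^ e \<in> max_ideal" using e by auto
    have "swap2 (XX ^ e) = YY ^ e" by (simp add: swap2_def sub_power sub_XX)
    then have "swap2 (sub hs (XX ^ e) YY) = sub hs (YY ^ e) XX" using swap2_sub[OF m(1), of YY hs] by simp
    then show ?thesis unfolding hs_def using sub_swap2[OF m(2), of XX] by simp
  qed
  also have "\<dots> = swap2 E * (\<Prod>\<gamma>\<leftarrow>\<gamma>s. XX - py \<gamma>)"
    by (simp add: E swap2_mult conj_prod_def swap2_prod_list swap2_diff pl \<gamma>s_def comp_def)
  finally have R1: "sub (new (series_of h)) XX (YY ^ e) = swap2 E * (\<Prod>\<gamma>\<leftarrow>\<gamma>s. XX - py \<gamma>)" .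
  have xm: "XX ^ m \<in> max_ideal" "XX ^ d \<in> max_ideal" "XX ^ e \<in> max_ideal" using m d e by auto
  have sub_px': "sub (px c) (XX ^ d) YY = px (fps_compose c (fps_X ^ d))" for c
    using d by (intro coef2_eqI) (simp add: has_wt_compose_XX(1) coef2_px fps_nth_compose_X_pow)
  have "sub (series_of H) (XX ^ e) YY = sub (sub (series_of H) (XX ^ m) YY) (XX ^ d) YY"
    using xm by (simp add: sub_sub sub_power sub_XX sub_YY k kd power_mult mult.commute flip: power_mult)
  also have "\<dots> = sub W (XX ^ d) YY * (\<Prod>\<eta>\<in>{\<eta>. \<eta> ^ m = 1}. YY - px (w \<eta>))"
    using xm by (simp add: W sub_mult conj_prod_def sub_prod sub_diff sub_YY sub_px' w_def)
  finally have "sub (series_of H ^ d) (XX ^ e) YY = sub W (XX ^ d) YY ^ d * (\<Prod>\<eta>\<in>{\<eta>. \<eta> ^ m = 1}. YY - px (w \<eta>)) ^ d"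
    using xm by (simp add: sub_power power_mult_distrib)
  also have "(\<Prod>\<eta>\<in>{\<eta>. \<eta> ^ m = 1}. YY - px (w \<eta>)) ^ d = (\<Prod>\<zeta>\<in>{\<zeta>. \<zeta> ^ e = 1}. YY - px (w (\<xi> * \<zeta> ^ d)))"
    using prod_power_map[OF d m k(2), of "\<lambda>\<eta>. YY - px (w \<eta>)"] by (simp add: k kd)
  also have "\<dots> = (\<Prod>\<zeta>\<leftarrow>zs. YY - px (arc_eval (new (series_of f)) (rot \<zeta> z0) (fps_X ^ e)))"
    unfolding pl using zs by (intro arg_cong[of _ _ prod_list] map_cong refl) (simp add: roots)
  finally have R2: "sub (series_of H ^ d) (XX ^ e) YY = sub W (XX ^ d) YY ^ d * (\<Prod>\<gamma>\<leftarrow>\<gamma>s. YY - px (arc_eval (new (series_of f)) \<gamma> (fps_X ^ e)))"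
    by (simp add: \<gamma>s_def comp_def)
  have "coef2 (swap2 E) 0 0 \<noteq> 0" using E by (simp add: coef2_swap2)
  moreover have "coef2 (sub W (XX ^ d) YY ^ d) 0 0 \<noteq> 0"
  proof -
    have "coef2 (A ^ n) 0 0 = coef2 A 0 0 ^ n" for A n by (induction n) (auto simp: coef2_mult_00 coef2_1)
    then show ?thesis using W by (simp add: coef2_sub_00)
  qed
  moreover have "\<forall>\<gamma>\<in>set \<gamma>s. fps_nth \<gamma> 0 = 0" using z00 by (auto simp: \<gamma>s_def)
  ultimately show ?thesis unfolding root_data_def using R1 R2 e by blast
qed

end

section \<open>Root data of units, products and rescalings\<close>

lemma sub_px_XX_power: "d > 0 \<Longrightarrow> sub (px c) (XX ^ d) YY = px (fps_compose c (fps_X ^ d))"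
  by (intro coef2_eqI) (simp add: has_wt_compose_XX(1) coef2_px fps_nth_compose_X_pow)

lemma sub_py_py: "sub (py c) A (py b) = py (fps_compose c b)"
proof (rule coef2_eqI)
  fix i j
  have "coef2 (sub (py c) A (py b)) i j = (\<Sum>k\<le>i+j. if k = 0 then \<Sum>l\<le>i+j. fps_nth c l * coef2 (py (b ^ l)) i j else 0)"
    unfolding coef2_sub by (intro sum.cong refl) (simp add: coef2_py py_power)
  then show "coef2 (sub (py c) A (py b)) i j = coef2 (py (fps_compose c b)) i j"
    by (cases "i = 0") (simp_all add: sum.delta coef2_py fps_compose_nth atLeast0AtMost)
qed

lemma z_order_subdegree:
  assumes "fps_nth G 0 \<noteq> 0" shows "z_order G (subdegree (fps_nth G 0))"
  unfolding z_order_def coef2_def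
  by (intro conjI allI impI nth_less_subdegree_zero nth_subdegree_nonzero[OF assms])

lemma root_data_1: "root_data F 1 1"
  unfolding root_data_def
  by (intro exI[of _ 1] exI[of _ "[]"]) (auto simp: coef2_1)

lemma root_data_unit:
  assumes "root_data F J D" "coef2 v 0 0 \<noteq> 0" "coef2 w 0 0 \<noteq> 0"
  shows "root_data F (v * J) (w * D)"
proof -
  obtain N \<gamma>s E W where N: "N > 0" "\<forall>\<gamma>\<in>set \<gamma>s. fps_nth \<gamma> 0 = 0" "coef2 E 0 0 \<noteq> 0" "coef2 W 0 0 \<noteq> 0"
     "sub J XX (YY ^ N) = E * (\<Prod>\<gamma>\<leftarrow>\<gamma>s. XX - py \<gamma>)"
     "sub D (XX ^ N) YY = W * (\<Prod>\<gamma>\<leftarrow>\<gamma>s. YY - px (arc_eval F \<gamma> (fps_X ^ N)))"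
    using assms(1) unfolding root_data_def by blast
  have m: "XX ^ N \<in> max_ideal" "YY ^ N \<in> max_ideal" using N by auto
  show ?thesis unfolding root_data_def
  proof (intro exI conjI)
    show "coef2 (sub v XX (YY ^ N) * E) 0 0 \<noteq> 0" "coef2 (sub w (XX ^ N) YY * W) 0 0 \<noteq> 0"
      using assms N by (auto simp: coef2_mult_00 coef2_sub_00)
    show "sub (v * J) XX (YY ^ N) = sub v XX (YY ^ N) * E * (\<Prod>\<gamma>\<leftarrow>\<gamma>s. XX - py \<gamma>)"
      using m by (simp add: sub_mult N mult.assoc)
    show "sub (w * D) (XX ^ N) YY = sub w (XX ^ N) YY * W * (\<Prod>\<gamma>\<leftarrow>\<gamma>s. YY - px (arc_eval F \<gamma> (fps_X ^ N)))"
      using m by (simp add: sub_mult N mult.assoc)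
  qed (use N in auto)
qed

text \<open>Passes from \<open>N\<close> to a multiple, in order to bring two root data to a common
  denominator.\<close>

lemma root_data_refine:
  assumes N: "N > 0" "M > 0" "\<forall>\<gamma>\<in>set \<gamma>s. fps_nth \<gamma> 0 = 0"
    and J: "sub J XX (YY ^ N) = E * (\<Prod>\<gamma>\<leftarrow>\<gamma>s. XX - py \<gamma>)"
    and D: "sub D (XX ^ N) YY = W * (\<Prod>\<gamma>\<leftarrow>\<gamma>s. YY - px (arc_eval F \<gamma> (fps_X ^ N)))"
    and \<delta>: "\<delta>s = map (\<lambda>\<gamma>. fps_compose \<gamma> (fps_X ^ M)) \<gamma>s"
  shows "sub J XX (YY ^ (M * N)) = sub E XX (YY ^ M) * (\<Prod>\<gamma>\<leftarrow>\<delta>s. XX - py \<gamma>)"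
    and "sub D (XX ^ (M * N)) YY = sub W (XX ^ M) YY * (\<Prod>\<gamma>\<leftarrow>\<delta>s. YY - px (arc_eval F \<gamma> (fps_X ^ (M * N))))"
proof -
  have m: "XX ^ N \<in> max_ideal" "YY ^ N \<in> max_ideal" "XX ^ M \<in> max_ideal" "YY ^ M \<in> max_ideal" using N by auto
  have "sub J XX (YY ^ (M * N)) = sub (sub J XX (YY ^ N)) XX (YY ^ M)"
    using m by (simp add: sub_sub sub_XX sub_YY sub_power power_mult)
  also have "\<dots> = sub E XX (YY ^ M) * (\<Prod>\<gamma>\<leftarrow>\<delta>s. XX - py \<gamma>)"
    unfolding J \<delta> using m N by (simp add: sub_mult sub_prod_list sub_diff sub_XX sub_py_YY_power comp_def)
  finally show "sub J XX (YY ^ (M * N)) = sub E XX (YY ^ M) * (\<Prod>\<gamma>\<leftarrow>\<delta>s. XX - py \<gamma>)" .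
  have a: "fps_compose (arc_eval F \<gamma> (fps_X ^ N)) (fps_X ^ M) = arc_eval F (fps_compose \<gamma> (fps_X ^ M)) (fps_X ^ (M * N))"
    if "\<gamma> \<in> set \<gamma>s" for \<gamma>
    using N that by (subst arc_compose[symmetric]) (auto simp: compose_X_pow power_mult)
  have "sub D (XX ^ (M * N)) YY = sub (sub D (XX ^ N) YY) (XX ^ M) YY"
    using m by (simp add: sub_sub sub_XX sub_YY sub_power power_mult)
  also have "\<dots> = sub W (XX ^ M) YY * (\<Prod>\<gamma>\<leftarrow>\<delta>s. YY - px (arc_eval F \<gamma> (fps_X ^ (M * N))))"
    unfolding D \<delta> using m N a by (simp add: sub_mult sub_prod_list sub_diff sub_YY sub_px_XX_power comp_def cong: map_cong)
  finally show "sub D (XX ^ (M * N)) YY = sub W (XX ^ M) YY * (\<Prod>\<gamma>\<leftarrow>\<delta>s. YY - px (arc_eval F \<gamma> (fps_X ^ (M * N))))" .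
qed

lemma root_data_mult:
  assumes "root_data F J1 D1" "root_data F J2 D2"
  shows "root_data F (J1 * J2) (D1 * D2)"
proof -
  obtain N \<gamma>s E W where 1: "N > 0" "\<forall>\<gamma>\<in>set \<gamma>s. fps_nth \<gamma> 0 = 0" "coef2 E 0 0 \<noteq> 0" "coef2 W 0 0 \<noteq> 0"
     "sub J1 XX (YY ^ N) = E * (\<Prod>\<gamma>\<leftarrow>\<gamma>s. XX - py \<gamma>)"
     "sub D1 (XX ^ N) YY = W * (\<Prod>\<gamma>\<leftarrow>\<gamma>s. YY - px (arc_eval F \<gamma> (fps_X ^ N)))"
    using assms(1) unfolding root_data_def by blast
  obtain M \<delta>s E' W' where 2: "M > 0" "\<forall>\<gamma>\<in>set \<delta>s. fps_nth \<gamma> 0 = 0" "coef2 E' 0 0 \<noteq> 0" "coef2 W' 0 0 \<noteq> 0"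
     "sub J2 XX (YY ^ M) = E' * (\<Prod>\<gamma>\<leftarrow>\<delta>s. XX - py \<gamma>)"
     "sub D2 (XX ^ M) YY = W' * (\<Prod>\<gamma>\<leftarrow>\<delta>s. YY - px (arc_eval F \<gamma> (fps_X ^ M)))"
    using assms(2) unfolding root_data_def by blast
  define \<gamma>s' where "\<gamma>s' = map (\<lambda>\<gamma>. fps_compose \<gamma> (fps_X ^ M)) \<gamma>s"
  define \<delta>s' where "\<delta>s' = map (\<lambda>\<gamma>. fps_compose \<gamma> (fps_X ^ N)) \<delta>s"
  note r1 = root_data_refine[OF 1(1) 2(1) 1(2,5,6) \<gamma>s'_def]
  note r2 = root_data_refine[OF 2(1) 1(1) 2(2,5,6) \<delta>s'_def]
  have NM: "N * M = M * N" by simp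
  have m: "XX ^ (M * N) \<in> max_ideal" "YY ^ (M * N) \<in> max_ideal" using 1 2 by auto
  show ?thesis unfolding root_data_def
  proof (intro exI conjI)
    show "M * N > 0" using 1 2 by simp
    show "\<forall>\<gamma>\<in>set (\<gamma>s' @ \<delta>s'). fps_nth \<gamma> 0 = 0" using 1 2 by (auto simp: \<gamma>s'_def \<delta>s'_def)
    show "coef2 (sub E XX (YY ^ M) * sub E' XX (YY ^ N)) 0 0 \<noteq> 0" "coef2 (sub W (XX ^ M) YY * sub W' (XX ^ N) YY) 0 0 \<noteq> 0"
      using 1 2 by (auto simp: coef2_mult_00 coef2_sub_00)
    show "sub (J1 * J2) XX (YY ^ (M * N)) = sub E XX (YY ^ M) * sub E' XX (YY ^ N) * (\<Prod>\<gamma>\<leftarrow>\<gamma>s' @ \<delta>s'. XX - py \<gamma>)"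
      using m by (simp add: sub_mult r1 r2[unfolded NM] mult_ac)
    show "sub (D1 * D2) (XX ^ (M * N)) YY = sub W (XX ^ M) YY * sub W' (XX ^ N) YY * (\<Prod>\<gamma>\<leftarrow>\<gamma>s' @ \<delta>s'. YY - px (arc_eval F \<gamma> (fps_X ^ (M * N))))"
      using m by (simp add: sub_mult r1 r2[unfolded NM] mult_ac)
  qed
qed

text \<open>With \<open>c ^ N = \<kappa>\<close> the rescaling
  \<open>u \<mapsto> \<kappa> * u\<close> lifts to \<open>t \<mapsto> c * t\<close>, which rotates
  the roots and the values of \<open>F\<close> at them.\<close>

lemma root_data_scale:
  assumes rd: "root_data F J D" and \<kappa>: "\<kappa> \<noteq> 0"
  shows "root_data (sub F XX (cc \<kappa> * YY)) (sub J XX (cc \<kappa> * YY)) (rotx \<kappa> D)"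
proof -
  obtain N \<gamma>s E W where N: "N > 0" "\<forall>\<gamma>\<in>set \<gamma>s. fps_nth \<gamma> 0 = 0" "coef2 E 0 0 \<noteq> 0" "coef2 W 0 0 \<noteq> 0"
     "sub J XX (YY ^ N) = E * (\<Prod>\<gamma>\<leftarrow>\<gamma>s. XX - py \<gamma>)"
     "sub D (XX ^ N) YY = W * (\<Prod>\<gamma>\<leftarrow>\<gamma>s. YY - px (arc_eval F \<gamma> (fps_X ^ N)))"
    using rd unfolding root_data_def by blast
  obtain c where c: "c ^ N = \<kappa>" using complex_root_exists[OF N(1)] by blast
  have m: "XX ^ N \<in> max_ideal" "YY ^ N \<in> max_ideal" "cc k * YY \<in> max_ideal" "cc k * XX \<in> max_ideal" for k using N by auto
  have sp: "sub (py \<gamma>) XX (cc c * YY) = py (rot c \<gamma>)" for \<gamma>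
  proof -
    have "cc c * YY = py (fps_const c * fps_X)" by (simp add: py_const py_X)
    then show ?thesis by (simp only: sub_py_py rot_def)
  qed
  have "sub (sub J XX (cc \<kappa> * YY)) XX (YY ^ N) = sub J XX (cc \<kappa> * YY ^ N)"
    using m by (simp add: sub_sub sub_XX sub_mult sub_YY)
  also have "\<dots> = sub (sub J XX (YY ^ N)) XX (cc c * YY)"
    using m by (simp add: sub_sub sub_XX sub_power sub_YY power_mult_distrib cc_power[symmetric] c)
  also have "\<dots> = sub E XX (cc c * YY) * (\<Prod>\<gamma>\<leftarrow>map (rot c) \<gamma>s. XX - py \<gamma>)"
    unfolding N(5) using m by (simp add: sub_mult sub_prod_list sub_diff sub_XX sp comp_def)
  finally have 1: "sub (sub J XX (cc \<kappa> * YY)) XX (YY ^ N) = sub E XX (cc c * YY) * (\<Prod>\<gamma>\<leftarrow>map (rot c) \<gamma>s. XX - py \<gamma>)" .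
  have ar: "arc_eval (sub F XX (cc \<kappa> * YY)) (rot c \<gamma>) (fps_X ^ N) = rot c (arc_eval F \<gamma> (fps_X ^ N))" if "\<gamma> \<in> set \<gamma>s" for \<gamma>
  proof -
    have "arc_eval (sub F XX (cc \<kappa> * YY)) (rot c \<gamma>) (fps_X ^ N) = arc_eval F (rot c \<gamma>) (fps_const \<kappa> * fps_X ^ N)"
      using N that m by (subst arc_sub) (auto simp: arc_XX arc_mult arc_YY)
    also have "fps_const \<kappa> * fps_X ^ N = fps_compose (fps_X ^ N) (fps_const c * fps_X)"
      by (subst compose_X_pow) (auto simp: power_mult_distrib c fps_const_power)
    also have "arc_eval F (rot c \<gamma>) \<dots> = rot c (arc_eval F \<gamma> (fps_X ^ N))"
      unfolding rot_def using N that by (intro arc_compose) auto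
    finally show ?thesis .
  qed
  have "sub (rotx \<kappa> D) (XX ^ N) YY = rotx c (sub D (XX ^ N) YY)"
    unfolding rotx_def using m by (simp add: sub_sub sub_XX sub_YY sub_mult sub_power power_mult_distrib cc_power[symmetric] c)
  also have "\<dots> = rotx c W * (\<Prod>\<gamma>\<leftarrow>map (rot c) \<gamma>s. YY - px (arc_eval (sub F XX (cc \<kappa> * YY)) \<gamma> (fps_X ^ N)))"
    unfolding N(6) using ar
    by (simp add: rotx_mult comp_def cong: map_cong)
      (simp add: rotx_def sub_prod_list sub_diff sub_YY comp_def flip: rotx_px)
  finally have 2: "sub (rotx \<kappa> D) (XX ^ N) YY = rotx c W * (\<Prod>\<gamma>\<leftarrow>map (rot c) \<gamma>s. YY - px (arc_eval (sub F XX (cc \<kappa> * YY)) \<gamma> (fps_X ^ N)))" .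
  have "coef2 (sub E XX (cc c * YY)) 0 0 \<noteq> 0" "coef2 (rotx c W) 0 0 \<noteq> 0"
    using N by (simp_all add: coef2_sub_00 rotx_def)
  moreover have "\<forall>\<gamma>\<in>set (map (rot c) \<gamma>s). fps_nth \<gamma> 0 = 0" using N by auto
  ultimately show ?thesis unfolding root_data_def using 1 2 N(1) by blast
qed

text \<open>After \<open>u = t ^ N\<close> the two series differ by the unit \<open>W\<close>. Its
  nonconstant terms have positive weight, so up to the weight \<open>r\<close> of the discriminant
  only \<open>C = W(0, 0)\<close> acts.\<close>

lemma root_data_discr:
  assumes rd: "root_data F (dx F) D" and z: "z_order (dx F) p"
  shows "\<exists>C. C \<noteq> 0 \<and> (\<forall>w1 w2 r. w1 > 0 \<longrightarrow> w2 > 0 \<longrightarrow> has_wt w1 w2 (discr p F) r \<longrightarrow>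
     (\<forall>i j. wt w1 w2 i j \<le> r \<longrightarrow> coef2 D i j = C * coef2 (discr p F) i j))"
proof -
  obtain N \<gamma>s E W where N: "N > 0" "\<forall>\<gamma>\<in>set \<gamma>s. fps_nth \<gamma> 0 = 0" "coef2 E 0 0 \<noteq> 0" "coef2 W 0 0 \<noteq> 0"
     "sub (dx F) XX (YY ^ N) = E * (\<Prod>\<gamma>\<leftarrow>\<gamma>s. XX - py \<gamma>)"
     "sub D (XX ^ N) YY = W * (\<Prod>\<gamma>\<leftarrow>\<gamma>s. YY - px (arc_eval F \<gamma> (fps_X ^ N)))"
    using rd unfolding root_data_def by blast
  define H where "H = sub (discr p F) (XX ^ N) YY"
  have eq: "sub D (XX ^ N) YY = W * H"
    unfolding N(6) H_def discr_roots[OF z N(3,2,1,5)] ..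
  show ?thesis
  proof (intro exI[of _ "coef2 W 0 0"] conjI allI impI)
    show "coef2 W 0 0 \<noteq> 0" by fact
    fix w1 w2 r i j assume w: "w1 > 0" "w2 > 0" and h: "has_wt w1 w2 (discr p F) r" and ij: "wt w1 w2 i j \<le> r"
    have hH: "has_wt (w1 / real N) w2 H r" unfolding H_def using h has_wt_compose_XX(2)[OF N(1)] by blast
    have wN: "wt (w1 / real N) w2 (N * i) j = wt w1 w2 i j" using N by (simp add: wt_def)
    have z: "coef2 W a b * coef2 H (N * i - a) (j - b) = 0" if ab: "a \<le> N * i" "b \<le> j" "(a, b) \<noteq> (0, 0)" for a b
    proof -
      have "wt (w1 / real N) w2 a b + wt (w1 / real N) w2 (N * i - a) (j - b) = wt (w1 / real N) w2 (N * i) j"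
        using ab by (simp add: wt_add[symmetric])
      moreover have "wt (w1 / real N) w2 a b > 0"
      proof (cases "a = 0")
        case True then show ?thesis using ab w by (auto simp: wt_def)
      next
        case False
        then have "w1 / real N * real a > 0" using w N by simp
        moreover have "w2 * real b \<ge> 0" using w by simp
        ultimately show ?thesis unfolding wt_def by linarith
      qed
      ultimately have "wt (w1 / real N) w2 (N * i - a) (j - b) < r" using ij wN by linarith
      then show ?thesis using hH unfolding has_wt_def by fastforce
    qed
    have "coef2 (W * H) (N * i) j = (\<Sum>b\<le>j. \<Sum>a\<le>N*i. if b = 0 then (if a = 0 then coef2 W 0 0 * coef2 H (N * i) j else 0) else 0)"
      unfolding coef2_mult
    proof (intro sum.cong refl)
      fix b a assume "b \<in> {..j}" "a \<in> {..N * i}"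
      then show "coef2 W a b * coef2 H (N * i - a) (j - b) = (if b = 0 then (if a = 0 then coef2 W 0 0 * coef2 H (N * i) j else 0) else 0)"
        using z[of a b] by (cases "(a, b) = (0, 0)") auto
    qed
    also have "\<dots> = (\<Sum>b\<le>j. if b = 0 then \<Sum>a\<le>N*i. (if a = 0 then coef2 W 0 0 * coef2 H (N * i) j else 0) else 0)"
      by (intro sum.cong refl) auto
    also have "\<dots> = coef2 W 0 0 * coef2 H (N * i) j" by (simp add: sum.delta)
    finally have "coef2 (sub D (XX ^ N) YY) (N * i) j = coef2 W 0 0 * coef2 H (N * i) j" unfolding eq .
    then show "coef2 D i j = coef2 W 0 0 * coef2 (discr p F) i j"
      unfolding H_def using N(1) by (simp add: has_wt_compose_XX(1))
  qed
qed

section \<open>The polar curve in adapted coordinates\<close>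

lemma series_of_polar: "series_of (polar l f) = dx (series_of l) * dy (series_of f) - dy (series_of l) * dx (series_of f)"
  by (simp add: polar_def minus_germ2.rep_eq times_germ2.rep_eq deriv_x.rep_eq deriv_y.rep_eq dx_def)

context coord_change
begin

text \<open>By the chain rule the Jacobian determinant of \<open>(Z, U)\<close>, taken at
  \<open>(Px, Py)\<close>, is an inverse up to sign.\<close>

lemma jacobian_unit: "coef2 (dy Px * dx Py - dy Py * dx Px) 0 0 \<noteq> 0"
proof -
  have c: "dx (sub F Px Py) = new (dx F) * dx Px + new (dy F) * dx Py" "dy (sub F Px Py) = new (dx F) * dy Px + new (dy F) * dy Py" for F
    unfolding new_def using max by (simp_all add: dx.chain dy.chain)
  have 1: "new (dx Z) * dx Px + new (dy Z) * dx Py = 1" "new (dx Z) * dy Px + new (dy Z) * dy Py = 0"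
    "new (dx U) * dx Px + new (dy U) * dx Py = 0" "new (dx U) * dy Px + new (dy U) * dy Py = 1"
    using c[of Z] c[of U] by (simp_all add: inv)
  have "(dy Px * dx Py - dy Py * dx Px) * (new (dx U) * new (dy Z) - new (dy U) * new (dx Z)) =
     (new (dx Z) * dx Px + new (dy Z) * dx Py) * (new (dx U) * dy Px + new (dy U) * dy Py)
      - (new (dx Z) * dy Px + new (dy Z) * dy Py) * (new (dx U) * dx Px + new (dy U) * dx Py)"
    by (simp add: algebra_simps)
  also have "\<dots> = 1" unfolding 1 by simp
  finally show ?thesis by (rule unit2_coef)
qed

text \<open>The polar is the Jacobian determinant of \<open>(l, f)\<close>. In the coordinates
  \<open>(z, u)\<close> the morphism is \<open>(u, F)\<close>, whose Jacobian determinant is the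
  \<open>z\<close>-derivative of \<open>F\<close> up to sign; the Jacobian of the coordinate change
  relates the two.\<close>

lemma dx_new:
  assumes l: "U = series_of l"
  shows "dx (new (series_of f)) = (dy Px * dx Py - dy Py * dx Px) * new (series_of (polar l f))"
proof -
  have c: "dx (sub F Px Py) = new (dx F) * dx Px + new (dy F) * dx Py" "dy (sub F Px Py) = new (dx F) * dy Px + new (dy F) * dy Py" for F
    unfolding new_def using max by (simp_all add: dx.chain dy.chain)
  have 1: "new (dx U) * dx Px = - (new (dy U) * dx Py)"
    using c(1)[of U] by (simp add: inv eq_neg_iff_add_eq_0)
  have 2: "new (dx U) * dy Px + new (dy U) * dy Py = 1" using c(2)[of U] by (simp add: inv)
  define f' where "f' = series_of f"
  have "dx (new f') = (new (dx f') * dx Px + new (dy f') * dx Py) * (new (dx U) * dy Px + new (dy U) * dy Py)"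
    unfolding 2 using c(1)[of f'] by (simp add: new_def)
  also have "\<dots> = new (dx f') * (new (dx U) * dx Px) * dy Px + new (dx f') * dx Px * new (dy U) * dy Py
     + new (dy f') * dx Py * new (dx U) * dy Px + new (dy f') * (new (dy U) * dx Py) * dy Py"
    by (simp add: algebra_simps)
  also have "new (dy U) * dx Py = - (new (dx U) * dx Px)" using 1 by simp
  also have "new (dx f') * (new (dx U) * dx Px) * dy Px = new (dx f') * (- (new (dy U) * dx Py)) * dy Px" by (simp only: 1)
  also have "new (dx f') * (- (new (dy U) * dx Py)) * dy Px + new (dx f') * dx Px * new (dy U) * dy Py
     + new (dy f') * dx Py * new (dx U) * dy Px + new (dy f') * (- (new (dx U) * dx Px)) * dy Py =
     (dy Px * dx Py - dy Py * dx Px) * (new (dx U) * new (dy f') - new (dy U) * new (dx f'))"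
    by (simp add: algebra_simps)
  also have "new (dx U) * new (dy f') - new (dy U) * new (dx f') = new (series_of (polar l f))"
    unfolding series_of_polar l[symmetric] f'_def[symmetric] using max by (simp add: new_def sub_diff sub_mult)
  finally show ?thesis unfolding f'_def .
qed

lemma new_unit: "coef2 (new w) 0 0 = coef2 w 0 0" by (simp add: new_def coef2_sub_00)

text \<open>\<open>root_data\<close> is multiplicative and tolerates units, so the branches of the
  polar are treated one by one. Regularity in \<open>z\<close> passes from the polar to each of its
  factors.\<close>

lemma discriminant_root_data:
  assumes D: "is_discriminant l f D" and l: "U = series_of l" and z: "z_order (dx (new (series_of f))) p"
  shows "root_data (new (series_of f)) (dx (new (series_of f))) (series_of D)"
proof -
  have fs: "(\<lambda>(h, d, H). h) = (fst :: germ2 \<times> nat \<times> germ2 \<Rightarrow> germ2)" "(\<lambda>(h, d, H). H ^ d) = (\<lambda>b :: germ2 \<times> nat \<times> germ2. snd (snd b) ^ fst (snd b))"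
    by auto
  obtain bs w w' where bs: "\<And>h d H. (h, d, H) \<in> set bs \<Longrightarrow> maps_branch l f h d H"
    and w: "w dvd 1" "polar l f = w * (\<Prod>b\<leftarrow>bs. fst b)"
    and w': "w' dvd 1" "D = w' * (\<Prod>b\<leftarrow>bs. snd (snd b) ^ fst (snd b))"
    using D unfolding is_discriminant_def direct_image_def fs by blast
  let ?v = "dy Px * dx Py - dy Py * dx Px"
  have eq: "dx (new (series_of f)) = ?v * new (series_of w) * new (series_of (\<Prod>b\<leftarrow>bs. fst b))"
    unfolding dx_new[OF l] w(2) series_of_mult new_mult by (simp add: mult.assoc)
  have "fps_nth (dx (new (series_of f))) 0 \<noteq> 0" using z by (auto simp: z_order_def coef2_def)
  then have nz: "fps_nth (new (series_of (\<Prod>b\<leftarrow>bs. fst b))) 0 \<noteq> 0" unfolding eq by auto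
  have "root_data (new (series_of f)) (new (series_of (\<Prod>b\<leftarrow>bs. fst b))) (series_of (\<Prod>b\<leftarrow>bs. snd (snd b) ^ fst (snd b)))"
    using bs nz
  proof (induction bs)
    case Nil then show ?case by (simp add: new_1 root_data_1)
  next
    case (Cons b bs)
    obtain h d H where b: "b = (h, d, H)" by (cases b)
    have nzs: "fps_nth (new (series_of h)) 0 \<noteq> 0" "fps_nth (new (series_of (\<Prod>b\<leftarrow>bs. fst b))) 0 \<noteq> 0"
      using Cons.prems(2) by (auto simp: b series_of_mult new_mult)
    have "root_data (new (series_of f)) (new (series_of h)) (series_of H ^ d)"
      using maps_branch_roots[OF Cons.prems(1) l z_order_subdegree[OF nzs(1)]] b by simp
    moreover have "root_data (new (series_of f)) (new (series_of (\<Prod>b\<leftarrow>bs. fst b))) (series_of (\<Prod>b\<leftarrow>bs. snd (snd b) ^ fst (snd b)))"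
      using Cons.IH Cons.prems(1) nzs(2) by simp
    ultimately show ?case
      using root_data_mult by (simp add: b series_of_mult series_of_power new_mult)
  qed
  from root_data_unit[OF this, of "?v * new (series_of w)" "series_of w'"]
  show ?thesis
    using germ_unit_coef[OF w(1)] germ_unit_coef[OF w'(1)] jacobian_unit
    by (simp only: eq w'(2) series_of_mult coef2_mult_00 new_unit) simp
qed

end

subsection \<open>Compact edges of Newton diagrams\<close>

definition up_set :: "(nat \<times> nat) set \<Rightarrow> (real \<times> real) set" where
  "up_set S = {(real i + s, real j + t) | i j s t. (i, j) \<in> S \<and> s \<ge> 0 \<and> t \<ge> 0}"

definition line_points :: "(nat \<times> nat) set \<Rightarrow> real \<Rightarrow> real \<Rightarrow> real \<Rightarrow> (real \<times> real) set" where
  "line_points S w1 w2 c = {(real i, real j) | i j. (i, j) \<in> S \<and> wt w1 w2 i j = c}"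

lemma up_set_translate:
  assumes "p \<in> convex hull up_set S" "s \<ge> 0" "t \<ge> 0"
  shows "p + (s, t) \<in> convex hull up_set S"
proof -
  have "(+) (s, t) ` up_set S \<subseteq> up_set S"
  proof
    fix x assume "x \<in> (+) (s, t) ` up_set S"
    then obtain i j s' t' where "x = (s, t) + (real i + s', real j + t')" "(i, j) \<in> S" "s' \<ge> 0" "t' \<ge> 0"
      by (auto simp: up_set_def)
    then show "x \<in> up_set S" using assms unfolding up_set_def
      by (intro CollectI exI[of _ i] exI[of _ j] exI[of _ "s + s'"] exI[of _ "t + t'"]) auto
  qed
  then have "(+) (s, t) ` (convex hull up_set S) \<subseteq> convex hull up_set S"
    using hull_mono[of "(+) (s, t) ` up_set S" "up_set S" convex] by (simp only: convex_hull_translation)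
  then have "(s, t) + p \<in> convex hull up_set S" using assms(1) by (meson image_subset_iff)
  then show ?thesis by (simp only: add.commute)
qed

text \<open>A convex combination attains the minimum of a linear form only if every point with
  positive coefficient does.\<close>

lemma face_of_convex_hull_supporting:
  fixes T :: "'a :: euclidean_space set"
  assumes "\<And>x. x \<in> T \<Longrightarrow> a \<bullet> x \<ge> c"
  shows "convex hull T \<inter> {x. a \<bullet> x = c} = convex hull (T \<inter> {x. a \<bullet> x = c})"
proof
  show "convex hull (T \<inter> {x. a \<bullet> x = c}) \<subseteq> convex hull T \<inter> {x. a \<bullet> x = c}"
  proof (rule hull_minimal)
    show "T \<inter> {x. a \<bullet> x = c} \<subseteq> convex hull T \<inter> {x. a \<bullet> x = c}" using hull_subset[of T convex] by auto
    show "convex (convex hull T \<inter> {x. a \<bullet> x = c})" by (intro convex_Int convex_convex_hull convex_hyperplane)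
  qed
  show "convex hull T \<inter> {x. a \<bullet> x = c} \<subseteq> convex hull (T \<inter> {x. a \<bullet> x = c})"
  proof
    fix x assume x: "x \<in> convex hull T \<inter> {x. a \<bullet> x = c}"
    then obtain V u where V: "finite V" "V \<subseteq> T" "\<forall>v\<in>V. u v \<ge> 0" "sum u V = 1" "(\<Sum>v\<in>V. u v *\<^sub>R v) = x"
      unfolding convex_hull_explicit by blast
    have "(\<Sum>v\<in>V. u v * (a \<bullet> v - c)) = a \<bullet> x - c"
      using V(4) by (simp add: V(5)[symmetric] inner_sum_right right_diff_distrib sum_subtractf flip: sum_distrib_right)
    also have "\<dots> = 0" using x by simp
    finally have "\<forall>v\<in>V. u v * (a \<bullet> v - c) = 0"
      using V assms by (subst (asm) sum_nonneg_eq_0_iff) auto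
    then have on: "a \<bullet> v = c" if "v \<in> V" "u v \<noteq> 0" for v using that by auto
    define V' where "V' = {v \<in> V. u v \<noteq> 0}"
    have "sum u V' = 1" "(\<Sum>v\<in>V'. u v *\<^sub>R v) = x"
      unfolding V(4)[symmetric] V(5)[symmetric] V'_def using V(1) by (auto intro!: sum.mono_neutral_left)
    moreover have "finite V'" "V' \<subseteq> T \<inter> {x. a \<bullet> x = c}" "\<forall>v\<in>V'. u v \<ge> 0" using V on by (auto simp: V'_def)
    ultimately show "x \<in> convex hull (T \<inter> {x. a \<bullet> x = c})" unfolding convex_hull_explicit by blast
  qed
qed

lemma up_set_line:
  assumes w: "w1 > 0" "w2 > 0" and c: "\<And>i j. (i, j) \<in> S \<Longrightarrow> c \<le> wt w1 w2 i j"
  shows "up_set S \<inter> {x. (w1, w2) \<bullet> x = c} = line_points S w1 w2 c" and "x \<in> up_set S \<Longrightarrow> c \<le> (w1, w2) \<bullet> x"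
proof -
  show ge: "c \<le> (w1, w2) \<bullet> x" if "x \<in> up_set S" for x
  proof -
    from that obtain i j s t where x: "x = (real i + s, real j + t)" "(i, j) \<in> S" "s \<ge> 0" "t \<ge> 0" by (auto simp: up_set_def)
    then have "w1 * s \<ge> 0" "w2 * t \<ge> 0" using w by simp_all
    then show ?thesis using c[OF x(2)] by (simp add: x inner_Pair wt_def algebra_simps)
  qed
  show "up_set S \<inter> {x. (w1, w2) \<bullet> x = c} = line_points S w1 w2 c"
  proof
    show "up_set S \<inter> {x. (w1, w2) \<bullet> x = c} \<subseteq> line_points S w1 w2 c"
    proof
      fix x assume "x \<in> up_set S \<inter> {x. (w1, w2) \<bullet> x = c}"
      then obtain i j s t where x: "x = (real i + s, real j + t)" "(i, j) \<in> S" "s \<ge> 0" "t \<ge> 0" and e: "(w1, w2) \<bullet> x = c"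
        by (auto simp: up_set_def)
      have st: "w1 * s \<ge> 0" "w2 * t \<ge> 0" using w x by simp_all
      have "wt w1 w2 i j + w1 * s + w2 * t = c" using e by (simp add: x inner_Pair wt_def algebra_simps)
      then have "w1 * s = 0" "w2 * t = 0" "wt w1 w2 i j = c" using c[OF x(2)] st by linarith+
      then show "x \<in> line_points S w1 w2 c" using w x by (auto simp: line_points_def)
    qed
    show "line_points S w1 w2 c \<subseteq> up_set S \<inter> {x. (w1, w2) \<bullet> x = c}"
    proof
      fix x assume "x \<in> line_points S w1 w2 c"
      then obtain i j where "x = (real i, real j)" "(i, j) \<in> S" "wt w1 w2 i j = c" by (auto simp: line_points_def)
      then show "x \<in> up_set S \<inter> {x. (w1, w2) \<bullet> x = c}"
        unfolding up_set_def
        by (intro IntI CollectI exI[of _ i] exI[of _ j] exI[of _ "0 :: real"] conjI) (simp_all add: inner_Pair wt_def)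
    qed
  qed
qed

lemma line_points_face:
  assumes w: "w1 > 0" "w2 > 0" and c: "\<And>i j. (i, j) \<in> S \<Longrightarrow> c \<le> wt w1 w2 i j"
  shows "convex hull line_points S w1 w2 c face_of convex hull up_set S"
    and "convex hull line_points S w1 w2 c = convex hull up_set S \<inter> {x. (w1, w2) \<bullet> x = c}"
proof -
  have ge: "c \<le> (w1, w2) \<bullet> x" if "x \<in> convex hull up_set S" for x
  proof -
    have "convex hull up_set S \<subseteq> {x. (w1, w2) \<bullet> x \<ge> c}"
      by (rule hull_minimal) (use up_set_line(2)[OF w c] convex_halfspace_ge in auto)
    then show ?thesis using that by auto
  qed
  show 1: "convex hull line_points S w1 w2 c = convex hull up_set S \<inter> {x. (w1, w2) \<bullet> x = c}"
  proof -
    have "convex hull up_set S \<inter> {x. (w1, w2) \<bullet> x = c} = convex hull (up_set S \<inter> {x. (w1, w2) \<bullet> x = c})"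
      by (rule face_of_convex_hull_supporting) (rule up_set_line(2)[OF w c])
    then show ?thesis by (simp only: up_set_line(1)[OF w c])
  qed
  show "convex hull line_points S w1 w2 c face_of convex hull up_set S"
    unfolding 1 by (rule face_of_Int_supporting_hyperplane_ge) (use ge in auto)
qed

text \<open>The diagram is stable under translation by the positive quadrant, so the weights of a
  supporting linear form are nonnegative. A zero weight would make the edge parallel to an axis, and
  such an edge extends to infinity, against compactness.\<close>

lemma compact_edge_weight:
  assumes E: "E edge_of convex hull up_set S" "compact E"
  shows "\<exists>w1 w2 c. w1 > 0 \<and> w2 > 0 \<and> (\<forall>i j. (i, j) \<in> S \<longrightarrow> c \<le> wt w1 w2 i j) \<and> E = convex hull line_points S w1 w2 c"
proof -
  define N where "N = convex hull up_set S"
  have face: "E face_of N" and dim: "aff_dim E = 1" using E(1) by (auto simp: edge_of_def N_def)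
  have convN: "convex N" and convE: "convex E" using face by (auto simp: N_def face_of_imp_convex)
  have EN: "E \<subseteq> N" using face by (rule face_of_imp_subset)
  have "E \<noteq> {}" using dim by auto
  then obtain e where e: "e \<in> E" by blast
  obtain e' where e': "e' \<in> E" "e' \<noteq> e"
  proof -
    have "E \<noteq> {e}" using dim by auto
    then show thesis using e that by blast
  qed
  have tr: "p + (s, t) \<in> N" if "p \<in> N" "s \<ge> 0" "t \<ge> 0" for p s t using up_set_translate that by (simp add: N_def)
  have bnd: "\<exists>B. \<forall>x\<in>E. norm x \<le> B" using compact_imp_bounded[OF E(2)] by (simp add: bounded_iff)
  have no_ray: False if v: "v = (1, 0) \<or> v = (0, 1)" and r: "\<And>t :: real. t > 0 \<Longrightarrow> p + t *\<^sub>R v \<in> E" for p v :: "real \<times> real"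
  proof -
    obtain B where B: "\<forall>x\<in>E. norm x \<le> B" using bnd by blast
    define t where "t = \<bar>B\<bar> + norm p + 1"
    have t: "t > 0" by (simp add: t_def add_nonneg_pos)
    have "norm (t *\<^sub>R v) = t" using v t by (auto simp: norm_prod_def)
    then have "t \<le> norm (p + t *\<^sub>R v) + norm p" using norm_triangle_ineq4[of "p + t *\<^sub>R v" p] by simp
    then show False using B r[OF t] by (force simp: t_def)
  qed
  \<comment> \<open>The point \<open>q\<close> lies strictly between \<open>p\<close> and
    \<open>q + t *\<^sub>R v\<close>, so the face property puts the latter into \<open>E\<close>,
    for every \<open>t > 0\<close>.\<close>
  have no_dir: False if pq: "p \<in> E" "q \<in> E" "q = p + d *\<^sub>R v" "d > 0" and v: "v = (1, 0) \<or> v = (0, 1)" for p q v :: "real \<times> real" and d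
  proof (rule no_ray[OF v])
    fix t :: real assume t: "t > 0"
    have "q + t *\<^sub>R v \<in> N" using tr[of q t 0] tr[of q 0 t] v t pq EN by auto
    moreover have "q \<in> open_segment p (q + t *\<^sub>R v)"
    proof -
      have "q = (1 - d / (d + t)) *\<^sub>R p + (d / (d + t)) *\<^sub>R (q + t *\<^sub>R v)"
      proof -
        have gen: "(1 - l) *\<^sub>R p + l *\<^sub>R (q + t *\<^sub>R v) = p + (l * (d + t)) *\<^sub>R v" for l
          unfolding pq(3) by (simp add: algebra_simps)
        have "(d / (d + t)) * (d + t) = d" using pq(4) t by simp
        then show ?thesis unfolding gen by (simp only: pq(3))
      qed
      moreover have "d / (d + t) > 0" "d / (d + t) < 1" using pq(4) t by (simp_all add: field_simps)
      moreover have "p \<noteq> q + t *\<^sub>R v" using v pq(3,4) t by (auto simp: prod_eq_iff)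
      ultimately show ?thesis unfolding in_segment by blast
    qed
    ultimately show "q + t *\<^sub>R v \<in> E" using face_ofD[OF face, of q p "q + t *\<^sub>R v"] pq EN by blast
  qed
  have "E \<noteq> N"
  proof
    assume "E = N"
    then show False using no_ray[of "(1, 0)" e] tr[of e] e by auto
  qed
  \<comment> \<open>A hyperplane that supports the diagram at a relative interior point of
    \<open>E\<close> contains all of \<open>E\<close>.\<close>
  obtain x where x: "x \<in> rel_interior E" using rel_interior_eq_empty[OF convE] \<open>E \<noteq> {}\<close> by blast
  have xE: "x \<in> E" using x rel_interior_subset by blast
  have "x \<notin> rel_interior N"
    using face_of_disjoint_rel_interior[OF face \<open>E \<noteq> N\<close>] xE by blast
  then obtain a where a: "a \<noteq> 0" "\<And>y. y \<in> N \<Longrightarrow> a \<bullet> x \<le> a \<bullet> y"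
    using supporting_hyperplane_rel_boundary[OF convN] xE EN by (metis subsetD)
  obtain w1 w2 where aw: "a = (w1, w2)" by (cases a)
  define c where "c = a \<bullet> x"
  have "a \<bullet> x \<le> a \<bullet> (x + (1, 0))" "a \<bullet> x \<le> a \<bullet> (x + (0, 1))"
    using xE EN by (auto intro!: a(2) tr)
  then have w0: "w1 \<ge> 0" "w2 \<ge> 0" by (simp_all add: aw inner_add_right inner_Pair)
  have "N \<inter> {y. a \<bullet> y = c} face_of N"
    by (rule face_of_Int_supporting_hyperplane_ge[OF convN]) (use a in \<open>simp add: c_def\<close>)
  from subset_of_face_of[OF this EN] have EF: "E \<subseteq> N \<inter> {y. a \<bullet> y = c}" using x xE EN by (auto simp: c_def)
  have eq: "w1 * fst e + w2 * snd e = w1 * fst e' + w2 * snd e'"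
    using EF e e' by (auto simp: aw inner_prod_def)
  have w1: "w1 > 0"
  proof (rule ccontr)
    assume "\<not> w1 > 0"
    then have "w1 = 0" using w0 by simp
    moreover have "w2 \<noteq> 0" using \<open>w1 = 0\<close> a(1) aw by (auto simp: zero_prod_def)
    ultimately have "w1 = 0" "w2 > 0" using w0 by simp_all
    then have s: "snd e = snd e'" using eq by simp
    then have "fst e \<noteq> fst e'" using e' by (auto simp: prod_eq_iff)
    then consider "fst e < fst e'" | "fst e' < fst e" by linarith
    then show False
    proof cases
      case 1 then show ?thesis using no_dir[of e e' "fst e' - fst e" "(1, 0)"] s e e' by (simp add: prod_eq_iff)
    next
      case 2 then show ?thesis using no_dir[of e' e "fst e - fst e'" "(1, 0)"] s e e' by (simp add: prod_eq_iff)
    qed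
  qed
  have w2: "w2 > 0"
  proof (rule ccontr)
    assume "\<not> w2 > 0"
    then have "w2 = 0" using w0 by auto
    then have s: "fst e = fst e'" using eq w1 by simp
    then have "snd e \<noteq> snd e'" using e' by (auto simp: prod_eq_iff)
    then consider "snd e < snd e'" | "snd e' < snd e" by linarith
    then show False
    proof cases
      case 1 then show ?thesis using no_dir[of e e' "snd e' - snd e" "(0, 1)"] s e e' by (simp add: prod_eq_iff)
    next
      case 2 then show ?thesis using no_dir[of e' e "snd e - snd e'" "(0, 1)"] s e e' by (simp add: prod_eq_iff)
    qed
  qed
  have cS: "c \<le> wt w1 w2 i j" if "(i, j) \<in> S" for i j
  proof -
    have "(real i + 0, real j + 0) \<in> up_set S" unfolding up_set_def using that by blast
    then have "(real i, real j) \<in> N" unfolding N_def by (intro hull_inc) simp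
    from a(2)[OF this] show ?thesis by (simp add: c_def aw inner_Pair wt_def)
  qed
  define F where "F = convex hull line_points S w1 w2 c"
  have F: "F = N \<inter> {y. a \<bullet> y = c}" unfolding F_def N_def aw by (rule line_points_face(2)[OF w1 w2 cS])
  have "E face_of F" using face_of_subset[OF face EF] by (simp add: F)
  \<comment> \<open>As a proper face of \<open>F\<close> the edge would have dimension below
    1.\<close>
  moreover have "aff_dim F \<le> 1"
  proof -
    have "aff_dim F \<le> aff_dim {y. a \<bullet> y = c}" unfolding F by (intro aff_dim_subset) auto
    also have "\<dots> = 1" using a(1) by (simp add: aff_dim_hyperplane)
    finally show ?thesis .
  qed
  ultimately have "E = F" using face_of_aff_dim_lt[of F E] dim convN
    by (metis F_def convex_convex_hull not_less)
  then show ?thesis using w1 w2 cS unfolding F_def by blast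
qed

text \<open>A compact edge is spanned by the points of least weight for some positive weight, and
  these are common to \<open>S1\<close> and \<open>S2\<close>.\<close>

lemma compact_edge_transfer:
  assumes S: "\<And>w1 w2. w1 > 0 \<Longrightarrow> w2 > 0 \<Longrightarrow> \<exists>r. (\<forall>(i, j)\<in>S1. r \<le> wt w1 w2 i j) \<and> (\<exists>(i, j)\<in>S1. wt w1 w2 i j = r) \<and>
      (\<forall>i j. wt w1 w2 i j \<le> r \<longrightarrow> ((i, j) \<in> S1 \<longleftrightarrow> (i, j) \<in> S2))"
    and E: "E edge_of convex hull up_set S1" "compact E"
  shows "E edge_of convex hull up_set S2"
    and "\<And>i j. (real i, real j) \<in> E \<Longrightarrow> \<exists>w1 w2 r. w1 > 0 \<and> w2 > 0 \<and> (\<forall>(i, j)\<in>S1. r \<le> wt w1 w2 i j) \<and> (\<exists>(i, j)\<in>S1. wt w1 w2 i j = r) \<and> wt w1 w2 i j = r"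
proof -
  obtain w1 w2 c where w: "w1 > 0" "w2 > 0" and c: "\<And>i j. (i, j) \<in> S1 \<Longrightarrow> c \<le> wt w1 w2 i j"
    and EE: "E = convex hull line_points S1 w1 w2 c" using compact_edge_weight[OF E] by blast
  have "E \<noteq> {}" using E(1) by (auto simp: edge_of_def)
  then have "line_points S1 w1 w2 c \<noteq> {}" using EE by auto
  then obtain i0 j0 where ij0: "(i0, j0) \<in> S1" "wt w1 w2 i0 j0 = c" by (auto simp: line_points_def)
  obtain r where r: "\<forall>(i, j)\<in>S1. r \<le> wt w1 w2 i j" "\<exists>(i, j)\<in>S1. wt w1 w2 i j = r"
      "\<forall>i j. wt w1 w2 i j \<le> r \<longrightarrow> ((i, j) \<in> S1 \<longleftrightarrow> (i, j) \<in> S2)" using S[OF w] by (elim exE conjE)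
  have "r \<le> c" using r(1) ij0 by fastforce
  moreover have "c \<le> r" using r(2) c by auto
  ultimately have rc: "r = c" by simp
  have c2: "c \<le> wt w1 w2 i j" if "(i, j) \<in> S2" for i j
    using r(3)[rule_format, of i j] c[of i j] that rc by linarith
  have "line_points S1 w1 w2 c = line_points S2 w1 w2 c"
    using r(3) rc unfolding line_points_def by auto
  then have "E face_of convex hull up_set S2" unfolding EE using line_points_face(1)[OF w c2] by simp
  then show "E edge_of convex hull up_set S2" using E(1) by (simp add: edge_of_def)
  fix i j assume "(real i, real j) \<in> E"
  then have "(w1, w2) \<bullet> (real i, real j) = c" using line_points_face(2)[OF w c] EE by auto
  then have "wt w1 w2 i j = r" by (simp add: rc wt_def inner_Pair)
  then show "\<exists>w1 w2 r. w1 > 0 \<and> w2 > 0 \<and> (\<forall>(i, j)\<in>S1. r \<le> wt w1 w2 i j) \<and> (\<exists>(i, j)\<in>S1. wt w1 w2 i j = r) \<and> wt w1 w2 i j = r"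
    using w r(1,2) by (intro exI[of _ w1] exI[of _ w2] exI[of _ r] conjI)
qed

lemma newton_diagram_up_set: "newton_diagram g = convex hull up_set {(i, j). coef g i j \<noteq> 0}"
  unfolding newton_diagram_def up_set_def by simp

text \<open>For every positive weight the terms of least weight agree up to the rescaling, hence
  have the same support, so the two diagrams have the same compact edges; every lattice point on
  such an edge has least weight for some positive weight.\<close>

lemma initial_newton_polynomial_agree:
  assumes AC: "A \<noteq> 0" "C \<noteq> 0"
    and w: "\<And>w1 w2. w1 > 0 \<Longrightarrow> w2 > 0 \<Longrightarrow> \<exists>r. (\<forall>i j. wt w1 w2 i j \<le> r \<longrightarrow> coef D1 i j = C * A ^ i * coef D2 i j) \<and> has_wt w1 w2 (series_of D1) r"
  shows "initial_newton_polynomial D1 = fps_const (fps_const C) * rescale A 1 (initial_newton_polynomial D2)"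
proof -
  define S1 where "S1 = {(i, j). coef D1 i j \<noteq> 0}"
  define S2 where "S2 = {(i, j). coef D2 i j \<noteq> 0}"
  have key: "\<exists>r. (\<forall>(i, j)\<in>S1. r \<le> wt w1 w2 i j) \<and> (\<exists>(i, j)\<in>S1. wt w1 w2 i j = r) \<and>
      (\<forall>i j. wt w1 w2 i j \<le> r \<longrightarrow> ((i, j) \<in> S1 \<longleftrightarrow> (i, j) \<in> S2)) \<and> (\<forall>i j. wt w1 w2 i j \<le> r \<longrightarrow> coef D1 i j = C * A ^ i * coef D2 i j)"
    if pos: "w1 > 0" "w2 > 0" for w1 w2
  proof -
    obtain r where r: "\<And>i j. wt w1 w2 i j \<le> r \<Longrightarrow> coef D1 i j = C * A ^ i * coef D2 i j" "has_wt w1 w2 (series_of D1) r"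
      using w[OF pos] by blast
    have "(i, j) \<in> S1 \<longleftrightarrow> (i, j) \<in> S2" if "wt w1 w2 i j \<le> r" for i j
      using r(1)[OF that] AC by (simp add: S1_def S2_def)
    moreover have "\<forall>(i, j)\<in>S1. r \<le> wt w1 w2 i j" "\<exists>(i, j)\<in>S1. wt w1 w2 i j = r"
      using r(2) by (auto simp: has_wt_def S1_def coef_def)
    ultimately show ?thesis using r(1) by blast
  qed
  have S12: "\<exists>r. (\<forall>(i, j)\<in>S1. r \<le> wt w1 w2 i j) \<and> (\<exists>(i, j)\<in>S1. wt w1 w2 i j = r) \<and>
      (\<forall>i j. wt w1 w2 i j \<le> r \<longrightarrow> ((i, j) \<in> S1 \<longleftrightarrow> (i, j) \<in> S2))" if pos: "w1 > 0" "w2 > 0" for w1 w2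
    using key[OF pos] by blast
  have S21: "\<exists>r. (\<forall>(i, j)\<in>S2. r \<le> wt w1 w2 i j) \<and> (\<exists>(i, j)\<in>S2. wt w1 w2 i j = r) \<and>
      (\<forall>i j. wt w1 w2 i j \<le> r \<longrightarrow> ((i, j) \<in> S2 \<longleftrightarrow> (i, j) \<in> S1))" if pos: "w1 > 0" "w2 > 0" for w1 w2
  proof -
    obtain r where r: "\<forall>(i, j)\<in>S1. r \<le> wt w1 w2 i j" "\<exists>(i, j)\<in>S1. wt w1 w2 i j = r"
      "\<forall>i j. wt w1 w2 i j \<le> r \<longrightarrow> ((i, j) \<in> S1 \<longleftrightarrow> (i, j) \<in> S2)" using S12[OF pos] by (elim exE conjE)
    have "r \<le> wt w1 w2 i j" if ij: "(i, j) \<in> S2" for i j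
    proof (rule ccontr)
      assume "\<not> r \<le> wt w1 w2 i j"
      then show False using r(1) r(3)[rule_format, of i j] ij by auto
    qed
    then have "\<forall>(i, j)\<in>S2. r \<le> wt w1 w2 i j" by auto
    moreover obtain i j where "(i, j) \<in> S1" "wt w1 w2 i j = r" using r(2) by auto
    then have "\<exists>(i, j)\<in>S2. wt w1 w2 i j = r" using r(3)[rule_format, of i j] by auto
    moreover have "\<forall>i j. wt w1 w2 i j \<le> r \<longrightarrow> ((i, j) \<in> S2 \<longleftrightarrow> (i, j) \<in> S1)" using r(3) by simp
    ultimately show ?thesis by (intro exI conjI)
  qed
  have edges: "(\<exists>E. E edge_of newton_diagram D1 \<and> compact E \<and> (real i, real j) \<in> E) \<longleftrightarrow>
     (\<exists>E. E edge_of newton_diagram D2 \<and> compact E \<and> (real i, real j) \<in> E)" for i j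
    unfolding newton_diagram_up_set S1_def[symmetric] S2_def[symmetric]
    using compact_edge_transfer(1)[OF S12] compact_edge_transfer(1)[OF S21] by blast
  have co: "coef D1 i j = C * A ^ i * coef D2 i j" if E: "E edge_of newton_diagram D1" "compact E" "(real i, real j) \<in> E" for E i j
  proof -
    have E': "E edge_of convex hull up_set S1" using E(1) by (simp add: newton_diagram_up_set S1_def)
    obtain w1 w2 r where r: "w1 > 0" "w2 > 0" "\<forall>(i, j)\<in>S1. r \<le> wt w1 w2 i j" "\<exists>(i, j)\<in>S1. wt w1 w2 i j = r" "wt w1 w2 i j = r"
      using compact_edge_transfer(2)[OF S12 E' E(2,3)] by blast
    obtain q where q: "\<forall>(i, j)\<in>S1. q \<le> wt w1 w2 i j" "\<exists>(i, j)\<in>S1. wt w1 w2 i j = q"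
      "\<And>i j. wt w1 w2 i j \<le> q \<Longrightarrow> coef D1 i j = C * A ^ i * coef D2 i j" using key[OF r(1,2)] by blast
    have "r \<le> q" using r(3) q(2) by auto
    moreover have "q \<le> r" using r(4) q(1) by auto
    ultimately have "r = q" by simp
    then show ?thesis using q(3) r(5) by simp
  qed
  show ?thesis
  proof (rule coef2_eqI)
    fix i j
    define P where "P D \<longleftrightarrow> (\<exists>E. E edge_of newton_diagram D \<and> compact E \<and> (real i, real j) \<in> E)" for D
    have l: "coef2 (initial_newton_polynomial D) i j = (if P D then coef D i j else 0)" for D
      by (simp add: initial_newton_polynomial_def coef2_def P_def)
    have "coef2 (fps_const (fps_const C) * rescale A 1 H) i j = C * (coef2 H i j * A ^ i)" for H
      by (simp add: coef2_def rescale_def)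
    then have "coef2 (fps_const (fps_const C) * rescale A 1 (initial_newton_polynomial D2)) i j = C * ((if P D2 then coef D2 i j else 0) * A ^ i)"
      by (simp only: l)
    moreover have "coef D1 i j = C * A ^ i * coef D2 i j" if "P D1" using co that unfolding P_def by blast
    moreover have "P D1 \<longleftrightarrow> P D2" unfolding P_def by (rule edges)
    ultimately show "coef2 (initial_newton_polynomial D1) i j = coef2 (fps_const (fps_const C) * rescale A 1 (initial_newton_polynomial D2)) i j"
      unfolding l[of D1] by simp
  qed
qed

subsection \<open>Coordinates adapted to the tangent\<close>

definition hform :: "complex fps fps \<Rightarrow> nat \<Rightarrow> complex \<Rightarrow> complex \<Rightarrow> complex" where
  "hform F n p q = (\<Sum>i\<le>n. coef2 F i (n - i) * p ^ i * q ^ (n - i))"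

text \<open>Restriction to the line through \<open>(p, q)\<close>; in this form
  \<open>arc_sub\<close> handles linear substitutions.\<close>

lemma hform_eq_arc: "hform F n p q = fps_nth (arc_eval F (fps_const p * fps_X) (fps_const q * fps_X)) n"
proof -
  have m: "fps_nth ((fps_const p * fps_X) ^ i * (fps_const q * fps_X) ^ j) n = (if j = n - i then p ^ i * q ^ (n - i) else 0)"
    if "i \<le> n" for i j
  proof -
    have "(fps_const p * fps_X) ^ i * (fps_const q * fps_X) ^ j = fps_const (p ^ i * q ^ j) * fps_X ^ (i + j)"
      by (simp only: power_mult_distrib power_add fps_const_power fps_const_mult[symmetric] mult_ac)
    then show ?thesis using that by (simp only: fps_mult_left_const_nth fps_X_power_nth) auto
  qed
  have "fps_nth (arc_eval F (fps_const p * fps_X) (fps_const q * fps_X)) n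
      = (\<Sum>i\<le>n. \<Sum>j\<le>n. coef2 F i j * (if j = n - i then p ^ i * q ^ (n - i) else 0))"
    unfolding arc_eval_def fps_nth_Abs_fps by (intro sum.cong refl) (simp only: atMost_iff m)
  also have "\<dots> = hform F n p q"
    unfolding hform_def by (intro sum.cong refl) (simp add: if_distrib sum.delta mult.assoc cong: if_cong)
  finally show ?thesis by simp
qed

definition lin2 :: "complex \<Rightarrow> complex \<Rightarrow> complex fps fps" where "lin2 a b = cc a * XX + cc b * YY"

lemma lin2_max [simp]: "lin2 a b \<in> max_ideal"
  by (simp add: lin2_def max_ideal_iff coef2_mult_00 coef2_XX coef2_YY)

lemma sub_lin2: "A \<in> max_ideal \<Longrightarrow> B \<in> max_ideal \<Longrightarrow> sub (lin2 a b) A B = cc a * A + cc b * B"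
  by (simp add: lin2_def sub_add sub_cc_mult sub_XX sub_YY)

lemma sub_lin2_lin2: "sub (lin2 a b) (lin2 p q) (lin2 r s) = lin2 (a * p + b * r) (a * q + b * s)"
  by (simp add: sub_lin2) (simp add: lin2_def algebra_simps)

lemma hform_lin2: "hform (sub F (lin2 e1 g1) (lin2 e2 g2)) n p q = hform F n (e1 * p + g1 * q) (e2 * p + g2 * q)"
proof -
  have a: "arc_eval (lin2 a b) (fps_const p * fps_X) (fps_const q * fps_X) = fps_const (a * p + b * q) * fps_X" for a b
    by (simp add: lin2_def arc_add arc_mult arc_XX arc_YY algebra_simps)
  show ?thesis unfolding hform_eq_arc by (simp add: arc_sub a)
qed

lemma hform_scale: "hform F n (t * p) (t * q) = t ^ n * hform F n p q"
  unfolding hform_def sum_distrib_left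
proof (intro sum.cong refl)
  fix i assume "i \<in> {..n}"
  then have "t ^ n = t ^ i * t ^ (n - i)" by (simp flip: power_add)
  then show "coef2 F i (n - i) * (t * p) ^ i * (t * q) ^ (n - i) = t ^ n * (coef2 F i (n - i) * p ^ i * q ^ (n - i))"
    by (simp add: power_mult_distrib)
qed

lemma poly_no_root:
  fixes a :: "nat \<Rightarrow> complex"
  assumes "\<And>x. (\<Sum>i\<le>n. a i * x ^ i) \<noteq> 0" and "0 < i" "i \<le> n"
  shows "a i = 0"
proof -
  define p where "p = (\<Sum>i\<le>n. monom (a i) i)"
  have "poly p x = (\<Sum>i\<le>n. a i * x ^ i)" for x by (simp add: p_def poly_sum poly_monom)
  then have "constant (poly p)"
    using Fundamental_Theorem_Algebra.fundamental_theorem_of_algebra[of p] assms(1) by auto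
  then have "degree p = 0" by (simp add: constant_degree)
  then have "coeff p i = 0" using assms(2) by (intro coeff_eq_0) simp
  then show ?thesis using assms(3) by (simp add: p_def coeff_sum if_distrib sum.delta cong: if_cong)
qed

lemma initial_form_hform: "initial_form f x y = hform (series_of f) (germ_order f) x y"
  by (simp add: initial_form_def hform_def coef_def)

lemma series_of_in_ideal: "series_of f \<in> in_ideal (germ_order f)"
proof (rule in_idealI)
  fix i j assume "i + j < germ_order f"
  then show "coef2 (series_of f) i j = 0"
    unfolding germ_order_def coef_def by (auto dest: not_less_Least)
qed

text \<open>A zero \<open>(t, 1)\<close> of the leading form in the new coordinates would span a
  second tangent line. So the leading form, as a polynomial in \<open>t\<close>, has no zero and is
  constant by the fundamental theorem of algebra.\<close>

lemma unitangent_normal_form: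
  assumes f: "unitangent f" and f0: "coef f 0 0 = 0"
  shows "\<exists>e1 e2 g1 g2 n c. n > 0 \<and> c \<noteq> 0 \<and> e1 * g2 - e2 * g1 \<noteq> 0 \<and>
    tangent_line {(x, y). e1 * y = e2 * x} f \<and>
    sub (series_of f) (lin2 e1 g1) (lin2 e2 g2) - cc c * YY ^ n \<in> in_ideal (Suc n)"
proof -
  obtain L where L: "tangent_line L f" and uniq: "\<And>L'. tangent_line L' f \<Longrightarrow> L' = L"
    using f unfolding unitangent_def by (elim ex1E) blast
  obtain a b where ab: "(a, b) \<noteq> (0, 0)" and Lab: "L = {(x, y). a * x + b * y = 0}"
    using L unfolding tangent_line_def line_through_0_def by blast
  define n where "n = germ_order f"
  \<comment> \<open>The first new basis vector \<open>(b, - a)\<close> spans the tangent line, the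
    second is the conjugate of its normal; the determinant is the sum of the squared moduli of
    \<open>a\<close> and \<open>b\<close>.\<close>
  define f' where "f' = sub (series_of f) (lin2 b (cnj a)) (lin2 (- a) (cnj b))"
  have pos: "a * cnj a + b * cnj b \<noteq> 0"
  proof -
    have "a * cnj a + b * cnj b = of_real ((cmod a)\<^sup>2 + (cmod b)\<^sup>2)" by (simp add: complex_norm_square[symmetric] flip: of_real_power)
    moreover have "(cmod a)\<^sup>2 + (cmod b)\<^sup>2 \<noteq> 0" using ab by (simp add: sum_power2_eq_zero_iff)
    ultimately show ?thesis by (simp only: of_real_eq_0_iff not_False_eq_True)
  qed
  have nz: "hform f' n t 1 \<noteq> 0" for t
  proof
    assume z: "hform f' n t 1 = 0"
    define P1 P2 where "P1 = b * t + cnj a" and "P2 = cnj b - a * t"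
    have P: "a * P1 + b * P2 \<noteq> 0" using pos by (simp add: P1_def P2_def algebra_simps)
    have h: "hform (series_of f) n P1 P2 = 0"
      using z unfolding f'_def hform_lin2 by (simp add: P1_def P2_def algebra_simps)
    have "tangent_line {(x, y). P2 * x + (- P1) * y = 0} f"
      unfolding tangent_line_def
    proof
      show "line_through_0 {(x, y). P2 * x + (- P1) * y = 0}"
        unfolding line_through_0_def using P by (intro exI[of _ P2] exI[of _ "- P1"]) auto
      show "{(x, y). P2 * x + (- P1) * y = 0} \<subseteq> tangent_cone f"
      proof clarify
        fix x y assume e: "P2 * x + (- P1) * y = 0"
        define s where "s = (a * x + b * y) / (a * P1 + b * P2)"
        have xy: "x * (a * P1 + b * P2) = (a * x + b * y) * P1" "y * (a * P1 + b * P2) = (a * x + b * y) * P2"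
          using e by algebra+
        have "x = s * P1" "y = s * P2" unfolding s_def using xy P by (simp_all add: nonzero_eq_divide_eq)
        then show "(x, y) \<in> tangent_cone f"
          using h by (simp add: tangent_cone_def initial_form_hform hform_scale flip: n_def)
      qed
    qed
    then have "L = {(x, y). P2 * x + (- P1) * y = 0}" using uniq by simp
    then have "(P1, P2) \<in> L" by simp
    then show False using P by (simp add: Lab)
  qed
  have hf: "hform f' n t 1 = (\<Sum>i\<le>n. coef2 f' i (n - i) * t ^ i)" for t by (simp add: hform_def)
  define c where "c = coef2 f' 0 n"
  have zero: "coef2 f' i (n - i) = 0" if "0 < i" "i \<le> n" for i
    by (rule poly_no_root[OF _ that, of "\<lambda>i. coef2 f' i (n - i)"]) (use nz in \<open>simp add: hf\<close>)
  have c: "c \<noteq> 0" using nz[of 0] by (simp add: hf c_def power_0_left if_distrib sum.delta cong: if_cong)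
  have "coef2 f' 0 0 = 0" using f0 by (simp add: f'_def coef2_sub_00 coef_def)
  then have n: "n > 0" using c by (cases n) (auto simp: c_def)
  have id: "f' \<in> in_ideal n" unfolding f'_def n_def by (rule sub_ideal) (simp_all add: series_of_in_ideal)
  have "f' - cc c * YY ^ n \<in> in_ideal (Suc n)"
  proof (rule in_idealI)
    fix i j assume ij: "i + j < Suc n"
    have m: "coef2 (YY ^ n) i j = (if i = 0 \<and> j = n then 1 else 0)" using coef2_mono[of 0 n i j] by simp
    consider "i + j < n" | "i = 0" "j = n" | "0 < i" "i \<le> n" "j = n - i" using ij by fastforce
    then show "coef2 (f' - cc c * YY ^ n) i j = 0"
    proof cases
      case 1 then show ?thesis using in_idealD[OF id 1] by (auto simp: m)
    next
      case 2
      then have "coef2 (YY ^ n) 0 n = 1" using m by simp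
      then show ?thesis using 2 by (simp add: c_def)
    next
      case 3
      then have "coef2 (YY ^ n) i j = 0" using m by simp
      then show ?thesis using zero[OF 3(1,2)] 3(3) by simp
    qed
  qed
  moreover have "{(x, y). b * y = (- a) * x} = L" by (auto simp: Lab eq_neg_iff_add_eq_0 add.commute)
  moreover have "b * cnj b - (- a) * cnj a \<noteq> 0" using pos by (simp add: add.commute)
  ultimately show ?thesis using n c L unfolding f'_def
    by (intro exI[of _ b] exI[of _ "- a"] exI[of _ "cnj a"] exI[of _ "cnj b"] exI[of _ n] exI[of _ c] conjI) simp_all
qed

text \<open>The number is the value of the linear part of \<open>l\<close> on the direction of the
  tangent of \<open>f\<close>; were it zero, the line would be tangent to both germs.\<close>

lemma transverse_linear_part:
  assumes l: "smooth_germ l" and t: "transverse l f" and L: "tangent_line {(x, y). e1 * y = e2 * x} f" and e: "e1 \<noteq> 0 \<or> e2 \<noteq> 0"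
  shows "coef l 1 0 * e1 + coef l 0 1 * e2 \<noteq> 0"
proof
  assume z: "coef l 1 0 * e1 + coef l 0 1 * e2 = 0"
  have "germ_order l = 1" unfolding germ_order_def
  proof (rule Least_equality)
    show "\<exists>i j. i + j = 1 \<and> coef l i j \<noteq> 0"
    proof (cases "coef l 1 0 = 0")
      case True then show ?thesis using l by (intro exI[of _ 0] exI[of _ 1]) (simp add: smooth_germ_def)
    next
      case False then show ?thesis by (intro exI[of _ 1] exI[of _ 0]) simp
    qed
    show "1 \<le> n" if "\<exists>i j. i + j = n \<and> coef l i j \<noteq> 0" for n
      using that l by (cases n) (auto simp: smooth_germ_def)
  qed
  then have init: "initial_form l x y = coef l 0 1 * y + coef l 1 0 * x" for x y by (simp add: initial_form_def)
  have "tangent_line {(x, y). e1 * y = e2 * x} l"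
    unfolding tangent_line_def
  proof
    show "line_through_0 {(x, y). e1 * y = e2 * x}" using L by (simp add: tangent_line_def)
    show "{(x, y). e1 * y = e2 * x} \<subseteq> tangent_cone l"
    proof clarify
      fix x y assume xy: "e1 * y = e2 * x"
      have "e1 * (coef l 0 1 * y + coef l 1 0 * x) = 0" "e2 * (coef l 0 1 * y + coef l 1 0 * x) = 0"
        using xy z by algebra+
      then have "coef l 0 1 * y + coef l 1 0 * x = 0" using e by auto
      then show "(x, y) \<in> tangent_cone l" by (simp add: tangent_cone_def init)
    qed
  qed
  then show False using t L by (simp add: transverse_def)
qed

text \<open>\<open>X\<close> solves \<open>U = u\<close> for the first linear coordinate in terms of
  \<open>z\<close> and \<open>u\<close>, which gives it the \<open>u\<close>-coefficient
  \<open>1 / \<kappa>\<close>; the second linear coordinate is kept as \<open>Z\<close>.\<close>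

lemma adapted_coordinates:
  assumes G0: "coef2 U 0 0 = 0" and k: "coef2 U 1 0 * e1 + coef2 U 0 1 * e2 = \<kappa>" "\<kappa> \<noteq> 0" and d: "e1 * g2 - e2 * g1 \<noteq> 0"
  shows "\<exists>X Z. X \<in> max_ideal \<and> \<kappa> * coef2 X 0 1 = 1 \<and>
    coord_change (sub (lin2 e1 g1) X XX) (sub (lin2 e2 g2) X XX) Z U"
proof -
  define G where "G = sub U (lin2 e1 g1) (lin2 e2 g2)"
  have U: "U \<in> max_ideal" using G0 by (simp add: max_ideal_iff)
  have dl: "dx (lin2 a b) = cc a" "dy (lin2 a b) = cc b" for a b
    by (simp_all add: lin2_def dx.add dy.add dx_cc_mult dy_cc_mult dx.cc dy.cc del: fps_deriv_add fps_deriv_mult)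
  have "coef2 (dx G) 0 0 = \<kappa>"
    unfolding G_def by (simp add: dx.chain dl coef2_mult_00 coef2_sub_00 coef2_dx coef2_dy coef2_cc k(1)[symmetric])
  then have G1: "coef2 G 1 0 = \<kappa>" by (simp add: coef2_dx)
  have "coef2 G 0 0 = 0" by (simp add: G_def coef2_sub_00 G0)
  then obtain X where X: "X \<in> max_ideal" "sub G X XX = YY"
    using implicit_exists[of XX YY G] G1 k(2) by auto
  have "dy (sub G X XX) = sub (dx G) X XX * dy X" using X(1) by (simp add: dy.chain)
  then have "sub (dx G) X XX * dy X = 1" by (simp add: X(2))
  then have "coef2 (sub (dx G) X XX * dy X) 0 0 = 1" by (simp add: coef2_1)
  then have X1: "\<kappa> * coef2 X 0 1 = 1" using G1 by (simp add: coef2_mult_00 coef2_sub_00 coef2_dx coef2_dy)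
  define D where "D = e1 * g2 - e2 * g1"
  define Z where "Z = lin2 (- e2 / D) (e1 / D)"
  define V where "V = lin2 (g2 / D) (- g1 / D)"
  have D: "D \<noteq> 0" using d by (simp add: D_def)
  have VZ: "sub (lin2 e1 g1) V Z = XX" "sub (lin2 e2 g2) V Z = YY"
  proof -
    have "e1 * (g2 / D) + g1 * (- e2 / D) = 1" "e1 * (- g1 / D) + g1 * (e1 / D) = 0"
      "e2 * (g2 / D) + g2 * (- e2 / D) = 0" "e2 * (- g1 / D) + g2 * (e1 / D) = 1"
      using D by (simp_all add: field_simps) (simp_all add: D_def algebra_simps)
    then show "sub (lin2 e1 g1) V Z = XX" "sub (lin2 e2 g2) V Z = YY"
      unfolding V_def Z_def sub_lin2_lin2 by (simp_all add: lin2_def del: cc_hom(3,4))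
  qed
  have ZV: "sub Z (lin2 e1 g1) (lin2 e2 g2) = YY"
  proof -
    have "(- e2 / D) * e1 + (e1 / D) * e2 = 0" "(- e2 / D) * g1 + (e1 / D) * g2 = 1"
      using D by (simp_all add: field_simps) (simp_all add: D_def algebra_simps)
    then show ?thesis unfolding Z_def sub_lin2_lin2 by (simp only: lin2_def cc_hom(1,2)) simp
  qed
  have mV: "V \<in> max_ideal" "Z \<in> max_ideal" by (simp_all add: V_def Z_def)
  \<comment> \<open>Both sides solve the same implicit equation for given \<open>Z\<close> and
    \<open>U\<close>; so \<open>X\<close> recovers the first linear coordinate.\<close>
  have XV: "sub X Z U = V"
  proof (rule implicit_unique[of _ _ Z G])
    have "sub G (sub X Z U) Z = sub (sub G X XX) Z U"
      using sub_sub[OF X(1) XX_ideal mV(2) U, of G] U mV by (simp only: sub_XX)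
    also have "\<dots> = U" using U mV by (simp add: X(2) sub_YY)
    also have "\<dots> = sub G V Z" unfolding G_def using mV by (simp add: sub_sub VZ)
    finally show "sub G (sub X Z U) Z = sub G V Z" .
  qed (use X mV G1 k(2) in \<open>auto intro: sub_max_ideal\<close>)
  have "coord_change (sub (lin2 e1 g1) X XX) (sub (lin2 e2 g2) X XX) Z U"
  proof
    show "sub (lin2 e1 g1) X XX \<in> max_ideal" "sub (lin2 e2 g2) X XX \<in> max_ideal" by (auto intro: sub_max_ideal)
    show "Z \<in> max_ideal" "U \<in> max_ideal" by fact+
    show "sub (sub (lin2 e1 g1) X XX) Z U = XX" "sub (sub (lin2 e2 g2) X XX) Z U = YY"
      using X U mV VZ by (simp_all add: sub_sub sub_XX XV)
    have "sub Z (sub (lin2 e1 g1) X XX) (sub (lin2 e2 g2) X XX) = sub (sub Z (lin2 e1 g1) (lin2 e2 g2)) X XX"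
      using X mV by (simp add: sub_sub)
    then show "sub Z (sub (lin2 e1 g1) X XX) (sub (lin2 e2 g2) X XX) = XX" using X by (simp add: ZV sub_YY)
    have "sub U (sub (lin2 e1 g1) X XX) (sub (lin2 e2 g2) X XX) = sub G X XX"
      using X by (simp add: G_def sub_sub)
    then show "sub U (sub (lin2 e1 g1) X XX) (sub (lin2 e2 g2) X XX) = YY" by (simp add: X(2))
  qed
  then show ?thesis using X(1) X1 by blast
qed

lemma z_order_scale:
  "z_order (sub J XX (cc \<kappa> * YY)) p \<longleftrightarrow> z_order J p"
proof -
  have m: "cc \<kappa> * YY \<in> max_ideal" by auto
  have "sub (sub J XX (cc \<kappa> * YY)) XX 0 = sub J XX 0"
    using m by (simp add: sub_sub sub_XX sub_cc_mult sub_YY)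
  then have "coef2 (sub J XX (cc \<kappa> * YY)) i 0 = coef2 J i 0" for i
    using sub_y0[of "sub J XX (cc \<kappa> * YY)" i 0] sub_y0[of J i 0] by simp
  then show ?thesis by (simp add: z_order_def)
qed

text \<open>Rescaling \<open>u\<close> by \<open>\<kappa>\<close> makes the
  \<open>u\<close>-coefficient of \<open>X\<close> equal to 1, as the deformation requires; on the
  discriminant this acts as \<open>rotx \<kappa>\<close>.\<close>

lemma normalized_root_data:
  assumes f': "sub (series_of f) (lin2 e1 g1) (lin2 e2 g2) - cc c * YY ^ n \<in> in_ideal (Suc n)" (is "?f' - _ \<in> _")
    and n: "n > 0" and c: "c \<noteq> 0" and d: "e1 * g2 - e2 * g1 \<noteq> 0"
    and l: "coef l 0 0 = 0" "coef l 1 0 * e1 + coef l 0 1 * e2 \<noteq> 0" and D: "is_discriminant l f D"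
  shows "\<exists>X \<kappa>. X \<in> max_ideal \<and> coef2 X 0 1 = 1 \<and> \<kappa> \<noteq> 0 \<and>
    root_data (sub ?f' X XX) (dx (sub ?f' X XX)) (rotx \<kappa> (series_of D))"
proof -
  define \<kappa> where "\<kappa> = coef l 1 0 * e1 + coef l 0 1 * e2"
  have \<kappa>: "\<kappa> \<noteq> 0" using l by (simp add: \<kappa>_def)
  obtain X Z where X: "X \<in> max_ideal" "\<kappa> * coef2 X 0 1 = 1"
      and cc: "coord_change (sub (lin2 e1 g1) X XX) (sub (lin2 e2 g2) X XX) Z (series_of l)"
    using adapted_coordinates[of "series_of l" e1 e2 \<kappa> g2 g1] l(1) \<kappa> d by (auto simp: coef_def \<kappa>_def)
  interpret coord_change "sub (lin2 e1 g1) X XX" "sub (lin2 e2 g2) X XX" Z "series_of l" by (rule cc)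
  define H where "H = new (series_of f)"
  have H: "H = sub ?f' X XX" using X(1) by (simp add: H_def new_def sub_sub)
  define Xh where "Xh = sub X XX (cc \<kappa> * YY)"
  have m: "cc \<kappa> * YY \<in> max_ideal" by auto
  have Xh: "Xh \<in> max_ideal" using X(1) by (simp add: Xh_def sub_max_ideal)
  have "dy Xh = sub (dy X) XX (cc \<kappa> * YY) * dy (cc \<kappa> * YY)" using m by (simp add: Xh_def dy.chain)
  then have "coef2 (dy Xh) 0 0 = coef2 X 0 1 * \<kappa>" by (simp add: coef2_mult_00 coef2_sub_00 coef2_dy coef2_YY coef2_cc dy_cc_mult)
  then have Xh1: "coef2 Xh 0 1 = 1" using X(2) by (simp add: coef2_dy mult.commute)
  have HX: "sub H XX (cc \<kappa> * YY) = sub ?f' Xh XX"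
    using sub_sub[OF X(1) XX_ideal XX_ideal m, of ?f'] m by (simp only: H Xh_def sub_XX XX_ideal)
  have dxH: "sub (dx H) XX (cc \<kappa> * YY) = dx (sub H XX (cc \<kappa> * YY))" using m by (simp add: dx.chain dx_cc_mult)
  \<comment> \<open>The constant family suffices to read off the order in \<open>z\<close> of the
    polar.\<close>
  interpret t: tangent_family ?f' Xh Xh n c
    by standard (use f' n c Xh Xh1 in auto)
  have "z_order (dx (sub ?f' Xh XX)) (n - 1)" using t.z_order_Fs[of 0] by (simp only: t.Fs_0)
  then have "z_order (dx H) (n - 1)" by (simp add: z_order_scale flip: HX dxH)
  from discriminant_root_data[OF D refl this[unfolded H_def]]
  have "root_data H (dx H) (series_of D)" by (simp only: H_def)
  from root_data_scale[OF this \<kappa>] have "root_data (sub ?f' Xh XX) (dx (sub ?f' Xh XX)) (rotx \<kappa> (series_of D))"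
    by (simp only: dxH HX)
  then show ?thesis using Xh Xh1 \<kappa> by blast
qed

theorem theorem6p6:
  fixes f l1 l2 D1 D2 :: germ2
  assumes "squarefree f" and "singular_germ f" and "unitangent f"
    and "smooth_germ l1" and "transverse l1 f"
    and "smooth_germ l2" and "transverse l2 f"
    and "is_discriminant l1 f D1" and "is_discriminant l2 f D2"
  shows "equal_up_to_rescaling (initial_newton_polynomial D1) (initial_newton_polynomial D2)"
proof -
  have "coef f 0 0 = 0" using assms(2) by (simp add: singular_germ_def)
  from unitangent_normal_form[OF assms(3) this] obtain e1 e2 g1 g2 n c where
    n: "n > 0" and c: "c \<noteq> 0" and d: "e1 * g2 - e2 * g1 \<noteq> 0" and L: "tangent_line {(x, y). e1 * y = e2 * x} f"
    and f': "sub (series_of f) (lin2 e1 g1) (lin2 e2 g2) - cc c * YY ^ n \<in> in_ideal (Suc n)" by (elim exE conjE)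
  define f' where "f' = sub (series_of f) (lin2 e1 g1) (lin2 e2 g2)"
  have e: "e1 \<noteq> 0 \<or> e2 \<noteq> 0" using d by auto
  have l0: "coef l1 0 0 = 0" "coef l2 0 0 = 0" using assms(4,6) by (simp_all add: smooth_germ_def)
  obtain X1 k1 where X1: "X1 \<in> max_ideal" "coef2 X1 0 1 = 1" and k1: "k1 \<noteq> 0"
      and rd1: "root_data (sub f' X1 XX) (dx (sub f' X1 XX)) (rotx k1 (series_of D1))"
    using normalized_root_data[OF f' n c d l0(1) transverse_linear_part[OF assms(4,5) L e] assms(8)]
    unfolding f'_def by (elim exE conjE)
  obtain X2 k2 where X2: "X2 \<in> max_ideal" "coef2 X2 0 1 = 1" and k2: "k2 \<noteq> 0"
      and rd2: "root_data (sub f' X2 XX) (dx (sub f' X2 XX)) (rotx k2 (series_of D2))"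
    using normalized_root_data[OF f' n c d l0(2) transverse_linear_part[OF assms(6,7) L e] assms(9)]
    unfolding f'_def by (elim exE conjE)
  interpret t: tangent_family f' X1 X2 n c
    by standard (use f' n c X1 X2 in \<open>auto simp: f'_def\<close>)
  \<comment> \<open>The reversed family provides the weight of \<open>E2\<close>, up to which
    \<open>D2\<close> is compared with \<open>E2\<close>.\<close>
  interpret t': tangent_family f' X2 X1 n c
    by standard (use f' n c X1 X2 in \<open>auto simp: f'_def\<close>)
  define E1 where "E1 = discr (n - 1) (sub f' X1 XX)"
  define E2 where "E2 = discr (n - 1) (sub f' X2 XX)"
  have Ds: "t.Ds 0 = E1" "t.Ds 1 = E2" "t'.Ds 0 = E2" "t'.Ds 1 = E1"
    by (simp_all only: t.Ds_def t'.Ds_def t.Fs_0 t.Fs_1 t'.Fs_0 t'.Fs_1 E1_def E2_def)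
  have z: "z_order (dx (sub f' X1 XX)) (n - 1)" "z_order (dx (sub f' X2 XX)) (n - 1)"
    using t.z_order_Fs[of 0] t'.z_order_Fs[of 0] by (simp_all only: t.Fs_0 t'.Fs_0)
  obtain C1 where C1: "C1 \<noteq> 0" and D1: "\<forall>w1 w2 r. w1 > 0 \<longrightarrow> w2 > 0 \<longrightarrow> has_wt w1 w2 E1 r \<longrightarrow>
     (\<forall>i j. wt w1 w2 i j \<le> r \<longrightarrow> coef2 (rotx k1 (series_of D1)) i j = C1 * coef2 E1 i j)"
    using root_data_discr[OF rd1 z(1)] unfolding E1_def by (elim exE conjE)
  obtain C2 where C2: "C2 \<noteq> 0" and D2: "\<forall>w1 w2 r. w1 > 0 \<longrightarrow> w2 > 0 \<longrightarrow> has_wt w1 w2 E2 r \<longrightarrow>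
     (\<forall>i j. wt w1 w2 i j \<le> r \<longrightarrow> coef2 (rotx k2 (series_of D2)) i j = C2 * coef2 E2 i j)"
    using root_data_discr[OF rd2 z(2)] unfolding E2_def by (elim exE conjE)
  \<comment> \<open>Only \<open>u\<close> is rescaled, by the quotient of the two normalizing
    factors; \<open>v\<close> keeps its scale because both morphisms have the second component
    \<open>f\<close>.\<close>
  have "initial_newton_polynomial D1 = fps_const (fps_const (C1 / C2)) * rescale (k2 / k1) 1 (initial_newton_polynomial D2)"
  proof (rule initial_newton_polynomial_agree)
    fix w1 w2 :: real assume w: "w1 > 0" "w2 > 0"
    obtain r where r: "\<forall>i j. wt w1 w2 i j \<le> r \<longrightarrow> coef2 E1 i j = coef2 E2 i j" "has_wt w1 w2 E1 r"
      using t.initial_forms_agree[OF w] unfolding Ds by (elim exE conjE)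
    obtain r' where r': "\<forall>i j. wt w1 w2 i j \<le> r' \<longrightarrow> coef2 E2 i j = coef2 E1 i j" "has_wt w1 w2 E2 r'"
      using t'.initial_forms_agree[OF w] unfolding Ds by (elim exE conjE)
    have "r \<le> r'"
    proof -
      obtain i j where ij: "coef2 E2 i j \<noteq> 0" "wt w1 w2 i j = r'" using r'(2) by (auto simp: has_wt_def)
      then have "coef2 E1 i j \<noteq> 0" using r'(1) by auto
      then show ?thesis using r(2) ij(2) by (auto simp: has_wt_def)
    qed
    moreover have "r' \<le> r"
    proof -
      obtain i j where ij: "coef2 E1 i j \<noteq> 0" "wt w1 w2 i j = r" using r(2) by (auto simp: has_wt_def)
      then have "coef2 E2 i j \<noteq> 0" using r(1) by auto
      then show ?thesis using r'(2) ij(2) by (auto simp: has_wt_def)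
    qed
    ultimately have rr: "r' = r" by simp
    have D1': "k1 ^ i * coef D1 i j = C1 * coef2 E1 i j" if "wt w1 w2 i j \<le> r" for i j
      using D1[rule_format, OF w r(2) that] by (simp add: coef2_rotx coef_def)
    have D2': "k2 ^ i * coef D2 i j = C2 * coef2 E1 i j" if "wt w1 w2 i j \<le> r" for i j
      using D2[rule_format, OF w r'(2), of i j] r(1)[rule_format, OF that] that by (simp add: rr coef2_rotx coef_def)
    have "coef D1 i j = C1 / C2 * (k2 / k1) ^ i * coef D2 i j" if "wt w1 w2 i j \<le> r" for i j
    proof -
      have "C2 * (k1 ^ i * coef D1 i j) = C1 * (k2 ^ i * coef D2 i j)"
        unfolding D1'[OF that] D2'[OF that] by (simp add: mult_ac)
      then show ?thesis using C2 k1 by (simp add: field_simps power_divide)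
    qed
    moreover have "has_wt w1 w2 (series_of D1) r"
      unfolding has_wt_def
    proof (intro conjI allI impI)
      fix i j assume nz: "coef2 (series_of D1) i j \<noteq> 0"
      show "r \<le> wt w1 w2 i j"
      proof (rule ccontr)
        assume "\<not> r \<le> wt w1 w2 i j"
        then have "coef2 E1 i j = 0" "wt w1 w2 i j \<le> r" using r(2) by (auto simp: has_wt_def)
        then show False using D1'[of i j] nz k1 by (simp add: coef_def)
      qed
    next
      obtain i j where ij: "coef2 E1 i j \<noteq> 0" "wt w1 w2 i j = r" using r(2) by (auto simp: has_wt_def)
      then have "coef2 (series_of D1) i j \<noteq> 0" using D1'[of i j] C1 by (auto simp: coef_def)
      then show "\<exists>i j. coef2 (series_of D1) i j \<noteq> 0 \<and> wt w1 w2 i j = r" using ij(2) by blast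
    qed
    ultimately show "\<exists>r. (\<forall>i j. wt w1 w2 i j \<le> r \<longrightarrow> coef D1 i j = C1 / C2 * (k2 / k1) ^ i * coef D2 i j) \<and>
        has_wt w1 w2 (series_of D1) r" by blast
  qed (use C1 C2 k1 k2 in simp_all)
  moreover have "k2 / k1 \<noteq> 0" "C1 / C2 \<noteq> 0" using C1 C2 k1 k2 by simp_all
  ultimately show ?thesis unfolding equal_up_to_rescaling_def
    by (intro exI[of _ "k2 / k1"] exI[of _ 1] exI[of _ "C1 / C2"]) simp
qed

end
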